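(* Let $g$ be a Carter background metric with zero scalar curvature ($k=0$), as defined in the context, and let $\Sigma=S^1_\phi\times\Omega$, $\Omega=[r_-,r_+]\times[x_-,x_+]$, be a bounded product slab on whose closure $$\rho^2>0,\quad \Delta_r>0,\quad \Delta_x>0,\quad A>0,\quad \Phi>0 .$$ Let $V_{\rm full}\subset H^1(\Sigma)$ be a form-realized reflecting domain (defined in the context; in particular $1\in V_{\rm full}$). Then: (1) For every $(u_0,u_1)\in V_{\rm full}\times L^2(\Sigma)$ there is a unique energy solution $u$ of $\Box_g u=0$ on $\mathbb R_t\times\Sigma$ with data $(u,u_t)|_{t=0}=(u_0,u_1)$ and $$u\in C(\mathbb R;V_{\rm full}),\qquad u_t\in C(\mathbb R;L^2(\Sigma)).$$ (2) It admits the unique decomposition $u(t,\phi,r,x)=c_0+c_1t+v(t,\phi,r,x)$, where $$c_0=\frac{\int_\Sigma A u_0}{\int_\Sigma A},\qquad c_1=\frac{\int_\Sigma A u_1}{\int_\Sigma A},$$ and the $A$-weighted averages $\int_\Sigma A v(t)$ and $\int_\Sigma A v_t(t)$ vanish for every $t$. (3) One has $$\sup_{t\in\mathbb R}\bigl(\|v(t)\|_{H^1(\Sigma)}+\|v_t(t)\|_{L^2(\Sigma)}\bigr)\le C_{\rm stab}\bigl(\|v(0)\|_{H^1(\Sigma)}+\|v_t(0)\|_{L^2(\Sigma)}\bigr),$$ where $C_{\rm stab}$ depends only on the coefficient bounds and the weighted Poincaré constant; explicitly one may take $C_{\rm stab}=(C_{\rm high}/c_{\rm low})^{1/2}$ (constants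 in the context), up to harmless constants from equivalence of norms. Equivalently, the full conformal scalar-curvature dynamics on the slab are stable modulo the generalized zero-mode space $\mathrm{span}\{1,t\}$. (4) There is no nontrivial finite-energy mode $u=e^{-i\sigma t}\psi(\phi,r,x)$ with $\operatorname{Im}\sigma>0$.
   Context: **Carter background ($k=0$).** Fix real parameters $a,M,\Lambda,C_1,\dots,C_5$ and set $\alpha_2=1-\frac{\Lambda a^2}{3}+\frac{C_1}{2}$. In coordinates $(t,\phi,r,x)$, with $\phi$ $2\pi$-periodic and $-1\le x\le1$, put $\rho^2=r^2+a^2x^2$, $$\Delta_r(r)=\alpha_2r^2+(C_2-2M)r+(a^2+C_3),\qquad \Delta_x(x)=-\alpha_2x^2-C_4x+(1+C_5),$$ $$g=-\frac{\Delta_r}{\rho^2}\bigl(dt-a(1-x^2)d\phi\bigr)^2+\frac{\Delta_x}{\rho^2}\bigl((r^2+a^2)d\phi-a\,dt\bigr)^2+\frac{\rho^2}{\Delta_r}dr^2+\frac{\rho^2}{\Delta_x}dx^2 .$$ Then $\sqrt{-\det g}=\rho^2$ and $g$ has zero scalar curvature. Define $$A=-\rho^2g^{tt}=\frac{(r^2+a^2)^2}{\Delta_r}-\frac{a^2(1-x^2)^2}{\Delta_x},\quad B=\rho^2g^{t\phi}=-\frac{a(r^2+a^2)}{\Delta_r}+\frac{a(1-x^2)}{\Delta_x},\quad \Phi=\rho^2g^{\phi\phi}=\frac1{\Delta_x}-\frac{a^2}{\Delta_r}.$$ The equation $\Box_gu=0$ reads $-Au_{tt}+2Bu_{t\phi}+\Phi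 u_{\phi\phi}+\partial_r(\Delta_ru_r)+\partial_x(\Delta_xu_x)=0$. **Conventions.** All integrals over $\Sigma$ are with respect to $d\phi\,dr\,dx$; functions are complex valued. A form-realized reflecting domain is a closed subspace $V_{\rm full}\subset H^1(\Sigma)$, dense in $L^2(\Sigma)$, consisting of $\phi$-periodic functions, invariant under complex conjugation and containing the constant function $1$. Put $$q[u,\eta]=\int_\Sigma\bigl(\Phi u_\phi\overline{\eta_\phi}+\Delta_ru_r\overline{\eta_r}+\Delta_xu_x\overline{\eta_x}\bigr),\qquad \mathfrak c[v,\eta]=2\int_\Sigma Bv\,\overline{\eta_\phi}.$$ An energy solution is a function with $u\in C(\mathbb R;V_{\rm full})$, $u_t\in C(\mathbb R;L^2(\Sigma))$, $u_{tt}\in L^\infty_{\rm loc}(\mathbb R;V_{\rm full}')$ such that $\int_\Sigma Au_{tt}\overline\eta+q[u,\eta]+\mathfrak c[u_t,\eta]=0$ for all $\eta\in V_{\rm full}$ (in the sense of distributions in $t$, with the first term a duality pairing). A finite-energy mode is an energy solution of the displayed form with $\psi\in V_{\rm full}$. **Constants.** $a_-=\inf A$, $a_+=\sup A$, $m_\nabla=\min\{\inf\Phi,\inf\Delta_r,\inf\Delta_x\}$, $M_\nabla=\max\{\sup\Phi,\sup\Delta_r,\sup\Delta_x\}$ over $\overline\Omega$; $C_P$ is a constant with $\|u\|_{L^2(\Sigma)}^2\le C_P\,q[u,u]$ for all $u\in H^1(\Sigma)$ with $\int_\Sigma Au=0$; $c_{\rm low}=\min\{\frac{a_-}{2},\frac{1}{2(C_P+m_\nabla^{-1})}\}$,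 $C_{\rm high}=\frac12\max\{a_+,M_\nabla\}$. *)

theory Defs
  imports "HOL-Analysis.Analysis"
begin

section \<open>The Carter background with \<open>k = 0\<close>\<close>

text \<open>Parameters of the metric together with the bounds of the slab
  \<open>[r_min, r_max] \<times> [x_min, x_max]\<close>.\<close>

record carter_slab =
  cs_a :: real
  cs_M :: real
  cs_Lambda :: real
  cs_C1 :: real
  cs_C2 :: real
  cs_C3 :: real
  cs_C4 :: real
  cs_C5 :: real
  r_min :: real
  r_max :: real
  x_min :: real
  x_max :: real

definition alpha2 :: "carter_slab \<Rightarrow> real" where
  "alpha2 S = 1 - cs_Lambda S * (cs_a S)\<^sup>2 / 3 + cs_C1 S / 2"

definition rho2 :: "carter_slab \<Rightarrow> real \<Rightarrow> real \<Rightarrow> real" where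
  "rho2 S r x = r\<^sup>2 + (cs_a S)\<^sup>2 * x\<^sup>2"

definition Delta_r :: "carter_slab \<Rightarrow> real \<Rightarrow> real" where
  "Delta_r S r = alpha2 S * r\<^sup>2 + (cs_C2 S - 2 * cs_M S) * r + ((cs_a S)\<^sup>2 + cs_C3 S)"

definition Delta_x :: "carter_slab \<Rightarrow> real \<Rightarrow> real" where
  "Delta_x S x = - alpha2 S * x\<^sup>2 - cs_C4 S * x + (1 + cs_C5 S)"

text \<open>The coordinates \<open>(t, \<phi>, r, x)\<close> are numbered 1 to 4.\<close>

definition d_t :: "real ^ 4" where "d_t = axis 1 1"
definition d_phi :: "real ^ 4" where "d_phi = axis 2 1"
definition d_r :: "real ^ 4" where "d_r = axis 3 1"
definition d_x :: "real ^ 4" where "d_x = axis 4 1"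

definition square_form :: "real ^ 4 \<Rightarrow> real ^ 4 ^ 4" where
  "square_form w = (\<chi> i j. w $ i * w $ j)"

definition carter_metric :: "carter_slab \<Rightarrow> real \<Rightarrow> real \<Rightarrow> real ^ 4 ^ 4" where
  "carter_metric S r x =
     - (Delta_r S r / rho2 S r x) *\<^sub>R square_form (d_t - (cs_a S * (1 - x\<^sup>2)) *\<^sub>R d_phi)
     + (Delta_x S x / rho2 S r x) *\<^sub>R square_form ((r\<^sup>2 + (cs_a S)\<^sup>2) *\<^sub>R d_phi - cs_a S *\<^sub>R d_t)
     + (rho2 S r x / Delta_r S r) *\<^sub>R square_form d_r
     + (rho2 S r x / Delta_x S x) *\<^sub>R square_form d_x"

definition inverse_metric :: "carter_slab \<Rightarrow> real \<Rightarrow> real \<Rightarrow> real ^ 4 ^ 4" where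
  "inverse_metric S r x = matrix_inv (carter_metric S r x)"

definition coef_A :: "carter_slab \<Rightarrow> real \<Rightarrow> real \<Rightarrow> real" where
  "coef_A S r x = - rho2 S r x * inverse_metric S r x $ 1 $ 1"

definition coef_B :: "carter_slab \<Rightarrow> real \<Rightarrow> real \<Rightarrow> real" where
  "coef_B S r x = rho2 S r x * inverse_metric S r x $ 1 $ 2"

definition coef_Phi :: "carter_slab \<Rightarrow> real \<Rightarrow> real \<Rightarrow> real" where
  "coef_Phi S r x = rho2 S r x * inverse_metric S r x $ 2 $ 2"

lemma matrix_inv_unique_right:
  fixes A B :: "real ^ 'n ^ 'n"
  assumes "A ** B = mat 1"
  shows "matrix_inv A = B"
proof -
  have BA: "B ** A = mat 1"
    using assms matrix_left_right_inverse by blast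
  have "A ** matrix_inv A = mat 1 \<and> matrix_inv A ** A = mat 1"
    unfolding matrix_inv_def by (rule someI[of _ B]) (use assms BA in blast)
  then have inv: "A ** matrix_inv A = mat 1" ..
  have "matrix_inv A = (B ** A) ** matrix_inv A"
    by (simp add: BA)
  also have "\<dots> = B"
    by (simp add: inv flip: matrix_mul_assoc)
  finally show ?thesis .
qed

lemma inverse_metric_explicit:
  assumes "rho2 S r x > 0" "Delta_r S r > 0" "Delta_x S x > 0"
  shows "inverse_metric S r x =
     (1 / rho2 S r x) *\<^sub>R
       (- (1 / Delta_r S r) *\<^sub>R square_form ((r\<^sup>2 + (cs_a S)\<^sup>2) *\<^sub>R d_t + cs_a S *\<^sub>R d_phi)
        + (1 / Delta_x S x) *\<^sub>R square_form (d_phi + (cs_a S * (1 - x\<^sup>2)) *\<^sub>R d_t)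
        + Delta_r S r *\<^sub>R square_form d_r
        + Delta_x S x *\<^sub>R square_form d_x)" (is "_ = ?H")
proof -
  define D where "D = Delta_r S r"
  define E where "E = Delta_x S x"
  define a where "a = cs_a S"
  define s where "s = a * (1 - x\<^sup>2)"
  define w where "w = r\<^sup>2 + a\<^sup>2"
  define R where "R = rho2 S r x"
  have pos: "D \<noteq> 0" "E \<noteq> 0" "R \<noteq> 0"
    using assms by (auto simp: D_def E_def R_def)
  have R: "w = R + a * s"
    by (simp add: R_def s_def w_def rho2_def a_def power2_eq_square algebra_simps)
  note folds = D_def[symmetric] E_def[symmetric] a_def[symmetric] R_def[symmetric]
      s_def[symmetric] w_def[symmetric]
  have "carter_metric S r x ** ?H = mat 1"
    unfolding carter_metric_def folds
    using pos
    by (simp add: vec_eq_iff forall_4 matrix_matrix_mult_def sum_4 mat_def square_form_def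
        d_t_def d_phi_def d_r_def d_x_def axis_def R)
       (simp add: divide_simps, simp add: algebra_simps power2_eq_square)
  then show ?thesis
    unfolding inverse_metric_def by (rule matrix_inv_unique_right)
qed

lemma coef_explicit:
  assumes "rho2 S r x > 0" "Delta_r S r > 0" "Delta_x S x > 0"
  shows "coef_A S r x = (r\<^sup>2 + (cs_a S)\<^sup>2)\<^sup>2 / Delta_r S r
                        - (cs_a S)\<^sup>2 * (1 - x\<^sup>2)\<^sup>2 / Delta_x S x"
    and "coef_B S r x = - cs_a S * (r\<^sup>2 + (cs_a S)\<^sup>2) / Delta_r S r
                        + cs_a S * (1 - x\<^sup>2) / Delta_x S x"
    and "coef_Phi S r x = 1 / Delta_x S x - (cs_a S)\<^sup>2 / Delta_r S r"
  using assms
  by (simp_all add: coef_A_def coef_B_def coef_Phi_def inverse_metric_explicit square_form_def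
      d_t_def d_phi_def d_r_def d_x_def axis_def power2_eq_square)

definition Omega :: "carter_slab \<Rightarrow> (real \<times> real) set" where
  "Omega S = {r_min S..r_max S} \<times> {x_min S..x_max S}"

definition admissible_slab :: "carter_slab \<Rightarrow> bool" where
  "admissible_slab S \<longleftrightarrow>
     r_min S < r_max S \<and> - 1 \<le> x_min S \<and> x_min S < x_max S \<and> x_max S \<le> 1 \<and>
     (\<forall>(r, x) \<in> Omega S. rho2 S r x > 0 \<and> Delta_r S r > 0 \<and> Delta_x S x > 0 \<and>
        coef_A S r x > 0 \<and> coef_Phi S r x > 0)"


section \<open>Function spaces on \<open>\<Sigma> = S\<^sup>1 \<times> \<Omega>\<close>\<close>

text \<open>Points of \<open>\<Sigma>\<close> are triples \<open>(\<phi>, r, x)\<close> in the fundamental domain \<open>0 \<le> \<phi> \<le> 2\<pi>\<close>.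
  Elements of \<open>L\<^sup>2\<close> and \<open>H\<^sup>1\<close> are represented by functions; two functions represent the same
  element iff they agree almost everywhere with respect to the measure below.\<close>

type_synonym cfun = "real \<times> real \<times> real \<Rightarrow> complex"

definition Sigma_meas :: "carter_slab \<Rightarrow> (real \<times> real \<times> real) measure" where
  "Sigma_meas S = lebesgue_on ({0..2 * pi} \<times> Omega S)"

definition ae_eq :: "carter_slab \<Rightarrow> cfun \<Rightarrow> cfun \<Rightarrow> bool" where
  "ae_eq S f g \<longleftrightarrow> (AE p in Sigma_meas S. f p = g p)"

definition L2 :: "carter_slab \<Rightarrow> cfun set" where
  "L2 S = {f \<in> borel_measurable (Sigma_meas S). integrable (Sigma_meas S) (\<lambda>p. (cmod (f p))\<^sup>2)}"

definition norm_L2 :: "carter_slab \<Rightarrow> cfun \<Rightarrow> real" where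
  "norm_L2 S f = sqrt (LINT p|Sigma_meas S. (cmod (f p))\<^sup>2)"

coinductive smooth :: "('a::euclidean_space \<Rightarrow> 'b::real_normed_vector) \<Rightarrow> bool" where
  "\<lbrakk>f differentiable_on UNIV; \<forall>e\<in>Basis. smooth (\<lambda>p. frechet_derivative f (at p) e)\<rbrakk> \<Longrightarrow> smooth f"

text \<open>Smooth functions on \<open>S\<^sup>1 \<times> \<Omega>\<close> with compact support in the interior: the support may meet
  \<open>\<phi> = 0\<close> and \<open>\<phi> = 2\<pi>\<close>, since \<open>S\<^sup>1\<close> has no boundary. Testing against these is what
  makes the elements of \<open>H\<^sup>1(\<Sigma>)\<close> periodic in \<open>\<phi>\<close>.\<close>

definition test_function :: "carter_slab \<Rightarrow> cfun \<Rightarrow> bool" where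
  "test_function S \<theta> \<longleftrightarrow>
     smooth \<theta> \<and>
     (\<forall>\<phi> r x. \<theta> (\<phi> + 2 * pi, r, x) = \<theta> (\<phi>, r, x)) \<and>
     (\<exists>K. compact K \<and> K \<subseteq> interior (Omega S) \<and> (\<forall>\<phi> r x. (r, x) \<notin> K \<longrightarrow> \<theta> (\<phi>, r, x) = 0))"

definition is_weak_deriv :: "carter_slab \<Rightarrow> real \<times> real \<times> real \<Rightarrow> cfun \<Rightarrow> cfun \<Rightarrow> bool" where
  "is_weak_deriv S e u g \<longleftrightarrow>
     (\<forall>\<theta>. test_function S \<theta> \<longrightarrow>
        (LINT p|Sigma_meas S. u p * frechet_derivative \<theta> (at p) e)
        = - (LINT p|Sigma_meas S. g p * \<theta> p))"

definition H1 :: "carter_slab \<Rightarrow> cfun set" where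
  "H1 S = {u \<in> L2 S. \<forall>e\<in>Basis. \<exists>g\<in>L2 S. is_weak_deriv S e u g}"

definition weak_deriv :: "carter_slab \<Rightarrow> real \<times> real \<times> real \<Rightarrow> cfun \<Rightarrow> cfun" where
  "weak_deriv S e u = (SOME g. g \<in> L2 S \<and> is_weak_deriv S e u g)"

abbreviation D_phi :: "carter_slab \<Rightarrow> cfun \<Rightarrow> cfun" where
  "D_phi S \<equiv> weak_deriv S (1, 0, 0)"

abbreviation D_r :: "carter_slab \<Rightarrow> cfun \<Rightarrow> cfun" where
  "D_r S \<equiv> weak_deriv S (0, 1, 0)"

abbreviation D_x :: "carter_slab \<Rightarrow> cfun \<Rightarrow> cfun" where
  "D_x S \<equiv> weak_deriv S (0, 0, 1)"

definition norm_H1 :: "carter_slab \<Rightarrow> cfun \<Rightarrow> real" where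
  "norm_H1 S u = sqrt ((norm_L2 S u)\<^sup>2 +
     (norm_L2 S (D_phi S u))\<^sup>2 + (norm_L2 S (D_r S u))\<^sup>2 + (norm_L2 S (D_x S u))\<^sup>2)"

text \<open>Sequential closedness, with limits ranging over all of \<open>H\<^sup>1\<close>, also makes the domain
  invariant under changes on null sets.\<close>

definition reflecting_domain :: "carter_slab \<Rightarrow> cfun set \<Rightarrow> bool" where
  "reflecting_domain S V \<longleftrightarrow>
     V \<subseteq> H1 S \<and>
     (\<forall>u\<in>V. \<forall>v\<in>V. (\<lambda>p. u p + v p) \<in> V) \<and>
     (\<forall>c. \<forall>u\<in>V. (\<lambda>p. c * u p) \<in> V) \<and>
     (\<forall>f u. (\<forall>n::nat. f n \<in> V) \<and> u \<in> H1 S \<and> (\<lambda>n. norm_H1 S (\<lambda>p. f n p - u p)) \<longlonglongrightarrow> 0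
        \<longrightarrow> u \<in> V) \<and>
     (\<forall>f\<in>L2 S. \<forall>\<epsilon>>0. \<exists>v\<in>V. norm_L2 S (\<lambda>p. f p - v p) < \<epsilon>) \<and>
     (\<forall>u\<in>V. (\<lambda>p. cnj (u p)) \<in> V) \<and>
     (\<lambda>p. 1) \<in> V"


section \<open>Forms and energy solutions\<close>

definition integral_A :: "carter_slab \<Rightarrow> cfun \<Rightarrow> complex" where
  "integral_A S f = (LINT (\<phi>, r, x)|Sigma_meas S. complex_of_real (coef_A S r x) * f (\<phi>, r, x))"

definition form_q :: "carter_slab \<Rightarrow> cfun \<Rightarrow> cfun \<Rightarrow> complex" where
  "form_q S u \<eta> = (LINT (\<phi>, r, x)|Sigma_meas S.
      complex_of_real (coef_Phi S r x) * D_phi S u (\<phi>, r, x) * cnj (D_phi S \<eta> (\<phi>, r, x))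
    + complex_of_real (Delta_r S r) * D_r S u (\<phi>, r, x) * cnj (D_r S \<eta> (\<phi>, r, x))
    + complex_of_real (Delta_x S x) * D_x S u (\<phi>, r, x) * cnj (D_x S \<eta> (\<phi>, r, x)))"

definition form_c :: "carter_slab \<Rightarrow> cfun \<Rightarrow> cfun \<Rightarrow> complex" where
  "form_c S v \<eta> = 2 * (LINT (\<phi>, r, x)|Sigma_meas S.
      complex_of_real (coef_B S r x) * v (\<phi>, r, x) * cnj (D_phi S \<eta> (\<phi>, r, x)))"

text \<open>\<open>u \<in> C(\<real>; V)\<close> and \<open>u_t \<in> C(\<real>; L\<^sup>2)\<close>, where \<open>ut\<close> is the derivative of \<open>u\<close>
  as a curve in \<open>L\<^sup>2\<close>.\<close>

definition energy_curve ::
  "carter_slab \<Rightarrow> cfun set \<Rightarrow> (real \<Rightarrow> cfun) \<Rightarrow> (real \<Rightarrow> cfun) \<Rightarrow> bool" where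
  "energy_curve S V u ut \<longleftrightarrow>
     (\<forall>t. u t \<in> V) \<and>
     (\<forall>t. ((\<lambda>s. norm_H1 S (\<lambda>p. u s p - u t p)) \<longlongrightarrow> 0) (at t)) \<and>
     (\<forall>t. ut t \<in> L2 S) \<and>
     (\<forall>t. ((\<lambda>s. norm_L2 S (\<lambda>p. ut s p - ut t p)) \<longlongrightarrow> 0) (at t)) \<and>
     (\<forall>t. ((\<lambda>s. norm_L2 S (\<lambda>p. (u s p - u t p) / (s - t) - ut t p)) \<longlongrightarrow> 0) (at t))"

text \<open>The dual consists of the bounded antilinear functionals, because pairings are of the form
  \<open>\<integral> w \<cdot> cnj \<eta>\<close>.\<close>

definition in_dual :: "carter_slab \<Rightarrow> cfun set \<Rightarrow> (cfun \<Rightarrow> complex) \<Rightarrow> bool" where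
  "in_dual S V W \<longleftrightarrow>
     (\<forall>\<eta>\<in>V. \<forall>\<zeta>\<in>V. W (\<lambda>p. \<eta> p + \<zeta> p) = W \<eta> + W \<zeta>) \<and>
     (\<forall>c. \<forall>\<eta>\<in>V. W (\<lambda>p. c * \<eta> p) = cnj c * W \<eta>) \<and>
     (\<exists>C. \<forall>\<eta>\<in>V. cmod (W \<eta>) \<le> C * norm_H1 S \<eta>)"

text \<open>Since \<open>V'\<close> is separable, measurability of \<open>t \<mapsto> W t\<close> amounts to weak measurability.\<close>

definition Linf_loc_dual ::
  "carter_slab \<Rightarrow> cfun set \<Rightarrow> (real \<Rightarrow> cfun \<Rightarrow> complex) \<Rightarrow> bool" where
  "Linf_loc_dual S V W \<longleftrightarrow>
     (\<forall>t. in_dual S V (W t)) \<and>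
     (\<forall>\<eta>\<in>V. (\<lambda>t. W t \<eta>) \<in> borel_measurable lebesgue) \<and>
     (\<forall>T. \<exists>C. AE t in lebesgue. \<bar>t\<bar> \<le> T \<longrightarrow> (\<forall>\<eta>\<in>V. cmod (W t \<eta>) \<le> C * norm_H1 S \<eta>))"

definition time_test :: "(real \<Rightarrow> complex) \<Rightarrow> bool" where
  "time_test \<theta> \<longleftrightarrow> smooth \<theta> \<and> (\<exists>T. \<forall>t. \<bar>t\<bar> > T \<longrightarrow> \<theta> t = 0)"

text \<open>\<open>utt t\<close> is \<open>u_tt(t)\<close> as an element of \<open>V'\<close>, and \<open>utt t \<eta>\<close> is the duality pairing
  \<open>\<integral> A u_tt cnj \<eta>\<close>. Functions are thus embedded in \<open>V'\<close> through the \<open>A\<close>-weighted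
  inner product of \<open>L\<^sup>2\<close>. With the unweighted embedding, \<open>A u_tt\<close> need not act on \<open>V\<close>, because
  \<open>V\<close> is not assumed to be invariant under multiplication by \<open>A\<close>.\<close>

definition is_second_time_deriv ::
  "carter_slab \<Rightarrow> cfun set \<Rightarrow> (real \<Rightarrow> cfun) \<Rightarrow> (real \<Rightarrow> cfun \<Rightarrow> complex) \<Rightarrow> bool" where
  "is_second_time_deriv S V ut utt \<longleftrightarrow>
     (\<forall>\<eta>\<in>V. \<forall>\<theta>. time_test \<theta> \<longrightarrow>
        (LINT t|lebesgue. \<theta> t * utt t \<eta>)
        = - (LINT t|lebesgue. vector_derivative \<theta> (at t)
                               * integral_A S (\<lambda>p. ut t p * cnj (\<eta> p))))"

definition energy_solution ::
  "carter_slab \<Rightarrow> cfun set \<Rightarrow> (real \<Rightarrow> cfun) \<Rightarrow> (real \<Rightarrow> cfun) \<Rightarrow> bool" where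
  "energy_solution S V u ut \<longleftrightarrow>
     energy_curve S V u ut \<and>
     (\<exists>utt. Linf_loc_dual S V utt \<and> is_second_time_deriv S V ut utt \<and>
        (\<forall>\<eta>\<in>V. \<forall>\<theta>. time_test \<theta> \<longrightarrow>
           (LINT t|lebesgue. \<theta> t * (utt t \<eta> + form_q S (u t) \<eta> + form_c S (ut t) \<eta>)) = 0))"

definition solves_Cauchy ::
  "carter_slab \<Rightarrow> cfun set \<Rightarrow> cfun \<Rightarrow> cfun \<Rightarrow> (real \<Rightarrow> cfun) \<Rightarrow> (real \<Rightarrow> cfun) \<Rightarrow> bool" where
  "solves_Cauchy S V u0 u1 u ut \<longleftrightarrow>
     energy_solution S V u ut \<and> ae_eq S (u 0) u0 \<and> ae_eq S (ut 0) u1"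

definition average_A :: "carter_slab \<Rightarrow> cfun \<Rightarrow> complex" where
  "average_A S f = integral_A S f / integral_A S (\<lambda>p. 1)"

definition zero_mode_decomposition ::
  "carter_slab \<Rightarrow> cfun set \<Rightarrow> (real \<Rightarrow> cfun) \<Rightarrow> complex \<Rightarrow> complex \<Rightarrow>
     (real \<Rightarrow> cfun) \<Rightarrow> (real \<Rightarrow> cfun) \<Rightarrow> bool" where
  "zero_mode_decomposition S V u c0 c1 v vt \<longleftrightarrow>
     energy_curve S V v vt \<and>
     (\<forall>t. ae_eq S (u t) (\<lambda>p. c0 + c1 * t + v t p)) \<and>
     (\<forall>t. integral_A S (v t) = 0 \<and> integral_A S (vt t) = 0)"

definition finite_energy_mode :: "carter_slab \<Rightarrow> cfun set \<Rightarrow> complex \<Rightarrow> cfun \<Rightarrow> bool" where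
  "finite_energy_mode S V \<sigma> \<psi> \<longleftrightarrow>
     \<psi> \<in> V \<and> (\<exists>ut. energy_solution S V (\<lambda>t p. exp (- \<i> * \<sigma> * t) * \<psi> p) ut)"


section \<open>Constants\<close>

definition a_minus :: "carter_slab \<Rightarrow> real" where
  "a_minus S = (INF (r, x) \<in> Omega S. coef_A S r x)"

definition a_plus :: "carter_slab \<Rightarrow> real" where
  "a_plus S = (SUP (r, x) \<in> Omega S. coef_A S r x)"

definition m_nabla :: "carter_slab \<Rightarrow> real" where
  "m_nabla S = Min {INF (r, x) \<in> Omega S. coef_Phi S r x,
     INF (r, x) \<in> Omega S. Delta_r S r, INF (r, x) \<in> Omega S. Delta_x S x}"

definition M_nabla :: "carter_slab \<Rightarrow> real" where
  "M_nabla S = Max {SUP (r, x) \<in> Omega S. coef_Phi S r x,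
     SUP (r, x) \<in> Omega S. Delta_r S r, SUP (r, x) \<in> Omega S. Delta_x S x}"

definition Poincare_constant :: "carter_slab \<Rightarrow> real \<Rightarrow> bool" where
  "Poincare_constant S CP \<longleftrightarrow>
     (\<forall>u\<in>H1 S. integral_A S u = 0 \<longrightarrow> (norm_L2 S u)\<^sup>2 \<le> CP * Re (form_q S u u))"

definition c_low :: "carter_slab \<Rightarrow> real \<Rightarrow> real" where
  "c_low S CP = min (a_minus S / 2) (1 / (2 * (CP + 1 / m_nabla S)))"

definition C_high :: "carter_slab \<Rightarrow> real" where
  "C_high S = max (a_plus S) (M_nabla S) / 2"

definition C_stab :: "carter_slab \<Rightarrow> real \<Rightarrow> real" where
  "C_stab S CP = sqrt (C_high S / c_low S CP)"

end

(* The space V x L^2 carries the conserved energy norm(v_t)_A^2 + q[v, v], which controls the full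
   norm on functions of vanishing A-average because of a Poincare inequality. This inequality is
   elementary on a box: a function differs from its value at another point by three integrals of
   weak derivatives along coordinate segments. The wave equation is written as an evolution
   equation generated by a skew form on the closed subspace of A-average zero; it is solved by
   Lax-Milgram and the exponentials of bounded approximations. Energy conservation
   for weak solutions follows from an antisymmetric function of two times and gives uniqueness,
   the stability bound and the absence of growing modes. The A-average of a solution is affine in
   t, which accounts for the zero modes. *)

theory Submission
  imports Defs "HOL-Real_Asymp.Real_Asymp" "HOL-Computational_Algebra.Polynomial"
begin

text \<open>Two defects shape the argument. The form \<open>q\<close> vanishes on constants, so the
  conserved energy is degenerate; existence is therefore proved for vanishing A-average, and the
  zero modes are put back afterwards. And \<open>u_t\<close> lies only in L2, so the equation cannot
  be tested with it, which is the usual road to energy conservation. Of V little more than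
  closedness and density is known, so the spatial operator has no explicit domain. The evolution is
  used in the integrated form d/dt k(z, y) = (j z, j y) with k bounded and skew. If K represents k
  in the energy product, the generator is formally the inverse of K. It is never formed: the bounded
  operators -K (\<epsilon> - K^2)^(-1) approximate it, and their exponentials are compared on the
  range of K^2, which is dense because k is nondegenerate. The mixed term \<open>c\<close> fits this
  scheme because B does not depend on \<phi> and elements of H1 have no jump at \<phi> = 0, so that
  integration by parts in \<phi> makes it skew. All Hilbert spaces are real; complex identities are
  recovered by testing also with \<i> times a test function.\<close>

section \<open>The Hilbert space of square-integrable complex functions\<close>

definition sq_integrable :: "('a::euclidean_space \<Rightarrow> complex) \<Rightarrow> bool" where
  "sq_integrable f \<longleftrightarrow> f \<in> borel_measurable lebesgue \<and> integrable lebesgue (\<lambda>x. (cmod (f x))\<^sup>2)"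

lemma measurable_cnj [measurable]:
  "f \<in> borel_measurable M \<Longrightarrow> (\<lambda>x. cnj (f x)) \<in> borel_measurable M"
  by (rule measurable_compose[OF _ borel_measurable_continuous_onI]) (auto intro: continuous_intros)

lemma sq_integrable_measurable [measurable_dest]:
  "sq_integrable f \<Longrightarrow> f \<in> borel_measurable lebesgue"
  by (simp add: sq_integrable_def)

lemma sq_integrable_bound:
  assumes f: "sq_integrable f" and g: "sq_integrable g" and h: "h \<in> borel_measurable lebesgue"
    and le: "\<And>x. norm (h x) \<le> c * ((cmod (f x))\<^sup>2 + (cmod (g x))\<^sup>2)"
  shows "integrable lebesgue (h :: 'a::euclidean_space \<Rightarrow> 'b::{banach,second_countable_topology})"
proof (rule Bochner_Integration.integrable_bound[OF _ h])
  show "integrable lebesgue (\<lambda>x. c * ((cmod (f x))\<^sup>2 + (cmod (g x))\<^sup>2))"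
    using f g by (simp add: sq_integrable_def)
  show "AE x in lebesgue. norm (h x) \<le> norm (c * ((cmod (f x))\<^sup>2 + (cmod (g x))\<^sup>2))"
    using order_trans[OF le abs_ge_self] by simp
qed

lemma cmod_add_sq_le: "(cmod (a + b))\<^sup>2 \<le> 2 * ((cmod a)\<^sup>2 + (cmod b)\<^sup>2)"
proof -
  have "(cmod (a + b))\<^sup>2 \<le> (cmod a + cmod b)\<^sup>2"
    by (simp add: norm_triangle_ineq power_mono)
  then show ?thesis
    using sum_squares_bound[of "cmod a" "cmod b"] by (simp add: power2_sum)
qed

lemma sq_integrable_mult_integrable:
  assumes "sq_integrable f" "sq_integrable g"
  shows "integrable lebesgue (\<lambda>x. f x * cnj (g x))"
proof (rule sq_integrable_bound[OF assms, where c = 1])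
  show "(\<lambda>x. f x * cnj (g x)) \<in> borel_measurable lebesgue"
    using assms[THEN sq_integrable_measurable] by measurable
  show "norm (f x * cnj (g x)) \<le> 1 * ((cmod (f x))\<^sup>2 + (cmod (g x))\<^sup>2)" for x
  proof -
    have "0 \<le> (cmod (f x) - cmod (g x))\<^sup>2 + (cmod (f x))\<^sup>2 + (cmod (g x))\<^sup>2" by simp
    then show ?thesis by (simp add: norm_mult power2_diff)
  qed
qed

lemma sq_integrable_add:
  assumes "sq_integrable f" "sq_integrable g"
  shows "sq_integrable (\<lambda>x. f x + g x)"
  unfolding sq_integrable_def
proof
  show m: "(\<lambda>x. f x + g x) \<in> borel_measurable lebesgue"
    using assms[THEN sq_integrable_measurable] by measurable
  show "integrable lebesgue (\<lambda>x. (cmod (f x + g x))\<^sup>2)"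
    by (rule sq_integrable_bound[OF assms, where c = 2]) (use m cmod_add_sq_le in auto)
qed

lemma sq_integrable_bounded_mult:
  assumes f: "sq_integrable f" and m: "m \<in> borel_measurable lebesgue" and le: "\<And>x. cmod (m x) \<le> C"
  shows "sq_integrable (\<lambda>x. m x * f x)"
  unfolding sq_integrable_def
proof
  show mm: "(\<lambda>x. m x * f x) \<in> borel_measurable lebesgue"
    using f[THEN sq_integrable_measurable] m by measurable
  show "integrable lebesgue (\<lambda>x. (cmod (m x * f x))\<^sup>2)"
  proof (rule sq_integrable_bound[OF f f, where c = "C\<^sup>2"])
    show "(\<lambda>x. (cmod (m x * f x))\<^sup>2) \<in> borel_measurable lebesgue" using mm by measurable
    fix x
    have "(cmod (m x * f x))\<^sup>2 = (cmod (m x))\<^sup>2 * (cmod (f x))\<^sup>2"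
      by (simp add: norm_mult power_mult_distrib)
    also have "\<dots> \<le> C\<^sup>2 * (cmod (f x))\<^sup>2"
      by (intro mult_right_mono power_mono le) auto
    also have "\<dots> \<le> C\<^sup>2 * ((cmod (f x))\<^sup>2 + (cmod (f x))\<^sup>2)"
      by (intro mult_left_mono) auto
    finally show "norm ((cmod (m x * f x))\<^sup>2) \<le> C\<^sup>2 * ((cmod (f x))\<^sup>2 + (cmod (f x))\<^sup>2)" by simp
  qed
qed

lemma sq_integrable_cmult: "sq_integrable f \<Longrightarrow> sq_integrable (\<lambda>x. c * f x)"
  by (rule sq_integrable_bounded_mult[where C = "cmod c"]) auto

lemma sq_integrable_zero: "sq_integrable (\<lambda>x. 0)"
  by (simp add: sq_integrable_def)

lemma sq_integrable_diff:
  assumes "sq_integrable f" "sq_integrable g"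
  shows "sq_integrable (\<lambda>x. f x - g x)"
  using sq_integrable_add[OF assms(1) sq_integrable_cmult[OF assms(2), of "-1"]] by simp

quotient_type (overloaded) 'a l2 = "'a::euclidean_space \<Rightarrow> complex" / partial:
  "\<lambda>f g. sq_integrable f \<and> sq_integrable g \<and> (AE x in lebesgue. f x = g x)"
proof (rule part_equivpI)
  show "\<exists>f::'a \<Rightarrow> complex. sq_integrable f \<and> sq_integrable f \<and> (AE x in lebesgue. f x = f x)"
    by (intro exI[of _ "\<lambda>x. 0"]) (simp add: sq_integrable_zero)
qed (auto simp: symp_def transp_def elim!: AE_mp)

instantiation l2 :: (euclidean_space) real_inner
begin

lift_definition zero_l2 :: "'a l2" is "\<lambda>x. 0"
  by (simp add: sq_integrable_zero)

lift_definition plus_l2 :: "'a l2 \<Rightarrow> 'a l2 \<Rightarrow> 'a l2" is "\<lambda>f g x. f x + g x"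
  by (auto intro: sq_integrable_add elim!: AE_mp)

lift_definition minus_l2 :: "'a l2 \<Rightarrow> 'a l2 \<Rightarrow> 'a l2" is "\<lambda>f g x. f x - g x"
  by (auto intro: sq_integrable_diff elim!: AE_mp)

lift_definition uminus_l2 :: "'a l2 \<Rightarrow> 'a l2" is "\<lambda>f x. - f x"
  using sq_integrable_cmult[of _ "-1"] by (auto elim!: AE_mp)

lift_definition scaleR_l2 :: "real \<Rightarrow> 'a l2 \<Rightarrow> 'a l2" is "\<lambda>c f x. complex_of_real c * f x"
  by (auto intro: sq_integrable_cmult elim!: AE_mp)

lift_definition inner_l2 :: "'a l2 \<Rightarrow> 'a l2 \<Rightarrow> real"
  is "\<lambda>f g. LINT x|lebesgue. Re (f x * cnj (g x))"
proof -
  fix f f' g g' :: "'a \<Rightarrow> complex"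
  assume 1: "sq_integrable f \<and> sq_integrable f' \<and> (AE x in lebesgue. f x = f' x)"
    and 2: "sq_integrable g \<and> sq_integrable g' \<and> (AE x in lebesgue. g x = g' x)"
  have *: "(\<lambda>x. Re (f x * cnj (g x))) \<in> borel_measurable lebesgue"
    if "sq_integrable f" "sq_integrable g" for f g :: "'a \<Rightarrow> complex"
    using that[THEN sq_integrable_measurable] by measurable
  show "(LINT x|lebesgue. Re (f x * cnj (g x))) = (LINT x|lebesgue. Re (f' x * cnj (g' x)))"
    using 1 2 by (intro integral_cong_AE *) (auto elim!: AE_mp)
qed

definition "norm_l2 (x :: 'a l2) = sqrt (inner x x)"
definition "dist_l2 (x :: 'a l2) y = norm (x - y)"
definition "sgn_l2 (x :: 'a l2) = inverse (norm x) *\<^sub>R x"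
definition "uniformity_l2 = (INF e\<in>{0 <..}. principal {(x :: 'a l2, y). dist x y < e})"
definition "open_l2 (U :: 'a l2 set) = (\<forall>x\<in>U. eventually (\<lambda>(x', y). x' = x \<longrightarrow> y \<in> U) uniformity)"

instance
proof
  fix x y z :: "'a l2" and a b :: real
  show "x + y + z = x + (y + z)" by transfer (simp add: sq_integrable_add add.assoc)
  show "x + y = y + x" by transfer (simp add: sq_integrable_add add.commute)
  show "0 + x = x" by transfer simp
  show "- x + x = 0" by transfer (simp add: sq_integrable_zero)
  show "x - y = x + - y" by transfer (simp add: sq_integrable_diff)
  show "a *\<^sub>R (x + y) = a *\<^sub>R x + a *\<^sub>R y"
    by transfer (simp add: sq_integrable_cmult sq_integrable_add distrib_left)
  show "(a + b) *\<^sub>R x = a *\<^sub>R x + b *\<^sub>R x"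
    by transfer (auto simp: distrib_right intro!: sq_integrable_cmult sq_integrable_add)
  show "a *\<^sub>R b *\<^sub>R x = (a * b) *\<^sub>R x"
    by transfer (simp add: sq_integrable_cmult mult.assoc)
  show "1 *\<^sub>R x = x" by transfer simp
  show "dist x y = norm (x - y)" by (simp add: dist_l2_def)
  show "sgn x = inverse (norm x) *\<^sub>R x" by (simp add: sgn_l2_def)
  show "norm x = sqrt (inner x x)" by (simp add: norm_l2_def)
  show "uniformity = (INF e\<in>{0 <..}. principal {(x :: 'a l2, y). dist x y < e})"
    by (simp add: uniformity_l2_def)
  show "open U = (\<forall>x\<in>U. eventually (\<lambda>(x', y). x' = x \<longrightarrow> y \<in> U) uniformity)" for U :: "'a l2 set"
    by (simp add: open_l2_def)
  show "inner x y = inner y x" by transfer (simp add: algebra_simps)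
  show "inner (x + y) z = inner x z + inner y z"
  proof transfer
    fix f g h :: "'a \<Rightarrow> complex"
    assume "sq_integrable f \<and> sq_integrable f \<and> (AE x in lebesgue. f x = f x)"
      "sq_integrable g \<and> sq_integrable g \<and> (AE x in lebesgue. g x = g x)"
      "sq_integrable h \<and> sq_integrable h \<and> (AE x in lebesgue. h x = h x)"
    then have "integrable lebesgue (\<lambda>x. Re (f x * cnj (h x)))" "integrable lebesgue (\<lambda>x. Re (g x * cnj (h x)))"
      using integrable_Re[OF sq_integrable_mult_integrable] by blast+
    from Bochner_Integration.integral_add[OF this]
    show "(LINT x|lebesgue. Re ((f x + g x) * cnj (h x))) =
       (LINT x|lebesgue. Re (f x * cnj (h x))) + (LINT x|lebesgue. Re (g x * cnj (h x)))"
      by (simp add: algebra_simps)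
  qed
  show "inner (a *\<^sub>R x) y = a * inner x y"
  proof transfer
    fix a f and g :: "'a \<Rightarrow> complex"
    have "(LINT x|lebesgue. Re (complex_of_real a * f x * cnj (g x))) = (LINT x|lebesgue. a * Re (f x * cnj (g x)))"
      by (simp add: algebra_simps)
    then show "(LINT x|lebesgue. Re (complex_of_real a * f x * cnj (g x))) = a * (LINT x|lebesgue. Re (f x * cnj (g x)))"
      by simp
  qed
  have sq: "Re (c * cnj c) = (cmod c)\<^sup>2" for c
    by (simp only: complex_norm_square[symmetric] Re_complex_of_real)
  show "0 \<le> inner x x"
    by transfer (unfold sq, simp)
  show "(inner x x = 0) = (x = 0)"
    by transfer (unfold sq, subst integral_nonneg_eq_0_iff_AE,
      auto simp: sq_integrable_def sq_integrable_zero[unfolded sq_integrable_def])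
qed

end


lemma l2_cases:
  obtains f where "sq_integrable f" "x = abs_l2 f"
  using Quotient3_abs_rep[OF Quotient3_l2, of x] Quotient3_rep_reflp[OF Quotient3_l2, of x] by metis

lemma abs_l2_eq_iff:
  "sq_integrable f \<Longrightarrow> sq_integrable g \<Longrightarrow> abs_l2 f = abs_l2 g \<longleftrightarrow> (AE x in lebesgue. f x = g x)"
  using Quotient3_rel[OF Quotient3_l2, of f g] by auto

lemma abs_l2_add:
  "sq_integrable f \<Longrightarrow> sq_integrable g \<Longrightarrow> abs_l2 f + abs_l2 g = abs_l2 (\<lambda>x. f x + g x)"
  by (rule plus_l2.abs_eq) auto

lemma abs_l2_diff:
  "sq_integrable f \<Longrightarrow> sq_integrable g \<Longrightarrow> abs_l2 f - abs_l2 g = abs_l2 (\<lambda>x. f x - g x)"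
  by (rule minus_l2.abs_eq) auto

lemma abs_l2_scaleR:
  "sq_integrable f \<Longrightarrow> c *\<^sub>R abs_l2 f = abs_l2 (\<lambda>x. complex_of_real c * f x)"
  by (rule scaleR_l2.abs_eq) auto

lemma inner_abs_l2:
  "sq_integrable f \<Longrightarrow> sq_integrable g \<Longrightarrow>
    inner (abs_l2 f) (abs_l2 g) = Re (LINT x|lebesgue. f x * cnj (g x))"
  by (subst inner_l2.abs_eq) (auto intro: integral_Re sq_integrable_mult_integrable simp del: complex_mult_cnj times_complex.sel)

lemma norm_abs_l2_sq:
  assumes "sq_integrable f"
  shows "(norm (abs_l2 f))\<^sup>2 = (LINT x|lebesgue. (cmod (f x))\<^sup>2)"
proof -
  have "(norm (abs_l2 f))\<^sup>2 = (LINT x|lebesgue. Re (f x * cnj (f x)))"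
    using assms by (simp add: power2_norm_eq_inner inner_l2.abs_eq)
  then show ?thesis
    by (simp add: complex_norm_square[symmetric] cmod_power2 power2_eq_square)
qed

lemma ennreal_norm_abs_l2_sq:
  assumes "sq_integrable f"
  shows "ennreal ((norm (abs_l2 f))\<^sup>2) = (\<integral>\<^sup>+ x. ennreal ((cmod (f x))\<^sup>2) \<partial>lebesgue)"
  using assms by (simp add: norm_abs_l2_sq nn_integral_eq_integral sq_integrable_def)

text \<open>Fatou's lemma for the squares of \<open>f n x - g x\<close>. One estimate yields both
  that the pointwise limit is square-integrable and that it is close to \<open>g\<close>;
  completeness uses it with \<open>g\<close> a member of the sequence itself.\<close>

lemma l2_fatou:
  assumes f: "\<And>n. sq_integrable (f n)" and F: "F \<in> borel_measurable lebesgue"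
    and lim: "AE x in lebesgue. (\<lambda>n. f n x) \<longlonglongrightarrow> F x"
    and g: "sq_integrable g"
    and le: "\<And>n. n \<ge> N \<Longrightarrow> norm (abs_l2 (f n) - abs_l2 g) \<le> e"
  shows "sq_integrable F" "norm (abs_l2 F - abs_l2 g) \<le> e"
proof -
  have e0: "e \<ge> 0" using order_trans[OF norm_ge_zero le[of N]] by simp
  have fm: "f n \<in> borel_measurable lebesgue" for n using f by (rule sq_integrable_measurable)
  have gm: "g \<in> borel_measurable lebesgue" using g by (rule sq_integrable_measurable)
  have "(\<integral>\<^sup>+ x. ennreal ((cmod (F x - g x))\<^sup>2) \<partial>lebesgue)
      = (\<integral>\<^sup>+ x. liminf (\<lambda>n. ennreal ((cmod (f n x - g x))\<^sup>2)) \<partial>lebesgue)"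
  proof (rule nn_integral_cong_AE)
    show "AE x in lebesgue. ennreal ((cmod (F x - g x))\<^sup>2)
            = liminf (\<lambda>n. ennreal ((cmod (f n x - g x))\<^sup>2))"
      using lim
    proof (rule AE_mp, intro AE_I2 impI)
      fix x assume "(\<lambda>n. f n x) \<longlonglongrightarrow> F x"
      then have *: "(\<lambda>n. ennreal ((cmod (f n x - g x))\<^sup>2)) \<longlonglongrightarrow> ennreal ((cmod (F x - g x))\<^sup>2)"
        by (intro tendsto_ennrealI tendsto_intros)
      then show "ennreal ((cmod (F x - g x))\<^sup>2) = liminf (\<lambda>n. ennreal ((cmod (f n x - g x))\<^sup>2))"
        using lim_imp_Liminf[OF _ *] by simp
    qed
  qed
  also have "\<dots> \<le> liminf (\<lambda>n. \<integral>\<^sup>+ x. ennreal ((cmod (f n x - g x))\<^sup>2) \<partial>lebesgue)"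
    using fm gm by (intro nn_integral_liminf) measurable
  also have "\<dots> = liminf (\<lambda>n. ennreal ((norm (abs_l2 (f n) - abs_l2 g))\<^sup>2))"
    using f g by (simp add: abs_l2_diff ennreal_norm_abs_l2_sq sq_integrable_diff)
  also have "\<dots> \<le> ennreal (e\<^sup>2)"
    by (rule Liminf_le) (auto simp: eventually_sequentially intro!: exI[of _ N] ennreal_leI power_mono le)
  finally have *: "(\<integral>\<^sup>+ x. ennreal ((cmod (F x - g x))\<^sup>2) \<partial>lebesgue) \<le> ennreal (e\<^sup>2)" .
  have "sq_integrable (\<lambda>x. F x - g x)"
    unfolding sq_integrable_def
    using F gm *
    by (auto intro!: integrableI_bounded intro: order_le_less_trans)
  then show "sq_integrable F"
    using sq_integrable_add[OF _ g, of "\<lambda>x. F x - g x"] by simp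
  then have "ennreal ((norm (abs_l2 F - abs_l2 g))\<^sup>2) \<le> ennreal (e\<^sup>2)"
    using * g by (simp add: abs_l2_diff ennreal_norm_abs_l2_sq sq_integrable_diff)
  then show "norm (abs_l2 F - abs_l2 g) \<le> e"
    using e0 by (simp add: ennreal_le_iff power2_le_iff_abs_le)
qed

text \<open>The squared norms of the increments are at most \<open>(1/4)^n\<close>, so the weight
  \<open>2^n\<close> still leaves a convergent series of integrals. Where the weighted series is
  finite, the increments are bounded by a multiple of \<open>(sqrt (1/2))^n\<close> and hence
  summable.\<close>

lemma l2_fast_Cauchy_AE_convergent:
  assumes f: "\<And>n. sq_integrable (f n)"
    and le: "\<And>n. norm (abs_l2 (f (Suc n)) - abs_l2 (f n)) \<le> (1/2)^n"
  shows "AE x in lebesgue. convergent (\<lambda>n. f n x)"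
proof -
  define d where "d n x = (cmod (f (Suc n) x - f n x))\<^sup>2" for n x
  have fm: "f n \<in> borel_measurable lebesgue" for n using f by (rule sq_integrable_measurable)
  have dm: "d n \<in> borel_measurable lebesgue" for n
    unfolding d_def using fm by measurable
  have "(\<integral>\<^sup>+ x. (\<Sum>n. ennreal (2^n * d n x)) \<partial>lebesgue) = (\<Sum>n. \<integral>\<^sup>+ x. ennreal (2^n * d n x) \<partial>lebesgue)"
    using dm by (intro nn_integral_suminf) measurable
  also have "\<dots> \<le> (\<Sum>n. ennreal ((1/2)^n))"
  proof (intro suminf_le summableI)
    fix n
    have "(\<integral>\<^sup>+ x. ennreal (2^n * d n x) \<partial>lebesgue) = ennreal (2^n) * (\<integral>\<^sup>+ x. ennreal (d n x) \<partial>lebesgue)"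
    proof -
      have "ennreal (2^n * d n x) = ennreal (2^n) * ennreal (d n x)" for x
        by (simp add: ennreal_mult d_def)
      then show ?thesis using dm[of n] by (simp add: nn_integral_cmult)
    qed
    also have "\<dots> = ennreal (2^n * (norm (abs_l2 (f (Suc n)) - abs_l2 (f n)))\<^sup>2)"
      using f by (simp add: d_def abs_l2_diff ennreal_norm_abs_l2_sq[symmetric] sq_integrable_diff ennreal_mult)
    also have "\<dots> \<le> ennreal (2^n * ((1/2)^n)\<^sup>2)"
      by (intro ennreal_leI mult_left_mono power_mono le) auto
    also have "2^n * ((1/2)^n)\<^sup>2 = ((1/2)^n :: real)"
      by (simp add: power2_eq_square flip: power_mult_distrib)
    finally show "(\<integral>\<^sup>+ x. ennreal (2^n * d n x) \<partial>lebesgue) \<le> ennreal ((1/2)^n)" .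
  qed
  also have "\<dots> < \<infinity>"
    by (subst suminf_ennreal2) auto
  finally have "(\<integral>\<^sup>+ x. (\<Sum>n. ennreal (2^n * d n x)) \<partial>lebesgue) \<noteq> \<infinity>" by simp
  then have "AE x in lebesgue. (\<Sum>n. ennreal (2^n * d n x)) \<noteq> \<infinity>"
    using dm by (intro nn_integral_PInf_AE) measurable
  then show ?thesis
  proof (rule AE_mp, intro AE_I2 impI)
    fix x assume "(\<Sum>n. ennreal (2^n * d n x)) \<noteq> \<infinity>"
    then have "summable (\<lambda>n. 2^n * d n x)"
      by (intro summable_suminf_not_top) (auto simp: d_def)
    then have "Bseq (\<lambda>n. 2^n * d n x)"
      by (intro convergent_imp_Bseq) (auto simp: convergent_def intro: summable_LIMSEQ_zero)
    then obtain C where C: "C > 0" "\<And>n. norm (2^n * d n x) \<le> C"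
      by (auto simp: Bseq_def)
    have "norm (f (Suc n) x - f n x) \<le> sqrt C * (sqrt (1/2))^n" for n
    proof -
      have "d n x \<le> C * (1/2)^n"
        using C(2)[of n] by (simp add: d_def field_simps)
      then have "sqrt (d n x) \<le> sqrt C * sqrt ((1/2)^n)"
        by (simp flip: real_sqrt_mult)
      then show ?thesis by (simp add: d_def real_sqrt_power)
    qed
    then have "summable (\<lambda>n. f (Suc n) x - f n x)"
      by (intro summable_comparison_test[OF _ summable_mult[OF summable_geometric]]) auto
    then have "convergent (\<lambda>n. \<Sum>k<n. f (Suc k) x - f k x)"
      by (simp add: summable_iff_convergent)
    moreover have "(\<Sum>k<n. f (Suc k) x - f k x) = f n x - f 0 x" for n
      by (rule sum_lessThan_telescope)
    ultimately have "convergent (\<lambda>n. f n x - f 0 x)"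
      by simp
    then show "convergent (\<lambda>n. f n x)"
      using convergent_add[OF _ convergent_const[of "f 0 x"], of "\<lambda>n. f n x - f 0 x"] by simp
  qed
qed

instance l2 :: (euclidean_space) banach
proof
  fix X :: "nat \<Rightarrow> 'a l2" assume X: "Cauchy X"
  obtain r :: "nat \<Rightarrow> nat" where r: "strict_mono r" "\<And>k. dist (X (r (Suc k))) (X (r k)) < (1/2)^k"
  proof -
    have "\<exists>N. \<forall>m\<ge>N. \<forall>n\<ge>N. dist (X m) (X n) < (1/2)^k" for k
      using X by (intro metric_CauchyD) auto
    then obtain N where N: "\<And>k m n. m \<ge> N k \<Longrightarrow> n \<ge> N k \<Longrightarrow> dist (X m) (X n) < (1/2)^k"
      by metis
    \<comment> \<open>The entry \<open>Suc s\<close> keeps the indices strictly increasing, the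
      other one makes them large enough for the next distance.\<close>
    define r where "r = rec_nat (N 0) (\<lambda>k s. max (Suc s) (N (Suc k)))"
    have r: "r (Suc k) = max (Suc (r k)) (N (Suc k))" for k by (simp add: r_def)
    have r0: "r k \<ge> N k" for k
      by (cases k) (simp_all add: r r_def[THEN fun_cong, of 0])
    have r1: "r (Suc k) > r k" for k by (simp add: r less_max_iff_disj)
    show ?thesis
    proof (rule that[of r])
      show "strict_mono r" using r1 by (simp add: strict_mono_Suc_iff)
      show "dist (X (r (Suc k))) (X (r k)) < (1/2)^k" for k
        using r0[of k] r1[of k] by (intro N) auto
    qed
  qed
  have "\<forall>n. \<exists>f. sq_integrable f \<and> X (r n) = abs_l2 f"
    by (metis l2_cases)
  then obtain f where f: "\<And>n. sq_integrable (f n)" "\<And>n. X (r n) = abs_l2 (f n)"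
    by metis
  have conv: "AE x in lebesgue. convergent (\<lambda>n. f n x)"
    using r(2) by (intro l2_fast_Cauchy_AE_convergent f) (simp add: f(2)[symmetric] dist_norm less_imp_le)
  define F where "F x = lim (\<lambda>n. f n x)" for x
  have Fm: "F \<in> borel_measurable lebesgue"
    unfolding F_def using f(1)[THEN sq_integrable_measurable] by measurable
  have lim: "AE x in lebesgue. (\<lambda>n. f n x) \<longlonglongrightarrow> F x"
    using conv by (rule AE_mp) (simp add: F_def convergent_LIMSEQ_iff)
  have close: "norm (abs_l2 F - X (r k)) \<le> e \<and> sq_integrable F"
    if "\<And>n. n \<ge> N \<Longrightarrow> norm (X (r n) - X (r k)) \<le> e" for k e N
    using l2_fatou[OF f(1) Fm lim f(1), of N k e] that by (simp add: f(2))
  have "(X \<circ> r) \<longlonglongrightarrow> abs_l2 F"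
  proof (rule metric_LIMSEQ_I)
    fix e :: real assume e: "e > 0"
    have "Cauchy (X \<circ> r)" using X r(1) by (rule Cauchy_subseq_Cauchy)
    then obtain N where N: "\<And>m n. m \<ge> N \<Longrightarrow> n \<ge> N \<Longrightarrow> dist (X (r m)) (X (r n)) < e/2"
      using metric_CauchyD[of "X \<circ> r" "e/2"] e by auto
    have "dist ((X \<circ> r) n) (abs_l2 F) < e" if n: "n \<ge> N" for n
    proof -
      have "norm (abs_l2 F - X (r n)) \<le> e/2"
        using close[of N n "e/2"] N n by (simp add: dist_norm less_imp_le)
      then show ?thesis using e by (simp add: dist_norm norm_minus_commute)
    qed
    then show "\<exists>no. \<forall>n\<ge>no. dist ((X \<circ> r) n) (abs_l2 F) < e" by blast
  qed
  then show "convergent X"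
    using X r(1) Cauchy_converges_subseq[of X r] by (auto simp: convergent_def o_def)
qed

section \<open>Multiplication operators\<close>

definition bounded_measurable :: "('a::euclidean_space \<Rightarrow> complex) \<Rightarrow> bool" where
  "bounded_measurable m \<longleftrightarrow> m \<in> borel_measurable lebesgue \<and> (\<exists>C. \<forall>x. cmod (m x) \<le> C)"

lemma sq_integrable_bounded_measurable_mult:
  "bounded_measurable m \<Longrightarrow> sq_integrable f \<Longrightarrow> sq_integrable (\<lambda>x. m x * f x)"
  by (auto simp: bounded_measurable_def intro: sq_integrable_bounded_mult)

text \<open>The multipliers that occur are constants, which carry the complex structure; the
  coefficient B; square roots of the other coefficients, which turn weighted products into plain
  ones; and the indicator of the slab, which acts as a projection.\<close>

lift_definition mul :: "('a::euclidean_space \<Rightarrow> complex) \<Rightarrow> 'a l2 \<Rightarrow> 'a l2"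
  is "\<lambda>m f. if bounded_measurable m then (\<lambda>x. m x * f x) else (\<lambda>x. 0)"
  by (auto simp: sq_integrable_zero sq_integrable_bounded_measurable_mult elim!: AE_mp)

lemma mul_abs_l2:
  "bounded_measurable m \<Longrightarrow> sq_integrable f \<Longrightarrow> mul m (abs_l2 f) = abs_l2 (\<lambda>x. m x * f x)"
  by (simp add: mul.abs_eq)

lemma norm_mul_le:
  assumes m: "bounded_measurable m" and le: "\<And>x. cmod (m x) \<le> C"
  shows "norm (mul m x) \<le> C * norm x"
proof -
  have C: "C \<ge> 0" using order_trans[OF norm_ge_zero le] .
  obtain f where f: "sq_integrable f" "x = abs_l2 f" by (rule l2_cases)
  have mf: "sq_integrable (\<lambda>x. m x * f x)" using m f(1) by (rule sq_integrable_bounded_measurable_mult)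
  have "(norm (mul m x))\<^sup>2 = (LINT x|lebesgue. (cmod (m x * f x))\<^sup>2)"
    using m f by (simp add: mul_abs_l2 norm_abs_l2_sq mf)
  also have "\<dots> \<le> (LINT x|lebesgue. C\<^sup>2 * (cmod (f x))\<^sup>2)"
    using mf f(1) by (intro integral_mono)
      (auto simp: sq_integrable_def norm_mult power_mult_distrib intro!: mult_right_mono power_mono le)
  also have "\<dots> = (C * norm x)\<^sup>2"
    using f by (simp add: norm_abs_l2_sq power_mult_distrib)
  finally show ?thesis
    using C by (simp add: power2_le_iff_abs_le)
qed

lemma bounded_linear_mul:
  assumes m: "bounded_measurable m"
  shows "bounded_linear (mul m)"
proof
  show "mul m (x + y) = mul m x + mul m y" for x y
    by (rule l2_cases[of x], rule l2_cases[of y])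
       (simp add: m mul_abs_l2 abs_l2_add sq_integrable_add sq_integrable_bounded_measurable_mult distrib_left)
  show "mul m (r *\<^sub>R x) = r *\<^sub>R mul m x" for r x
    by (rule l2_cases[of x])
       (simp add: m mul_abs_l2 abs_l2_scaleR sq_integrable_cmult sq_integrable_bounded_measurable_mult mult.left_commute)
  obtain C where "\<And>x. cmod (m x) \<le> C"
    using m by (auto simp: bounded_measurable_def)
  then show "\<exists>K. \<forall>x. norm (mul m x) \<le> norm x * K"
    using norm_mul_le[OF m] by (metis mult.commute)
qed

lemma norm_mul_ge:
  assumes m: "bounded_measurable m" and ge: "\<And>x. c \<le> cmod (m x)" and c: "c \<ge> 0"
  shows "c * norm x \<le> norm (mul m x)"
proof -
  obtain f where f: "sq_integrable f" "x = abs_l2 f" by (rule l2_cases)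
  have mf: "sq_integrable (\<lambda>x. m x * f x)" using m f(1) by (rule sq_integrable_bounded_measurable_mult)
  have "(c * norm x)\<^sup>2 = (LINT x|lebesgue. c\<^sup>2 * (cmod (f x))\<^sup>2)"
    using f by (simp add: norm_abs_l2_sq power_mult_distrib)
  also have "\<dots> \<le> (LINT x|lebesgue. (cmod (m x * f x))\<^sup>2)"
    using mf f(1) c by (intro integral_mono)
      (auto simp: sq_integrable_def norm_mult power_mult_distrib intro!: mult_right_mono power_mono ge)
  also have "\<dots> = (norm (mul m x))\<^sup>2"
    using m f by (simp add: mul_abs_l2 norm_abs_l2_sq mf)
  finally show ?thesis
    using c by (simp add: power2_le_iff_abs_le)
qed

text \<open>Symmetric Lax--Milgram on a closed subspace, by minimising the energy.\<close>

lemma form_representation: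
  fixes \<beta> :: "'a::banach \<Rightarrow> 'a \<Rightarrow> real"
  assumes \<beta>: "bounded_bilinear \<beta>" and Z: "subspace Z" "closed Z"
    and sym: "\<And>x y. x \<in> Z \<Longrightarrow> y \<in> Z \<Longrightarrow> \<beta> x y = \<beta> y x"
    and coer: "\<And>x. x \<in> Z \<Longrightarrow> c * (norm x)\<^sup>2 \<le> \<beta> x x" and c: "c > 0"
    and f: "bounded_linear f"
  shows "\<exists>x\<in>Z. \<forall>y\<in>Z. \<beta> x y = f y"
proof -
  interpret \<beta>: bounded_bilinear \<beta> by fact
  interpret f: bounded_linear f by fact
  obtain B where B: "\<And>x. \<bar>f x\<bar> \<le> norm x * B" "B > 0"
    using f.pos_bounded by auto
  \<comment> \<open>On Z, the derivative of this functional at x in direction y is twice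
    \<open>\<beta> x y - f y\<close>, so a minimiser is the vector wanted.\<close>
  define F where "F x = \<beta> x x - 2 * f x" for x
  have F_ge: "F x \<ge> - (B\<^sup>2 / c)" if "x \<in> Z" for x
  proof -
    have "0 \<le> (c * norm x - B)\<^sup>2" by simp
    then have "2 * (norm x * B) \<le> c * (norm x)\<^sup>2 + B\<^sup>2 / c"
      using c by (simp add: power2_eq_square field_simps)
    then show ?thesis using coer[OF that] B(1)[of x] by (simp add: F_def abs_le_iff)
  qed
  define I where "I = Inf (F ` Z)"
  have 0: "0 \<in> Z" using Z(1) by (rule subspace_0)
  have bdd: "bdd_below (F ` Z)" using F_ge by (auto intro!: bdd_belowI[of _ "- (B\<^sup>2 / c)"])
  have I_le: "I \<le> F x" if "x \<in> Z" for x
    unfolding I_def using bdd that by (intro cInf_lower) auto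
  have "\<exists>x\<in>Z. F x < I + inverse (Suc n)" for n
  proof -
    have "Inf (F ` Z) < I + inverse (Suc n)" by (simp add: I_def)
    then show ?thesis using 0 by (subst (asm) cInf_less_iff) (use bdd in auto)
  qed
  then obtain X where X: "\<And>n. X n \<in> Z" "\<And>n. F (X n) < I + inverse (Suc n)" by metis
  \<comment> \<open>Parallelogram law: the midpoint cannot fall below the infimum \<open>I\<close>,
    so two nearly minimal points are close to each other.\<close>
  have mid: "c * (norm (x - y))\<^sup>2 \<le> 2 * F x + 2 * F y - 4 * I" if "x \<in> Z" "y \<in> Z" for x y
  proof -
    have z: "(1/2) *\<^sub>R (x + y) \<in> Z" "x - y \<in> Z"
      using that Z(1) by (auto intro: subspace_scale subspace_add subspace_diff)
    have "4 * F ((1/2) *\<^sub>R (x + y)) + \<beta> (x - y) (x - y) = 2 * F x + 2 * F y"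
      by (simp add: F_def \<beta>.add_left \<beta>.add_right \<beta>.diff_left \<beta>.diff_right \<beta>.scaleR_left
          \<beta>.scaleR_right f.add f.scaleR algebra_simps)
    then show ?thesis using I_le[OF z(1)] coer[OF z(2)] by linarith
  qed
  have "Cauchy X"
  proof (rule metric_CauchyI)
    fix e :: real assume e: "e > 0"
    obtain N where N: "inverse (Suc N) < c * e\<^sup>2 / 4"
      using reals_Archimedean[of "c * e\<^sup>2 / 4"] e c by auto
    have "dist (X m) (X n) < e" if "m \<ge> N" "n \<ge> N" for m n
    proof -
      have le: "inverse (real (Suc k)) \<le> inverse (Suc N)" if "k \<ge> N" for k
        using that by (intro le_imp_inverse_le) auto
      have "c * (norm (X m - X n))\<^sup>2 < c * e\<^sup>2"
        using mid[OF X(1) X(1), of m n] X(2)[of m] X(2)[of n] le[OF that(1)] le[OF that(2)] N by linarith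
      then show ?thesis using c e by (simp add: dist_norm power_less_imp_less_base)
    qed
    then show "\<exists>M. \<forall>m\<ge>M. \<forall>n\<ge>M. dist (X m) (X n) < e" by blast
  qed
  then obtain x where x: "X \<longlonglongrightarrow> x" by (auto simp: Cauchy_convergent_iff convergent_def)
  have xZ: "x \<in> Z" using Z(2) X(1) x by (rule closed_sequentially)
  have "(\<lambda>n. F (X n)) \<longlonglongrightarrow> F x"
    unfolding F_def by (intro tendsto_intros \<beta>.tendsto f.tendsto x)
  moreover have "(\<lambda>n. I + inverse (real (Suc n))) \<longlonglongrightarrow> I + 0"
    by (intro tendsto_intros LIMSEQ_inverse_real_of_nat)
  ultimately have FxI: "F x \<le> I"
    using X(2) by (intro LIMSEQ_le[of "\<lambda>n. F (X n)" "F x" "\<lambda>n. I + inverse (real (Suc n))"]) (auto intro: less_imp_le)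
  have "\<beta> x y = f y" if y: "y \<in> Z" for y
  proof -
    define d where "d = \<beta> x y - f y"
    have *: "0 \<le> 2 * s * d + s\<^sup>2 * \<beta> y y" for s
    proof -
      have "x + s *\<^sub>R y \<in> Z" using xZ y Z(1) by (intro subspace_add subspace_scale)
      from I_le[OF this] have "F x \<le> F (x + s *\<^sub>R y)" using FxI by linarith
      then show ?thesis
        by (simp add: F_def d_def \<beta>.add_left \<beta>.add_right \<beta>.scaleR_left
          \<beta>.scaleR_right f.add f.scaleR algebra_simps sym[OF y xZ] power2_eq_square)
    qed
    \<comment> \<open>The quadratic in \<open>s\<close> is least at
      \<open>- d / \<beta> y y\<close>. Adding 1 to the denominator avoids division by zero and
      still gives a negative value unless \<open>d\<close> vanishes.\<close>
    define q where "q = \<beta> y y + 1"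
    have q: "q > 0" using coer[OF y] c by (simp add: q_def add_nonneg_pos order_trans[rotated])
    have "0 \<le> 2 * (- d / q) * d + (- d / q)\<^sup>2 * \<beta> y y" by (rule *)
    also have "\<dots> = - (d\<^sup>2) * (\<beta> y y + 2) / q\<^sup>2"
      using q by (simp add: q_def power2_eq_square divide_simps) (simp add: algebra_simps)
    finally have "d\<^sup>2 * (\<beta> y y + 2) / q\<^sup>2 \<le> 0" by simp
    moreover have "(\<beta> y y + 2) / q\<^sup>2 > 0" using q by (auto simp: q_def)
    ultimately have "d\<^sup>2 \<le> 0"
      by (metis mult_le_0_iff not_less times_divide_eq_right)
    then show ?thesis by (simp add: d_def)
  qed
  then show ?thesis using xZ by blast
qed

text \<open>Solves the representation problem for all functionals \<open>k x\<close> at once.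
  Coercivity makes the solution unique, hence linear in \<open>x\<close>, and testing with
  \<open>K x\<close> itself bounds it. This is how forms are turned into bounded operators
  below.\<close>

lemma form_operator:
  fixes \<beta> :: "'a::banach \<Rightarrow> 'a \<Rightarrow> real" and k :: "'b::real_normed_vector \<Rightarrow> 'a \<Rightarrow> real"
  assumes \<beta>: "bounded_bilinear \<beta>" and Z: "subspace Z" "closed Z"
    and sym: "\<And>x y. x \<in> Z \<Longrightarrow> y \<in> Z \<Longrightarrow> \<beta> x y = \<beta> y x"
    and coer: "\<And>x. x \<in> Z \<Longrightarrow> c * (norm x)\<^sup>2 \<le> \<beta> x x" and c: "c > 0"
    and k: "bounded_bilinear k"
  shows "\<exists>K. bounded_linear K \<and> (\<forall>x. K x \<in> Z \<and> (\<forall>y\<in>Z. \<beta> (K x) y = k x y))"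
proof -
  interpret \<beta>: bounded_bilinear \<beta> by fact
  interpret k: bounded_bilinear k by fact
  have "\<exists>z\<in>Z. \<forall>y\<in>Z. \<beta> z y = k x y" for x
    by (rule form_representation[OF \<beta> Z sym coer c k.bounded_linear_right])
  then obtain K where K: "\<And>x. K x \<in> Z" "\<And>x y. y \<in> Z \<Longrightarrow> \<beta> (K x) y = k x y" by metis
  have uniq: "z = z'" if "z \<in> Z" "z' \<in> Z" "\<And>y. y \<in> Z \<Longrightarrow> \<beta> z y = \<beta> z' y" for z z'
  proof -
    have d: "z - z' \<in> Z" using that Z(1) by (auto intro: subspace_diff)
    have "\<beta> (z - z') (z - z') = 0" using that(3)[OF d] by (simp add: \<beta>.diff_left)
    then show ?thesis using coer[OF d] c by (simp add: mult_le_0_iff)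
  qed
  have "bounded_linear K"
  proof
    show "K (x + y) = K x + K y" for x y
      by (rule uniq) (use K Z(1) in \<open>auto intro: subspace_add simp: \<beta>.add_left k.add_left\<close>)
    show "K (r *\<^sub>R x) = r *\<^sub>R K x" for r x
      by (rule uniq) (use K Z(1) in \<open>auto intro: subspace_scale simp: \<beta>.scaleR_left k.scaleR_left\<close>)
    obtain B where B: "B \<ge> 0" "\<And>x y. \<bar>k x y\<bar> \<le> norm x * norm y * B" using k.nonneg_bounded by auto
    have "norm (K x) \<le> norm x * (B / c)" for x
    proof (cases "K x = 0")
      case True
      then show ?thesis using B(1) c by simp
    next
      case False
      have "c * (norm (K x))\<^sup>2 \<le> norm x * norm (K x) * B"
        using coer[OF K(1)[of x]] K(2)[OF K(1), of x x] B(2)[of x "K x"] by linarith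
      then show ?thesis using False c by (simp add: power2_eq_square field_simps)
    qed
    then show "\<exists>B. \<forall>x. norm (K x) \<le> norm x * B" by blast
  qed
  then show ?thesis using K by blast
qed


subsection \<open>Exponential of a bounded operator\<close>

definition op_exp :: "('a::banach \<Rightarrow> 'a) \<Rightarrow> real \<Rightarrow> 'a \<Rightarrow> 'a" where
  "op_exp G t x = (\<Sum>n. (t ^ n / fact n) *\<^sub>R (G ^^ n) x)"

lemma op_power_bound:
  fixes G :: "'a::real_normed_vector \<Rightarrow> 'a"
  assumes "bounded_linear G" "\<And>x. norm (G x) \<le> norm x * C" "C \<ge> 0"
  shows "norm ((G ^^ n) x) \<le> C ^ n * norm x"
proof (induction n)
  case (Suc n)
  have "norm ((G ^^ Suc n) x) \<le> norm ((G ^^ n) x) * C" using assms(2)[of "(G ^^ n) x"] by simp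
  also have "\<dots> \<le> C ^ n * norm x * C" using Suc assms(3) by (intro mult_right_mono) auto
  finally show ?case by (simp add: algebra_simps)
qed simp

lemma op_exp_summable:
  assumes G: "bounded_linear (G :: 'a::banach \<Rightarrow> 'a)"
  shows "summable (\<lambda>n. (t ^ n / fact n) *\<^sub>R (G ^^ n) x)"
proof -
  obtain C where C: "C > 0" "\<And>x. norm (G x) \<le> norm x * C"
    using bounded_linear.pos_bounded[OF G] by auto
  show ?thesis
  proof (rule summable_comparison_test)
    show "summable (\<lambda>n. ((\<bar>t\<bar> * C) ^ n / fact n) * norm x)"
      using summable_exp[of "\<bar>t\<bar> * C"] by (intro summable_mult2) (simp add: field_simps)
    show "\<exists>N. \<forall>n\<ge>N. norm ((t ^ n / fact n) *\<^sub>R (G ^^ n) x) \<le> ((\<bar>t\<bar> * C) ^ n / fact n) * norm x"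
    proof (intro exI allI impI)
      fix n
      have "norm ((t ^ n / fact n) *\<^sub>R (G ^^ n) x) = \<bar>t\<bar> ^ n / fact n * norm ((G ^^ n) x)"
        by (simp add: power_abs)
      also have "\<dots> \<le> \<bar>t\<bar> ^ n / fact n * (C ^ n * norm x)"
        using op_power_bound[OF G C(2)] C(1) by (intro mult_left_mono) auto
      finally show "norm ((t ^ n / fact n) *\<^sub>R (G ^^ n) x) \<le> ((\<bar>t\<bar> * C) ^ n / fact n) * norm x"
        by (simp add: power_mult_distrib)
    qed
  qed
qed

text \<open>Commutation is asked for on an invariant subspace only: the operators to which this is
  applied are defined through forms on Z and need not commute outside it.\<close>

lemma op_exp_commute:
  assumes "bounded_linear (G :: 'a::banach \<Rightarrow> 'a)" "bounded_linear L" "subspace Z"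
    and "\<And>x. x \<in> Z \<Longrightarrow> G x \<in> Z" "\<And>x. x \<in> Z \<Longrightarrow> L (G x) = G (L x)" "x \<in> Z"
  shows "L (op_exp G t x) = op_exp G t (L x)"
proof -
  interpret L: bounded_linear L by fact
  have *: "(G ^^ n) x \<in> Z \<and> L ((G ^^ n) x) = (G ^^ n) (L x)" for n
    by (induction n) (auto simp: assms)
  show ?thesis
    unfolding op_exp_def using L.suminf[OF op_exp_summable[OF assms(1)], of t x, symmetric] *
    by (simp add: L.scaleR)
qed

lemma op_exp_0: "op_exp G 0 x = x"
proof -
  have "(\<lambda>n. (0 ^ n / fact n) *\<^sub>R (G ^^ n) x) sums (\<Sum>n\<in>{0}. (0 ^ n / fact n) *\<^sub>R (G ^^ n) x)"
    by (rule sums_finite) auto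
  then show ?thesis by (simp add: op_exp_def sums_iff)
qed

lemma op_exp_closed:
  assumes "bounded_linear (G :: 'a::banach \<Rightarrow> 'a)" "subspace Z" "closed Z" "\<And>x. x \<in> Z \<Longrightarrow> G x \<in> Z" "x \<in> Z"
  shows "op_exp G t x \<in> Z"
proof -
  have *: "(G ^^ n) x \<in> Z" for n by (induction n) (auto simp: assms)
  have lim: "(\<lambda>n. \<Sum>k<n. (t ^ k / fact k) *\<^sub>R (G ^^ k) x) \<longlonglongrightarrow> op_exp G t x"
    unfolding op_exp_def using op_exp_summable[OF assms(1)] by (rule summable_LIMSEQ)
  show ?thesis
    by (rule closed_sequentially[OF assms(3) _ lim]) (intro subspace_sum subspace_scale assms(2) *)
qed

lemma op_exp_has_vector_derivative:
  assumes G: "bounded_linear (G :: 'a::banach \<Rightarrow> 'a)"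
  shows "((\<lambda>t. op_exp G t x) has_vector_derivative G (op_exp G t x)) (at t)"
proof -
  interpret G: bounded_linear G by fact
  obtain C where C: "C > 0" "\<And>x. norm (G x) \<le> norm x * C"
    using bounded_linear.pos_bounded[OF G] by auto
  define T where "T = \<bar>t\<bar> + 1"
  let ?f = "\<lambda>n t. (t ^ n / fact n) *\<^sub>R (G ^^ n) x"
  let ?f' = "\<lambda>n t. (real n * t ^ (n - 1) / fact n) *\<^sub>R (G ^^ n) x"
  \<comment> \<open>The derivative of the term of index \<open>n + 1\<close> is \<open>G\<close>
    applied to the term of index \<open>n\<close>; this shift is what produces \<open>G\<close> in
    the derivative of the series.\<close>
  have suc: "?f' (Suc n) s = G (?f n s)" for n s
    by (simp add: G.scaleR field_simps del: of_nat_Suc)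
  have sums: "(\<lambda>n. ?f' n s) sums G (op_exp G s x)" for s
  proof -
    have "(\<lambda>n. G (?f n s)) sums G (op_exp G s x)"
      unfolding op_exp_def by (rule G.sums[OF summable_sums[OF op_exp_summable[OF G]]])
    then have "(\<lambda>n. ?f' (Suc n) s) sums G (op_exp G s x)" by (simp only: suc)
    then show ?thesis by (subst (asm) sums_Suc_iff) simp
  qed
  have unif: "uniform_limit (ball 0 T) (\<lambda>n s. \<Sum>i<n. ?f' i s) (\<lambda>s. suminf (\<lambda>i. ?f' i s)) sequentially"
  proof (rule Weierstrass_m_test)
    let ?M = "\<lambda>n. case n of 0 \<Rightarrow> 0 | Suc m \<Rightarrow> C * norm x * ((T * C) ^ m / fact m)"
    show "norm (?f' n s) \<le> ?M n" if "s \<in> ball 0 T" for n s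
    proof (cases n)
      case (Suc m)
      have "norm (?f' n s) \<le> norm (?f m s) * C" unfolding Suc suc by (rule C(2))
      also have "norm (?f m s) = \<bar>s\<bar> ^ m / fact m * norm ((G ^^ m) x)" by (simp add: power_abs)
      also have "\<dots> \<le> T ^ m / fact m * (C ^ m * norm x)"
        using that op_power_bound[OF G C(2)] C(1)
        by (intro mult_mono divide_right_mono power_mono) (auto simp: dist_norm T_def)
      finally show ?thesis using C(1) by (simp add: Suc power_mult_distrib algebra_simps)
    qed simp
    have "summable (\<lambda>m. C * norm x * ((T * C) ^ m / fact m))"
      using summable_exp[of "T * C"] by (intro summable_mult) (simp add: field_simps)
    then show "summable ?M" by (subst summable_Suc_iff[symmetric]) simp
  qed
  have "\<exists>g. \<forall>s\<in>ball 0 T. (\<lambda>n. ?f n s) sums g s \<and> (g has_derivative (\<lambda>h. h *\<^sub>R G (op_exp G s x))) (at s within ball 0 T)"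
  proof (rule has_derivative_series)
    show "convex (ball (0::real) T)" by simp
    show "((\<lambda>s. ?f n s) has_derivative (\<lambda>h. h *\<^sub>R ?f' n s)) (at s within ball 0 T)" if "s \<in> ball 0 T" for n s
      by (auto intro!: derivative_eq_intros ext simp: field_simps)
    show "\<forall>\<^sub>F n in sequentially. \<forall>s\<in>ball 0 T. \<forall>h. norm (sum (\<lambda>i. h *\<^sub>R ?f' i s) {..<n} - h *\<^sub>R G (op_exp G s x)) \<le> e * norm h"
      if "e > 0" for e
      using uniform_limitD[OF unif that]
    proof eventually_elim
      case (elim n)
      show ?case
      proof (intro ballI allI)
        fix s h assume "s \<in> ball (0::real) T"
        then have "dist (\<Sum>i<n. ?f' i s) (suminf (\<lambda>i. ?f' i s)) < e"
          using elim by blast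
        then have "norm ((\<Sum>i<n. ?f' i s) - G (op_exp G s x)) \<le> e"
          unfolding sums_unique[OF sums, symmetric] dist_norm by (rule less_imp_le)
        then have "\<bar>h\<bar> * norm ((\<Sum>i<n. ?f' i s) - G (op_exp G s x)) \<le> e * norm h"
          unfolding real_norm_def mult.commute[of e] by (rule mult_left_mono) simp
        then show "norm (sum (\<lambda>i. h *\<^sub>R ?f' i s) {..<n} - h *\<^sub>R G (op_exp G s x)) \<le> e * norm h"
          by (simp only: scaleR_sum_right[symmetric] scaleR_diff_right[symmetric] norm_scaleR)
      qed
    qed
    show "0 \<in> ball (0::real) T" by (simp add: T_def)
    show "(\<lambda>n. ?f n 0) sums op_exp G 0 x" unfolding op_exp_def using op_exp_summable[OF G] by (rule summable_sums)
  qed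
  then obtain g where g: "\<forall>s\<in>ball 0 T. (\<lambda>n. ?f n s) sums g s \<and>
      (g has_derivative (\<lambda>h. h *\<^sub>R G (op_exp G s x))) (at s within ball 0 T)"
    by (rule exE)
  have t: "t \<in> ball 0 T" by (simp add: T_def)
  have "(g has_derivative (\<lambda>h. h *\<^sub>R G (op_exp G t x))) (at t)"
    using conjunct2[OF bspec[OF g t]] by (simp only: at_within_open[OF t open_ball])
  then show ?thesis unfolding has_vector_derivative_def
    by (rule has_derivative_transform_within_open[OF _ open_ball t]) (unfold op_exp_def, rule sums_unique[OF conjunct1[OF bspec[OF g]]])
qed


lemma subspace_closure:
  fixes S :: "'a::real_normed_vector set"
  assumes "subspace S" shows "subspace (closure S)"
  unfolding subspace_def
proof (intro conjI ballI allI)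
  show "0 \<in> closure S" using subspace_0[OF assms] closure_subset by blast
  fix x assume "x \<in> closure S"
  then obtain f where f: "\<And>n. f n \<in> S" "f \<longlonglongrightarrow> x" by (auto simp: closure_sequential)
  show "c *\<^sub>R x \<in> closure S" for c
    unfolding closure_sequential
    by (rule exI[of _ "\<lambda>n. c *\<^sub>R f n"]) (auto intro!: tendsto_intros f subspace_scale[OF assms])
  fix y assume "y \<in> closure S"
  then obtain g where g: "\<And>n. g n \<in> S" "g \<longlonglongrightarrow> y" by (auto simp: closure_sequential)
  show "x + y \<in> closure S"
    unfolding closure_sequential
    by (rule exI[of _ "\<lambda>n. f n + g n"]) (auto intro!: tendsto_intros f g subspace_add[OF assms])
qed

section \<open>Evolution generated by a skew form\<close>

text \<open>The equation to be solved is d/dt k(u, y) = (j u, j y) for all y in Z. The energy is the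
  squared norm of \<open>j u\<close>; going through \<open>j\<close> separates it from the given
  norm of Z, to which it is equivalent on Z. Nondegeneracy of k will say that the operator
  representing k has dense range.\<close>

locale skew_form =
  fixes Z :: "'z::banach set" and j :: "'z \<Rightarrow> 'x::real_inner" and k :: "'z \<Rightarrow> 'z \<Rightarrow> real" and m :: real
  assumes subspace_Z: "subspace Z" and closed_Z: "closed Z"
    and j: "bounded_linear j" and m: "m > 0" and j_ge: "\<And>z. z \<in> Z \<Longrightarrow> m * norm z \<le> norm (j z)"
    and k: "bounded_bilinear k" and k_skew: "\<And>x y. x \<in> Z \<Longrightarrow> y \<in> Z \<Longrightarrow> k x y = - k y x"
    and k_nondegenerate: "\<And>x. x \<in> Z \<Longrightarrow> (\<And>y. y \<in> Z \<Longrightarrow> k x y = 0) \<Longrightarrow> x = 0"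
begin

sublocale j: bounded_linear j by (rule j)
sublocale k: bounded_bilinear k by (rule k)

definition b :: "'z \<Rightarrow> 'z \<Rightarrow> real" where "b x y = inner (j x) (j y)"

lemma bounded_bilinear_b: "bounded_bilinear b"
  unfolding b_def by (rule bounded_bilinear.comp[OF bounded_bilinear_inner j j])

sublocale b: bounded_bilinear b by (rule bounded_bilinear_b)

lemma b_sym: "b x y = b y x" by (simp add: b_def inner_commute)

lemma b_self: "b x x = (norm (j x))\<^sup>2" by (simp add: b_def power2_norm_eq_inner)

lemma b_le: "\<bar>b x y\<bar> \<le> norm (j x) * norm (j y)"
  unfolding b_def by (rule Cauchy_Schwarz_ineq2)

lemma j_ge_sq: "z \<in> Z \<Longrightarrow> m\<^sup>2 * (norm z)\<^sup>2 \<le> (norm (j z))\<^sup>2"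
  using power_mono[OF j_ge, of z 2] m by (simp add: power_mult_distrib)

lemma Z_eqI:
  assumes "x \<in> Z" "y \<in> Z" "\<And>z. z \<in> Z \<Longrightarrow> b x z = b y z"
  shows "x = y"
proof -
  have d: "x - y \<in> Z" using assms(1,2) by (rule subspace_diff[OF subspace_Z])
  have "b (x - y) (x - y) = 0" using assms(3)[OF d] by (simp add: b.diff_left)
  then show ?thesis using j_ge[OF d] m by (simp add: b_self mult_le_0_iff)
qed

lemma ex_K: "\<exists>K. bounded_linear K \<and> (\<forall>x. K x \<in> Z \<and> (\<forall>y\<in>Z. b (K x) y = k x y))"
  by (rule form_operator[OF bounded_bilinear_b subspace_Z closed_Z b_sym _ _ k, where c = "m\<^sup>2"])
     (use m j_ge_sq in \<open>auto simp: b_self\<close>)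

definition K :: "'z \<Rightarrow> 'z" where
  "K = (SOME K. bounded_linear K \<and> (\<forall>x. K x \<in> Z \<and> (\<forall>y\<in>Z. b (K x) y = k x y)))"

lemma bounded_linear_K: "bounded_linear K" and K_in: "K x \<in> Z" and b_K: "y \<in> Z \<Longrightarrow> b (K x) y = k x y"
  using someI_ex[OF ex_K] unfolding K_def[symmetric] by auto

sublocale K: bounded_linear K by (rule bounded_linear_K)

lemma K_skew: "x \<in> Z \<Longrightarrow> y \<in> Z \<Longrightarrow> b (K x) y = - b x (K y)"
  by (metis b_K b_sym k_skew)

text \<open>For y in Z, skewness gives \<open>b (K w) (K y) = - b (K (K w)) y\<close> for w in Z, so
  the operator obtained is the resolvent (\<epsilon> - K^2)^(-1) on Z. It exists because the second
  term of the form is nonnegative on the diagonal and cannot spoil coercivity.\<close>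

lemma ex_M:
  assumes "\<epsilon> > 0"
  shows "\<exists>M. bounded_linear M \<and> (\<forall>x. M x \<in> Z \<and> (\<forall>y\<in>Z. \<epsilon> * b (M x) y + b (K (M x)) (K y) = b x y))"
proof -
  \<comment> \<open>Written as an inner product of pairs, the form is visibly bilinear, bounded and
    symmetric.\<close>
  let ?j = "\<lambda>x. (sqrt \<epsilon> *\<^sub>R j x, j (K x))"
  have bl: "bounded_linear ?j"
    by (intro bounded_linear_Pair bounded_linear_scaleR_right[THEN bounded_linear_compose]
        j bounded_linear_compose[OF j bounded_linear_K])
  have eq: "inner (?j x) (?j y) = \<epsilon> * b x y + b (K x) (K y)" for x y
    using assms by (simp add: b_def)
  show ?thesis
    unfolding eq[symmetric]
  proof (rule form_operator[OF _ subspace_Z closed_Z _ _ _ bounded_bilinear_b, where c = "\<epsilon> * m\<^sup>2"])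
    show "bounded_bilinear (\<lambda>x y. inner (?j x) (?j y))"
      by (rule bounded_bilinear.comp[OF bounded_bilinear_inner bl bl])
    show "inner (?j x) (?j y) = inner (?j y) (?j x)" for x y by (rule inner_commute)
    show "\<epsilon> * m\<^sup>2 > 0" using assms m by simp
    fix x assume "x \<in> Z"
    then have "\<epsilon> * (m\<^sup>2 * (norm x)\<^sup>2) \<le> \<epsilon> * (norm (j x))\<^sup>2"
      using j_ge_sq assms by (intro mult_left_mono) auto
    then show "\<epsilon> * m\<^sup>2 * (norm x)\<^sup>2 \<le> inner (?j x) (?j x)"
      unfolding eq b_self by (simp add: mult.assoc add_increasing2)
  qed
qed

definition M :: "real \<Rightarrow> 'z \<Rightarrow> 'z" where
  "M \<epsilon> = (SOME M. bounded_linear M \<and> (\<forall>x. M x \<in> Z \<and> (\<forall>y\<in>Z. \<epsilon> * b (M x) y + b (K (M x)) (K y) = b x y)))"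

context
  fixes \<epsilon> :: real
  assumes \<epsilon>: "\<epsilon> > 0"
begin

lemma bounded_linear_M: "bounded_linear (M \<epsilon>)" and M_in: "M \<epsilon> x \<in> Z"
  and M: "y \<in> Z \<Longrightarrow> \<epsilon> * b (M \<epsilon> x) y + b (K (M \<epsilon> x)) (K y) = b x y"
  using someI_ex[OF ex_M[OF \<epsilon>]] unfolding M_def[symmetric] by auto

lemma M_eq:
  assumes "x \<in> Z" shows "\<epsilon> *\<^sub>R M \<epsilon> x = x + K (K (M \<epsilon> x))"
proof (rule Z_eqI)
  show "\<epsilon> *\<^sub>R M \<epsilon> x \<in> Z" "x + K (K (M \<epsilon> x)) \<in> Z"
    using assms by (auto intro: subspace_scale[OF subspace_Z] subspace_add[OF subspace_Z] M_in K_in)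
  show "b (\<epsilon> *\<^sub>R M \<epsilon> x) z = b (x + K (K (M \<epsilon> x))) z" if "z \<in> Z" for z
    using M[OF that, of x] K_skew[OF K_in that, of "M \<epsilon> x"] by (simp add: b.scaleR_left b.add_left)
qed

text \<open>Both sides solve the same resolvent equation. Their difference y satisfies
  \<open>\<epsilon> *\<^sub>R y = K (K y)\<close>, and pairing with y makes the left side
  nonnegative and the right side nonpositive.\<close>

lemma M_K:
  assumes "x \<in> Z" shows "M \<epsilon> (K x) = K (M \<epsilon> x)"
proof -
  have "y = 0" if y: "y \<in> Z" "\<epsilon> *\<^sub>R y = K (K y)" for y
  proof -
    have "\<epsilon> * b y y = b (K (K y)) y" using y(2) by (metis b.scaleR_left real_scaleR_def)
    also have "\<dots> = - b (K y) (K y)" by (rule K_skew[OF K_in y(1)])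
    finally have "\<epsilon> * b y y \<le> 0" by (simp add: b_self)
    then show ?thesis using \<epsilon> j_ge[OF y(1)] m by (simp add: b_self mult_le_0_iff)
  qed
  note this[of "M \<epsilon> (K x) - K (M \<epsilon> x)"]
  moreover have "M \<epsilon> (K x) - K (M \<epsilon> x) \<in> Z" by (intro subspace_diff[OF subspace_Z] M_in K_in)
  moreover have "\<epsilon> *\<^sub>R (M \<epsilon> (K x) - K (M \<epsilon> x)) = K (K (M \<epsilon> (K x) - K (M \<epsilon> x)))"
    using M_eq[OF K_in, of x] arg_cong[OF M_eq[OF assms], of K]
    by (simp add: scaleR_diff_right K.add K.diff K.scaleR)
  ultimately show ?thesis by simp
qed

lemma M_sym: "x \<in> Z \<Longrightarrow> y \<in> Z \<Longrightarrow> b (M \<epsilon> x) y = b x (M \<epsilon> y)"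
  using M[OF M_in, of y x] M[OF M_in, of x y] by (simp add: b_sym)

lemma norm_M_le:
  assumes "x \<in> Z" shows "norm (j (\<epsilon> *\<^sub>R M \<epsilon> x)) \<le> norm (j x)"
proof -
  let ?n = "norm (j (M \<epsilon> x))"
  have "\<epsilon> * ?n\<^sup>2 \<le> norm (j x) * ?n"
    using M[OF M_in, of x x] b_le[of x "M \<epsilon> x"] by (simp add: b_self) (smt (verit) zero_le_power2)
  then have "\<epsilon> * ?n \<le> norm (j x)"
    by (cases "?n = 0") (simp_all add: power2_eq_square)
  then show ?thesis using \<epsilon> by (simp add: j.scaleR)
qed

text \<open>On the range of K the resolvent gains a factor \<open>sqrt \<epsilon>\<close>: testing
  its equation with the solution w and moving K over to w leaves a product that the term with
  \<open>K w\<close> absorbs. This gain is the source of all convergence below.\<close>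

lemma norm_M_K_le:
  assumes "y \<in> Z" shows "norm (j (\<epsilon> *\<^sub>R M \<epsilon> (K y))) \<le> sqrt \<epsilon> * norm (j y)"
proof -
  define w where "w = M \<epsilon> (K y)"
  have w: "w \<in> Z" by (simp add: w_def M_in)
  have "\<epsilon> * (norm (j w))\<^sup>2 + (norm (j (K w)))\<^sup>2 = b (K y) w"
    using M[OF w, of "K y"] by (simp add: w_def b_self)
  also have "\<dots> \<le> norm (j y) * norm (j (K w))"
    using K_skew[OF assms w] b_le[of y "K w"] by simp
  finally have *: "\<epsilon> * (norm (j w))\<^sup>2 + (norm (j (K w)))\<^sup>2 \<le> norm (j y) * norm (j (K w))" .
  have "0 \<le> (norm (j y) - norm (j (K w)))\<^sup>2 + norm (j y) * norm (j (K w))" by simp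
  then have "norm (j y) * norm (j (K w)) \<le> (norm (j y))\<^sup>2 + (norm (j (K w)))\<^sup>2"
    unfolding power2_diff by linarith
  then have "\<epsilon> * (norm (j w))\<^sup>2 \<le> (norm (j y))\<^sup>2" using * by linarith
  then have "(norm (j (\<epsilon> *\<^sub>R w)))\<^sup>2 \<le> (sqrt \<epsilon> * norm (j y))\<^sup>2"
    using \<epsilon> mult_left_mono[of "\<epsilon> * (norm (j w))\<^sup>2" "(norm (j y))\<^sup>2" \<epsilon>]
    by (simp add: j.scaleR power_mult_distrib) (simp add: power2_eq_square mult.assoc)
  then show ?thesis unfolding w_def by (rule power2_le_imp_le) (use \<epsilon> in simp)
qed

text \<open>This is -K (\<epsilon> - K^2)^(-1), a bounded skew approximation of the inverse of K:
  \<open>K (G x)\<close> differs from x only by \<open>\<epsilon> *\<^sub>R M \<epsilon> x\<close>,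
  for x in Z.\<close>

definition G :: "'z \<Rightarrow> 'z" where "G x = - K (M \<epsilon> x)"

lemma bounded_linear_G: "bounded_linear G"
  unfolding G_def by (intro bounded_linear_minus bounded_linear_compose[OF bounded_linear_K bounded_linear_M])

lemma G_in: "G x \<in> Z"
  unfolding G_def by (intro subspace_neg[OF subspace_Z] K_in)

lemma G_skew: "x \<in> Z \<Longrightarrow> y \<in> Z \<Longrightarrow> b (G x) y = - b x (G y)"
  unfolding G_def
  by (simp add: b.minus_left b.minus_right K_skew[OF M_in] M_sym[OF _ K_in] M_K)

lemma K_G: "x \<in> Z \<Longrightarrow> K (G x) = G (K x)"
  unfolding G_def by (simp add: K.neg M_K)

lemma K_G_eq: "x \<in> Z \<Longrightarrow> K (G x) = x - \<epsilon> *\<^sub>R M \<epsilon> x"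
  unfolding G_def by (simp add: M_eq K.neg)

definition U :: "real \<Rightarrow> 'z \<Rightarrow> 'z" where "U = op_exp G"

lemma U_in: "x \<in> Z \<Longrightarrow> U t x \<in> Z"
  unfolding U_def by (rule op_exp_closed[OF bounded_linear_G subspace_Z closed_Z G_in])

lemma U_0: "U 0 x = x"
  by (simp add: U_def op_exp_0)

lemma U_deriv: "((\<lambda>t. U t x) has_vector_derivative G (U t x)) (at t)"
  unfolding U_def by (rule op_exp_has_vector_derivative[OF bounded_linear_G])

lemma U_K: "x \<in> Z \<Longrightarrow> K (U t x) = U t (K x)"
  unfolding U_def by (rule op_exp_commute[OF bounded_linear_G bounded_linear_K subspace_Z G_in K_G])

lemma U_diff: "U t (x - y) = U t x - U t y"
proof -
  interpret G: bounded_linear G by (rule bounded_linear_G)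
  have *: "(G ^^ n) (x - y) = (G ^^ n) x - (G ^^ n) y" for n
    by (induction n) (auto simp: G.diff)
  show ?thesis
    unfolding U_def op_exp_def *
    by (simp add: scaleR_diff_right suminf_diff op_exp_summable bounded_linear_G)
qed

lemma norm_U:
  assumes "x \<in> Z" shows "norm (j (U t x)) = norm (j x)"
proof -
  have "((\<lambda>t. b (U t x) (U t x)) has_vector_derivative b (U t x) (G (U t x)) + b (G (U t x)) (U t x)) (at t)" for t
    by (rule b.has_vector_derivative[OF U_deriv U_deriv])
  then have "((\<lambda>t. b (U t x) (U t x)) has_field_derivative 0) (at t within UNIV)" for t
    using G_skew[OF U_in[OF assms] U_in[OF assms]]
    by (simp add: has_real_derivative_iff_has_vector_derivative)
  then have "norm (b (U t x) (U t x) - b (U 0 x) (U 0 x)) \<le> 0 * norm (t - 0)"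
    by (intro field_differentiable_bound[of UNIV]) auto
  then show ?thesis by (simp add: b_self U_0 power2_eq_iff_nonneg)
qed

end

text \<open>Interpolation between two evolutions: go forward with \<delta> up to time s and let the
  \<epsilon>-evolution act on the test vector for the time s - t. The derivative in s contains only
  the difference of the two generators along the orbit of x, and the \<epsilon>-evolution preserves
  the energy norm. For \<delta> = \<epsilon> it vanishes, which gives the adjoint of the
  evolution.\<close>

lemma duality:
  assumes \<delta>: "\<delta> > 0" and \<epsilon>: "\<epsilon> > 0" and x: "x \<in> Z" and z: "z \<in> Z"
    and le: "\<And>s. norm (j (G \<delta> (U \<delta> s x) - G \<epsilon> (U \<delta> s x))) \<le> C"
  shows "\<bar>b (U \<delta> t x) z - b x (U \<epsilon> (- t) z)\<bar> \<le> C * norm (j z) * \<bar>t\<bar>"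
proof -
  note in_Z = U_in[OF \<delta> x] U_in[OF \<epsilon> z]
  have "((\<lambda>s. b (U \<delta> s x) (U \<epsilon> (s - t) z)) has_vector_derivative
      b (U \<delta> s x) (1 *\<^sub>R G \<epsilon> (U \<epsilon> (s - t) z)) + b (G \<delta> (U \<delta> s x)) (U \<epsilon> (s - t) z)) (at s)" for s
    by (rule b.has_vector_derivative[OF U_deriv[OF \<delta>]
          vector_diff_chain_at[OF _ U_deriv[OF \<epsilon>], unfolded o_def]])
       (auto intro!: derivative_eq_intros)
  then have "((\<lambda>s. b (U \<delta> s x) (U \<epsilon> (s - t) z)) has_field_derivative
      b (G \<delta> (U \<delta> s x) - G \<epsilon> (U \<delta> s x)) (U \<epsilon> (s - t) z)) (at s within UNIV)" for s
    using G_skew[OF \<epsilon> in_Z(1) in_Z(2), of s "s - t"]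
    by (simp add: has_real_derivative_iff_has_vector_derivative b.diff_left add.commute)
  then have "norm (b (U \<delta> t x) (U \<epsilon> (t - t) z) - b (U \<delta> 0 x) (U \<epsilon> (0 - t) z)) \<le> C * norm (j z) * norm (t - 0)"
  proof (rule field_differentiable_bound[OF convex_UNIV])
    fix s
    have "norm (b (G \<delta> (U \<delta> s x) - G \<epsilon> (U \<delta> s x)) (U \<epsilon> (s - t) z))
        \<le> norm (j (G \<delta> (U \<delta> s x) - G \<epsilon> (U \<delta> s x))) * norm (j (U \<epsilon> (s - t) z))"
      using b_le by simp
    also have "\<dots> \<le> C * norm (j z)"
      unfolding norm_U[OF \<epsilon> z] by (intro mult_right_mono le) auto
    finally show "norm (b (G \<delta> (U \<delta> s x) - G \<epsilon> (U \<delta> s x)) (U \<epsilon> (s - t) z)) \<le> C * norm (j z)" .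
  qed auto
  then show ?thesis by (simp add: U_0[OF \<delta>] U_0[OF \<epsilon>])
qed

text \<open>On vectors \<open>K (K w)\<close> with w in Z both generators are explicit: each gives
  \<open>K w\<close> up to an error that \<open>norm_M_K_le\<close> makes small. The orbit of
  \<open>K (K y)\<close> stays of this form, because the evolution commutes with K.\<close>

lemma U_difference:
  assumes \<delta>: "\<delta> > 0" and \<epsilon>: "\<epsilon> > 0" and y: "y \<in> Z"
  shows "norm (j (U \<delta> t (K (K y)) - U \<epsilon> t (K (K y)))) \<le> (sqrt \<delta> + sqrt \<epsilon>) * norm (j y) * \<bar>t\<bar>"
proof -
  let ?x = "K (K y)"
  have x: "?x \<in> Z" by (rule K_in)
  have adj: "b (U \<epsilon> t ?x) z = b ?x (U \<epsilon> (- t) z)" if "z \<in> Z" for z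
    using duality[OF \<epsilon> \<epsilon> x that, of 0 t] by (simp add: j.zero)
  have eq: "G \<eta> (K (K w)) = K w - \<eta> *\<^sub>R M \<eta> (K w)" if "\<eta> > 0" "w \<in> Z" for \<eta> w
    using that by (simp add: K_G[symmetric] K_in K_G_eq K.diff K.scaleR M_K)
  have le: "norm (j (G \<delta> (U \<delta> s ?x) - G \<epsilon> (U \<delta> s ?x))) \<le> (sqrt \<delta> + sqrt \<epsilon>) * norm (j y)" for s
  proof -
    define w where "w = U \<delta> s y"
    have w: "w \<in> Z" "norm (j w) = norm (j y)"
      using y \<delta> by (auto simp: w_def U_in norm_U)
    have "U \<delta> s ?x = K (K w)"
      using y \<delta> by (simp add: w_def U_K K_in)
    then have "G \<delta> (U \<delta> s ?x) - G \<epsilon> (U \<delta> s ?x) = \<epsilon> *\<^sub>R M \<epsilon> (K w) - \<delta> *\<^sub>R M \<delta> (K w)"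
      using w(1) \<delta> \<epsilon> by (simp add: eq)
    then have "norm (j (G \<delta> (U \<delta> s ?x) - G \<epsilon> (U \<delta> s ?x)))
        \<le> norm (j (\<epsilon> *\<^sub>R M \<epsilon> (K w))) + norm (j (\<delta> *\<^sub>R M \<delta> (K w)))"
      by (simp add: j.diff norm_triangle_ineq4)
    then show ?thesis
      using norm_M_K_le[OF \<delta> w(1)] norm_M_K_le[OF \<epsilon> w(1)] w(2) by (simp add: distrib_right)
  qed
  define z where "z = U \<delta> t ?x - U \<epsilon> t ?x"
  have z: "z \<in> Z" unfolding z_def by (intro subspace_diff[OF subspace_Z] U_in \<delta> \<epsilon> x)
  \<comment> \<open>Duality is used with the difference \<open>z\<close> itself as test vector; the
    adjoint relation turns the left side into \<open>b z z\<close>.\<close>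
  have "b z z \<le> (sqrt \<delta> + sqrt \<epsilon>) * norm (j y) * norm (j z) * \<bar>t\<bar>"
  proof -
    have "b z z = b (U \<delta> t ?x) z - b ?x (U \<epsilon> (- t) z)"
      using adj[OF z] by (simp add: z_def b.diff_left)
    then show ?thesis using duality[OF \<delta> \<epsilon> x z le, of t] by linarith
  qed
  then show ?thesis
    unfolding z_def[symmetric] b_self power2_eq_square
    using \<delta> \<epsilon> by (cases "norm (j z) = 0") (auto simp: mult.assoc mult.left_commute[of "norm (j z)"])
qed

text \<open>The defect of the orthogonal projection of x onto the closed range of K is annihilated
  by k, hence zero by nondegeneracy.\<close>

lemma K_dense:
  assumes x: "x \<in> Z" and e: "e > 0"
  shows "\<exists>y\<in>Z. norm (x - K y) < e"
proof -
  let ?W = "closure (K ` Z)"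
  have W: "subspace ?W"
    by (rule subspace_closure[OF linear_subspace_image[OF bounded_linear.linear[OF bounded_linear_K] subspace_Z]])
  have "K ` Z \<subseteq> Z" using K_in by (rule image_subsetI)
  then have WZ: "?W \<subseteq> Z" using closed_Z by (rule closure_minimal)
  \<comment> \<open>\<open>p\<close> is the projection of \<open>x\<close> onto \<open>?W\<close> in
    the energy product.\<close>
  have "\<exists>p\<in>?W. \<forall>y\<in>?W. b p y = b x y"
  proof (rule form_representation[OF bounded_bilinear_b W closed_closure b_sym _ _ b.bounded_linear_right])
    show "m\<^sup>2 * (norm z)\<^sup>2 \<le> b z z" if "z \<in> ?W" for z
      unfolding b_self using WZ that by (intro j_ge_sq) blast
  qed (use m in simp)
  then obtain p where p: "p \<in> ?W" "\<And>y. y \<in> ?W \<Longrightarrow> b p y = b x y" by blast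
  have "p \<in> Z" using p(1) WZ by (rule rev_subsetD)
  then have d: "x - p \<in> Z" using x by (intro subspace_diff[OF subspace_Z])
  have "k (x - p) y = 0" if "y \<in> Z" for y
  proof -
    have "K y \<in> ?W" by (rule subsetD[OF closure_subset imageI[OF that]])
    then have "b (x - p) (K y) = 0" using p(2) by (simp add: b.diff_left)
    then show ?thesis using K_skew[OF d that] b_K[OF that] by simp
  qed
  then have "x = p" using k_nondegenerate[OF d] by simp
  then obtain q where "q \<in> K ` Z" "dist q x < e"
    using p(1) e by (metis closure_approachable)
  then show ?thesis by (metis dist_commute dist_norm imageE)
qed

lemma K_K_dense:
  assumes x: "x \<in> Z" and e: "e > 0"
  shows "\<exists>y\<in>Z. norm (x - K (K y)) < e"
proof -
  obtain C where C: "C > 0" "\<And>x. norm (K x) \<le> norm x * C" using K.pos_bounded by auto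
  obtain y where y: "y \<in> Z" "norm (x - K y) < e/2" using K_dense[OF x, of "e/2"] e by auto
  obtain w where w: "w \<in> Z" "norm (y - K w) < e/(2*C)" using K_dense[OF y(1), of "e/(2*C)"] e C by auto
  have "norm (K (y - K w)) < e/2" using C(2)[of "y - K w"] w(2) C(1) by (simp add: field_simps)
  then have "norm ((x - K y) + K (y - K w)) < e" using y(2) norm_triangle_ineq[of "x - K y" "K (y - K w)"] by linarith
  then show ?thesis using w(1) by (auto simp: K.diff)
qed



end

section \<open>Removing the regularisation\<close>

context skew_form begin

text \<open>Approximate y by \<open>K w\<close>. The remainder is handled by
  \<open>\<epsilon> *\<^sub>R M \<epsilon>\<close> being a contraction in the energy norm, and the
  main part by the gain of \<open>sqrt \<epsilon>\<close>.\<close>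

lemma M_tendsto_0:
  assumes \<epsilon>: "\<And>n. \<epsilon> n > 0" "\<epsilon> \<longlonglongrightarrow> 0" and y: "y \<in> Z"
  shows "(\<lambda>n. j (\<epsilon> n *\<^sub>R M (\<epsilon> n) y)) \<longlonglongrightarrow> 0"
proof (rule LIMSEQ_I)
  fix r :: real assume r: "r > 0"
  obtain C where C: "C > 0" "\<And>x. norm (j x) \<le> norm x * C" using j.pos_bounded by auto
  obtain w where w: "w \<in> Z" "norm (y - K w) < r/(2*C)" using K_dense[OF y, of "r/(2*C)"] r C by auto
  have "(\<lambda>n. sqrt (\<epsilon> n) * norm (j w)) \<longlonglongrightarrow> sqrt 0 * norm (j w)"
    by (intro tendsto_intros \<epsilon>(2))
  then have "eventually (\<lambda>n. sqrt (\<epsilon> n) * norm (j w) < r/2) sequentially"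
    using r by (intro order_tendstoD(2)) auto
  then obtain N where N: "\<And>n. n \<ge> N \<Longrightarrow> sqrt (\<epsilon> n) * norm (j w) < r/2"
    by (auto simp: eventually_sequentially)
  have "norm (j (\<epsilon> n *\<^sub>R M (\<epsilon> n) y)) < r" if "n \<ge> N" for n
  proof -
    interpret M: bounded_linear "M (\<epsilon> n)" using \<epsilon>(1) by (rule bounded_linear_M)
    have "norm (j (\<epsilon> n *\<^sub>R M (\<epsilon> n) (y - K w))) \<le> norm (j (y - K w))"
      by (intro norm_M_le \<epsilon>(1) subspace_diff[OF subspace_Z] y K_in)
    also have "\<dots> < r/2" using C(2)[of "y - K w"] w(2) C(1) by (simp add: field_simps)
    finally have "norm (j (\<epsilon> n *\<^sub>R M (\<epsilon> n) (y - K w))) < r/2" .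
    moreover have "norm (j (\<epsilon> n *\<^sub>R M (\<epsilon> n) (K w))) < r/2"
      using norm_M_K_le[OF \<epsilon>(1) w(1)] N[OF that] by (rule order_le_less_trans)
    moreover have "j (\<epsilon> n *\<^sub>R M (\<epsilon> n) y) =
        j (\<epsilon> n *\<^sub>R M (\<epsilon> n) (y - K w)) + j (\<epsilon> n *\<^sub>R M (\<epsilon> n) (K w))"
      by (simp add: M.diff j.scaleR j.diff scaleR_diff_right)
    ultimately show ?thesis
      using norm_triangle_ineq[of "j (\<epsilon> n *\<^sub>R M (\<epsilon> n) (y - K w))" "j (\<epsilon> n *\<^sub>R M (\<epsilon> n) (K w))"]
      by (simp only:)
  qed
  then show "\<exists>N. \<forall>n\<ge>N. norm (j (\<epsilon> n *\<^sub>R M (\<epsilon> n) y) - 0) < r" by (intro exI[of _ N]) simp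
qed

lemma U_uniformly_convergent:
  assumes \<epsilon>: "\<And>n. \<epsilon> n > 0" "\<epsilon> \<longlonglongrightarrow> 0" and x: "x \<in> Z"
  shows "uniformly_convergent_on {-T..T} (\<lambda>n t. U (\<epsilon> n) t x)"
proof (rule Cauchy_uniformly_convergent, rule uniformly_Cauchy_onI)
  fix e :: real assume e: "e > 0"
  obtain C where C: "C > 0" "\<And>x. norm (j x) \<le> norm x * C" using j.pos_bounded by auto
  \<comment> \<open>The error splits into three parts of energy norm below \<open>m * e / 3\<close>:
    the two orbits of the remainder, whose norms are preserved, and the difference of the orbits of
    \<open>K (K y)\<close>. The factors \<open>C\<close> and \<open>m\<close> convert between the
    norm of Z and the energy norm.\<close>
  obtain y where y: "y \<in> Z" "norm (x - K (K y)) < m * e/(3*C)"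
    using K_K_dense[OF x, of "m * e/(3*C)"] e C m by auto
  let ?x = "K (K y)"
  have d: "x - ?x \<in> Z" by (intro subspace_diff[OF subspace_Z] x K_in)
  have jd: "norm (j (x - ?x)) < m * e / 3"
    using C(2)[of "x - ?x"] y(2) C(1) by (simp add: field_simps)
  have "(\<lambda>n. sqrt (\<epsilon> n) * norm (j y) * \<bar>T\<bar>) \<longlonglongrightarrow> sqrt 0 * norm (j y) * \<bar>T\<bar>"
    by (intro tendsto_intros \<epsilon>(2))
  then have "eventually (\<lambda>n. sqrt (\<epsilon> n) * norm (j y) * \<bar>T\<bar> < m * e/6) sequentially"
    using e m by (intro order_tendstoD(2)) auto
  then obtain N where N: "\<And>n. n \<ge> N \<Longrightarrow> sqrt (\<epsilon> n) * norm (j y) * \<bar>T\<bar> < m * e/6"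
    by (auto simp: eventually_sequentially)
  have "dist (U (\<epsilon> p) t x) (U (\<epsilon> q) t x) < e" if t: "t \<in> {-T..T}" and pq: "p \<ge> N" "q \<ge> N" for t p q
  proof -
    let ?P = "U (\<epsilon> p) t" and ?Q = "U (\<epsilon> q) t"
    have "norm (j (?P ?x - ?Q ?x)) \<le> (sqrt (\<epsilon> p) + sqrt (\<epsilon> q)) * norm (j y) * \<bar>t\<bar>"
      by (rule U_difference[OF \<epsilon>(1) \<epsilon>(1) y(1)])
    also have "\<dots> \<le> (sqrt (\<epsilon> p) + sqrt (\<epsilon> q)) * norm (j y) * \<bar>T\<bar>"
      using t \<epsilon>(1)[THEN less_imp_le] by (intro mult_left_mono) auto
    also have "\<dots> < m * e / 3"
      using N[OF pq(1)] N[OF pq(2)] by (simp add: algebra_simps)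
    finally have 1: "norm (j (?P ?x - ?Q ?x)) < m * e / 3" .
    have 2: "norm (j (U (\<epsilon> n) t (x - ?x))) < m * e / 3" for n
      using jd norm_U[OF \<epsilon>(1) d] by simp
    have eq: "j (?P x - ?Q x) = j (?P ?x - ?Q ?x) + j (?P (x - ?x)) - j (?Q (x - ?x))"
      by (simp add: U_diff[OF \<epsilon>(1)] j.diff)
    have "norm (j (?P x - ?Q x)) \<le> norm (j (?P ?x - ?Q ?x)) + norm (j (?P (x - ?x))) + norm (j (?Q (x - ?x)))"
      using norm_triangle_ineq4[of "j (?P ?x - ?Q ?x) + j (?P (x - ?x))" "j (?Q (x - ?x))"]
        norm_triangle_ineq[of "j (?P ?x - ?Q ?x)" "j (?P (x - ?x))"] unfolding eq by linarith
    then have "norm (j (?P x - ?Q x)) < m * e" using 1 2[of p] 2[of q] by linarith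
    moreover have "m * norm (?P x - ?Q x) \<le> norm (j (?P x - ?Q x))"
      by (intro j_ge subspace_diff[OF subspace_Z] U_in \<epsilon>(1) x)
    ultimately show ?thesis using m by (simp add: dist_norm) (metis mult_less_cancel_left_pos order_le_less_trans)
  qed
  then show "\<exists>N. \<forall>t\<in>{-T..T}. \<forall>p\<ge>N. \<forall>q\<ge>N. dist (U (\<epsilon> p) t x) (U (\<epsilon> q) t x) < e" by blast
qed

theorem skew_evolution:
  assumes x: "x \<in> Z"
  obtains u where "\<And>t. u t \<in> Z" "u 0 = x" "continuous_on UNIV u"
    "\<And>y t. y \<in> Z \<Longrightarrow> ((\<lambda>t. k (u t) y) has_real_derivative inner (j (u t)) (j y)) (at t)"
proof -
  define \<epsilon> where "\<epsilon> n = inverse (real (Suc n))" for n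
  have \<epsilon>: "\<And>n. \<epsilon> n > 0" "\<epsilon> \<longlonglongrightarrow> 0"
    unfolding \<epsilon>_def by simp (rule LIMSEQ_inverse_real_of_nat)
  define u where "u t = lim (\<lambda>n. U (\<epsilon> n) t x)" for t
  have unif: "uniform_limit {-T..T} (\<lambda>n t. U (\<epsilon> n) t x) u sequentially" for T
    using U_uniformly_convergent[OF \<epsilon> x, of T]
    unfolding uniformly_convergent_uniform_limit_iff u_def by simp
  have lim: "(\<lambda>n. U (\<epsilon> n) t x) \<longlonglongrightarrow> u t" for t
    by (rule tendsto_uniform_limitI[OF unif[of "\<bar>t\<bar>"]]) auto
  have uZ: "u t \<in> Z" for t
    by (rule closed_sequentially[OF closed_Z _ lim]) (intro U_in \<epsilon>(1) x)
  have U_cont: "continuous_on A (\<lambda>t. U (\<epsilon> n) t x)" for A n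
    by (intro continuous_at_imp_continuous_on ballI has_vector_derivative_continuous[OF U_deriv[OF \<epsilon>(1)]])
  have cont_at: "isCont u t" for t
  proof -
    have "continuous_on {-(\<bar>t\<bar>+1)..\<bar>t\<bar>+1} u"
      by (rule uniform_limit_theorem[OF _ unif]) (auto intro: U_cont always_eventually)
    then have "continuous_on {-(\<bar>t\<bar>+1)<..<\<bar>t\<bar>+1} u"
      by (rule continuous_on_subset) auto
    moreover have "- (\<bar>t\<bar> + 1) < t" "t < \<bar>t\<bar> + 1" by linarith+
    ultimately show ?thesis by (subst (asm) continuous_on_eq_continuous_at) auto
  qed
  have deriv: "((\<lambda>t. k (u t) y) has_real_derivative b (u t) y) (at t)" if y: "y \<in> Z" for y t
  proof -
    define S where "S = {-(\<bar>t\<bar>+1)<..<\<bar>t\<bar>+1}"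
    let ?f = "\<lambda>n s. k (U (\<epsilon> n) s x) y"
    \<comment> \<open>\<open>M\<close> is symmetric, so the error of the approximate generator can
      be put on the fixed vector \<open>y\<close>. There it tends to zero uniformly in
      \<open>s\<close>, since the orbits have constant energy norm.\<close>
    let ?f' = "\<lambda>n s. b (U (\<epsilon> n) s x) y - b (U (\<epsilon> n) s x) (\<epsilon> n *\<^sub>R M (\<epsilon> n) y)"
    have d: "(?f n has_derivative (\<lambda>h. h * ?f' n s)) (at s within S)" for n s
    proof -
      note in_Z = U_in[OF \<epsilon>(1)[of n] x, of s]
      have "((\<lambda>s. b (K (U (\<epsilon> n) s x)) y) has_vector_derivative b (K (G (\<epsilon> n) (U (\<epsilon> n) s x))) y) (at s within S)"
        by (intro bounded_linear.has_vector_derivative[OF b.bounded_linear_left]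
            bounded_linear.has_vector_derivative[OF bounded_linear_K]
            has_vector_derivative_at_within[OF U_deriv[OF \<epsilon>(1)]])
      also have "b (K (G (\<epsilon> n) (U (\<epsilon> n) s x))) y = ?f' n s"
        using in_Z y \<epsilon>(1)[of n] by (simp add: K_G_eq b.diff_left b.scaleR_left b.scaleR_right M_sym)
      finally show ?thesis by (simp add: b_K[OF y] has_vector_derivative_def)
    qed
    obtain C where C: "C > 0" "\<And>x. norm (j x) \<le> norm x * C" using j.pos_bounded by auto
    have close: "\<forall>\<^sub>F n in sequentially. \<forall>s\<in>S. \<forall>h. norm (h * ?f' n s - h * b (u s) y) \<le> e * norm h" if e: "e > 0" for e
    proof -
      have "\<forall>\<^sub>F n in sequentially. \<forall>s\<in>{-(\<bar>t\<bar>+1)..\<bar>t\<bar>+1}. dist (U (\<epsilon> n) s x) (u s) < e / (2 * C * (norm (j y) + 1))"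
        using e C by (intro uniform_limitD[OF unif] divide_pos_pos mult_pos_pos add_nonneg_pos) auto
      moreover have "(\<lambda>n. norm (j x) * norm (j (\<epsilon> n *\<^sub>R M (\<epsilon> n) y))) \<longlonglongrightarrow> norm (j x) * norm (0::'x)"
        by (intro tendsto_intros M_tendsto_0[OF \<epsilon> y])
      then have "\<forall>\<^sub>F n in sequentially. norm (j x) * norm (j (\<epsilon> n *\<^sub>R M (\<epsilon> n) y)) < e/2"
        using e by (intro order_tendstoD(2)) auto
      ultimately show ?thesis
      proof eventually_elim
        case (elim n)
        show ?case
        proof (intro ballI allI)
          fix s h assume "s \<in> S"
          then have *: "norm (U (\<epsilon> n) s x - u s) < e / (2 * C * (norm (j y) + 1))"
            using elim(1) by (auto simp: S_def dist_norm)
          have "\<bar>b (U (\<epsilon> n) s x - u s) y\<bar> \<le> norm (U (\<epsilon> n) s x - u s) * C * norm (j y)"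
            by (rule order_trans[OF b_le]) (intro mult_right_mono C norm_ge_zero)
          also have "\<dots> \<le> norm (U (\<epsilon> n) s x - u s) * C * (norm (j y) + 1)"
            using C(1) by (intro mult_left_mono) auto
          also have "\<dots> \<le> e/2"
          proof -
            have "2 * C * (norm (j y) + 1) > 0" using C(1) by (intro mult_pos_pos add_nonneg_pos) auto
            from * [unfolded pos_less_divide_eq[OF this]] show ?thesis by (simp add: algebra_simps)
          qed
          finally have 1: "\<bar>b (U (\<epsilon> n) s x - u s) y\<bar> \<le> e/2" .
          have 2: "\<bar>b (U (\<epsilon> n) s x) (\<epsilon> n *\<^sub>R M (\<epsilon> n) y)\<bar> \<le> e/2"
            using b_le[of "U (\<epsilon> n) s x" "\<epsilon> n *\<^sub>R M (\<epsilon> n) y"] elim(2) norm_U[OF \<epsilon>(1) x] by simp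
          have "norm (h * ?f' n s - h * b (u s) y) =
              \<bar>h\<bar> * \<bar>b (U (\<epsilon> n) s x - u s) y - b (U (\<epsilon> n) s x) (\<epsilon> n *\<^sub>R M (\<epsilon> n) y)\<bar>"
            by (simp add: abs_mult[symmetric] b.diff_left algebra_simps)
          also have "\<dots> \<le> \<bar>h\<bar> * e" using 1 2 by (intro mult_left_mono) auto
          finally show "norm (h * ?f' n s - h * b (u s) y) \<le> e * norm h" by (simp add: mult.commute)
        qed
      qed
    qed
    have tS: "t \<in> S" unfolding S_def greaterThanLessThan_iff by (intro conjI; linarith)
    have "\<exists>g. \<forall>s\<in>S. (\<lambda>n. ?f n s) \<longlonglongrightarrow> g s \<and> (g has_derivative (\<lambda>h. h * b (u s) y)) (at s within S)"
    proof (rule has_derivative_sequence[OF _ d close tS])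
      show "convex S" by (simp add: S_def)
      show "(\<lambda>n. ?f n t) \<longlonglongrightarrow> k (u t) y" by (rule k.tendsto[OF lim tendsto_const])
    qed
    then obtain g where g: "\<forall>s\<in>S. (\<lambda>n. ?f n s) \<longlonglongrightarrow> g s \<and> (g has_derivative (\<lambda>h. h * b (u s) y)) (at s within S)"
      by (rule exE)
    have "g s = k (u s) y" if "s \<in> S" for s
      using LIMSEQ_unique[OF conjunct1[OF bspec[OF g that]] k.tendsto[OF lim tendsto_const]] .
    moreover have "open S" by (simp add: S_def)
    moreover have "(g has_derivative (\<lambda>h. h * b (u t) y)) (at t)"
      using conjunct2[OF bspec[OF g tS]] by (simp only: at_within_open[OF tS \<open>open S\<close>])
    ultimately have "((\<lambda>s. k (u s) y) has_derivative (\<lambda>h. h * b (u t) y)) (at t)"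
      using tS by (metis (no_types, lifting) has_derivative_transform_within_open)
    then show ?thesis by (rule has_derivative_imp_has_field_derivative) (rule refl)
  qed
  have "u 0 = x" using lim[of 0] unfolding U_0[OF \<epsilon>(1)] LIMSEQ_const_iff by simp
  moreover have "continuous_on UNIV u" using cont_at by (intro continuous_at_imp_continuous_on) simp
  ultimately show ?thesis
    using deriv unfolding b_def by (intro that[OF uZ]) simp_all
qed

end

section \<open>Abstract wave equation\<close>

text \<open>The remainder of the first-order expansion lies in H and may be used as the test vector
  against itself. The mean value estimate and continuity of v at the point then bound its norm,
  uniformly in the choice of test vector.\<close>

lemma weak_derivative_imp_has_vector_derivative:
  fixes u v :: "real \<Rightarrow> 'h::real_inner" and a :: "'h \<Rightarrow> 'h"
  assumes a: "bounded_linear a" and ca: "ca > 0" "\<And>h. ca * norm h \<le> norm (a h)"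
    and H: "subspace H" "\<And>t. u t \<in> H" "\<And>t. v t \<in> H" and v: "isCont v t"
    and deriv: "\<And>l t. l \<in> H \<Longrightarrow> ((\<lambda>t. inner (a (u t)) (a l)) has_real_derivative inner (a (v t)) (a l)) (at t)"
  shows "(u has_vector_derivative v t) (at t)"
  unfolding has_vector_derivative_def has_derivative_at_alt
proof (intro conjI allI impI)
  show "bounded_linear (\<lambda>h. h *\<^sub>R v t)" by (rule bounded_linear_scaleR_left)
  fix e :: real assume e: "e > 0"
  interpret a: bounded_linear a by fact
  obtain C where C: "C > 0" "\<And>h. norm (a h) \<le> norm h * C" using a.pos_bounded by auto
  have "ca * e / C > 0" using ca e C by simp
  then obtain \<delta> where \<delta>: "\<delta> > 0" "\<And>s. dist s t < \<delta> \<Longrightarrow> dist (v s) (v t) < ca * e / C"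
    using v[unfolded isCont_def, THEN metric_LIM_D, of "ca * e / C"] by (metis dist_self zero_less_dist_iff)
  have "norm (u s - u t - (s - t) *\<^sub>R v t) \<le> e * norm (s - t)" if s: "norm (s - t) < \<delta>" for s
  proof -
    define d where "d = u s - u t - (s - t) *\<^sub>R v t"
    have d: "d \<in> H" unfolding d_def by (intro subspace_diff subspace_scale H)
    let ?f = "\<lambda>\<tau>. inner (a (u \<tau>)) (a d) - \<tau> * inner (a (v t)) (a d)"
    have "norm (?f s - ?f t) \<le> ca * e * norm (a d) * norm (s - t)"
    proof (rule field_differentiable_bound[of "ball t \<delta>"])
      show "(?f has_field_derivative inner (a (v \<tau> - v t)) (a d)) (at \<tau> within ball t \<delta>)" for \<tau>
        by (auto intro!: derivative_eq_intros has_field_derivative_at_within[OF deriv[OF d]]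
            simp: a.diff inner_diff_left)
      fix \<tau> assume "\<tau> \<in> ball t \<delta>"
      then have "norm (v \<tau> - v t) < ca * e / C" using \<delta>(2)[of \<tau>] by (simp add: dist_commute dist_norm)
      then have "norm (a (v \<tau> - v t)) \<le> ca * e"
        using C(2)[of "v \<tau> - v t"] C(1) by (simp add: field_simps)
      then show "norm (inner (a (v \<tau> - v t)) (a d)) \<le> ca * e * norm (a d)"
        using Cauchy_Schwarz_ineq2[of "a (v \<tau> - v t)" "a d"]
        using mult_right_mono[of "norm (a (v \<tau> - v t))" "ca * e" "norm (a d)"] by simp
    qed (use s \<delta>(1) in \<open>auto simp: dist_norm norm_minus_commute\<close>)
    also have "?f s - ?f t = inner (a (u s) - a (u t) - (s - t) *\<^sub>R a (v t)) (a d)"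
      by (simp add: inner_diff_left algebra_simps)
    also have "a (u s) - a (u t) - (s - t) *\<^sub>R a (v t) = a d"
      by (simp add: d_def a.diff a.scaleR)
    finally have "norm (a d) * norm (a d) \<le> ca * e * norm (s - t) * norm (a d)"
      by (simp add: dot_square_norm power2_eq_square mult_ac)
    then have "norm (a d) \<le> ca * e * norm (s - t)"
      using ca e by (cases "norm (a d) = 0") auto
    then have "ca * norm d \<le> ca * (e * norm (s - t))" using ca(2)[of d] by (simp add: mult.assoc)
    then show ?thesis using ca(1) by (simp add: d_def)
  qed
  then show "\<exists>d>0. \<forall>y. norm (y - t) < d \<longrightarrow> norm (u y - u t - (y - t) *\<^sub>R v t) \<le> e * norm (y - t)"
    using \<delta>(1) by blast
qed

text \<open>No regularisation in time is needed: the antisymmetric two-time function \<open>N\<close> below has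
  partial derivatives \<open>e\<close> and \<open>- e\<close>, where \<open>e\<close> is the polarised energy of the solution at two times,
  so it depends on the difference of the times only.\<close>

lemma wave_energy_conserved:
  fixes u v :: "real \<Rightarrow> 'h::real_inner" and g :: "real \<Rightarrow> 'g::real_inner"
    and a :: "'h \<Rightarrow> 'h" and w :: "'g \<Rightarrow> 'g" and B :: "'g \<Rightarrow> 'h"
  assumes a: "bounded_linear a" and w: "bounded_linear w" and B: "bounded_linear B"
    and W: "\<And>t. (u t, g t) \<in> W"
    and skew: "\<And>u g u' g'. (u, g) \<in> W \<Longrightarrow> (u', g') \<in> W \<Longrightarrow> inner u (B g') = - inner u' (B g)"
    and u: "\<And>t. (u has_vector_derivative v t) (at t)" and v: "continuous_on UNIV v"
    and g: "continuous_on UNIV g"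
    and eq: "\<And>h h' t. (h, h') \<in> W \<Longrightarrow> ((\<lambda>t. inner (a (v t)) (a h)) has_real_derivative
               - (inner (w (g t)) (w h') + inner (v t) (B h'))) (at t)"
  shows "(norm (a (v t)))\<^sup>2 + (norm (w (g t)))\<^sup>2 = (norm (a (v 0)))\<^sup>2 + (norm (w (g 0)))\<^sup>2"
proof -
  define e where "e t s = inner (a (v t)) (a (v s)) + inner (w (g t)) (w (g s))" for t s
  define N where "N t s = inner (a (v s)) (a (u t)) - inner (a (v t)) (a (u s)) + inner (u s) (B (g t))" for t s
  have N_anti: "N t s = - N s t" for t s
    unfolding N_def using skew[OF W W, of s t] by simp
  have Nt: "((\<lambda>t. N t s) has_real_derivative e t s) (at t)" for t s
  proof -
    have 1: "((\<lambda>t. inner (a (v s)) (a (u t))) has_vector_derivative inner (a (v s)) (a (v t))) (at t)"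
      by (intro bounded_linear.has_vector_derivative[OF bounded_linear_inner_right]
          bounded_linear.has_vector_derivative[OF a] u)
    have 2: "((\<lambda>t. inner (u t) (B (g s))) has_vector_derivative inner (v t) (B (g s))) (at t)"
      by (intro bounded_linear.has_vector_derivative[OF bounded_linear_inner_left] u)
    \<comment> \<open>\<open>g\<close> is only continuous in time. Skewness first rewrites the last
      term with \<open>u t\<close> in place of \<open>g t\<close>, which can be
      differentiated.\<close>
    have "(\<lambda>t. N t s) = (\<lambda>t. inner (a (v s)) (a (u t)) - inner (a (v t)) (a (u s)) - inner (u t) (B (g s)))"
      unfolding N_def using skew[OF W W, of s] by simp
    moreover note DERIV_diff[OF DERIV_diff[OF 1[folded has_real_derivative_iff_has_vector_derivative]
        eq[OF W, of s]] 2[folded has_real_derivative_iff_has_vector_derivative]]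
    ultimately show ?thesis
      by (simp add: e_def inner_commute)
  qed
  have e_sym: "e t s = e s t" for t s
    by (simp add: e_def inner_commute)
  have Ns: "((\<lambda>s. N t s) has_real_derivative - e t s) (at s)" for t s
  proof -
    have "(\<lambda>s. N t s) = (\<lambda>s. - N s t)" by (rule ext) (rule N_anti)
    then show ?thesis using DERIV_minus[OF Nt[of t s]] by (simp only: e_sym[of t s])
  qed
  have cont_e: "continuous_on UNIV (\<lambda>p. e (fst p) (snd p))"
  proof -
    have av: "continuous_on UNIV (\<lambda>t. a (v t))" by (rule bounded_linear.continuous_on[OF a v])
    have wg: "continuous_on UNIV (\<lambda>t. w (g t))" by (rule bounded_linear.continuous_on[OF w g])
    note c = continuous_on_compose2[OF _ continuous_on_fst[OF continuous_on_id]]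
      continuous_on_compose2[OF _ continuous_on_snd[OF continuous_on_id]]
    show ?thesis
      unfolding e_def
      by (intro continuous_on_add continuous_on_inner c(1)[OF av] c(2)[OF av] c(1)[OF wg] c(2)[OF wg]) auto
  qed
  \<comment> \<open>Partial derivatives alone do not give the derivative along the diagonal; joint
    continuity of \<open>e\<close> supplies total differentiability.\<close>
  have "((\<lambda>(t, s). N t s) has_derivative (\<lambda>(tt, ts). tt * e t s + ts * (- e t s))) (at (t, s))" for t s
  proof -
    have "((\<lambda>(t, s). N t s) has_derivative
        (\<lambda>(tt, ts). tt * e t s + blinfun_apply (blinfun_scaleR_left (- e t s)) ts)) (at (t, s) within UNIV \<times> UNIV)"
    proof (rule has_derivative_partialsI)
      show "((\<lambda>t. N t s) has_derivative (\<lambda>h. h * e t s)) (at t within UNIV)"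
        using Nt[of s t] by (simp add: has_field_derivative_def mult_commute_abs)
      show "((\<lambda>s. N t' s) has_derivative blinfun_apply (blinfun_scaleR_left (- e t' s'))) (at s' within UNIV)" for t' s'
        by (rule has_derivative_eq_rhs[OF Ns[unfolded has_field_derivative_def]]) (simp add: fun_eq_iff)
      have c: "continuous_on UNIV (\<lambda>p. blinfun_scaleR_left (- e (fst p) (snd p)))"
        by (rule bounded_linear.continuous_on[OF bounded_linear_blinfun_scaleR_left continuous_on_minus[OF cont_e]])
      show "continuous (at (t, s) within UNIV \<times> UNIV) (\<lambda>(t, s). blinfun_scaleR_left (- e t s))"
        using c[unfolded continuous_on_eq_continuous_within, rule_format, of "(t, s)"]
        by (simp add: case_prod_unfold)
    qed auto
    then show ?thesis by simp
  qed
  note N_deriv = this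
  have shift: "N (t + \<tau>) (s + \<tau>) = N t s" for t s \<tau>
  proof -
    have "((\<lambda>\<tau>. N (t + \<tau>) (s + \<tau>)) has_field_derivative 0) (at \<tau> within UNIV)" for \<tau>
    proof -
      have "((\<lambda>\<tau>. (t + \<tau>, s + \<tau>)) has_derivative (\<lambda>h. (h, h))) (at \<tau>)"
        by (auto intro!: derivative_eq_intros)
      from has_derivative_compose[OF this N_deriv]
      have "((\<lambda>\<tau>. N (t + \<tau>) (s + \<tau>)) has_derivative (\<lambda>h. 0)) (at \<tau>)" by simp
      then show ?thesis by (rule has_derivative_imp_has_field_derivative) simp
    qed
    then have "norm (N (t + \<tau>) (s + \<tau>) - N (t + 0) (s + 0)) \<le> 0 * norm (\<tau> - 0)"
      by (intro field_differentiable_bound[of UNIV]) auto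
    then show ?thesis by simp
  qed
  \<comment> \<open>By translation invariance this is the function \<open>N x 0\<close>, so its
    derivative at 0 equals both \<open>e t t\<close> and \<open>e 0 0\<close>.\<close>
  have "((\<lambda>x. N (x + t) t) has_real_derivative e (0 + t) t) (at 0)"
    using DERIV_shift[of "\<lambda>x. N x t" "e (0 + t) t" 0 t] Nt by simp
  moreover have "(\<lambda>x. N (x + t) t) = (\<lambda>x. N x 0)" using shift[of _ t 0] by simp
  ultimately have "((\<lambda>x. N x 0) has_real_derivative e (0 + t) t) (at 0)" by simp
  then have "e (0 + t) t = e 0 0" using Nt[of 0 0] by (rule DERIV_unique)
  then show ?thesis by (simp add: e_def power2_norm_eq_inner)
qed

text \<open>The state is ((u, g), v), with g standing for the gradient of u. The energy map drops u,
  which the Poincare hypothesis recovers from g. \<open>V\<close> will be a graph of gradients, and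
  \<open>closable\<close> says that the gradient is determined by the function.\<close>

theorem wave_existence:
  fixes V :: "('h::{real_inner, banach} \<times> 'g::{real_inner, banach}) set" and H :: "'h set"
    and a :: "'h \<Rightarrow> 'h" and w :: "'g \<Rightarrow> 'g" and B :: "'g \<Rightarrow> 'h"
  assumes a: "bounded_linear a" and w: "bounded_linear w" and B: "bounded_linear B"
    and ca: "ca > 0" "\<And>h. ca * norm h \<le> norm (a h)"
    and cw: "cw > 0" "\<And>g. cw * norm g \<le> norm (w g)"
    and V: "subspace V" "closed V" and H: "subspace H" "closed H"
    and VH: "\<And>u g. (u, g) \<in> V \<Longrightarrow> u \<in> H"
    and dense: "\<And>h e. h \<in> H \<Longrightarrow> e > 0 \<Longrightarrow> \<exists>(u, g)\<in>V. norm (h - u) < e"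
    and C: "C \<ge> 0" "\<And>u g. (u, g) \<in> V \<Longrightarrow> norm u \<le> C * norm (w g)"
    and skew: "\<And>u g u' g'. (u, g) \<in> V \<Longrightarrow> (u', g') \<in> V \<Longrightarrow> inner u (B g') = - inner u' (B g)"
    and closable: "\<And>g. (0, g) \<in> V \<Longrightarrow> g = 0"
    and init: "(u0, g0) \<in> V" "v0 \<in> H"
  obtains u g v where "\<And>t. (u t, g t) \<in> V" "\<And>t. v t \<in> H" "u 0 = u0" "g 0 = g0" "v 0 = v0"
    "continuous_on UNIV u" "continuous_on UNIV g" "continuous_on UNIV v"
    "\<And>t. (u has_vector_derivative v t) (at t)"
    "\<And>h h' t. (h, h') \<in> V \<Longrightarrow> ((\<lambda>t. inner (a (v t)) (a h)) has_real_derivative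
               - (inner (w (g t)) (w h') + inner (v t) (B h'))) (at t)"
proof -
  interpret a: bounded_linear a by fact
  interpret w: bounded_linear w by fact
  interpret B: bounded_linear B by fact
  define j :: "('h \<times> 'g) \<times> 'h \<Rightarrow> 'g \<times> 'h" where "j = (\<lambda>z. (w (snd (fst z)), a (snd z)))"
  \<comment> \<open>Testing with \<open>((0, 0), l)\<close> will say that u has derivative v, and
    testing with \<open>((h, h'), 0)\<close> will give the wave equation. The mixed term stands
    under the time derivative, so that u instead of v is paired with \<open>B h'\<close>; only then
    does skewness of B on V make k skew.\<close>
  define k :: "('h \<times> 'g) \<times> 'h \<Rightarrow> ('h \<times> 'g) \<times> 'h \<Rightarrow> real" where
    "k = (\<lambda>x y. inner (fst (fst x), a (snd x), a (fst (fst x))) (- B (snd (fst y)), - a (fst (fst y)), a (snd y)))"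
  have k_eq: "k ((u, g), v) ((h, h'), l) = - inner u (B h') - inner (a v) (a h) + inner (a u) (a l)" for u g v h h' l
    by (simp add: k_def)
  note bl = bounded_linear_compose[OF bounded_linear_fst bounded_linear_fst]
    bounded_linear_compose[OF bounded_linear_snd bounded_linear_fst]
  interpret E: skew_form "V \<times> H" j k "1 / (C + 1 / cw + 1 / ca)"
  proof (rule skew_form.intro)
    show "subspace (V \<times> H)" using V H by (intro subspace_Times)
    show "closed (V \<times> H)" using V H by (intro closed_Times)
    show "bounded_linear j" unfolding j_def
      by (rule bounded_linear_Pair[OF bounded_linear_compose[OF w bl(2)] bounded_linear_compose[OF a bounded_linear_snd]])
    have pos: "C + 1 / cw + 1 / ca > 0" using C ca cw by (simp add: add_nonneg_pos)
    then show "1 / (C + 1 / cw + 1 / ca) > 0" by simp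
    fix z assume "z \<in> V \<times> H"
    then obtain u g v where z: "z = ((u, g), v)" "(u, g) \<in> V" "v \<in> H" by auto
    have "norm z \<le> norm u + norm g + norm v"
      using norm_Pair_le[of "(u, g)" v] norm_Pair_le[of u g] by (simp add: z(1))
    also have "\<dots> \<le> C * norm (w g) + 1 / cw * norm (w g) + 1 / ca * norm (a v)"
      using C(2)[OF z(2)] cw(2)[of g] ca(2)[of v] cw(1) ca(1)
      by (intro add_mono) (simp_all add: field_simps)
    also have "\<dots> \<le> C * norm (j z) + 1 / cw * norm (j z) + 1 / ca * norm (j z)"
      using C cw ca norm_fst_le[of "w g" "a v"] norm_snd_le[of "a v" "w g"]
      by (intro add_mono mult_left_mono) (simp_all add: z(1) j_def)
    finally have "norm z \<le> (C + 1 / cw + 1 / ca) * norm (j z)" by (simp add: algebra_simps)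
    then show "1 / (C + 1 / cw + 1 / ca) * norm z \<le> norm (j z)"
      using pos by (simp add: divide_simps mult.commute)
  next
    have 1: "bounded_linear (\<lambda>x::('h \<times> 'g) \<times> 'h. fst (fst x))" by (rule bl(1))
    have 2: "bounded_linear (\<lambda>x::('h \<times> 'g) \<times> 'h. a (fst (fst x)))" by (rule bounded_linear_compose[OF a 1])
    have 3: "bounded_linear (\<lambda>x::('h \<times> 'g) \<times> 'h. a (snd x))"
      by (rule bounded_linear_compose[OF a bounded_linear_snd])
    have 4: "bounded_linear (\<lambda>x::('h \<times> 'g) \<times> 'h. - B (snd (fst x)))"
      by (rule bounded_linear_minus[OF bounded_linear_compose[OF B bl(2)]])
    have 5: "bounded_linear (\<lambda>x::('h \<times> 'g) \<times> 'h. (fst (fst x), a (snd x), a (fst (fst x))))"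
      by (rule bounded_linear_Pair[OF 1 bounded_linear_Pair[OF 3 2]])
    have 6: "bounded_linear (\<lambda>y::('h \<times> 'g) \<times> 'h. (- B (snd (fst y)), - a (fst (fst y)), a (snd y)))"
      by (rule bounded_linear_Pair[OF 4 bounded_linear_Pair[OF bounded_linear_minus[OF 2] 3]])
    show "bounded_bilinear k" unfolding k_def
      by (rule bounded_bilinear.comp[OF bounded_bilinear_inner 5 6])
  next
    fix x y assume xy: "x \<in> V \<times> H" "y \<in> V \<times> H"
    obtain u g v where x: "x = ((u, g), v)"
      using that[of "fst (fst x)" "snd (fst x)" "snd x"] by simp
    obtain h h' l where y: "y = ((h, h'), l)"
      using that[of "fst (fst y)" "snd (fst y)" "snd y"] by simp
    have "(u, g) \<in> V" "(h, h') \<in> V" using xy by (simp_all add: x y)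
    from skew[OF this] show "k x y = - k y x"
      by (simp add: x y k_eq inner_commute)
  next
    fix x assume "x \<in> V \<times> H" and 0: "\<And>y. y \<in> V \<times> H \<Longrightarrow> k x y = 0"
    then obtain u g v where x: "x = ((u, g), v)" "(u, g) \<in> V" "v \<in> H" by auto
    \<comment> \<open>Since V lies over H, u itself may stand in the velocity slot of the test
      vector.\<close>
    have "inner (a u) (a u) = 0"
      using 0[of "((0, 0), u)"] VH[OF x(2)] subspace_0[OF V(1)]
      by (simp add: x(1) k_eq a.zero B.zero zero_prod_def)
    then have u: "u = 0" using ca(2)[of u] ca(1) by (simp add: mult_le_0_iff)
    then have g: "g = 0" using closable x(2) by simp
    obtain D where D: "D > 0" "\<And>h. norm (a h) \<le> norm h * D" using a.pos_bounded by auto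
    have "norm (a v) \<le> e" if e: "e > 0" for e
    proof -
      obtain h h' where h: "(h, h') \<in> V" "norm (v - h) < e / D"
        using dense[OF x(3), of "e / D"] e D by auto
      have "inner (a v) (a h) = 0"
        using 0[of "((h, h'), 0)"] h(1) subspace_0[OF H(1)] by (simp add: x(1) k_eq u a.zero)
      then have "(norm (a v))\<^sup>2 = inner (a v) (a (v - h))"
        by (simp add: a.diff inner_diff_right power2_norm_eq_inner)
      also have "\<dots> \<le> norm (a v) * norm (a (v - h))" by (rule norm_cauchy_schwarz)
      also have "\<dots> \<le> norm (a v) * e"
        using D(2)[of "v - h"] h(2) D(1) by (intro mult_left_mono) (simp_all add: field_simps)
      finally show ?thesis using e by (cases "a v = 0") (auto simp: power2_eq_square)
    qed
    then have "norm (a v) \<le> 0" using field_le_epsilon[of "norm (a v)" 0] by simp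
    then have "v = 0" using ca(2)[of v] ca(1) by (simp add: mult_le_0_iff)
    then show "x = 0" using u g by (simp add: x(1) zero_prod_def)
  qed
  obtain z where z: "\<And>t. z t \<in> V \<times> H" "z 0 = ((u0, g0), v0)" "continuous_on UNIV z"
    and dz: "\<And>y t. y \<in> V \<times> H \<Longrightarrow> ((\<lambda>t. k (z t) y) has_real_derivative inner (j (z t)) (j y)) (at t)"
    by (rule E.skew_evolution[of "((u0, g0), v0)"]) (use init in auto)
  define u g v where "u = (\<lambda>t. fst (fst (z t)))" and "g = (\<lambda>t. snd (fst (z t)))" and "v = (\<lambda>t. snd (z t))"
  have z_eq: "z t = ((u t, g t), v t)" for t by (simp add: u_def g_def v_def)
  have in_V: "(u t, g t) \<in> V" and in_H: "v t \<in> H" for t using z(1)[of t] by (simp_all add: z_eq)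
  have cont: "continuous_on UNIV u" "continuous_on UNIV g" "continuous_on UNIV v"
    unfolding u_def g_def v_def
    by (intro continuous_on_fst continuous_on_snd z(3))+
  have 1: "((\<lambda>t. inner (a (u t)) (a l)) has_real_derivative inner (a (v t)) (a l)) (at t)" if "l \<in> H" for l t
    using dz[of "((0, 0), l)" t] that subspace_0[OF V(1)]
    by (simp add: z_eq k_eq j_def a.zero B.zero w.zero zero_prod_def)
  have u': "(u has_vector_derivative v t) (at t)" for t
    by (rule weak_derivative_imp_has_vector_derivative[OF a ca H(1) VH[OF in_V] in_H _ 1])
       (use cont(3) in \<open>simp add: continuous_on_eq_continuous_at\<close>)
  have "((\<lambda>t. inner (a (v t)) (a h)) has_real_derivative - (inner (w (g t)) (w h') + inner (v t) (B h'))) (at t)"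
    if "(h, h') \<in> V" for h h' t
  proof -
    \<comment> \<open>Now that v is known to be the derivative of u, the mixed term can be
      differentiated by itself and taken out of the time derivative again.\<close>
    have "((\<lambda>t. inner (u t) (B h')) has_real_derivative inner (v t) (B h')) (at t)"
      unfolding has_real_derivative_iff_has_vector_derivative
      by (intro bounded_linear.has_vector_derivative[OF bounded_linear_inner_left] u')
    moreover have "((\<lambda>t. - inner (u t) (B h') - inner (a (v t)) (a h)) has_real_derivative inner (w (g t)) (w h')) (at t)"
      using dz[of "((h, h'), 0)" t] that subspace_0[OF H(1)]
      by (simp add: z_eq k_eq j_def a.zero)
    ultimately have "((\<lambda>t. - (- inner (u t) (B h') - inner (a (v t)) (a h)) - inner (u t) (B h'))
        has_real_derivative - inner (w (g t)) (w h') - inner (v t) (B h')) (at t)"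
      by (intro DERIV_diff DERIV_minus)
    then show ?thesis by simp
  qed
  then show ?thesis
    using z(2) by (intro that[OF in_V in_H _ _ _ cont u']) (simp_all add: z_eq)
qed

section \<open>Smooth functions of one variable\<close>

text \<open>Counting derivatives allows closure under products and compositions to be proved by
  induction. The coinductive predicate \<open>smooth\<close> is entered only at the end, for
  functions built from such factors.\<close>

primrec Ck :: "nat \<Rightarrow> (real \<Rightarrow> real) \<Rightarrow> bool" where
  "Ck 0 f \<longleftrightarrow> True"
| "Ck (Suc n) f \<longleftrightarrow> (\<exists>f'. (\<forall>x. (f has_real_derivative f' x) (at x)) \<and> Ck n f')"

definition Cinf :: "(real \<Rightarrow> real) \<Rightarrow> bool" where "Cinf f \<longleftrightarrow> (\<forall>n. Ck n f)"

lemma Ck_Suc_imp: "Ck (Suc n) f \<Longrightarrow> Ck n f"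
  by (induction n arbitrary: f) (simp, metis Ck.simps(2))

lemma Ck_const: "Ck n (\<lambda>x. c)"
  by (induction n arbitrary: c) (auto intro!: exI[of _ "\<lambda>x. 0"] derivative_eq_intros)

lemma Ck_id: "Ck n (\<lambda>x. x)"
  by (cases n) (auto intro!: exI[of _ "\<lambda>x. 1"] derivative_eq_intros Ck_const)

lemma Ck_add: "Ck n f \<Longrightarrow> Ck n g \<Longrightarrow> Ck n (\<lambda>x. f x + g x)"
proof (induction n arbitrary: f g)
  case (Suc n)
  obtain f' g' where "\<And>x. (f has_real_derivative f' x) (at x)" "\<And>x. (g has_real_derivative g' x) (at x)"
    "Ck n f'" "Ck n g'" using Suc.prems by auto
  then show ?case using Suc.IH by (auto intro!: exI[of _ "\<lambda>x. f' x + g' x"] DERIV_add)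
qed simp

lemma Ck_mult: "Ck n f \<Longrightarrow> Ck n g \<Longrightarrow> Ck n (\<lambda>x. f x * g x)"
proof (induction n arbitrary: f g)
  case (Suc n)
  obtain f' g' where fg: "\<And>x. (f has_real_derivative f' x) (at x)" "\<And>x. (g has_real_derivative g' x) (at x)"
    "Ck n f'" "Ck n g'" using Suc.prems by auto
  have "Ck n (\<lambda>x. f' x * g x + g' x * f x)"
    using Suc.IH fg Suc.prems[THEN Ck_Suc_imp] by (intro Ck_add) auto
  then show ?case using fg by (auto intro!: exI[of _ "\<lambda>x. f' x * g x + g' x * f x"] DERIV_mult)
qed simp

lemma Ck_compose: "Ck n f \<Longrightarrow> Ck n g \<Longrightarrow> Ck n (\<lambda>x. f (g x))"
proof (induction n arbitrary: f g)
  case (Suc n)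
  obtain f' g' where fg: "\<And>x. (f has_real_derivative f' x) (at x)" "\<And>x. (g has_real_derivative g' x) (at x)"
    "Ck n f'" "Ck n g'" using Suc.prems by auto
  have "Ck n (\<lambda>x. f' (g x) * g' x)"
    using Suc.IH fg Suc.prems[THEN Ck_Suc_imp] by (intro Ck_mult) auto
  moreover have "((\<lambda>x. f (g x)) has_real_derivative f' (g x) * g' x) (at x)" for x
    using fg by (intro DERIV_chain2)
  ultimately show ?case by (auto intro!: exI[of _ "\<lambda>x. f' (g x) * g' x"])
qed simp

lemma Ck_sin_cos: "Ck n sin \<and> Ck n cos"
proof (induction n)
  case (Suc n)
  have "Ck n (\<lambda>x. (-1) * sin x)" using Suc by (intro Ck_mult Ck_const) auto
  then have "Ck (Suc n) cos" by (auto intro!: exI[of _ "\<lambda>x. - sin x"] derivative_eq_intros)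
  moreover have "Ck (Suc n) sin" using Suc by (auto intro!: exI[of _ cos] derivative_eq_intros)
  ultimately show ?case by blast
qed simp

lemma Cinf_const: "Cinf (\<lambda>x. c)" and Cinf_id: "Cinf (\<lambda>x. x)"
  and Cinf_add: "Cinf f \<Longrightarrow> Cinf g \<Longrightarrow> Cinf (\<lambda>x. f x + g x)"
  and Cinf_mult: "Cinf f \<Longrightarrow> Cinf g \<Longrightarrow> Cinf (\<lambda>x. f x * g x)"
  and Cinf_compose: "Cinf f \<Longrightarrow> Cinf g \<Longrightarrow> Cinf (\<lambda>x. f (g x))"
  and Cinf_cos: "Cinf cos"
  by (simp_all add: Cinf_def Ck_const Ck_id Ck_add Ck_mult Ck_compose Ck_sin_cos)

lemma Cinf_deriv:
  assumes "Cinf f"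
  shows "(f has_real_derivative deriv f x) (at x)" "Cinf (deriv f)"
proof -
  have *: "\<exists>f'. (\<forall>x. (f has_real_derivative f' x) (at x)) \<and> Ck n f'" for n
    using assms Ck.simps(2) unfolding Cinf_def by blast
  then have d: "(f has_real_derivative deriv f x) (at x)" for x
    by (metis DERIV_imp_deriv)
  then show "(f has_real_derivative deriv f x) (at x)" .
  have "Ck n (deriv f)" for n
  proof -
    obtain f' where f': "\<And>x. (f has_real_derivative f' x) (at x)" "Ck n f'" using * by blast
    then have "f' = deriv f" by (auto intro!: DERIV_imp_deriv[symmetric])
    then show ?thesis using f'(2) by simp
  qed
  then show "Cinf (deriv f)" by (simp add: Cinf_def)
qed

lemma Cinf_primitive: "Cinf f \<Longrightarrow> (\<And>x. (F has_real_derivative f x) (at x)) \<Longrightarrow> Cinf F"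
  unfolding Cinf_def by (metis Ck.simps(2) Ck_Suc_imp)

lemma Cinf_isCont: "Cinf f \<Longrightarrow> isCont f x"
  using Cinf_deriv(1) DERIV_isCont by blast

lemma Cinf_continuous_on: "Cinf f \<Longrightarrow> continuous_on A f"
  by (simp add: Cinf_isCont continuous_at_imp_continuous_on)

lemma Cinf_measurable: "Cinf f \<Longrightarrow> f \<in> borel_measurable borel"
  by (intro borel_measurable_continuous_onI Cinf_continuous_on)

lemma ex_primitive:
  assumes "Cinf f" shows "\<exists>F. \<forall>x. (F has_real_derivative f x) (at x)"
proof -
  have "\<exists>F. \<forall>x. -\<infinity> < ereal x \<longrightarrow> ereal x < \<infinity> \<longrightarrow> (F has_vector_derivative f x) (at x)"
    by (rule einterval_antiderivative) (auto intro: Cinf_isCont assms)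
  then show ?thesis by (simp add: has_real_derivative_iff_has_vector_derivative)
qed

text \<open>The polynomial in 1/x makes the family closed under differentiation, so that smoothness
  of exp(-1/x) at 0 becomes a single induction over all \<open>p\<close>.\<close>

definition flat :: "real poly \<Rightarrow> real \<Rightarrow> real" where
  "flat p x = (if x > 0 then poly p (1/x) * exp (- (1/x)) else 0)"

lemma poly_exp_decay: "((\<lambda>y::real. poly p y * exp (- y)) \<longlongrightarrow> 0) at_top"
proof -
  have "((\<lambda>y::real. \<Sum>i\<le>degree p. coeff p i * (y ^ i / exp y)) \<longlongrightarrow> (\<Sum>i\<le>degree p. coeff p i * 0)) at_top"
    by (intro tendsto_intros tendsto_power_div_exp_0)
  then show ?thesis
    by (simp add: poly_altdef sum_distrib_right exp_minus divide_inverse mult.assoc)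
qed

lemma flat_at_right: "(flat p \<longlongrightarrow> 0) (at_right 0)"
proof -
  have "((\<lambda>x. poly p (inverse x) * exp (- (inverse x))) \<longlongrightarrow> 0) (at_right 0)"
    by (rule filterlim_compose[OF poly_exp_decay filterlim_inverse_at_top_right])
  then show ?thesis
    by (rule Lim_transform_eventually)
       (auto simp: flat_def eventually_at_right_field inverse_eq_divide intro!: exI[of _ 1])
qed

text \<open>For positive x the chain rule produces the factor 1/x^2, which is the polynomial
  \<open>[:0, 0, 1:]\<close> evaluated at 1/x.\<close>

lemma flat_deriv: "(flat p has_real_derivative flat ([:0, 0, 1:] * (p - pderiv p)) x) (at x)"
proof -
  consider "x > 0" | "x < 0" | "x = 0" by linarith
  then show ?thesis
  proof cases
    case 1
    have "((\<lambda>x. poly p (1/x) * exp (- (1/x))) has_real_derivative flat ([:0, 0, 1:] * (p - pderiv p)) x) (at x)"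
      using 1 by (auto intro!: derivative_eq_intros DERIV_chain2[OF poly_DERIV] simp: flat_def field_simps power2_eq_square)
    then show ?thesis
      by (rule has_field_derivative_transform_within_open[of _ _ _ "{0<..}"]) (use 1 in \<open>auto simp: flat_def\<close>)
  next
    case 2
    have "((\<lambda>x. 0) has_real_derivative flat ([:0, 0, 1:] * (p - pderiv p)) x) (at x)"
      using 2 by (simp add: flat_def)
    then show ?thesis
      by (rule has_field_derivative_transform_within_open[of _ _ _ "{..<0}"]) (use 2 in \<open>auto simp: flat_def\<close>)
  next
    case 3
    \<comment> \<open>Dividing by h amounts to multiplying \<open>p\<close> by its variable, so the
      difference quotient is again of the form \<open>flat\<close>.\<close>
    have "((\<lambda>h. flat p h / h) \<longlongrightarrow> 0) (at_right 0)"
      by (rule Lim_transform_eventually[OF flat_at_right[of "[:0, 1:] * p"]])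
         (auto simp: flat_def eventually_at_right_field intro!: exI[of _ 1])
    moreover have "((\<lambda>h. flat p h / h) \<longlongrightarrow> 0) (at_left 0)"
      by (rule Lim_transform_eventually[OF tendsto_const])
         (auto simp: flat_def eventually_at_left_field intro!: exI[of _ "-1"])
    ultimately have "((\<lambda>h. flat p h / h) \<longlongrightarrow> 0) (at 0)"
      by (simp add: filterlim_split_at_real)
    then show ?thesis
      unfolding 3 DERIV_def by (simp add: flat_def)
  qed
qed

lemma Cinf_flat: "Cinf (flat p)"
proof -
  have "Ck n (flat p)" for n
  proof (induction n arbitrary: p)
    case (Suc n)
    then show ?case using flat_deriv by auto
  qed simp
  then show ?thesis by (simp add: Cinf_def)
qed

definition step :: "real \<Rightarrow> real" where "step = flat 1"

lemma step_eq: "step x = (if x > 0 then exp (- (1/x)) else 0)"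
  by (simp add: step_def flat_def)

lemma Cinf_step: "Cinf step" by (simp add: step_def Cinf_flat)

lemma step_nonneg: "0 \<le> step x" and step_le_1: "step x \<le> 1"
  by (simp_all add: step_eq)

lemma step_tendsto:
  assumes "x > 0"
  shows "(\<lambda>n. step (real n * x - c)) \<longlonglongrightarrow> 1"
proof -
  have lim: "filterlim (\<lambda>n. real n * x - c) at_top sequentially"
    using assms by real_asymp
  have "((\<lambda>y::real. exp (- (inverse y))) \<longlongrightarrow> exp (- 0)) at_top"
    by (intro tendsto_intros tendsto_inverse_0_at_top filterlim_ident)
  from filterlim_compose[OF this lim]
  have "(\<lambda>n. exp (- (inverse (real n * x - c)))) \<longlonglongrightarrow> 1" by simp
  moreover have "eventually (\<lambda>n. real n * x - c > 0) sequentially"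
    using lim unfolding filterlim_at_top_dense by blast
  then have "eventually (\<lambda>n. exp (- (inverse (real n * x - c))) = step (real n * x - c)) sequentially"
    by eventually_elim (simp add: step_eq inverse_eq_divide)
  ultimately show ?thesis by (rule Lim_transform_eventually)
qed

text \<open>The shift by 1 keeps the support at a positive distance from both end points while the
  values increase to the indicator as n grows.\<close>

definition interval_bump :: "real \<Rightarrow> real \<Rightarrow> nat \<Rightarrow> real \<Rightarrow> real" where
  "interval_bump l u n x = step (real n * (x - l) - 1) * step (real n * (u - x) - 1)"

text \<open>An arc of the circle is the set where the cosine of the distance to its midpoint exceeds
  the cosine of half its length. This keeps the bump smooth across the seam at 0 and 2 pi.\<close>

definition periodic_bump :: "real \<Rightarrow> real \<Rightarrow> nat \<Rightarrow> real \<Rightarrow> real" where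
  "periodic_bump l u n x = step (real n * (cos (x - (l + u) / 2) - cos ((u - l) / 2)))"

lemma Cinf_interval_bump: "Cinf (interval_bump l u n)"
proof -
  have "Cinf (\<lambda>x. step (c * x + d))" for c d
    by (intro Cinf_compose[OF Cinf_step] Cinf_add Cinf_mult Cinf_const Cinf_id)
  note Cinf_mult[OF this[of n "- real n * l - 1"] this[of "- real n" "real n * u - 1"]]
  then show ?thesis by (simp add: interval_bump_def[abs_def] algebra_simps)
qed

lemma Cinf_periodic_bump: "Cinf (periodic_bump l u n)"
proof -
  have "Cinf (\<lambda>x. step (real n * (cos (x + - ((l + u) / 2)) + - cos ((u - l) / 2))))"
    by (intro Cinf_compose[OF Cinf_step] Cinf_compose[OF Cinf_cos] Cinf_add Cinf_mult Cinf_const Cinf_id)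
  then show ?thesis by (simp add: periodic_bump_def[abs_def])
qed

lemma interval_bump_range: "0 \<le> interval_bump l u n x \<and> interval_bump l u n x \<le> 1"
  by (auto simp: interval_bump_def step_nonneg step_le_1 mult_le_one)

lemma periodic_bump_range: "0 \<le> periodic_bump l u n x \<and> periodic_bump l u n x \<le> 1"
  by (auto simp: periodic_bump_def step_nonneg step_le_1)

lemma interval_bump_tendsto: "(\<lambda>n. interval_bump l u n x) \<longlonglongrightarrow> indicator {l<..<u} x"
proof (cases "x \<in> {l<..<u}")
  case True
  then have "(\<lambda>n. step (real n * (x - l) - 1) * step (real n * (u - x) - 1)) \<longlonglongrightarrow> 1 * 1"
    by (intro tendsto_mult step_tendsto) auto
  then show ?thesis using True by (simp add: interval_bump_def)
next
  case False
  have "interval_bump l u n x = 0" for n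
  proof (cases "x \<le> l")
    case True
    then have "real n * (x - l) \<le> 0" by (simp add: mult_nonneg_nonpos)
    then show ?thesis by (simp add: interval_bump_def step_eq)
  next
    case 2: False
    then have "real n * (u - x) \<le> 0" using False by (intro mult_nonneg_nonpos) auto
    then show ?thesis by (simp add: interval_bump_def step_eq)
  qed
  then show ?thesis using False by simp
qed

text \<open>With \<open>Suc n\<close> the margin is positive also for n = 0, where the bump vanishes
  identically.\<close>

lemma interval_bump_support:
  assumes "interval_bump l u n x \<noteq> 0"
  shows "x \<in> {l + 1 / real (Suc n)..u - 1 / real (Suc n)}"
proof -
  have *: "1 / real (Suc n) \<le> d" if "real n * d - 1 > 0" for d
  proof -
    have "d > 0"
    proof (rule ccontr)
      assume "\<not> d > 0"
      then have "real n * d \<le> 0" by (intro mult_nonneg_nonpos) auto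
      then show False using that by simp
    qed
    then have "real (Suc n) * d \<ge> 1" using that by (simp add: algebra_simps)
    then show ?thesis by (simp add: field_simps)
  qed
  have "real n * (x - l) - 1 > 0" "real n * (u - x) - 1 > 0"
    using assms by (auto simp: interval_bump_def step_eq split: if_splits)
  from this[THEN *] show ?thesis by auto
qed

lemma periodic_bump_periodic: "periodic_bump l u n (x + 2 * pi) = periodic_bump l u n x"
proof -
  have "cos (x + 2 * pi - c) = cos (x - c)" for c
    using cos_periodic[of "x - c"] by (simp add: algebra_simps)
  then show ?thesis by (simp add: periodic_bump_def)
qed

lemma periodic_bump_tendsto:
  assumes lu: "0 \<le> l" "l < u" "u \<le> 2 * pi" and x: "x \<in> {0..2 * pi}"
  shows "(\<lambda>n. periodic_bump l u n x) \<longlonglongrightarrow> indicator {l<..<u} x"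
proof -
  define d where "d = (u - l) / 2"
  define y where "y = \<bar>x - (l + u) / 2\<bar>"
  have d: "0 < d" "d \<le> pi" using lu by (auto simp: d_def)
  have cy: "cos (x - (l + u) / 2) = cos y" by (simp add: y_def cos_abs_real)
  have y: "0 \<le> y" "y \<le> 2 * pi - d"
    using lu x by (auto simp: y_def d_def abs_if field_simps)
  have iff: "x \<in> {l<..<u} \<longleftrightarrow> y < d" by (auto simp: y_def d_def abs_if field_simps)
  show ?thesis
  proof (cases "y < d")
    case True
    have "cos d < cos y" using True y d by (intro cos_monotone_0_pi) auto
    then have "(\<lambda>n. step (real n * (cos y - cos d) - 0)) \<longlonglongrightarrow> 1" by (intro step_tendsto) auto
    then show ?thesis using True iff by (simp add: periodic_bump_def cy d_def[symmetric])
  next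
    case False
    have "cos y \<le> cos d"
    proof (cases "y \<le> pi")
      case True
      then show ?thesis using False d y by (intro cos_monotone_0_pi_le) auto
    next
      case 2: False
      \<comment> \<open>Beyond pi the cosine increases again, so y is reflected; it stays outside
        the arc because \<open>y \<le> 2 * pi - d\<close>.\<close>
      have "cos (2 * pi - y) \<le> cos d" using 2 False d y by (intro cos_monotone_0_pi_le) auto
      then show ?thesis by (simp add: cos_diff)
    qed
    then have "periodic_bump l u n x = 0" for n
      by (simp add: periodic_bump_def step_eq cy d_def[symmetric] mult_nonneg_nonpos not_less)
    then show ?thesis using False iff by simp
  qed
qed

section \<open>Test functions of one variable\<close>

definition interval_tests :: "real \<Rightarrow> real \<Rightarrow> (real \<Rightarrow> real) set" where
  "interval_tests a b = {f. Cinf f \<and> (\<exists>c d. a < c \<and> d < b \<and> (\<forall>x. x \<notin> {c..d} \<longrightarrow> f x = 0))}"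

definition periodic_tests :: "(real \<Rightarrow> real) set" where
  "periodic_tests = {f. Cinf f \<and> (\<forall>x. f (x + 2 * pi) = f x)}"

text \<open>A density keeps the whole line as space and the Borel sets as sigma-algebra, so
  measurability never mentions the interval.\<close>

definition Nm :: "real \<Rightarrow> real \<Rightarrow> real measure" where
  "Nm a b = density lborel (indicator {a..b})"

lemma sets_Nm [measurable_cong, simp]: "sets (Nm a b) = sets borel"
  and space_Nm [simp]: "space (Nm a b) = UNIV"
  by (simp_all add: Nm_def)

lemma integral_Nm:
  fixes f :: "real \<Rightarrow> 'a::{banach, second_countable_topology}"
  assumes "f \<in> borel_measurable borel"
  shows "integral\<^sup>L (Nm a b) f = (LINT x|lborel. indicator {a..b} x *\<^sub>R f x)"
proof -
  have "Nm a b = density lborel (\<lambda>x. ennreal (indicator {a..b} x))"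
    unfolding Nm_def by (simp add: ennreal_indicator)
  then show ?thesis using assms by (simp add: integral_density)
qed

lemma emeasure_Nm: "emeasure (Nm a b) UNIV = emeasure lborel {a..b}"
  by (simp add: Nm_def emeasure_density)

lemma finite_measure_Nm: "finite_measure (Nm a b)"
  by (rule finite_measureI) (simp add: emeasure_Nm emeasure_lborel_Icc_eq)

lemma AE_Nm: "(AE x in Nm a b. P x) \<longleftrightarrow> (AE x in lborel. x \<in> {a..b} \<longrightarrow> P x)"
proof -
  have "(AE x in Nm a b. P x) \<longleftrightarrow> (AE x in lborel. 0 < (indicator {a..b} x :: ennreal) \<longrightarrow> P x)"
    unfolding Nm_def by (rule AE_density) simp
  also have "(\<lambda>x. 0 < (indicator {a..b} x :: ennreal)) = (\<lambda>x. x \<in> {a..b})"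
    by (auto simp: indicator_def)
  finally show ?thesis by (simp only:)
qed

lemma integral_Nm_deriv:
  assumes "a \<le> b" "\<And>x. (F has_real_derivative f x) (at x)" "Cinf f"
  shows "integral\<^sup>L (Nm a b) f = F b - F a"
  using integral_FTC_Icc_real[OF assms(1), of F f] assms(2,3)
  by (simp add: integral_Nm Cinf_measurable Cinf_isCont mult.commute)

text \<open>Common ground of periodic and of compactly supported test functions.
  \<open>T_prim\<close> says that mean zero characterises derivatives of test functions, the key to
  du Bois-Reymond arguments; \<open>T_approx\<close> says that the tests reach the indicators of
  intervals and hence determine integrable functions.\<close>

locale test_space =
  fixes a b :: real and T :: "(real \<Rightarrow> real) set"
  assumes ab: "a < b"
    and T_Cinf: "f \<in> T \<Longrightarrow> Cinf f"
    and T_bounded: "f \<in> T \<Longrightarrow> \<exists>C. \<forall>x. \<bar>f x\<bar> \<le> C"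
    and T_comb: "f \<in> T \<Longrightarrow> g \<in> T \<Longrightarrow> (\<lambda>x. f x - c * g x) \<in> T"
    and T_prim: "f \<in> T \<Longrightarrow> integral\<^sup>L (Nm a b) f = 0 \<Longrightarrow>
       \<exists>F\<in>T. (\<forall>x. (F has_real_derivative f x) (at x)) \<and> F a = 0 \<and> F b = 0"
    and T_approx: "\<exists>f. (\<forall>n::nat. f n \<in> T) \<and> (\<forall>n x. 0 \<le> f n x \<and> f n x \<le> 1) \<and>
       (\<forall>x\<in>{a<..<b}. (\<lambda>n. f n x) \<longlonglongrightarrow> indicator {l<..<u} x)"

lemma test_space_interval:
  assumes ab: "a < b"
  shows "test_space a b (interval_tests a b)"
proof
  show "a < b" by fact
  fix f assume f: "f \<in> interval_tests a b"
  then obtain c d where cd: "a < c" "d < b" "\<And>x. x \<notin> {c..d} \<Longrightarrow> f x = 0" and fi: "Cinf f"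
    by (auto simp: interval_tests_def)
  show "Cinf f" by fact
  have "bounded (f ` {c..d})"
    by (intro compact_imp_bounded compact_continuous_image Cinf_continuous_on fi) auto
  then obtain C where "\<forall>x\<in>{c..d}. \<bar>f x\<bar> \<le> C" by (auto simp: bounded_iff)
  then have "\<bar>f x\<bar> \<le> max C 0" for x using cd(3)[of x] by (cases "x \<in> {c..d}") (auto intro: max.coboundedI1)
  then show "\<exists>C. \<forall>x. \<bar>f x\<bar> \<le> C" by blast
  show "(\<lambda>x. f x - e * g x) \<in> interval_tests a b" if "g \<in> interval_tests a b" for g e
  proof -
    obtain c' d' where cd': "a < c'" "d' < b" "\<And>x. x \<notin> {c'..d'} \<Longrightarrow> g x = 0" and gi: "Cinf g"
      using \<open>g \<in> _\<close> by (auto simp: interval_tests_def)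
    have 1: "Cinf (\<lambda>x. f x + (- e) * g x)" by (intro Cinf_add Cinf_mult Cinf_const fi gi)
    have 2: "f x - e * g x = 0" if "x \<notin> {min c c'..max d d'}" for x
    proof -
      have "x \<notin> {c..d}" "x \<notin> {c'..d'}" using that by auto
      then show ?thesis using cd(3)[of x] cd'(3)[of x] by simp
    qed
    have 3: "a < min c c'" "max d d' < b" using cd(1,2) cd'(1,2) by auto
    show ?thesis
      unfolding interval_tests_def using 1
      by (intro CollectI conjI exI[of _ "min c c'"] exI[of _ "max d d'"] allI impI 2 3) simp_all
  qed
  assume 0: "integral\<^sup>L (Nm a b) f = 0"
  obtain F where F: "\<And>x. (F has_real_derivative f x) (at x)" using ex_primitive[OF fi] by blast
  have Fab: "F b = F a" using integral_Nm_deriv[OF _ F fi, of a b] 0 ab by simp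
  \<comment> \<open>The primitive is constant on each side of the support; vanishing mean makes its
    values at a and b, and so the two constants, agree.\<close>
  have const: "F x = F y" if "convex A" "A \<inter> {c..d} = {}" "x \<in> A" "y \<in> A" for A x y
  proof -
    have "f z = 0" if "z \<in> A" for z
      using that \<open>A \<inter> {c..d} = {}\<close> by (intro cd(3)) blast
    then have "norm (F x - F y) \<le> 0 * norm (x - y)"
      using that(3,4) by (intro field_differentiable_bound[OF that(1) has_field_derivative_at_within[OF F]]) simp_all
    then show ?thesis by simp
  qed
  have "F x - F a = 0" if "x \<notin> {c..d}" for x
  proof -
    have "x < c \<or> x > d" using that by auto
    then show ?thesis
    proof
      assume "x < c"
      then have "F x = F a" by (intro const[of "{..<c}"]) (use cd(1) in auto)
      then show ?thesis by simp
    next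
      assume "x > d"
      then have "F x = F b" by (intro const[of "{d<..}"]) (use cd(2) in auto)
      then show ?thesis using Fab by simp
    qed
  qed
  moreover have F': "((\<lambda>x. F x - F a) has_real_derivative f x) (at x)" for x
    using DERIV_diff[OF F DERIV_const] by simp
  then have "Cinf (\<lambda>x. F x - F a)"
    by (rule Cinf_primitive[OF fi])
  ultimately have "(\<lambda>x. F x - F a) \<in> interval_tests a b"
    unfolding interval_tests_def using cd(1,2) by blast
  then show "\<exists>F\<in>interval_tests a b. (\<forall>x. (F has_real_derivative f x) (at x)) \<and> F a = 0 \<and> F b = 0"
    by (rule bexI[rotated]) (simp add: F' Fab)
next
  fix l u :: real
  define f where "f n = interval_bump (max a l) (min b u) n" for n
  have "f n \<in> interval_tests a b" for n
  proof -
    have "f n x = 0" if "x \<notin> {max a l + 1 / real (Suc n)..min b u - 1 / real (Suc n)}" for x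
      using interval_bump_support that unfolding f_def by blast
    moreover have "a < max a l + 1 / real (Suc n)" "min b u - 1 / real (Suc n) < b"
    proof -
      have "1 / real (Suc n) > 0" by simp
      then show "a < max a l + 1 / real (Suc n)" "min b u - 1 / real (Suc n) < b" by linarith+
    qed
    moreover have "Cinf (f n)" unfolding f_def by (rule Cinf_interval_bump)
    ultimately show ?thesis
      unfolding interval_tests_def by blast
  qed
  moreover have "(\<lambda>n. f n x) \<longlonglongrightarrow> indicator {l<..<u} x" if "x \<in> {a<..<b}" for x
    using interval_bump_tendsto[of "max a l" "min b u" x] that by (simp add: f_def indicator_def)
  ultimately show "\<exists>f. (\<forall>n::nat. f n \<in> interval_tests a b) \<and> (\<forall>n x. 0 \<le> f n x \<and> f n x \<le> 1) \<and>
       (\<forall>x\<in>{a<..<b}. (\<lambda>n. f n x) \<longlonglongrightarrow> indicator {l<..<u} x)"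
    using interval_bump_range by (intro exI[of _ f]) (auto simp: f_def)
qed

lemma periodic_int: "(\<And>x. f (x + 2 * pi) = f x) \<Longrightarrow> f (x + 2 * pi * real_of_int k) = f x"
  for f :: "real \<Rightarrow> real"
proof (induction k rule: int_induct[where k = 0])
  case (step1 i)
  have "f (x + 2 * pi * real_of_int (i + 1)) = f ((x + 2 * pi * real_of_int i) + 2 * pi)"
    by (simp add: algebra_simps)
  then show ?case using step1 by simp
next
  case (step2 i)
  have "f (x + 2 * pi * real_of_int i) = f ((x + 2 * pi * real_of_int (i - 1)) + 2 * pi)"
    by (simp add: algebra_simps)
  then show ?case using step2 by simp
qed simp

lemma test_space_periodic: "test_space 0 (2 * pi) periodic_tests"
proof
  show "0 < 2 * pi" by simp
  fix f assume f: "f \<in> periodic_tests"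
  then have fi: "Cinf f" and per: "\<And>x. f (x + 2 * pi) = f x" by (auto simp: periodic_tests_def)
  show "Cinf f" by fact
  have "bounded (f ` {0..2 * pi})"
    by (intro compact_imp_bounded compact_continuous_image Cinf_continuous_on fi) auto
  then obtain C where C: "\<forall>x\<in>{0..2 * pi}. \<bar>f x\<bar> \<le> C" by (auto simp: bounded_iff)
  have "\<bar>f x\<bar> \<le> C" for x
  proof -
    let ?k = "- \<lfloor>x / (2 * pi)\<rfloor>"
    have "x + 2 * pi * real_of_int ?k \<in> {0..2 * pi}"
    proof -
      have "2 * pi * real_of_int \<lfloor>x / (2 * pi)\<rfloor> \<le> 2 * pi * (x / (2 * pi))"
        "2 * pi * (x / (2 * pi)) \<le> 2 * pi * (real_of_int \<lfloor>x / (2 * pi)\<rfloor> + 1)"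
        using floor_correct[of "x / (2 * pi)"] by (intro mult_left_mono; simp)+
      then show ?thesis by (simp add: algebra_simps)
    qed
    from bspec[OF C this] show ?thesis by (simp only: periodic_int[of f, OF per])
  qed
  then show "\<exists>C. \<forall>x. \<bar>f x\<bar> \<le> C" by blast
  show "(\<lambda>x. f x - e * g x) \<in> periodic_tests" if "g \<in> periodic_tests" for g e
  proof -
    have "Cinf (\<lambda>x. f x + (- e) * g x)"
      using that by (intro Cinf_add Cinf_mult Cinf_const fi) (simp add: periodic_tests_def)
    then show ?thesis using that per by (simp add: periodic_tests_def)
  qed
  assume 0: "integral\<^sup>L (Nm 0 (2 * pi)) f = 0"
  obtain F where F: "\<And>x. (F has_real_derivative f x) (at x)" using ex_primitive[OF fi] by blast
  have F0: "F (2 * pi) = F 0" using integral_Nm_deriv[OF _ F fi, of 0 "2 * pi"] 0 by simp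
  \<comment> \<open>The increment over a period has derivative zero by periodicity of f, and
    vanishes at 0 because f has mean zero.\<close>
  have "F (x + 2 * pi) = F x" for x
  proof -
    have "((\<lambda>x. F (x + 2 * pi) - F x) has_field_derivative 0) (at y within UNIV)" for y
      using DERIV_diff[OF F[of "y + 2 * pi", unfolded DERIV_shift] F[of y]] per[of y] by simp
    then have "norm ((F (x + 2 * pi) - F x) - (F (0 + 2 * pi) - F 0)) \<le> 0 * norm (x - 0)"
      by (intro field_differentiable_bound[of UNIV]) auto
    then show ?thesis using F0 by simp
  qed
  moreover have "Cinf (\<lambda>x. F x - F 0)"
    by (rule Cinf_primitive[OF fi]) (auto intro!: derivative_eq_intros F)
  ultimately have "(\<lambda>x. F x - F 0) \<in> periodic_tests"
    by (auto simp: periodic_tests_def)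
  then show "\<exists>F\<in>periodic_tests. (\<forall>x. (F has_real_derivative f x) (at x)) \<and> F 0 = 0 \<and> F (2 * pi) = 0"
    by (rule bexI[rotated]) (auto intro!: derivative_eq_intros F simp: F0)
next
  fix l u :: real
  define l' u' where "l' = max 0 l" and "u' = min (2 * pi) u"
  show "\<exists>f. (\<forall>n::nat. f n \<in> periodic_tests) \<and> (\<forall>n x. 0 \<le> f n x \<and> f n x \<le> 1) \<and>
       (\<forall>x\<in>{0<..<2 * pi}. (\<lambda>n. f n x) \<longlonglongrightarrow> indicator {l<..<u} x)"
  proof (cases "l' < u'")
    case True
    have "periodic_bump l' u' n \<in> periodic_tests" for n
      by (simp add: periodic_tests_def Cinf_periodic_bump periodic_bump_periodic)
    moreover have "(\<lambda>n. periodic_bump l' u' n x) \<longlonglongrightarrow> indicator {l<..<u} x" if "x \<in> {0<..<2 * pi}" for x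
      using periodic_bump_tendsto[of l' u' x] that True by (simp add: l'_def u'_def indicator_def)
    ultimately show ?thesis
      using periodic_bump_range by (intro exI[of _ "periodic_bump l' u'"]) auto
  next
    case False
    then show ?thesis
      by (intro exI[of _ "\<lambda>n x. 0"]) (auto simp: periodic_tests_def Cinf_const l'_def u'_def indicator_def)
  qed
qed

section \<open>Weak derivatives along one coordinate\<close>

lemma (in finite_measure) integrable_of_square:
  fixes f :: "'a \<Rightarrow> complex"
  assumes "f \<in> borel_measurable M" "integrable M (\<lambda>x. (cmod (f x))\<^sup>2)"
  shows "integrable M f"
proof (rule Bochner_Integration.integrable_bound)
  show "integrable M (\<lambda>x. 1 + (cmod (f x))\<^sup>2)" using assms(2) by simp
  have "cmod z \<le> 1 + (cmod z)\<^sup>2" for z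
  proof -
    have "0 \<le> (cmod z - 1)\<^sup>2 + cmod z" by simp
    then show ?thesis by (simp add: power2_diff)
  qed
  then show "AE x in M. norm (f x) \<le> norm (1 + (cmod (f x))\<^sup>2)" by simp
qed fact

lemma integrable_mult_squares:
  fixes f g :: "'a \<Rightarrow> complex"
  assumes "f \<in> borel_measurable M" "integrable M (\<lambda>x. (cmod (f x))\<^sup>2)"
    "g \<in> borel_measurable M" "integrable M (\<lambda>x. (cmod (g x))\<^sup>2)"
  shows "integrable M (\<lambda>x. f x * g x)"
proof (rule Bochner_Integration.integrable_bound)
  show "integrable M (\<lambda>x. (cmod (f x))\<^sup>2 + (cmod (g x))\<^sup>2)" using assms by simp
  have "cmod (z * w) \<le> (cmod z)\<^sup>2 + (cmod w)\<^sup>2" for z w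
  proof -
    have "0 \<le> (cmod z - cmod w)\<^sup>2 + cmod z * cmod w" by simp
    then show ?thesis unfolding norm_mult power2_diff by linarith
  qed
  then show "AE x in M. norm (f x * g x) \<le> norm ((cmod (f x))\<^sup>2 + (cmod (g x))\<^sup>2)" by simp
qed (use assms in measurable)

lemma integrable_bounded_mult:
  fixes f g :: "'a \<Rightarrow> complex"
  assumes "integrable M f" "g \<in> borel_measurable M" "\<And>x. cmod (g x) \<le> C"
  shows "integrable M (\<lambda>x. f x * g x)"
proof (rule Bochner_Integration.integrable_bound)
  show "integrable M (\<lambda>x. C * norm (f x))" using assms(1) by simp
  have "norm (f x) * norm (g x) \<le> C * norm (f x)" for x
    using mult_left_mono[OF assms(3), of "norm (f x)" x] by (simp add: mult.commute)
  then show "AE x in M. norm (f x * g x) \<le> norm (C * norm (f x))"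
    unfolding norm_mult real_norm_def using order_trans[OF _ abs_ge_self] by blast
qed (use assms in measurable)

text \<open>The variance around the mean value \<open>c\<close> is nonnegative.\<close>

lemma (in finite_measure) integral_square_le:
  fixes g :: "'a \<Rightarrow> real"
  assumes "integrable M g" "integrable M (\<lambda>x. (g x)\<^sup>2)" and L: "measure M (space M) = L" "L > 0"
  shows "(integral\<^sup>L M g)\<^sup>2 \<le> L * (\<integral>x. (g x)\<^sup>2 \<partial>M)"
proof -
  define c where "c = integral\<^sup>L M g / L"
  have "0 \<le> (\<integral>x. (g x - c)\<^sup>2 \<partial>M)" by simp
  also have "(\<lambda>x. (g x - c)\<^sup>2) = (\<lambda>x. (g x)\<^sup>2 - 2 * c * g x + c\<^sup>2)"
    by (simp add: fun_eq_iff power2_diff)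
  also have "(\<integral>x. (g x)\<^sup>2 - 2 * c * g x + c\<^sup>2 \<partial>M) = (\<integral>x. (g x)\<^sup>2 \<partial>M) - 2 * c * integral\<^sup>L M g + c\<^sup>2 * L"
    using assms by simp
  finally show ?thesis
    using L(2) by (simp add: c_def field_simps power2_eq_square)
qed

lemma (in pair_sigma_finite) AE_fst:
  assumes "AE x in M1. P x" shows "AE z in M1 \<Otimes>\<^sub>M M2. P (fst z)"
proof -
  obtain A where A: "{x\<in>space M1. \<not> P x} \<subseteq> A" "emeasure M1 A = 0" "A \<in> sets M1"
    using assms by (rule AE_E)
  show ?thesis
  proof (rule AE_I)
    show "{z \<in> space (M1 \<Otimes>\<^sub>M M2). \<not> P (fst z)} \<subseteq> A \<times> space M2"
      using A(1) by (auto simp: space_pair_measure)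
    show "emeasure (M1 \<Otimes>\<^sub>M M2) (A \<times> space M2) = 0"
      using A by (simp add: M2.emeasure_pair_measure_Times)
    show "A \<times> space M2 \<in> sets (M1 \<Otimes>\<^sub>M M2)" using A by simp
  qed
qed

lemma (in pair_sigma_finite) AE_snd:
  assumes "AE x in M2. P x" shows "AE z in M1 \<Otimes>\<^sub>M M2. P (snd z)"
proof -
  obtain A where A: "{x\<in>space M2. \<not> P x} \<subseteq> A" "emeasure M2 A = 0" "A \<in> sets M2"
    using assms by (rule AE_E)
  show ?thesis
  proof (rule AE_I)
    show "{z \<in> space (M1 \<Otimes>\<^sub>M M2). \<not> P (snd z)} \<subseteq> space M1 \<times> A"
      using A(1) by (auto simp: space_pair_measure)
    show "emeasure (M1 \<Otimes>\<^sub>M M2) (space M1 \<times> A) = 0"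
      using A by (simp add: M2.emeasure_pair_measure_Times)
    show "space M1 \<times> A \<in> sets (M1 \<Otimes>\<^sub>M M2)" using A by simp
  qed
qed

text \<open>One coordinate is singled out for differentiation and ranges over the last factor;
  \<open>NQ\<close> carries the transverse variables with their own tests. Weak derivatives are then
  handled slice by slice, and \<open>separating\<close> passes from products of tests to statements
  almost everywhere.\<close>

locale coordinate = test_space a b T for a b :: real and T +
  fixes NQ :: "'q measure" and T2 :: "('q \<Rightarrow> real) set"
  assumes finite_NQ: "finite_measure NQ"
    and T2_measurable: "\<beta> \<in> T2 \<Longrightarrow> \<beta> \<in> borel_measurable NQ"
    and T2_bounded: "\<beta> \<in> T2 \<Longrightarrow> \<exists>C. \<forall>p. \<bar>\<beta> p\<bar> \<le> C"
    and separating: "\<And>Z :: 'q \<times> real \<Rightarrow> complex. integrable (NQ \<Otimes>\<^sub>M Nm a b) Z \<Longrightarrow>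
       (\<And>f \<beta>. f \<in> T \<Longrightarrow> \<beta> \<in> T2 \<Longrightarrow>
          (\<integral>z. Z z * of_real (\<beta> (fst z) * f (snd z)) \<partial>(NQ \<Otimes>\<^sub>M Nm a b)) = 0) \<Longrightarrow>
       AE z in NQ \<Otimes>\<^sub>M Nm a b. Z z = 0"
begin

abbreviation "N \<equiv> Nm a b"
abbreviation "F \<equiv> NQ \<Otimes>\<^sub>M N"

sublocale N: finite_measure N by (rule finite_measure_Nm)
sublocale NQ: finite_measure NQ by (rule finite_NQ)
sublocale pair_sigma_finite NQ N ..
sublocale F: finite_measure F by (intro finite_measure_pair_measure finite_NQ finite_measure_Nm)
sublocale NN: pair_sigma_finite N N ..

lemma borel_measurable_N [simp]: "borel_measurable N = borel_measurable borel"
  by (rule measurable_cong_sets) simp_all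

lemma measure_N: "measure N UNIV = b - a"
  using ab by (simp add: measure_def emeasure_Nm)

lemma T_measurable [measurable]: "f \<in> T \<Longrightarrow> f \<in> borel_measurable borel"
  by (intro Cinf_measurable T_Cinf)

lemma T2_measurable' [measurable]: "\<beta> \<in> T2 \<Longrightarrow> \<beta> \<in> borel_measurable NQ"
  by (rule T2_measurable)

definition sq :: "('q \<times> real \<Rightarrow> complex) \<Rightarrow> bool" where
  "sq U \<longleftrightarrow> U \<in> borel_measurable F \<and> integrable F (\<lambda>z. (cmod (U z))\<^sup>2)"

definition weak :: "('q \<times> real \<Rightarrow> complex) \<Rightarrow> ('q \<times> real \<Rightarrow> complex) \<Rightarrow> bool" where
  "weak U G \<longleftrightarrow> sq U \<and> sq G \<and> (\<forall>f\<in>T. \<forall>\<beta>\<in>T2.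
     (\<integral>z. U z * of_real (\<beta> (fst z) * deriv f (snd z)) \<partial>F) = - (\<integral>z. G z * of_real (\<beta> (fst z) * f (snd z)) \<partial>F))"

text \<open>The antiderivative of G along the slice, started at the left end: the measure
  \<open>N\<close> already confines the integral to [a, b].\<close>

definition prim :: "('q \<times> real \<Rightarrow> complex) \<Rightarrow> 'q \<times> real \<Rightarrow> complex" where
  "prim G z = (\<integral>\<sigma>. indicator {..snd z} \<sigma> *\<^sub>R G (fst z, \<sigma>) \<partial>N)"

text \<open>Almost every slice of a square-integrable function has this property, so arguments on a
  single slice need no further exceptional sets for integrability.\<close>

definition good :: "('q \<times> real \<Rightarrow> complex) \<Rightarrow> 'q \<Rightarrow> bool" where
  "good G p \<longleftrightarrow> (\<lambda>\<sigma>. G (p, \<sigma>)) \<in> borel_measurable borel \<and> integrable N (\<lambda>\<sigma>. (cmod (G (p, \<sigma>)))\<^sup>2)"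

lemma sq_measurable: "sq U \<Longrightarrow> U \<in> borel_measurable F"
  by (simp add: sq_def)

lemma sq_integrable: "sq U \<Longrightarrow> integrable F U"
  unfolding sq_def by (blast intro: F.integrable_of_square)

lemma AE_good: "sq G \<Longrightarrow> AE p in NQ. good G p"
proof -
  assume G: "sq G"
  have "AE p in NQ. integrable N (\<lambda>\<sigma>. (cmod (G (p, \<sigma>)))\<^sup>2)"
    using G AE_integrable_fst'[of "\<lambda>z. (cmod (G z))\<^sup>2"] by (simp add: sq_def)
  moreover have "AE p in NQ. (\<lambda>\<sigma>. G (p, \<sigma>)) \<in> borel_measurable borel"
  proof (rule AE_I2)
    fix p assume "p \<in> space NQ"
    then have "(\<lambda>\<sigma>. G (p, \<sigma>)) \<in> borel_measurable N"
      using sq_measurable[OF G] by measurable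
    then show "(\<lambda>\<sigma>. G (p, \<sigma>)) \<in> borel_measurable borel" by simp
  qed
  ultimately show ?thesis by eventually_elim (simp add: good_def)
qed

lemma good_integrable: "good G p \<Longrightarrow> integrable N (\<lambda>\<sigma>. G (p, \<sigma>))"
  unfolding good_def by (intro N.integrable_of_square) simp_all

lemma good_L1_le:
  assumes "good G p"
  shows "(\<integral>\<sigma>. cmod (G (p, \<sigma>)) \<partial>N)\<^sup>2 \<le> (b - a) * (\<integral>\<sigma>. (cmod (G (p, \<sigma>)))\<^sup>2 \<partial>N)"
  using assms good_integrable[OF assms] ab
  by (intro N.integral_square_le) (auto simp: good_def measure_N)

lemma good_prim_le:
  assumes "good G p" shows "(cmod (prim G (p, s)))\<^sup>2 \<le> (b - a) * (\<integral>\<sigma>. (cmod (G (p, \<sigma>)))\<^sup>2 \<partial>N)"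
proof -
  note i = good_integrable[OF assms]
  have "cmod (prim G (p, s)) \<le> (\<integral>\<sigma>. cmod (G (p, \<sigma>)) \<partial>N)"
    unfolding prim_def fst_conv snd_conv
  proof (rule order_trans[OF integral_norm_bound integral_mono])
    show "integrable N (\<lambda>\<sigma>. cmod (indicator {..s} \<sigma> *\<^sub>R G (p, \<sigma>)))"
      using i by (intro integrable_norm integrable_mult_indicator) simp_all
  qed (use i in \<open>auto simp: indicator_def\<close>)
  then have "(cmod (prim G (p, s)))\<^sup>2 \<le> (\<integral>\<sigma>. cmod (G (p, \<sigma>)) \<partial>N)\<^sup>2" by (rule power_mono) simp
  then show ?thesis using good_L1_le[OF assms] by linarith
qed

lemma prim_measurable:
  assumes "sq G" shows "prim G \<in> borel_measurable F"
proof -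
  have [measurable]: "G \<in> borel_measurable F" using assms by (rule sq_measurable)
  have "(\<lambda>z. \<integral>\<sigma>. (if \<sigma> \<le> snd z then G (fst z, \<sigma>) else 0) \<partial>N) \<in> borel_measurable F"
    by measurable
  also have "(\<lambda>z. \<integral>\<sigma>. (if \<sigma> \<le> snd z then G (fst z, \<sigma>) else 0) \<partial>N) = prim G"
    by (auto simp: prim_def fun_eq_iff indicator_def intro!: Bochner_Integration.integral_cong)
  finally show ?thesis .
qed

lemma integrable_lift:
  fixes h :: "'q \<Rightarrow> 'c::{banach, second_countable_topology}"
  assumes "integrable NQ h" shows "integrable F (\<lambda>z. h (fst z))"
proof (rule Fubini_integrable)
  show "(\<lambda>z. h (fst z)) \<in> borel_measurable F" using assms by measurable
  show "integrable NQ (\<lambda>x. LINT y|N. norm (h (fst (x, y))))" using assms by simp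
  show "AE x in NQ. integrable N (\<lambda>y. h (fst (x, y)))" by simp
qed

lemma prim_sq:
  assumes "sq G" shows "sq (prim G)"
  unfolding sq_def
proof
  show m: "prim G \<in> borel_measurable F" using assms by (rule prim_measurable)
  have i: "integrable NQ (\<lambda>p. (b - a) * (\<integral>\<sigma>. (cmod (G (p, \<sigma>)))\<^sup>2 \<partial>N))"
    using integrable_fst'[of "\<lambda>z. (cmod (G z))\<^sup>2"] assms by (simp add: sq_def)
  show "integrable F (\<lambda>z. (cmod (prim G z))\<^sup>2)"
  proof (rule Bochner_Integration.integrable_bound[OF integrable_lift[OF i]])
    show "(\<lambda>z. (cmod (prim G z))\<^sup>2) \<in> borel_measurable F" using m by measurable
    show "AE z in F. norm ((cmod (prim G z))\<^sup>2)
        \<le> norm ((b - a) * (\<integral>\<sigma>. (cmod (G (fst z, \<sigma>)))\<^sup>2 \<partial>N))"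
      using AE_fst[OF AE_good[OF assms]]
    proof eventually_elim
      case (elim z)
      then show ?case using good_prim_le[OF elim, of "snd z"]
        by simp
    qed
  qed
qed

lemma sq_diff: "sq U \<Longrightarrow> sq V \<Longrightarrow> sq (\<lambda>z. U z - V z)"
  unfolding sq_def
proof safe
  assume [measurable]: "U \<in> borel_measurable F" "V \<in> borel_measurable F"
    and i: "integrable F (\<lambda>z. (cmod (U z))\<^sup>2)" "integrable F (\<lambda>z. (cmod (V z))\<^sup>2)"
  show "(\<lambda>z. U z - V z) \<in> borel_measurable F" by measurable
  show "integrable F (\<lambda>z. (cmod (U z - V z))\<^sup>2)"
  proof (rule Bochner_Integration.integrable_bound)
    show "integrable F (\<lambda>z. 2 * ((cmod (U z))\<^sup>2 + (cmod (V z))\<^sup>2))" using i by simp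
    have "(cmod (z - w))\<^sup>2 \<le> 2 * ((cmod z)\<^sup>2 + (cmod w)\<^sup>2)" for z w
    proof -
      have "(cmod (z - w))\<^sup>2 \<le> (cmod z + cmod w)\<^sup>2" by (intro power_mono norm_triangle_ineq4) simp
      moreover have "0 \<le> (cmod z - cmod w)\<^sup>2" by simp
      ultimately show ?thesis by (simp add: power2_diff power2_sum)
    qed
    then show "AE z in F. norm ((cmod (U z - V z))\<^sup>2) \<le> norm (2 * ((cmod (U z))\<^sup>2 + (cmod (V z))\<^sup>2))" by simp
  qed measurable
qed

lemma test_mult:
  fixes U :: "'q \<times> real \<Rightarrow> complex"
  assumes "f \<in> T" "\<beta> \<in> T2" "integrable F U"
  shows "integrable F (\<lambda>z. U z * of_real (\<beta> (fst z) * f (snd z)))"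
proof -
  obtain C D where C: "\<And>p. \<bar>\<beta> p\<bar> \<le> C" "\<And>s. \<bar>f s\<bar> \<le> D"
    using T2_bounded[OF assms(2)] T_bounded[OF assms(1)] by blast
  show ?thesis
  proof (rule integrable_bounded_mult[OF assms(3)])
    show "(\<lambda>z. complex_of_real (\<beta> (fst z) * f (snd z))) \<in> borel_measurable F"
      using assms(1,2) by measurable
    show "cmod (complex_of_real (\<beta> (fst z) * f (snd z))) \<le> C * D" for z
      unfolding norm_of_real abs_mult
      by (intro mult_mono C) (use order_trans[OF abs_ge_zero C(1)] in auto)
  qed
qed

lemma T_integrable: "f \<in> T \<Longrightarrow> integrable N f"
proof -
  assume f: "f \<in> T"
  then obtain D where "\<And>s. \<bar>f s\<bar> \<le> D" using T_bounded by blast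
  then show ?thesis using f by (intro N.integrable_const_bound[of _ D]) auto
qed

lemma AE_N_in: "AE s in N. s \<in> {a..b}"
  by (simp add: AE_Nm)

lemma AE_N_open: "AE s in N. s \<in> {a<..<b}"
proof -
  have "AE s in lborel. s \<noteq> a \<and> s \<noteq> b" by (simp add: AE_lborel_singleton)
  then show ?thesis unfolding AE_Nm by eventually_elim auto
qed

lemma ex_normalizer: "\<exists>\<kappa>\<in>T. integral\<^sup>L N \<kappa> = 1"
proof -
  obtain f where f: "\<And>n::nat. f n \<in> T" "\<And>n x. 0 \<le> f n x \<and> f n x \<le> 1"
    "\<And>x. x \<in> {a<..<b} \<Longrightarrow> (\<lambda>n. f n x) \<longlonglongrightarrow> indicator {a<..<b} x"
    using T_approx[of a b] by blast
  have "(\<lambda>n. integral\<^sup>L N (f n)) \<longlonglongrightarrow> (\<integral>x. 1 \<partial>N)"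
  proof (rule integral_dominated_convergence[where w = "\<lambda>x. 1"])
    show "AE x in N. (\<lambda>n. f n x) \<longlonglongrightarrow> 1"
      using AE_N_open
    proof eventually_elim
      case (elim x)
      then show ?case using f(3)[OF elim] by simp
    qed
  qed (use f in auto)
  then have "(\<lambda>n. integral\<^sup>L N (f n)) \<longlonglongrightarrow> b - a" by (simp add: measure_N)
  then have "eventually (\<lambda>n. integral\<^sup>L N (f n) > 0) sequentially"
    using ab by (intro order_tendstoD(1)) auto
  then obtain n where n: "integral\<^sup>L N (f n) > 0" by (auto simp: eventually_sequentially)
  \<comment> \<open>Chosen so that (1 - c) times the integral is 1; the only combinations under
    which tests are known to be closed are those of the form \<open>f - c g\<close>.\<close>
  define c where "c = 1 - 1 / integral\<^sup>L N (f n)"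
  have "(\<lambda>x. f n x - c * f n x) \<in> T" by (intro T_comb f)
  moreover have "(\<integral>x. f n x - c * f n x \<partial>N) = 1"
    using n T_integrable[OF f(1)] by (simp add: c_def field_simps)
  ultimately show ?thesis by blast
qed

text \<open>Fubini on the triangle where \<sigma> lies below s: the inner integral of h from
  \<sigma> to b is -\<open>\<alpha> \<sigma>\<close>, because \<alpha> vanishes at b.\<close>

lemma prim_by_parts:
  assumes p: "good G p" and h: "h \<in> T" and \<alpha>: "\<alpha> \<in> T" "\<And>x. (\<alpha> has_real_derivative h x) (at x)" "\<alpha> b = 0"
  shows "(\<integral>s. prim G (p, s) * of_real (h s) \<partial>N) = - (\<integral>s. G (p, s) * of_real (\<alpha> s) \<partial>N)"
proof -
  have Gm [measurable]: "(\<lambda>\<sigma>. G (p, \<sigma>)) \<in> borel_measurable borel" using p by (simp add: good_def)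
  note [measurable] = T_measurable[OF h]
  obtain D where D: "\<And>s. \<bar>h s\<bar> \<le> D" using T_bounded[OF h] by blast
  have prod: "integrable (N \<Otimes>\<^sub>M N) (\<lambda>(\<sigma>, s). indicator {..s} \<sigma> *\<^sub>R G (p, \<sigma>) * of_real (h s))"
  proof -
    have 1: "integrable (N \<Otimes>\<^sub>M N) (\<lambda>z. G (p, fst z))"
    proof (rule NN.Fubini_integrable)
      show "(\<lambda>z. G (p, fst z)) \<in> borel_measurable (N \<Otimes>\<^sub>M N)"
        by (rule measurable_compose[OF measurable_fst]) simp
    qed (use good_integrable[OF p] in simp_all)
    have 2: "(\<lambda>z. (if fst z \<le> snd z then 1 else 0) * complex_of_real (h (snd z))) \<in> borel_measurable (N \<Otimes>\<^sub>M N)"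
      by measurable
    have 3: "cmod ((if fst z \<le> snd z then 1 else 0) * complex_of_real (h (snd z))) \<le> D" for z
      using D[of "snd z"] order_trans[OF abs_ge_zero D[of "snd z"]] by (simp add: norm_mult)
    have "integrable (N \<Otimes>\<^sub>M N) (\<lambda>z. G (p, fst z) * ((if fst z \<le> snd z then 1 else 0) * of_real (h (snd z))))"
      by (rule integrable_bounded_mult[OF 1 2 3])
    also have "(\<lambda>z. G (p, fst z) * ((if fst z \<le> snd z then 1 else 0) * of_real (h (snd z))))
        = (\<lambda>(\<sigma>, s). indicator {..s} \<sigma> *\<^sub>R G (p, \<sigma>) * of_real (h s))"
      by (auto simp: fun_eq_iff indicator_def)
    finally show ?thesis .
  qed
  have "(\<integral>s. prim G (p, s) * of_real (h s) \<partial>N)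
      = (\<integral>s. (\<integral>\<sigma>. indicator {..s} \<sigma> *\<^sub>R G (p, \<sigma>) * of_real (h s) \<partial>N) \<partial>N)"
    by (simp only: prim_def fst_conv snd_conv integral_mult_left_zero)
  also have "\<dots> = (\<integral>\<sigma>. (\<integral>s. indicator {..s} \<sigma> *\<^sub>R G (p, \<sigma>) * of_real (h s) \<partial>N) \<partial>N)"
    by (rule NN.Fubini_integral[OF prod])
  also have "\<dots> = (\<integral>\<sigma>. - (G (p, \<sigma>) * of_real (\<alpha> \<sigma>)) \<partial>N)"
  proof (rule integral_cong_AE)
    show "AE \<sigma> in N. (\<integral>s. indicator {..s} \<sigma> *\<^sub>R G (p, \<sigma>) * of_real (h s) \<partial>N) = - (G (p, \<sigma>) * of_real (\<alpha> \<sigma>))"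
      using AE_N_in
    proof eventually_elim
      case (elim \<sigma>)
      have "(\<integral>s. indicator {..s} \<sigma> *\<^sub>R G (p, \<sigma>) * of_real (h s) \<partial>N)
          = (\<integral>s. G (p, \<sigma>) * of_real (indicator {\<sigma>..} s * h s) \<partial>N)"
        by (intro Bochner_Integration.integral_cong) (auto simp: indicator_def)
      also have "\<dots> = G (p, \<sigma>) * of_real (\<integral>s. indicator {\<sigma>..} s * h s \<partial>N)"
        by (simp only: integral_mult_right_zero integral_complex_of_real)
      also have "(\<integral>s. indicator {\<sigma>..} s * h s \<partial>N) = integral\<^sup>L (Nm \<sigma> b) h"
        using elim by (simp add: integral_Nm)
          (intro Bochner_Integration.integral_cong, auto simp: indicator_def)
      also have "\<dots> = - \<alpha> \<sigma>"
        using integral_Nm_deriv[OF _ \<alpha>(2) T_Cinf[OF h], of \<sigma> b] elim \<alpha>(3) by simp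
      finally show ?case by simp
    qed
    show "(\<lambda>\<sigma>. \<integral>s. indicator {..s} \<sigma> *\<^sub>R G (p, \<sigma>) * of_real (h s) \<partial>N) \<in> borel_measurable N"
      using borel_measurable_integrable[OF NN.integrable_fst'[OF prod]] by simp
    show "(\<lambda>\<sigma>. - (G (p, \<sigma>) * of_real (\<alpha> \<sigma>))) \<in> borel_measurable N"
      using T_measurable[OF \<alpha>(1)] by simp
  qed
  finally show ?thesis by simp
qed

text \<open>A test h of mean zero is the derivative of a test, so the weak identity for U and
  integration by parts for the primitive of G produce the same integral against h.\<close>

lemma weak_minus_prim:
  assumes w: "weak U G" and h: "h \<in> T" "integral\<^sup>L N h = 0" and \<beta>: "\<beta> \<in> T2"
  shows "(\<integral>z. (U z - prim G z) * of_real (\<beta> (fst z) * h (snd z)) \<partial>F) = 0"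
proof -
  have U: "sq U" and G: "sq G" using w by (auto simp: weak_def)
  obtain \<alpha> where \<alpha>: "\<alpha> \<in> T" "\<And>x. (\<alpha> has_real_derivative h x) (at x)" "\<alpha> b = 0"
    using T_prim[OF h] by blast
  have "deriv \<alpha> = h" using \<alpha>(2) by (auto intro: DERIV_imp_deriv)
  then have 1: "(\<integral>z. U z * of_real (\<beta> (fst z) * h (snd z)) \<partial>F) = - (\<integral>z. G z * of_real (\<beta> (fst z) * \<alpha> (snd z)) \<partial>F)"
    using w \<alpha>(1) \<beta> by (auto simp: weak_def)
  have int: "integrable F (\<lambda>z. V z * of_real (\<beta> (fst z) * f (snd z)))" if "f \<in> T" "sq V" for f V
    by (rule test_mult[OF that(1) \<beta> sq_integrable[OF that(2)]])
  have "(\<integral>z. prim G z * of_real (\<beta> (fst z) * h (snd z)) \<partial>F)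
      = (\<integral>p. (\<integral>s. prim G (p, s) * of_real (\<beta> p * h s) \<partial>N) \<partial>NQ)"
    using integral_fst'[OF int[OF h(1) prim_sq[OF G]]] by simp
  also have "\<dots> = (\<integral>p. (\<integral>s. - (G (p, s) * of_real (\<beta> p * \<alpha> s)) \<partial>N) \<partial>NQ)"
  proof (rule integral_cong_AE)
    show "(\<lambda>p. \<integral>s. prim G (p, s) * of_real (\<beta> p * h s) \<partial>N) \<in> borel_measurable NQ"
      using integrable_fst'[OF int[OF h(1) prim_sq[OF G]]] by simp
    show "(\<lambda>p. \<integral>s. - (G (p, s) * of_real (\<beta> p * \<alpha> s)) \<partial>N) \<in> borel_measurable NQ"
      using integrable_fst'[OF int[OF \<alpha>(1) G]] by simp
    show "AE p in NQ. (\<integral>s. prim G (p, s) * of_real (\<beta> p * h s) \<partial>N) = (\<integral>s. - (G (p, s) * of_real (\<beta> p * \<alpha> s)) \<partial>N)"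
      using AE_good[OF G]
    proof eventually_elim
      case (elim p)
      from arg_cong[OF prim_by_parts[OF elim h(1) \<alpha>], of "\<lambda>c. of_real (\<beta> p) * c"]
      show ?case by (simp add: mult_ac flip: integral_mult_right_zero)
    qed
  qed
  also have "\<dots> = - (\<integral>z. G z * of_real (\<beta> (fst z) * \<alpha> (snd z)) \<partial>F)"
    using integral_fst'[OF int[OF \<alpha>(1) G]] by simp
  finally have 2: "(\<integral>z. prim G z * of_real (\<beta> (fst z) * h (snd z)) \<partial>F) = - (\<integral>z. G z * of_real (\<beta> (fst z) * \<alpha> (snd z)) \<partial>F)" .
  show ?thesis
    using 1 2 int[OF h(1) U] int[OF h(1) prim_sq[OF G]] by (simp add: left_diff_distrib)
qed

text \<open>Du Bois-Reymond on slices. Any test is a mean-zero test plus a multiple of the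
  normaliser \<kappa>, and \<open>U - prim G\<close> ignores the first part; it therefore agrees
  with its \<kappa>-average over the slice, a function of the transverse variables alone.\<close>

lemma weak_representation:
  assumes w: "weak U G"
  obtains k where "k \<in> borel_measurable NQ" "AE z in F. U z = prim G z + k (fst z)"
proof -
  have U: "sq U" and G: "sq G" using w by (auto simp: weak_def)
  obtain \<kappa> where \<kappa>: "\<kappa> \<in> T" "integral\<^sup>L N \<kappa> = 1" using ex_normalizer by blast
  define V where "V z = U z - prim G z" for z
  have V: "sq V" unfolding V_def by (intro sq_diff U prim_sq G)
  obtain D where D: "\<And>s. \<bar>\<kappa> s\<bar> \<le> D" using T_bounded[OF \<kappa>(1)] by blast
  have V\<kappa>: "integrable F (\<lambda>z. V z * of_real (\<kappa> (snd z)))"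
    by (rule integrable_bounded_mult[OF sq_integrable[OF V], where C = D])
       (use T_measurable[OF \<kappa>(1)] D in \<open>auto intro: measurable_compose[OF measurable_snd]\<close>)
  define k where "k p = (\<integral>s. V (p, s) * of_real (\<kappa> s) \<partial>N)" for p
  have k: "integrable NQ k" unfolding k_def using integrable_fst'[OF V\<kappa>] by simp
  have kF: "integrable F (\<lambda>z. k (fst z))" by (rule integrable_lift[OF k])
  have "AE z in F. V z - k (fst z) = 0"
  proof (rule separating)
    show "integrable F (\<lambda>z. V z - k (fst z))" using sq_integrable[OF V] kF by simp
    fix f \<beta> assume f: "f \<in> T" and \<beta>: "\<beta> \<in> T2"
    define c where "c = integral\<^sup>L N f"
    have h: "(\<lambda>s. f s - c * \<kappa> s) \<in> T" by (intro T_comb f \<kappa>(1))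
    have h0: "integral\<^sup>L N (\<lambda>s. f s - c * \<kappa> s) = 0"
      using T_integrable[OF f] T_integrable[OF \<kappa>(1)] \<kappa>(2) by (simp add: c_def)
    note ints = test_mult[OF f \<beta> sq_integrable[OF V]] test_mult[OF \<kappa>(1) \<beta> sq_integrable[OF V]] test_mult[OF f \<beta> kF]
    have "(\<integral>z. k (fst z) * of_real (\<beta> (fst z) * f (snd z)) \<partial>F) = (\<integral>p. k p * of_real (\<beta> p) * of_real c \<partial>NQ)"
      using integral_fst'[OF ints(3)] by (simp add: c_def mult.assoc)
    also have "\<dots> = of_real c * (\<integral>p. (\<integral>s. V (p, s) * of_real (\<beta> p * \<kappa> s) \<partial>N) \<partial>NQ)"
      by (simp add: k_def mult_ac flip: integral_mult_right_zero integral_mult_left_zero)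
    also have "\<dots> = of_real c * (\<integral>z. V z * of_real (\<beta> (fst z) * \<kappa> (snd z)) \<partial>F)"
      using integral_fst'[OF ints(2)] by simp
    also have "\<dots> = (\<integral>z. V z * of_real (\<beta> (fst z) * f (snd z)) \<partial>F)"
      using weak_minus_prim[OF w h h0 \<beta>] ints(1,2)
      by (simp add: V_def[symmetric] right_diff_distrib mult_ac)
    finally show "(\<integral>z. (V z - k (fst z)) * of_real (\<beta> (fst z) * f (snd z)) \<partial>F) = 0"
      using ints by (simp add: left_diff_distrib)
  qed
  then have "AE z in F. U z = prim G z + k (fst z)"
    by eventually_elim (simp add: V_def algebra_simps)
  then show ?thesis using k by (intro that[of k]) auto
qed


lemma AE_slice_representation:
  assumes "weak U G"
  shows "AE p in NQ. good G p \<and> good U p \<and> (\<exists>c. AE s in N. U (p, s) = prim G (p, s) + c)"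
proof -
  obtain k where "AE z in F. U z = prim G z + k (fst z)" using assms by (rule weak_representation)
  from AE_pair[OF this] have "AE p in NQ. \<exists>c. AE s in N. U (p, s) = prim G (p, s) + c"
    by (rule AE_mp) auto
  with AE_good[of G] AE_good[of U] assms show ?thesis
    unfolding weak_def by (auto elim!: AE_mp)
qed

text \<open>The transverse function cancels in differences along a slice, leaving differences of
  \<open>prim G\<close>. Of the three factors \<open>b - a\<close>, one comes from Cauchy-Schwarz
  and two from integrating over s and s'.\<close>

lemma weak_oscillation:
  assumes w: "weak U G"
  shows "(\<integral>\<^sup>+p. \<integral>\<^sup>+s. \<integral>\<^sup>+s'. ennreal ((cmod (U (p, s) - U (p, s')))\<^sup>2) \<partial>N \<partial>N \<partial>NQ)
    \<le> ennreal ((b - a) ^ 3) * (\<integral>\<^sup>+z. ennreal ((cmod (G z))\<^sup>2) \<partial>F)"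
proof -
  have G: "sq G" using w by (auto simp: weak_def)
  have [measurable]: "G \<in> borel_measurable F" using G by (rule sq_measurable)
  have "(\<integral>\<^sup>+p. \<integral>\<^sup>+s. \<integral>\<^sup>+s'. ennreal ((cmod (U (p, s) - U (p, s')))\<^sup>2) \<partial>N \<partial>N \<partial>NQ)
      \<le> (\<integral>\<^sup>+p. ennreal ((b - a) ^ 3) * (\<integral>\<^sup>+s. ennreal ((cmod (G (p, s)))\<^sup>2) \<partial>N) \<partial>NQ)"
  proof (rule nn_integral_mono_AE)
    show "AE p in NQ. (\<integral>\<^sup>+s. \<integral>\<^sup>+s'. ennreal ((cmod (U (p, s) - U (p, s')))\<^sup>2) \<partial>N \<partial>N)
        \<le> ennreal ((b - a) ^ 3) * (\<integral>\<^sup>+s. ennreal ((cmod (G (p, s)))\<^sup>2) \<partial>N)"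
      using AE_slice_representation[OF w]
    proof eventually_elim
      case (elim p)
      then obtain c where g: "good G p" and c: "AE s in N. U (p, s) = prim G (p, s) + c" by blast
      note i = good_integrable[OF g]
      define E where "E = (\<integral>\<sigma>. (cmod (G (p, \<sigma>)))\<^sup>2 \<partial>N)"
      have E0: "E \<ge> 0" by (simp add: E_def)
      have osc: "(cmod (prim G (p, s) - prim G (p, s')))\<^sup>2 \<le> (b - a) * E" for s s'
      proof -
        have int: "integrable N (\<lambda>\<sigma>. indicator {..s} \<sigma> *\<^sub>R G (p, \<sigma>))" for s
          using i by (intro integrable_mult_indicator) simp_all
        have "prim G (p, s) - prim G (p, s') = (\<integral>\<sigma>. indicator {..s} \<sigma> *\<^sub>R G (p, \<sigma>) - indicator {..s'} \<sigma> *\<^sub>R G (p, \<sigma>) \<partial>N)"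
          unfolding prim_def fst_conv snd_conv by (rule Bochner_Integration.integral_diff[symmetric, OF int int])
        also have "cmod \<dots> \<le> (\<integral>\<sigma>. cmod (G (p, \<sigma>)) \<partial>N)"
        proof (rule order_trans[OF integral_norm_bound integral_mono])
          show "integrable N (\<lambda>\<sigma>. cmod (indicator {..s} \<sigma> *\<^sub>R G (p, \<sigma>) - indicator {..s'} \<sigma> *\<^sub>R G (p, \<sigma>)))"
            by (intro integrable_norm Bochner_Integration.integrable_diff int)
        qed (use i in \<open>auto simp: indicator_def\<close>)
        finally have "(cmod (prim G (p, s) - prim G (p, s')))\<^sup>2 \<le> (\<integral>\<sigma>. cmod (G (p, \<sigma>)) \<partial>N)\<^sup>2"
          by (rule power_mono) simp
        then show ?thesis using good_L1_le[OF g] unfolding E_def by linarith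
      qed
      have "(\<integral>\<^sup>+s. \<integral>\<^sup>+s'. ennreal ((cmod (U (p, s) - U (p, s')))\<^sup>2) \<partial>N \<partial>N)
          \<le> (\<integral>\<^sup>+s. \<integral>\<^sup>+s'. ennreal ((b - a) * E) \<partial>N \<partial>N)"
      proof (rule nn_integral_mono_AE)
        show "AE s in N. (\<integral>\<^sup>+s'. ennreal ((cmod (U (p, s) - U (p, s')))\<^sup>2) \<partial>N) \<le> (\<integral>\<^sup>+s'. ennreal ((b - a) * E) \<partial>N)"
          using c
        proof eventually_elim
          case s: (elim s)
          show ?case
          proof (rule nn_integral_mono_AE)
            show "AE s' in N. ennreal ((cmod (U (p, s) - U (p, s')))\<^sup>2) \<le> ennreal ((b - a) * E)"
              using c
            proof eventually_elim
              case (elim s')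
              then show ?case using s osc[of s s'] by (intro ennreal_leI) simp
            qed
          qed
        qed
      qed
      also have "\<dots> = ennreal ((b - a) * E) * ennreal (b - a) * ennreal (b - a)"
        using ab by (simp add: emeasure_Nm mult.assoc)
      also have "\<dots> = ennreal ((b - a) ^ 3) * ennreal E"
        using ab E0 by (simp add: power3_eq_cube mult_ac flip: ennreal_mult)
      also have "ennreal E = (\<integral>\<^sup>+s. ennreal ((cmod (G (p, s)))\<^sup>2) \<partial>N)"
        unfolding E_def using g by (intro nn_integral_eq_integral[symmetric]) (auto simp: good_def)
      finally show ?case .
    qed
  qed
  also have "\<dots> = ennreal ((b - a) ^ 3) * (\<integral>\<^sup>+p. \<integral>\<^sup>+s. ennreal ((cmod (G (p, s)))\<^sup>2) \<partial>N \<partial>NQ)"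
    by (intro nn_integral_cmult) measurable
  also have "(\<integral>\<^sup>+p. \<integral>\<^sup>+s. ennreal ((cmod (G (p, s)))\<^sup>2) \<partial>N \<partial>NQ) = (\<integral>\<^sup>+z. ennreal ((cmod (G z))\<^sup>2) \<partial>F)"
    by (intro N.nn_integral_fst) measurable
  finally show ?thesis .
qed

text \<open>For periodic tests the constant 1 is admissible in the slice direction, and its
  derivative vanishes. The conclusion says that U has no jump across the seam of the circle: this is
  where periodicity of H1 functions is extracted from the definition.\<close>

lemma AE_slice_mean_zero:
  assumes w: "weak U G" and one: "(\<lambda>s. 1) \<in> T"
  shows "AE p in NQ. (\<integral>s. G (p, s) \<partial>N) = 0"
proof -
  have G: "sq G" using w by (auto simp: weak_def)
  define m where "m p = (\<integral>s. G (p, s) \<partial>N)" for p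
  have m: "integrable NQ m" unfolding m_def using integrable_fst'[OF sq_integrable[OF G]] by simp
  have "AE z in F. m (fst z) = 0"
  proof (rule separating)
    show mF: "integrable F (\<lambda>z. m (fst z))" by (rule integrable_lift[OF m])
    fix f \<beta> assume f: "f \<in> T" and \<beta>: "\<beta> \<in> T2"
    have "(\<integral>z. m (fst z) * of_real (\<beta> (fst z) * f (snd z)) \<partial>F)
        = (\<integral>p. m p * of_real (\<beta> p) * of_real (integral\<^sup>L N f) \<partial>NQ)"
      using integral_fst'[OF test_mult[OF f \<beta> mF]] by (simp add: mult.assoc)
    also have "\<dots> = (\<integral>p. (\<integral>s. G (p, s) * of_real (\<beta> p * 1) \<partial>N) \<partial>NQ) * of_real (integral\<^sup>L N f)"
      by (simp add: m_def)
    also have "(\<integral>p. (\<integral>s. G (p, s) * of_real (\<beta> p * 1) \<partial>N) \<partial>NQ) = (\<integral>z. G z * of_real (\<beta> (fst z) * 1) \<partial>F)"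
      using integral_fst'[OF test_mult[OF one \<beta> sq_integrable[OF G]]] by simp
    also have "\<dots> = 0"
      using w one \<beta> unfolding weak_def by (force dest: bspec)
    finally show "(\<integral>z. m (fst z) * of_real (\<beta> (fst z) * f (snd z)) \<partial>F) = 0" by simp
  qed
  from AE_pair[OF this] have "AE p in NQ. AE s in N. m p = 0" by simp
  moreover have "ae_filter N \<noteq> bot" using ab by (simp add: ae_filter_eq_bot_iff emeasure_Nm)
  ultimately show ?thesis
    by (simp add: m_def eventually_const)
qed

lemma prim_slice_measurable:
  assumes "good K p" shows "(\<lambda>s. prim K (p, s)) \<in> borel_measurable borel"
proof -
  have [measurable]: "(\<lambda>\<sigma>. K (p, \<sigma>)) \<in> borel_measurable borel" using assms by (simp add: good_def)
  have "(\<lambda>s. \<integral>\<sigma>. (if \<sigma> \<le> s then K (p, \<sigma>) else 0) \<partial>N) \<in> borel_measurable borel" by measurable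
  also have "(\<lambda>s. \<integral>\<sigma>. (if \<sigma> \<le> s then K (p, \<sigma>) else 0) \<partial>N) = (\<lambda>s. prim K (p, s))"
    by (auto simp: prim_def fun_eq_iff indicator_def intro!: Bochner_Integration.integral_cong)
  finally show ?thesis .
qed

text \<open>Integration by parts for primitives. Exchanging the order leaves the integral of H
  beyond \<sigma>, which is minus its integral up to \<sigma> since the total vanishes; thus no
  boundary term appears.\<close>

lemma prim_skew_slice:
  assumes g: "good G p" and h: "good H p" and 0: "(\<integral>s. H (p, s) \<partial>N) = 0"
  shows "(\<integral>s. prim G (p, s) * cnj (H (p, s)) + G (p, s) * cnj (prim H (p, s)) \<partial>N) = 0"
proof -
  have [measurable]: "(\<lambda>\<sigma>. G (p, \<sigma>)) \<in> borel_measurable borel" "(\<lambda>\<sigma>. H (p, \<sigma>)) \<in> borel_measurable borel"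
    using g h by (auto simp: good_def)
  note ig = good_integrable[OF g] and ih = good_integrable[OF h]
  have prod: "integrable (N \<Otimes>\<^sub>M N) (\<lambda>z. G (p, fst z) * cnj (H (p, snd z)))"
  proof (rule NN.Fubini_integrable)
    show "(\<lambda>z. G (p, fst z) * cnj (H (p, snd z))) \<in> borel_measurable (N \<Otimes>\<^sub>M N)" by measurable
    show "integrable N (\<lambda>x. LINT y|N. norm (G (p, fst (x, y)) * cnj (H (p, snd (x, y)))))"
      using ig by (simp add: norm_mult)
    show "AE x in N. integrable N (\<lambda>y. G (p, fst (x, y)) * cnj (H (p, snd (x, y))))"
      using ih by simp
  qed
  have prod': "integrable (N \<Otimes>\<^sub>M N) (\<lambda>(\<sigma>, s). indicator {..s} \<sigma> *\<^sub>R G (p, \<sigma>) * cnj (H (p, s)))"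
  proof -
    have "integrable (N \<Otimes>\<^sub>M N) (\<lambda>z. (G (p, fst z) * cnj (H (p, snd z))) * (if fst z \<le> snd z then 1 else 0))"
      by (rule integrable_bounded_mult[OF prod, where C = 1]) auto
    also have "(\<lambda>z. (G (p, fst z) * cnj (H (p, snd z))) * (if fst z \<le> snd z then 1 else 0))
        = (\<lambda>(\<sigma>, s). indicator {..s} \<sigma> *\<^sub>R G (p, \<sigma>) * cnj (H (p, s)))"
      by (auto simp: fun_eq_iff indicator_def)
    finally show ?thesis .
  qed
  have "(\<integral>s. prim G (p, s) * cnj (H (p, s)) \<partial>N) = (\<integral>s. (\<integral>\<sigma>. indicator {..s} \<sigma> *\<^sub>R G (p, \<sigma>) * cnj (H (p, s)) \<partial>N) \<partial>N)"
    by (simp only: prim_def fst_conv snd_conv integral_mult_left_zero)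
  also have "\<dots> = (\<integral>\<sigma>. (\<integral>s. indicator {..s} \<sigma> *\<^sub>R G (p, \<sigma>) * cnj (H (p, s)) \<partial>N) \<partial>N)"
    by (rule NN.Fubini_integral[OF prod'])
  also have "\<dots> = (\<integral>\<sigma>. - (G (p, \<sigma>) * cnj (prim H (p, \<sigma>))) \<partial>N)"
  proof (rule Bochner_Integration.integral_cong[OF refl])
    fix \<sigma>
    have int: "integrable N (\<lambda>s. indicator {..\<sigma>} s *\<^sub>R H (p, s))"
      using ih by (intro integrable_mult_indicator) simp_all
    have "(\<integral>s. indicator {..s} \<sigma> *\<^sub>R G (p, \<sigma>) * cnj (H (p, s)) \<partial>N)
        = (\<integral>s. G (p, \<sigma>) * cnj (H (p, s) - indicator {..\<sigma>} s *\<^sub>R H (p, s)) \<partial>N)"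
    proof (rule integral_cong_AE)
      \<comment> \<open>The conditions that s is at least \<sigma> and that s is not below or equal
        to \<sigma> differ at a single point.\<close>
      have "AE s in N. s \<noteq> \<sigma>"
        unfolding AE_Nm using AE_lborel_singleton[of \<sigma>] by (rule AE_mp) auto
      then show "AE s in N. indicator {..s} \<sigma> *\<^sub>R G (p, \<sigma>) * cnj (H (p, s))
          = G (p, \<sigma>) * cnj (H (p, s) - indicator {..\<sigma>} s *\<^sub>R H (p, s))"
        by eventually_elim (auto simp: indicator_def)
      have "(\<lambda>s. indicator {\<sigma>..} s *\<^sub>R G (p, \<sigma>) * cnj (H (p, s))) \<in> borel_measurable borel" by measurable
      also have "(\<lambda>s. indicator {\<sigma>..} s *\<^sub>R G (p, \<sigma>) * cnj (H (p, s)))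
          = (\<lambda>s. indicator {..s} \<sigma> *\<^sub>R G (p, \<sigma>) * cnj (H (p, s)))"
        by (auto simp: fun_eq_iff indicator_def)
      finally show "(\<lambda>s. indicator {..s} \<sigma> *\<^sub>R G (p, \<sigma>) * cnj (H (p, s))) \<in> borel_measurable N" by simp
      have "(\<lambda>s. G (p, \<sigma>) * cnj (H (p, s) - indicator {..\<sigma>} s *\<^sub>R H (p, s))) \<in> borel_measurable borel"
        by measurable
      then show "(\<lambda>s. G (p, \<sigma>) * cnj (H (p, s) - indicator {..\<sigma>} s *\<^sub>R H (p, s))) \<in> borel_measurable N"
        by simp
    qed
    also have "\<dots> = G (p, \<sigma>) * cnj (\<integral>s. H (p, s) - indicator {..\<sigma>} s *\<^sub>R H (p, s) \<partial>N)"
      by (simp only: integral_mult_right_zero Bochner_Integration.integral_cnj)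
    also have "(\<integral>s. H (p, s) - indicator {..\<sigma>} s *\<^sub>R H (p, s) \<partial>N) = - prim H (p, \<sigma>)"
      using ih int 0 by (simp add: prim_def)
    finally show "(\<integral>s. indicator {..s} \<sigma> *\<^sub>R G (p, \<sigma>) * cnj (H (p, s)) \<partial>N) = - (G (p, \<sigma>) * cnj (prim H (p, \<sigma>)))"
      by simp
  qed
  finally have eq: "(\<integral>s. prim G (p, s) * cnj (H (p, s)) \<partial>N) = - (\<integral>\<sigma>. G (p, \<sigma>) * cnj (prim H (p, \<sigma>)) \<partial>N)"
    by simp
  have bound: "\<exists>C. \<forall>s. cmod (prim K (p, s)) \<le> C" if "good K p" for K
    using good_prim_le[OF that] by (metis norm_ge_zero real_le_rsqrt)
  obtain C D where C: "\<And>s. cmod (prim G (p, s)) \<le> C" and D: "\<And>s. cmod (prim H (p, s)) \<le> D"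
    using bound[OF g] bound[OF h] by blast
  have "integrable N (\<lambda>s. cnj (H (p, s)) * prim G (p, s))"
    by (rule integrable_bounded_mult[where C = C]) (use ih prim_slice_measurable[OF g] C in auto)
  moreover have "integrable N (\<lambda>s. G (p, s) * cnj (prim H (p, s)))"
    by (rule integrable_bounded_mult[where C = D]) (use ig prim_slice_measurable[OF h] D in auto)
  ultimately show ?thesis
    using eq by (simp add: mult.commute[of "cnj _"])
qed

text \<open>The weight depends on the transverse variables only and comes out of the slice integral.
  On almost every slice U and V are primitives up to constants.\<close>

lemma weak_skew:
  assumes w: "weak U G" "weak V H" and one: "(\<lambda>s. 1) \<in> T"
    and m: "m \<in> borel_measurable NQ" "\<And>p. cmod (m p) \<le> C"
  shows "(\<integral>z. m (fst z) * (U z * cnj (H z) + G z * cnj (V z)) \<partial>F) = 0"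
proof -
  have sqs: "sq U" "sq G" "sq V" "sq H" using w by (auto simp: weak_def)
  have 1: "integrable F (\<lambda>z. X z * cnj (Y z))" if "sq X" "sq Y" for X Y
    using that unfolding sq_def by (intro integrable_mult_squares) auto
  have "integrable F (\<lambda>z. (U z * cnj (H z) + G z * cnj (V z)) * m (fst z))"
    by (rule integrable_bounded_mult[OF Bochner_Integration.integrable_add[OF 1 1]])
       (use sqs m in auto)
  from integral_fst'[OF this]
  have "(\<integral>z. (U z * cnj (H z) + G z * cnj (V z)) * m (fst z) \<partial>F)
      = (\<integral>p. (\<integral>s. U (p, s) * cnj (H (p, s)) + G (p, s) * cnj (V (p, s)) \<partial>N) * m p \<partial>NQ)"
    by simp
  also have "\<dots> = (\<integral>p. 0 \<partial>NQ)"
  proof (rule integral_cong_AE)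
    have "AE p in NQ. (\<integral>s. U (p, s) * cnj (H (p, s)) + G (p, s) * cnj (V (p, s)) \<partial>N) = 0"
      using AE_slice_representation[OF w(1)] AE_slice_representation[OF w(2)]
        AE_slice_mean_zero[OF w(1) one] AE_slice_mean_zero[OF w(2) one]
    proof eventually_elim
      case (elim p)
      then obtain c d where g: "good G p" "good H p" "good U p" "good V p"
        and c: "AE s in N. U (p, s) = prim G (p, s) + c" and d: "AE s in N. V (p, s) = prim H (p, s) + d"
        and 0: "(\<integral>s. G (p, s) \<partial>N) = 0" "(\<integral>s. H (p, s) \<partial>N) = 0" by blast
      note i = g[THEN good_integrable]
      have i2: "integrable N (\<lambda>s. X (p, s) * cnj (Y (p, s)))" if "good X p" "good Y p" for X Y
        using that unfolding good_def by (intro integrable_mult_squares) auto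
      \<comment> \<open>The constants may be subtracted because G and H have mean zero on the
        slice.\<close>
      have "(\<integral>s. U (p, s) * cnj (H (p, s)) + G (p, s) * cnj (V (p, s)) \<partial>N)
          = (\<integral>s. (U (p, s) - c) * cnj (H (p, s)) + G (p, s) * cnj (V (p, s) - d) \<partial>N)"
        using i i2[OF g(3,2)] i2[OF g(1,4)] 0
        by (simp add: left_diff_distrib right_diff_distrib)
      also have "\<dots> = (\<integral>s. prim G (p, s) * cnj (H (p, s)) + G (p, s) * cnj (prim H (p, s)) \<partial>N)"
      proof (rule integral_cong_AE)
        show "AE s in N. (U (p, s) - c) * cnj (H (p, s)) + G (p, s) * cnj (V (p, s) - d)
            = prim G (p, s) * cnj (H (p, s)) + G (p, s) * cnj (prim H (p, s))"
          using c d by eventually_elim simp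
        have [measurable]: "(\<lambda>s. X (p, s)) \<in> borel_measurable borel" if "good X p" for X
          using that by (simp add: good_def)
        note [measurable] = g prim_slice_measurable[OF g(1)] prim_slice_measurable[OF g(2)]
        have "(\<lambda>s. (U (p, s) - c) * cnj (H (p, s)) + G (p, s) * cnj (V (p, s) - d)) \<in> borel_measurable borel"
          by measurable
        then show "(\<lambda>s. (U (p, s) - c) * cnj (H (p, s)) + G (p, s) * cnj (V (p, s) - d)) \<in> borel_measurable N"
          by simp
        have "(\<lambda>s. prim G (p, s) * cnj (H (p, s)) + G (p, s) * cnj (prim H (p, s))) \<in> borel_measurable borel"
          by measurable
        then show "(\<lambda>s. prim G (p, s) * cnj (H (p, s)) + G (p, s) * cnj (prim H (p, s))) \<in> borel_measurable N"
          by simp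
      qed
      also have "\<dots> = 0" by (rule prim_skew_slice[OF g(1,2) 0(2)])
      finally show ?case .
    qed
    then show "AE p in NQ. (\<integral>s. U (p, s) * cnj (H (p, s)) + G (p, s) * cnj (V (p, s)) \<partial>N) * m p = 0"
      by eventually_elim simp
    show "(\<lambda>p. (\<integral>s. U (p, s) * cnj (H (p, s)) + G (p, s) * cnj (V (p, s)) \<partial>N) * m p) \<in> borel_measurable NQ"
      using sqs[THEN sq_measurable] m(1) by measurable
  qed simp
  finally show ?thesis by (simp add: mult.commute)
qed

end

text \<open>Only \<open>separating\<close> needs an argument: bounded products of tests converge to
  indicators of boxes, so Z has integral zero over every box, and boxes form an intersection-stable
  generator of the sigma-algebra.\<close>

lemma coordinate_product:
  assumes 1: "test_space a1 b1 T1" and 2: "test_space a2 b2 T2" and 3: "test_space a b T"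
  shows "coordinate a b T (Nm a1 b1 \<Otimes>\<^sub>M Nm a2 b2) {\<lambda>p. f (fst p) * g (snd p) | f g. f \<in> T1 \<and> g \<in> T2}"
proof -
  interpret T1: test_space a1 b1 T1 by fact
  interpret T2: test_space a2 b2 T2 by fact
  interpret T3: test_space a b T by fact
  let ?Q = "Nm a1 b1 \<Otimes>\<^sub>M Nm a2 b2"
  let ?F = "?Q \<Otimes>\<^sub>M Nm a b"
  interpret N1: finite_measure "Nm a1 b1" by (rule finite_measure_Nm)
  interpret N2: finite_measure "Nm a2 b2" by (rule finite_measure_Nm)
  interpret N3: finite_measure "Nm a b" by (rule finite_measure_Nm)
  interpret Q: pair_sigma_finite "Nm a1 b1" "Nm a2 b2" ..
  interpret Qf: finite_measure ?Q by (intro finite_measure_pair_measure finite_measure_Nm)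
  interpret F: pair_sigma_finite ?Q "Nm a b" ..
  interpret Ff: finite_measure ?F by (intro finite_measure_pair_measure Qf.finite_measure_axioms finite_measure_Nm)
  show ?thesis
  proof (rule coordinate.intro[OF 3 coordinate_axioms.intro])
    show "finite_measure ?Q" by (rule Qf.finite_measure_axioms)
  next
    fix \<beta> assume "\<beta> \<in> {\<lambda>p. f (fst p) * g (snd p) | f g. f \<in> T1 \<and> g \<in> T2}"
    then obtain f g where \<beta>: "\<beta> = (\<lambda>p. f (fst p) * g (snd p))" "f \<in> T1" "g \<in> T2" by blast
    note [measurable] = Cinf_measurable[OF T1.T_Cinf[OF \<beta>(2)]] Cinf_measurable[OF T2.T_Cinf[OF \<beta>(3)]]
    show "\<beta> \<in> borel_measurable ?Q" unfolding \<beta> by measurable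
    obtain C D where "\<And>x. \<bar>f x\<bar> \<le> C" "\<And>x. \<bar>g x\<bar> \<le> D"
      using T1.T_bounded[OF \<beta>(2)] T2.T_bounded[OF \<beta>(3)] by blast
    then have "\<bar>\<beta> p\<bar> \<le> C * D" for p
      unfolding \<beta> abs_mult by (intro mult_mono) (auto intro: order_trans[OF abs_ge_zero])
    then show "\<exists>C. \<forall>p. \<bar>\<beta> p\<bar> \<le> C" by blast
  next
    fix Z :: "(real \<times> real) \<times> real \<Rightarrow> complex"
    assume Z: "integrable ?F Z"
      and 0: "\<And>f \<beta>. f \<in> T \<Longrightarrow> \<beta> \<in> {\<lambda>p. f (fst p) * g (snd p) | f g. f \<in> T1 \<and> g \<in> T2} \<Longrightarrow>
          (\<integral>z. Z z * of_real (\<beta> (fst z) * f (snd z)) \<partial>?F) = 0"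
    have AE_open: "AE z in ?F. fst (fst z) \<in> {a1<..<b1} \<and> snd (fst z) \<in> {a2<..<b2} \<and> snd z \<in> {a<..<b}"
    proof -
      have o: "AE s in Nm c d. s \<in> {c<..<d}" for c d
      proof -
        have "AE s in lborel. s \<noteq> c \<and> s \<noteq> d" by (simp add: AE_lborel_singleton)
        then show ?thesis unfolding AE_Nm by eventually_elim auto
      qed
      show ?thesis
        using F.AE_fst[OF Q.AE_fst[OF o]] F.AE_fst[OF Q.AE_snd[OF o]] F.AE_snd[OF o]
        by eventually_elim blast
    qed
    have box: "set_lebesgue_integral ?F (({l1<..<u1} \<times> {l2<..<u2}) \<times> {l3<..<u3}) Z = 0" for l1 u1 l2 u2 l3 u3
    proof -
      obtain f1 where f1: "\<And>n::nat. f1 n \<in> T1" "\<And>n x. 0 \<le> f1 n x \<and> f1 n x \<le> 1"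
        "\<And>x. x \<in> {a1<..<b1} \<Longrightarrow> (\<lambda>n. f1 n x) \<longlonglongrightarrow> indicator {l1<..<u1} x"
        using T1.T_approx[of l1 u1] by blast
      obtain f2 where f2: "\<And>n::nat. f2 n \<in> T2" "\<And>n x. 0 \<le> f2 n x \<and> f2 n x \<le> 1"
        "\<And>x. x \<in> {a2<..<b2} \<Longrightarrow> (\<lambda>n. f2 n x) \<longlonglongrightarrow> indicator {l2<..<u2} x"
        using T2.T_approx[of l2 u2] by blast
      obtain f3 where f3: "\<And>n::nat. f3 n \<in> T" "\<And>n x. 0 \<le> f3 n x \<and> f3 n x \<le> 1"
        "\<And>x. x \<in> {a<..<b} \<Longrightarrow> (\<lambda>n. f3 n x) \<longlonglongrightarrow> indicator {l3<..<u3} x"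
        using T3.T_approx[of l3 u3] by blast
      note [measurable] = Cinf_measurable[OF T1.T_Cinf[OF f1(1)]] Cinf_measurable[OF T2.T_Cinf[OF f2(1)]]
        Cinf_measurable[OF T3.T_Cinf[OF f3(1)]] borel_measurable_integrable[OF Z]
      let ?w = "\<lambda>n z. (f1 n (fst (fst z)) * f2 n (snd (fst z))) * f3 n (snd z)"
      let ?B = "({l1<..<u1} \<times> {l2<..<u2}) \<times> {l3<..<u3}"
      have "(\<integral>z. Z z * of_real (?w n z) \<partial>?F) = 0" for n
        using 0[of "f3 n" "\<lambda>p. f1 n (fst p) * f2 n (snd p)"] f1(1) f2(1) f3(1) by blast
      moreover have "(\<lambda>n. \<integral>z. Z z * of_real (?w n z) \<partial>?F) \<longlonglongrightarrow> (\<integral>z. Z z * of_real (indicator ?B z) \<partial>?F)"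
      proof (rule integral_dominated_convergence[where w = "\<lambda>z. norm (Z z)"])
        show "AE z in ?F. (\<lambda>n. Z z * of_real (?w n z)) \<longlonglongrightarrow> Z z * of_real (indicator ?B z)"
          using AE_open
        proof eventually_elim
          case (elim z)
          have "(\<lambda>n. ?w n z) \<longlonglongrightarrow> (indicator {l1<..<u1} (fst (fst z)) * indicator {l2<..<u2} (snd (fst z))) * indicator {l3<..<u3} (snd z)"
            using elim by (intro tendsto_mult f1(3) f2(3) f3(3)) auto
          also have "(indicator {l1<..<u1} (fst (fst z)) * indicator {l2<..<u2} (snd (fst z))) * indicator {l3<..<u3} (snd z)
              = (indicator ?B z :: real)"
            by (cases z, cases "fst z") (simp add: indicator_times)
          finally show ?case by (intro tendsto_mult tendsto_const tendsto_of_real)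
        qed
        have w1: "\<bar>?w n z\<bar> \<le> 1" for n z
          using f1(2)[of n "fst (fst z)"] f2(2)[of n "snd (fst z)"] f3(2)[of n "snd z"]
          by (simp add: abs_mult mult_le_one)
        show "AE z in ?F. norm (Z z * of_real (?w n z)) \<le> norm (Z z)" for n
          using mult_left_mono[OF w1[of n], of "norm (Z _)"] by (intro AE_I2) (simp only: norm_mult norm_of_real mult_1_right norm_ge_zero)
        show "(\<lambda>z. Z z * of_real (indicator ?B z)) \<in> borel_measurable ?F" by measurable
        show "(\<lambda>z. Z z * of_real (?w n z)) \<in> borel_measurable ?F" for n by measurable
        show "integrable ?F (\<lambda>z. norm (Z z))" using Z by simp
      qed
      ultimately have "(\<integral>z. Z z * of_real (indicator ?B z) \<partial>?F) = 0"
        by (simp add: LIMSEQ_const_iff)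
      then show ?thesis
        by (simp add: set_lebesgue_integral_def scaleR_conv_of_real mult.commute)
    qed
    have int: "set_integrable ?F A Z" if "A \<in> sets ?F" for A
      unfolding set_integrable_def using that Z by (rule integrable_mult_indicator)
    \<comment> \<open>The case of complements in the induction over measurable sets needs the
      integral over the whole space.\<close>
    have whole: "set_lebesgue_integral ?F UNIV Z = 0"
    proof -
      have "set_lebesgue_integral ?F UNIV Z = set_lebesgue_integral ?F (({a1<..<b1} \<times> {a2<..<b2}) \<times> {a<..<b}) Z"
        unfolding set_lebesgue_integral_def
        by (rule integral_cong_AE)
           (use AE_open borel_measurable_integrable[OF Z] in \<open>auto elim!: AE_mp simp: indicator_def\<close>)
      then show ?thesis using box by simp
    qed
    let ?G = "range (\<lambda>(l, u). box l u :: ((real \<times> real) \<times> real) set)"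
    have setsF: "sets ?F = sigma_sets UNIV ?G"
    proof -
      have "sets ?F = sets (borel \<Otimes>\<^sub>M borel)"
        by (intro sets_pair_measure_cong) (simp_all add: borel_prod[symmetric] cong: sets_pair_measure_cong)
      also have "\<dots> = sets (borel :: ((real \<times> real) \<times> real) measure)" by (simp only: borel_prod)
      also have "\<dots> = sigma_sets UNIV ?G" unfolding borel_eq_box by simp
      finally show ?thesis .
    qed
    have box_eq: "box l u = ({fst (fst l)<..<fst (fst u)} \<times> {snd (fst l)<..<snd (fst u)}) \<times> {snd l<..<snd u}"
      for l u :: "(real \<times> real) \<times> real"
      by (auto simp: mem_box Basis_prod_def inner_prod_def)
    have sub: "?G \<subseteq> Pow UNIV" by simp
    have stable: "Int_stable ?G"
    proof (rule Int_stableI)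
      fix A B assume "A \<in> ?G" "B \<in> ?G"
      moreover have "\<exists>p q. X = box p q" if "X \<in> ?G" for X
        using that by (elim rangeE) (simp only: split_beta, blast)
      ultimately obtain p q p' q' where "A = box p q" "B = box p' q'" by meson
      then have "A \<inter> B = box ((max (fst (fst p)) (fst (fst p')), max (snd (fst p)) (snd (fst p'))), max (snd p) (snd p'))
           ((min (fst (fst q)) (fst (fst q')), min (snd (fst q)) (snd (fst q'))), min (snd q) (snd q'))"
        by (simp only: box_eq Times_Int_Times Int_greaterThanLessThan fst_conv snd_conv)
      then show "A \<inter> B \<in> ?G" by blast
    qed
    have "set_lebesgue_integral ?F A Z = 0" if "A \<in> sets ?F" for A
      using stable sub that[unfolded setsF]
    proof (induction rule: sigma_sets_induct_disjoint)
      case (basic A)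
      then obtain l u where A: "A = box l u" by auto
      then show ?case using box by (simp add: box_eq)
    next
      case empty
      then show ?case by (simp add: set_lebesgue_integral_def)
    next
      case (compl A)
      then have A: "A \<in> sets ?F" "UNIV - A \<in> sets ?F" using setsF by (auto intro: sigma_sets.intros)
      have "set_lebesgue_integral ?F (A \<union> (UNIV - A)) Z
          = set_lebesgue_integral ?F A Z + set_lebesgue_integral ?F (UNIV - A) Z"
        by (rule set_integral_Un) (use A int in auto)
      then show ?case using compl whole by simp
    next
      case (union A)
      then have A: "\<And>i. A i \<in> sets ?F" using setsF by blast
      have "set_lebesgue_integral ?F (\<Union>i. A i) Z = (\<Sum>i. set_lebesgue_integral ?F (A i) Z)"
        using union(1) A
        by (intro lebesgue_integral_countable_add int) (auto simp: disjoint_family_on_def)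
      then show ?case using union by simp
    qed
    then show "AE z in ?F. Z z = 0"
      by (intro sigma_finite_measure.density_zero[OF finite_measure.axioms(1)[OF Ff.finite_measure_axioms] Z])
  qed
qed

section \<open>Iterated integrals over the slab\<close>

locale box3 =
  fixes a1 b1 a2 b2 a3 b3 :: real
  assumes lt: "a1 < b1" "a2 < b2" "a3 < b3"
begin

abbreviation "N1 \<equiv> Nm a1 b1"
abbreviation "N2 \<equiv> Nm a2 b2"
abbreviation "N3 \<equiv> Nm a3 b3"

definition M :: "(real \<times> real \<times> real) measure" where
  "M = density lborel (indicator ({a1..b1} \<times> {a2..b2} \<times> {a3..b3}))"

sublocale N1: finite_measure N1 by (rule finite_measure_Nm)
sublocale N2: finite_measure N2 by (rule finite_measure_Nm)
sublocale N3: finite_measure N3 by (rule finite_measure_Nm)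
sublocale N12: pair_sigma_finite N1 N2 ..
sublocale N13: pair_sigma_finite N1 N3 ..
sublocale N23: pair_sigma_finite N2 N3 ..
sublocale F12: finite_measure "N1 \<Otimes>\<^sub>M N2" by (intro finite_measure_pair_measure finite_measure_Nm)
sublocale F13: finite_measure "N1 \<Otimes>\<^sub>M N3" by (intro finite_measure_pair_measure finite_measure_Nm)
sublocale F23: finite_measure "N2 \<Otimes>\<^sub>M N3" by (intro finite_measure_pair_measure finite_measure_Nm)
sublocale N1_23: pair_sigma_finite N1 "N2 \<Otimes>\<^sub>M N3" ..
sublocale N23_1: pair_sigma_finite "N2 \<Otimes>\<^sub>M N3" N1 ..

lemma sets_M [measurable_cong, simp]: "sets M = sets borel" and space_M [simp]: "space M = UNIV"
  by (simp_all add: M_def)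

lemma M_pair: "M = N1 \<Otimes>\<^sub>M (N2 \<Otimes>\<^sub>M N3)"
proof -
  have sf: "sigma_finite_measure (Nm a b)" for a b
  proof -
    interpret finite_measure "Nm a b" by (rule finite_measure_Nm)
    show ?thesis ..
  qed
  have ind: "(\<lambda>(x, y). indicator A x * indicator B y :: ennreal) = indicator (A \<times> B)" for A B
    by (auto simp: fun_eq_iff indicator_def)
  have 1: "N2 \<Otimes>\<^sub>M N3 = density lborel (indicator ({a2..b2} \<times> {a3..b3}))"
    unfolding Nm_def
    by (subst pair_measure_density)
       (simp_all add: lborel_prod Nm_def[symmetric] sf ind lborel.sigma_finite_measure_axioms)
  have sf2: "sigma_finite_measure (density lborel (indicator ({a2..b2} \<times> {a3..b3})))"
    unfolding 1[symmetric] ..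
  show ?thesis
    unfolding 1 M_def unfolding Nm_def
    by (subst pair_measure_density)
       (simp_all add: lborel_prod sf2 ind lborel.sigma_finite_measure_axioms borel_closed closed_Times)
qed

sublocale M: finite_measure M
  unfolding M_pair by (intro finite_measure_pair_measure finite_measure_Nm)

lemma borel_measurable_M: "f \<in> borel_measurable M \<longleftrightarrow> f \<in> borel_measurable borel"
  by (rule arg_cong[of _ _ "\<lambda>A. f \<in> A"]) (rule measurable_cong_sets, simp_all)

lemma borel3: "f \<in> borel_measurable borel \<longleftrightarrow> f \<in> borel_measurable (borel \<Otimes>\<^sub>M (borel \<Otimes>\<^sub>M borel))"
  for f :: "real \<times> real \<times> real \<Rightarrow> _"
  by (simp only: borel_prod)

lemma nn_integral_M:
  assumes [measurable]: "h \<in> borel_measurable (borel \<Otimes>\<^sub>M (borel \<Otimes>\<^sub>M borel))"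
  shows "(\<integral>\<^sup>+z. h z \<partial>M) = (\<integral>\<^sup>+x. \<integral>\<^sup>+y. \<integral>\<^sup>+z. h (x, y, z) \<partial>N3 \<partial>N2 \<partial>N1)"
proof -
  have "(\<integral>\<^sup>+z. h z \<partial>M) = (\<integral>\<^sup>+x. \<integral>\<^sup>+p. h (x, p) \<partial>(N2 \<Otimes>\<^sub>M N3) \<partial>N1)"
    unfolding M_pair by (rule sigma_finite_measure.nn_integral_fst[OF pair_sigma_finite.axioms(2)[OF N1_23.pair_sigma_finite_axioms], symmetric]) measurable
  also have "\<dots> = (\<integral>\<^sup>+x. \<integral>\<^sup>+y. \<integral>\<^sup>+z. h (x, y, z) \<partial>N3 \<partial>N2 \<partial>N1)"
    by (intro nn_integral_cong N3.nn_integral_fst[symmetric]) measurable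
  finally show ?thesis .
qed

lemma swap:
  assumes "case_prod h \<in> borel_measurable (borel \<Otimes>\<^sub>M borel)"
  shows "(\<integral>\<^sup>+x. \<integral>\<^sup>+y. h x y \<partial>Nm c d \<partial>Nm a b) = (\<integral>\<^sup>+y. \<integral>\<^sup>+x. h x y \<partial>Nm a b \<partial>Nm c d)"
proof -
  interpret X: finite_measure "Nm a b" by (rule finite_measure_Nm)
  interpret Y: finite_measure "Nm c d" by (rule finite_measure_Nm)
  interpret pair_sigma_finite "Nm a b" "Nm c d" ..
  have [measurable]: "case_prod h \<in> borel_measurable (borel \<Otimes>\<^sub>M borel)" by fact
  have "case_prod h \<in> borel_measurable (Nm a b \<Otimes>\<^sub>M Nm c d)" by measurable
  from Fubini'[OF this] show ?thesis by simp
qed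

text \<open>These three maps undo the rearrangement that brings the coordinate of differentiation to
  the last place, the shape which \<open>coordinate\<close> demands.\<close>

definition \<tau>1 :: "(real \<times> real) \<times> real \<Rightarrow> real \<times> real \<times> real" where "\<tau>1 z = (snd z, fst (fst z), snd (fst z))"
definition \<tau>2 :: "(real \<times> real) \<times> real \<Rightarrow> real \<times> real \<times> real" where "\<tau>2 z = (fst (fst z), snd z, snd (fst z))"
definition \<tau>3 :: "(real \<times> real) \<times> real \<Rightarrow> real \<times> real \<times> real" where "\<tau>3 z = (fst (fst z), snd (fst z), snd z)"

lemma \<tau>_measurable [measurable]:
  "\<tau>1 \<in> borel_measurable ((N2 \<Otimes>\<^sub>M N3) \<Otimes>\<^sub>M N1)" "\<tau>2 \<in> borel_measurable ((N1 \<Otimes>\<^sub>M N3) \<Otimes>\<^sub>M N2)"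
  "\<tau>3 \<in> borel_measurable ((N1 \<Otimes>\<^sub>M N2) \<Otimes>\<^sub>M N3)"
  unfolding \<tau>1_def[abs_def] \<tau>2_def[abs_def] \<tau>3_def[abs_def] by (intro borel_measurable_Pair; measurable)+

lemma nn_integral_\<tau>:
  assumes [measurable]: "h \<in> borel_measurable (borel \<Otimes>\<^sub>M (borel \<Otimes>\<^sub>M borel))"
  shows "(\<integral>\<^sup>+z. h (\<tau>1 z) \<partial>((N2 \<Otimes>\<^sub>M N3) \<Otimes>\<^sub>M N1)) = (\<integral>\<^sup>+z. h z \<partial>M)"
    "(\<integral>\<^sup>+z. h (\<tau>2 z) \<partial>((N1 \<Otimes>\<^sub>M N3) \<Otimes>\<^sub>M N2)) = (\<integral>\<^sup>+z. h z \<partial>M)"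
    "(\<integral>\<^sup>+z. h (\<tau>3 z) \<partial>((N1 \<Otimes>\<^sub>M N2) \<Otimes>\<^sub>M N3)) = (\<integral>\<^sup>+z. h z \<partial>M)"
proof -
  have m1: "(\<lambda>z. h (\<tau>1 z)) \<in> borel_measurable ((N2 \<Otimes>\<^sub>M N3) \<Otimes>\<^sub>M N1)"
    and m2: "(\<lambda>z. h (\<tau>2 z)) \<in> borel_measurable ((N1 \<Otimes>\<^sub>M N3) \<Otimes>\<^sub>M N2)"
    and m3: "(\<lambda>z. h (\<tau>3 z)) \<in> borel_measurable ((N1 \<Otimes>\<^sub>M N2) \<Otimes>\<^sub>M N3)"
    using assms by (auto intro!: measurable_compose[OF \<tau>_measurable(1)] measurable_compose[OF \<tau>_measurable(2)]
        measurable_compose[OF \<tau>_measurable(3)] simp: borel_prod)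
  have n1: "(\<lambda>p. \<integral>\<^sup>+x. h (x, fst p, snd p) \<partial>N1) \<in> borel_measurable (N2 \<Otimes>\<^sub>M N3)"
    using N1.borel_measurable_nn_integral_fst[OF m1] by (simp add: \<tau>1_def)
  have n2: "(\<lambda>p. \<integral>\<^sup>+y. h (fst p, y, snd p) \<partial>N2) \<in> borel_measurable (N1 \<Otimes>\<^sub>M N3)"
    using N2.borel_measurable_nn_integral_fst[OF m2] by (simp add: \<tau>2_def)
  have n3: "(\<lambda>p. \<integral>\<^sup>+z. h (fst p, snd p, z) \<partial>N3) \<in> borel_measurable (N1 \<Otimes>\<^sub>M N2)"
    using N3.borel_measurable_nn_integral_fst[OF m3] by (simp add: \<tau>3_def)
  have "(\<integral>\<^sup>+z. h (\<tau>1 z) \<partial>((N2 \<Otimes>\<^sub>M N3) \<Otimes>\<^sub>M N1)) = (\<integral>\<^sup>+p. \<integral>\<^sup>+x. h (x, fst p, snd p) \<partial>N1 \<partial>(N2 \<Otimes>\<^sub>M N3))"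
    using N1.nn_integral_fst[OF m1] by (simp add: \<tau>1_def)
  also have "\<dots> = (\<integral>\<^sup>+y. \<integral>\<^sup>+z. \<integral>\<^sup>+x. h (x, y, z) \<partial>N1 \<partial>N3 \<partial>N2)"
    using N3.nn_integral_fst[OF n1] by simp
  also have "\<dots> = (\<integral>\<^sup>+y. \<integral>\<^sup>+x. \<integral>\<^sup>+z. h (x, y, z) \<partial>N3 \<partial>N1 \<partial>N2)"
    by (intro nn_integral_cong swap) measurable
  also have "\<dots> = (\<integral>\<^sup>+x. \<integral>\<^sup>+y. \<integral>\<^sup>+z. h (x, y, z) \<partial>N3 \<partial>N2 \<partial>N1)"
    by (intro swap) measurable
  finally show "(\<integral>\<^sup>+z. h (\<tau>1 z) \<partial>((N2 \<Otimes>\<^sub>M N3) \<Otimes>\<^sub>M N1)) = (\<integral>\<^sup>+z. h z \<partial>M)" by (simp add: nn_integral_M)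
  have "(\<integral>\<^sup>+z. h (\<tau>2 z) \<partial>((N1 \<Otimes>\<^sub>M N3) \<Otimes>\<^sub>M N2)) = (\<integral>\<^sup>+p. \<integral>\<^sup>+y. h (fst p, y, snd p) \<partial>N2 \<partial>(N1 \<Otimes>\<^sub>M N3))"
    using N2.nn_integral_fst[OF m2] by (simp add: \<tau>2_def)
  also have "\<dots> = (\<integral>\<^sup>+x. \<integral>\<^sup>+z. \<integral>\<^sup>+y. h (x, y, z) \<partial>N2 \<partial>N3 \<partial>N1)"
    using N3.nn_integral_fst[OF n2] by simp
  also have "\<dots> = (\<integral>\<^sup>+x. \<integral>\<^sup>+y. \<integral>\<^sup>+z. h (x, y, z) \<partial>N3 \<partial>N2 \<partial>N1)"
    by (intro nn_integral_cong swap) measurable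
  finally show "(\<integral>\<^sup>+z. h (\<tau>2 z) \<partial>((N1 \<Otimes>\<^sub>M N3) \<Otimes>\<^sub>M N2)) = (\<integral>\<^sup>+z. h z \<partial>M)" by (simp add: nn_integral_M)
  have "(\<integral>\<^sup>+z. h (\<tau>3 z) \<partial>((N1 \<Otimes>\<^sub>M N2) \<Otimes>\<^sub>M N3)) = (\<integral>\<^sup>+p. \<integral>\<^sup>+z. h (fst p, snd p, z) \<partial>N3 \<partial>(N1 \<Otimes>\<^sub>M N2))"
    using N3.nn_integral_fst[OF m3] by (simp add: \<tau>3_def)
  also have "\<dots> = (\<integral>\<^sup>+x. \<integral>\<^sup>+y. \<integral>\<^sup>+z. h (x, y, z) \<partial>N3 \<partial>N2 \<partial>N1)"
    using N2.nn_integral_fst[OF n3] by simp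
  finally show "(\<integral>\<^sup>+z. h (\<tau>3 z) \<partial>((N1 \<Otimes>\<^sub>M N2) \<Otimes>\<^sub>M N3)) = (\<integral>\<^sup>+z. h z \<partial>M)" by (simp add: nn_integral_M)
qed

lemma distr_eq_M:
  assumes \<tau>: "\<tau> \<in> borel_measurable P"
    and eq: "\<And>h. h \<in> borel_measurable (borel \<Otimes>\<^sub>M (borel \<Otimes>\<^sub>M borel)) \<Longrightarrow> (\<integral>\<^sup>+z. h (\<tau> z) \<partial>P) = (\<integral>\<^sup>+z. h z \<partial>M)"
  shows "distr P borel \<tau> = M"
proof (rule measure_eqI)
  fix A assume "A \<in> sets (distr P borel \<tau>)"
  then have A: "A \<in> sets borel" by simp
  have h: "indicator A \<in> borel_measurable (borel \<Otimes>\<^sub>M (borel \<Otimes>\<^sub>M borel) :: (real \<times> real \<times> real) measure)"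
    using A by (simp add: borel_prod)
  have "emeasure (distr P borel \<tau>) A = (\<integral>\<^sup>+z. indicator A z \<partial>distr P borel \<tau>)" using A by simp
  also have "\<dots> = (\<integral>\<^sup>+z. indicator A (\<tau> z) \<partial>P)" using A \<tau> by (intro nn_integral_distr) auto
  also have "\<dots> = emeasure M A" unfolding eq[OF h] using A by simp
  finally show "emeasure (distr P borel \<tau>) A = emeasure M A" .
qed simp

lemma distr_\<tau>:
  "distr ((N2 \<Otimes>\<^sub>M N3) \<Otimes>\<^sub>M N1) borel \<tau>1 = M" "distr ((N1 \<Otimes>\<^sub>M N3) \<Otimes>\<^sub>M N2) borel \<tau>2 = M"
  "distr ((N1 \<Otimes>\<^sub>M N2) \<Otimes>\<^sub>M N3) borel \<tau>3 = M"
  by (intro distr_eq_M \<tau>_measurable nn_integral_\<tau>; assumption)+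

text \<open>Change one coordinate at a time, going from a point to another one.\<close>

lemma double_integral_le_oscillations:
  fixes u :: "real \<times> real \<times> real \<Rightarrow> complex"
  assumes u: "u \<in> borel_measurable borel"
  shows "(\<integral>\<^sup>+p. \<integral>\<^sup>+q. ennreal ((cmod (u p - u q))\<^sup>2) \<partial>M \<partial>M) \<le>
    3 * (ennreal ((b2 - a2) * (b3 - a3)) *
           (\<integral>\<^sup>+p. \<integral>\<^sup>+s. \<integral>\<^sup>+s'. ennreal ((cmod (u (\<tau>1 (p, s)) - u (\<tau>1 (p, s'))))\<^sup>2) \<partial>N1 \<partial>N1 \<partial>(N2 \<Otimes>\<^sub>M N3))
       + ennreal ((b1 - a1) * (b3 - a3)) *
           (\<integral>\<^sup>+p. \<integral>\<^sup>+s. \<integral>\<^sup>+s'. ennreal ((cmod (u (\<tau>2 (p, s)) - u (\<tau>2 (p, s'))))\<^sup>2) \<partial>N2 \<partial>N2 \<partial>(N1 \<Otimes>\<^sub>M N3))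
       + ennreal ((b1 - a1) * (b2 - a2)) *
           (\<integral>\<^sup>+p. \<integral>\<^sup>+s. \<integral>\<^sup>+s'. ennreal ((cmod (u (\<tau>3 (p, s)) - u (\<tau>3 (p, s'))))\<^sup>2) \<partial>N3 \<partial>N3 \<partial>(N1 \<Otimes>\<^sub>M N2)))"
proof -
  define f where "f p q = ennreal ((cmod (u p - u q))\<^sup>2)" for p q
  have um [measurable]: "u \<in> borel_measurable (borel \<Otimes>\<^sub>M (borel \<Otimes>\<^sub>M borel))"
    using u by (simp add: borel3)
  have fm [measurable]: "(\<lambda>z. f (g z) (h z)) \<in> borel_measurable L"
    if "g \<in> measurable L (borel \<Otimes>\<^sub>M (borel \<Otimes>\<^sub>M borel))" "h \<in> measurable L (borel \<Otimes>\<^sub>M (borel \<Otimes>\<^sub>M borel))" for g h L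
    unfolding f_def using measurable_compose[OF that(1) um] measurable_compose[OF that(2) um] by measurable
  \<comment> \<open>The factor 3 is the cost of squaring a sum of three increments.\<close>
  have tri: "f p q \<le> 3 * (f p r + f r s + f s q)" for p q r s
  proof -
    have "cmod (u p - u q) \<le> cmod (u p - u r) + cmod (u r - u s) + cmod (u s - u q)"
      using norm_triangle_ineq[of "u p - u r + (u r - u s)" "u s - u q"]
        norm_triangle_ineq[of "u p - u r" "u r - u s"] by simp
    then have "(cmod (u p - u q))\<^sup>2 \<le> (cmod (u p - u r) + cmod (u r - u s) + cmod (u s - u q))\<^sup>2"
      by (rule power_mono) simp
    also have "\<dots> \<le> 3 * ((cmod (u p - u r))\<^sup>2 + (cmod (u r - u s))\<^sup>2 + (cmod (u s - u q))\<^sup>2)"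
    proof -
      have "(x + y + z)\<^sup>2 \<le> 3 * (x\<^sup>2 + y\<^sup>2 + z\<^sup>2)" for x y z :: real
      proof -
        have "0 \<le> (x - y)\<^sup>2 + (y - z)\<^sup>2 + (x - z)\<^sup>2" by simp
        then show ?thesis by (simp add: power2_eq_square algebra_simps)
      qed
      then show ?thesis .
    qed
    finally show ?thesis
      unfolding f_def by (simp add: ennreal_leI flip: ennreal_plus ennreal_numeral ennreal_mult)
  qed
  define I6 where "I6 F = (\<integral>\<^sup>+x. \<integral>\<^sup>+y. \<integral>\<^sup>+z. \<integral>\<^sup>+x'. \<integral>\<^sup>+y'. \<integral>\<^sup>+z'. F x y z x' y' z'
      \<partial>N3 \<partial>N2 \<partial>N1 \<partial>N3 \<partial>N2 \<partial>N1)" for F :: "real \<Rightarrow> real \<Rightarrow> real \<Rightarrow> real \<Rightarrow> real \<Rightarrow> real \<Rightarrow> ennreal"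
  have eN: "emeasure (Nm a b) UNIV = ennreal (b - a)" if "a < b" for a b
    using that by (simp add: emeasure_Nm)
  have "f p \<in> borel_measurable (borel \<Otimes>\<^sub>M (borel \<Otimes>\<^sub>M borel))" for p
    using fm[of "\<lambda>z. p" _ "\<lambda>z. z"] by (simp add: space_pair_measure)
  then have "(\<integral>\<^sup>+p. \<integral>\<^sup>+q. f p q \<partial>M \<partial>M) = (\<integral>\<^sup>+p. \<integral>\<^sup>+x'. \<integral>\<^sup>+y'. \<integral>\<^sup>+z'. f p (x', y', z') \<partial>N3 \<partial>N2 \<partial>N1 \<partial>M)"
    by (intro nn_integral_cong nn_integral_M)
  also have "\<dots> = I6 (\<lambda>x y z x' y' z'. f (x, y, z) (x', y', z'))"
    unfolding I6_def by (rule nn_integral_M) measurable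
  also have "\<dots> \<le> I6 (\<lambda>x y z x' y' z'. 3 * (f (x, y, z) (x', y, z) + f (x', y, z) (x', y', z) + f (x', y', z) (x', y', z')))"
    unfolding I6_def by (intro nn_integral_mono tri)
  also have "\<dots> = 3 * (I6 (\<lambda>x y z x' y' z'. f (x, y, z) (x', y, z)) + I6 (\<lambda>x y z x' y' z'. f (x', y, z) (x', y', z))
      + I6 (\<lambda>x y z x' y' z'. f (x', y', z) (x', y', z')))"
    unfolding I6_def by (simp add: nn_integral_add nn_integral_cmult del: nn_integral_const)
  \<comment> \<open>Two of the six variables do not occur in each term; they integrate to the side
    lengths of the box. The remaining integrals are reordered until the two variables of the same
    coordinate are innermost.\<close>
  also have "I6 (\<lambda>x y z x' y' z'. f (x, y, z) (x', y, z))
      = ennreal ((b2 - a2) * (b3 - a3)) * (\<integral>\<^sup>+x. \<integral>\<^sup>+y. \<integral>\<^sup>+z. \<integral>\<^sup>+x'. f (x, y, z) (x', y, z) \<partial>N1 \<partial>N3 \<partial>N2 \<partial>N1)"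
    unfolding I6_def using lt
    by (simp add: eN nn_integral_multc nn_integral_cmult ennreal_mult mult_ac)
  also have "(\<integral>\<^sup>+x. \<integral>\<^sup>+y. \<integral>\<^sup>+z. \<integral>\<^sup>+x'. f (x, y, z) (x', y, z) \<partial>N1 \<partial>N3 \<partial>N2 \<partial>N1)
      = (\<integral>\<^sup>+y. \<integral>\<^sup>+x. \<integral>\<^sup>+z. \<integral>\<^sup>+x'. f (x, y, z) (x', y, z) \<partial>N1 \<partial>N3 \<partial>N1 \<partial>N2)"
    by (intro swap) measurable
  also have "\<dots> = (\<integral>\<^sup>+y. \<integral>\<^sup>+z. \<integral>\<^sup>+x. \<integral>\<^sup>+x'. f (x, y, z) (x', y, z) \<partial>N1 \<partial>N1 \<partial>N3 \<partial>N2)"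
    by (intro nn_integral_cong swap) measurable
  also have "\<dots> = (\<integral>\<^sup>+p. \<integral>\<^sup>+s. \<integral>\<^sup>+s'. f (\<tau>1 (p, s)) (\<tau>1 (p, s')) \<partial>N1 \<partial>N1 \<partial>(N2 \<Otimes>\<^sub>M N3))"
  proof -
    have "(\<lambda>p. \<integral>\<^sup>+s. \<integral>\<^sup>+s'. f (s, fst p, snd p) (s', fst p, snd p) \<partial>N1 \<partial>N1) \<in> borel_measurable (N2 \<Otimes>\<^sub>M N3)"
      by measurable
    from N3.nn_integral_fst[OF this] show ?thesis by (simp add: \<tau>1_def)
  qed
  also have "I6 (\<lambda>x y z x' y' z'. f (x', y, z) (x', y', z))
      = ennreal ((b1 - a1) * (b3 - a3)) * (\<integral>\<^sup>+y. \<integral>\<^sup>+z. \<integral>\<^sup>+x'. \<integral>\<^sup>+y'. f (x', y, z) (x', y', z) \<partial>N2 \<partial>N1 \<partial>N3 \<partial>N2)"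
    unfolding I6_def using lt
    by (simp add: eN nn_integral_multc nn_integral_cmult ennreal_mult mult_ac)
  also have "(\<integral>\<^sup>+y. \<integral>\<^sup>+z. \<integral>\<^sup>+x'. \<integral>\<^sup>+y'. f (x', y, z) (x', y', z) \<partial>N2 \<partial>N1 \<partial>N3 \<partial>N2)
      = (\<integral>\<^sup>+y. \<integral>\<^sup>+x'. \<integral>\<^sup>+z. \<integral>\<^sup>+y'. f (x', y, z) (x', y', z) \<partial>N2 \<partial>N3 \<partial>N1 \<partial>N2)"
    by (intro nn_integral_cong swap) measurable
  also have "\<dots> = (\<integral>\<^sup>+x'. \<integral>\<^sup>+y. \<integral>\<^sup>+z. \<integral>\<^sup>+y'. f (x', y, z) (x', y', z) \<partial>N2 \<partial>N3 \<partial>N2 \<partial>N1)"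
    by (intro swap) measurable
  also have "\<dots> = (\<integral>\<^sup>+x'. \<integral>\<^sup>+z. \<integral>\<^sup>+y. \<integral>\<^sup>+y'. f (x', y, z) (x', y', z) \<partial>N2 \<partial>N2 \<partial>N3 \<partial>N1)"
    by (intro nn_integral_cong swap) measurable
  also have "\<dots> = (\<integral>\<^sup>+p. \<integral>\<^sup>+s. \<integral>\<^sup>+s'. f (\<tau>2 (p, s)) (\<tau>2 (p, s')) \<partial>N2 \<partial>N2 \<partial>(N1 \<Otimes>\<^sub>M N3))"
  proof -
    have "(\<lambda>p. \<integral>\<^sup>+s. \<integral>\<^sup>+s'. f (fst p, s, snd p) (fst p, s', snd p) \<partial>N2 \<partial>N2) \<in> borel_measurable (N1 \<Otimes>\<^sub>M N3)"
      by measurable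
    from N3.nn_integral_fst[OF this] show ?thesis by (simp add: \<tau>2_def)
  qed
  also have "I6 (\<lambda>x y z x' y' z'. f (x', y', z) (x', y', z'))
      = ennreal ((b1 - a1) * (b2 - a2)) * (\<integral>\<^sup>+z. \<integral>\<^sup>+x'. \<integral>\<^sup>+y'. \<integral>\<^sup>+z'. f (x', y', z) (x', y', z') \<partial>N3 \<partial>N2 \<partial>N1 \<partial>N3)"
    unfolding I6_def using lt
    by (simp add: eN nn_integral_multc nn_integral_cmult ennreal_mult mult_ac)
  also have "(\<integral>\<^sup>+z. \<integral>\<^sup>+x'. \<integral>\<^sup>+y'. \<integral>\<^sup>+z'. f (x', y', z) (x', y', z') \<partial>N3 \<partial>N2 \<partial>N1 \<partial>N3)
      = (\<integral>\<^sup>+x'. \<integral>\<^sup>+z. \<integral>\<^sup>+y'. \<integral>\<^sup>+z'. f (x', y', z) (x', y', z') \<partial>N3 \<partial>N2 \<partial>N3 \<partial>N1)"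
    by (intro swap) measurable
  also have "\<dots> = (\<integral>\<^sup>+x'. \<integral>\<^sup>+y'. \<integral>\<^sup>+z. \<integral>\<^sup>+z'. f (x', y', z) (x', y', z') \<partial>N3 \<partial>N3 \<partial>N2 \<partial>N1)"
    by (intro nn_integral_cong swap) measurable
  also have "\<dots> = (\<integral>\<^sup>+p. \<integral>\<^sup>+s. \<integral>\<^sup>+s'. f (\<tau>3 (p, s)) (\<tau>3 (p, s')) \<partial>N3 \<partial>N3 \<partial>(N1 \<Otimes>\<^sub>M N2))"
  proof -
    have "(\<lambda>p. \<integral>\<^sup>+s. \<integral>\<^sup>+s'. f (fst p, snd p, s) (fst p, snd p, s') \<partial>N3 \<partial>N3) \<in> borel_measurable (N1 \<Otimes>\<^sub>M N2)"
      by measurable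
    from N2.nn_integral_fst[OF this] show ?thesis by (simp add: \<tau>3_def)
  qed
  finally show ?thesis unfolding f_def .
qed

end

section \<open>Product test functions\<close>

definition pt :: "(real \<Rightarrow> real) \<Rightarrow> (real \<Rightarrow> real) \<Rightarrow> (real \<Rightarrow> real) \<Rightarrow> cfun" where
  "pt a b c p = complex_of_real (a (fst p) * b (fst (snd p)) * c (snd (snd p)))"

lemma pt_has_derivative:
  assumes "Cinf a" "Cinf b" "Cinf c"
  shows "(pt a b c has_derivative (\<lambda>h. pt (deriv a) b c p * of_real (fst h) + pt a (deriv b) c p * of_real (fst (snd h))
    + pt a b (deriv c) p * of_real (snd (snd h)))) (at p)"
proof -
  note d = assms[THEN Cinf_deriv(1), unfolded has_field_derivative_def]
  have 1: "((\<lambda>p. a (fst p)) has_derivative (\<lambda>h. deriv a (fst p) * fst h)) (at p)"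
    by (rule has_derivative_compose[OF _ d(1), of fst fst]) (intro derivative_intros)
  have 2: "((\<lambda>p. b (fst (snd p))) has_derivative (\<lambda>h. deriv b (fst (snd p)) * fst (snd h))) (at p)"
    by (rule has_derivative_compose[OF _ d(2), of "\<lambda>p. fst (snd p)" "\<lambda>p. fst (snd p)"]) (intro derivative_intros)
  have 3: "((\<lambda>p. c (snd (snd p))) has_derivative (\<lambda>h. deriv c (snd (snd p)) * snd (snd h))) (at p)"
    by (rule has_derivative_compose[OF _ d(3), of "\<lambda>p. snd (snd p)" "\<lambda>p. snd (snd p)"]) (intro derivative_intros)
  have "(pt a b c has_derivative (\<lambda>h. complex_of_real (a (fst p) * b (fst (snd p)) * (deriv c (snd (snd p)) * snd (snd h))
     + (a (fst p) * (deriv b (fst (snd p)) * fst (snd h)) + deriv a (fst p) * fst h * b (fst (snd p))) * c (snd (snd p))))) (at p)"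
    unfolding pt_def[abs_def]
    by (intro has_derivative_of_real has_derivative_mult 1 2 3)
  then show ?thesis
    by (rule has_derivative_eq_rhs) (simp add: pt_def fun_eq_iff algebra_simps)
qed

lemma pt_frechet:
  assumes "Cinf a" "Cinf b" "Cinf c"
  shows "frechet_derivative (pt a b c) (at p) (1, 0, 0) = pt (deriv a) b c p"
    "frechet_derivative (pt a b c) (at p) (0, 1, 0) = pt a (deriv b) c p"
    "frechet_derivative (pt a b c) (at p) (0, 0, 1) = pt a b (deriv c) p"
  by (simp_all add: frechet_derivative_at[OF pt_has_derivative[OF assms], symmetric])

lemma Basis3: "(Basis :: (real \<times> real \<times> real) set) = {(1, 0, 0), (0, 1, 0), (0, 0, 1)}"
  by (auto simp: Basis_prod_def zero_prod_def)

text \<open>Coinduction with the set of all products of three smooth factors, which is closed under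
  partial derivatives.\<close>

lemma pt_smooth: "Cinf a \<Longrightarrow> Cinf b \<Longrightarrow> Cinf c \<Longrightarrow> smooth (pt a b c)"
proof -
  assume "Cinf a" "Cinf b" "Cinf c"
  then have "\<exists>a b c. pt a b c = pt a b c \<and> Cinf a \<and> Cinf b \<and> Cinf c" by blast
  define X where "X f \<longleftrightarrow> (\<exists>a b c. f = pt a b c \<and> Cinf a \<and> Cinf b \<and> Cinf c)" for f
  have "X (pt a b c)" using \<open>Cinf a\<close> \<open>Cinf b\<close> \<open>Cinf c\<close> by (auto simp: X_def)
  then show ?thesis
  proof (rule smooth.coinduct)
    fix f assume "X f"
    then obtain a b c where f: "f = pt a b c" "Cinf a" "Cinf b" "Cinf c" by (auto simp: X_def)
    have d: "f differentiable_on UNIV"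
      using pt_has_derivative[OF f(2-4)] unfolding f(1) differentiable_on_def differentiable_def by blast
    have "\<forall>e\<in>Basis. X (\<lambda>p. frechet_derivative f (at p) e)"
      unfolding Basis3 f(1) using f(2-4) by (simp add: pt_frechet X_def) (metis Cinf_deriv(2))
    then show "\<exists>g. f = g \<and> g differentiable_on UNIV \<and>
        (\<forall>e\<in>Basis. X (\<lambda>p. frechet_derivative g (at p) e) \<or> smooth (\<lambda>p. frechet_derivative g (at p) e))"
      using d by blast
  qed
qed

lemma smooth_of_real:
  assumes "Cinf f" shows "smooth (\<lambda>t::real. complex_of_real (f t))"
proof -
  have d: "((\<lambda>t. complex_of_real (f t)) has_derivative (\<lambda>h. of_real (deriv f t * h))) (at t)" if "Cinf f" for f t
    by (intro has_derivative_of_real Cinf_deriv(1)[OF that, unfolded has_field_derivative_def])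
  define X where "X g \<longleftrightarrow> (\<exists>f. g = (\<lambda>t::real. complex_of_real (f t)) \<and> Cinf f)" for g
  have "X (\<lambda>t. complex_of_real (f t))" using assms by (auto simp: X_def)
  then show ?thesis
  proof (rule smooth.coinduct)
    fix g assume "X g"
    then obtain f where f: "g = (\<lambda>t. complex_of_real (f t))" "Cinf f" by (auto simp: X_def)
    have "frechet_derivative g (at t) 1 = complex_of_real (deriv f t)" for t
      unfolding f(1) by (simp add: frechet_derivative_at[OF d[OF f(2)], symmetric])
    then have "\<forall>e\<in>Basis. X (\<lambda>p. frechet_derivative g (at p) e)"
      using Cinf_deriv(2)[OF f(2)] by (auto simp: X_def)
    moreover have "g differentiable_on UNIV"
      using d[OF f(2)] unfolding f(1) differentiable_on_def differentiable_def by blast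
    ultimately show "\<exists>h. g = h \<and> h differentiable_on UNIV \<and>
        (\<forall>e\<in>Basis. X (\<lambda>p. frechet_derivative h (at p) e) \<or> smooth (\<lambda>p. frechet_derivative h (at p) e))"
      by blast
  qed
qed

lemma smoothD:
  fixes f :: "'a::euclidean_space \<Rightarrow> 'b::real_normed_vector"
  assumes "smooth f"
  shows "(f has_derivative frechet_derivative f (at p)) (at p)" "continuous_on A f"
    "e \<in> Basis \<Longrightarrow> smooth (\<lambda>p. frechet_derivative f (at p) e)"
proof -
  have d: "f differentiable_on UNIV" and e: "\<forall>e\<in>Basis. smooth (\<lambda>p. frechet_derivative f (at p) e)"
    using assms by (auto elim: smooth.cases)
  show "(f has_derivative frechet_derivative f (at p)) (at p)"
    using d by (simp add: differentiable_on_def frechet_derivative_works)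
  show "continuous_on A f"
    using differentiable_imp_continuous_on[OF d] by (rule continuous_on_subset) simp
  show "e \<in> Basis \<Longrightarrow> smooth (\<lambda>p. frechet_derivative f (at p) e)" using e by blast
qed

section \<open>Function spaces on the slab\<close>

locale slab =
  fixes S :: carter_slab
  assumes admissible: "admissible_slab S"
begin

sublocale box3 0 "2 * pi" "r_min S" "r_max S" "x_min S" "x_max S"
  using admissible by unfold_locales (auto simp: admissible_slab_def)

definition Sig :: "(real \<times> real \<times> real) set" where
  "Sig = {0..2 * pi} \<times> {r_min S..r_max S} \<times> {x_min S..x_max S}"

abbreviation "SM \<equiv> Sigma_meas S"

lemma Sigma_meas_eq: "SM = lebesgue_on Sig"
  by (simp add: Sigma_meas_def Omega_def Sig_def)

lemma compact_Sig: "compact Sig"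
  unfolding Sig_def by (intro compact_Times compact_Icc)

lemma Sig_borel [measurable]: "Sig \<in> sets borel"
  by (intro borel_closed compact_imp_closed compact_Sig)

lemma Sig_lebesgue [simp]: "Sig \<in> sets lebesgue"
  using Sig_borel by simp

lemma space_SM [simp]: "space SM = Sig"
  by (simp add: Sigma_meas_eq)

lemma finite_SM: "finite_measure SM"
  unfolding Sigma_meas_eq
  using emeasure_bounded_finite[OF compact_imp_bounded[OF compact_Sig]]
  by (intro finite_measureI) (simp add: emeasure_restrict_space)

sublocale SM: finite_measure SM by (rule finite_SM)

lemma AE_SM: "(AE p in SM. P p) \<longleftrightarrow> (AE p in lebesgue. p \<in> Sig \<longrightarrow> P p)"
  unfolding Sigma_meas_eq by (simp add: AE_restrict_space_iff)

lemma AE_M: "(AE p in M. P p) \<longleftrightarrow> (AE p in lborel. p \<in> Sig \<longrightarrow> P p)"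
proof -
  have "(AE x in M. P x) \<longleftrightarrow> (AE x in lborel. 0 < (indicator Sig x :: ennreal) \<longrightarrow> P x)"
    unfolding M_def Sig_def[symmetric] by (rule AE_density) simp
  also have "(\<lambda>x. 0 < (indicator Sig x :: ennreal)) = (\<lambda>x. x \<in> Sig)"
    by (auto simp: indicator_def)
  finally show ?thesis by (simp only:)
qed

lemma AE_SM_iff_M: "(AE p in SM. P p) \<longleftrightarrow> (AE p in M. P p)"
  by (simp add: AE_SM AE_M AE_completion_iff)

lemma integral_SM:
  fixes f :: "real \<times> real \<times> real \<Rightarrow> 'b::{banach, second_countable_topology}"
  assumes "f \<in> borel_measurable borel"
  shows "integral\<^sup>L SM f = integral\<^sup>L M f"
proof -
  have "integral\<^sup>L SM f = (LINT x|lebesgue. indicator Sig x *\<^sub>R f x)"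
    unfolding Sigma_meas_eq by (simp add: integral_restrict_space)
  also have "\<dots> = (LINT x|lborel. indicator Sig x *\<^sub>R f x)"
    using assms by (intro integral_completion) measurable
  also have "\<dots> = integral\<^sup>L (density lborel (\<lambda>x. ennreal (indicator Sig x))) f"
    using assms by (intro integral_density[symmetric]) auto
  also have "density lborel (\<lambda>x. ennreal (indicator Sig x)) = M"
    unfolding M_def Sig_def[symmetric] by (simp add: ennreal_indicator)
  finally show ?thesis .
qed

lemma integrable_SM:
  fixes f :: "real \<times> real \<times> real \<Rightarrow> 'b::{banach, second_countable_topology}"
  assumes "f \<in> borel_measurable borel"
  shows "integrable SM f \<longleftrightarrow> integrable M f"
proof -
  have "integrable SM f \<longleftrightarrow> integrable lebesgue (\<lambda>x. indicator Sig x *\<^sub>R f x)"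
    unfolding Sigma_meas_eq by (simp add: integrable_restrict_space)
  also have "\<dots> \<longleftrightarrow> integrable lborel (\<lambda>x. indicator Sig x *\<^sub>R f x)"
    using assms by (intro integrable_completion) measurable
  also have "\<dots> \<longleftrightarrow> integrable (density lborel (\<lambda>x. ennreal (indicator Sig x))) f"
    using assms by (intro integrable_density[symmetric]) auto
  also have "density lborel (\<lambda>x. ennreal (indicator Sig x)) = M"
    unfolding M_def Sig_def[symmetric] by (simp add: ennreal_indicator)
  finally show ?thesis .
qed

lemma borel_imp_SM: "f \<in> borel_measurable borel \<Longrightarrow> f \<in> borel_measurable SM"
  unfolding Sigma_meas_eq
  by (rule measurable_restrict_space1[OF measurable_completion]) simp

text \<open>Elements of L2 are Lebesgue measurable, whereas Fubini and the product measures work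
  with Borel functions. Every slice argument therefore begins by passing to such a
  representative.\<close>

lemma ex_borel_rep:
  fixes f :: cfun
  assumes "f \<in> borel_measurable SM"
  shows "\<exists>g\<in>borel_measurable borel. AE p in SM. f p = g p"
proof -
  have m: "(\<lambda>p. indicator Sig p *\<^sub>R f p) \<in> borel_measurable lebesgue"
    using assms unfolding Sigma_meas_eq by (simp add: borel_measurable_restrict_space_iff)
  obtain g where g: "g \<in> borel_measurable lborel" "AE p in lborel. Re (indicator Sig p *\<^sub>R f p) = g p"
    using completion_ex_borel_measurable_real[OF measurable_compose[OF m borel_measurable_Re]] by (rule bexE)
  obtain h where h: "h \<in> borel_measurable lborel" "AE p in lborel. Im (indicator Sig p *\<^sub>R f p) = h p"
    using completion_ex_borel_measurable_real[OF measurable_compose[OF m borel_measurable_Im]] by (rule bexE)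
  show ?thesis
  proof (rule bexI)
    show "AE p in SM. f p = Complex (g p) (h p)"
      unfolding AE_SM_iff_M AE_M using g(2) h(2)
      by eventually_elim (auto simp: complex_eq_iff)
    show "(\<lambda>p. Complex (g p) (h p)) \<in> borel_measurable borel"
      using g(1) h(1) by (simp add: borel_measurable_complex_iff)
  qed
qed

lemma L2_rep:
  assumes "f \<in> L2 S"
  obtains g where "g \<in> borel_measurable borel" "AE p in SM. f p = g p" "integrable M (\<lambda>p. (cmod (g p))\<^sup>2)"
    "(norm_L2 S f)\<^sup>2 = (LINT p|M. (cmod (g p))\<^sup>2)"
proof -
  have fm: "f \<in> borel_measurable SM" and fi: "integrable SM (\<lambda>p. (cmod (f p))\<^sup>2)"
    using assms by (auto simp: L2_def)
  obtain g where g: "g \<in> borel_measurable borel" "AE p in SM. f p = g p"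
    using ex_borel_rep[OF fm] by blast
  note [measurable] = fm g(1) borel_imp_SM[OF g(1)]
  have ae: "AE p in SM. (cmod (f p))\<^sup>2 = (cmod (g p))\<^sup>2" using g(2) by eventually_elim simp
  have "integrable SM (\<lambda>p. (cmod (g p))\<^sup>2)"
    using fi ae by (subst (asm) integrable_cong_AE) auto
  then have 1: "integrable M (\<lambda>p. (cmod (g p))\<^sup>2)" by (subst (asm) integrable_SM) auto
  have "(norm_L2 S f)\<^sup>2 = (LINT p|SM. (cmod (f p))\<^sup>2)" by (simp add: norm_L2_def)
  also have "\<dots> = (LINT p|SM. (cmod (g p))\<^sup>2)" using ae by (intro integral_cong_AE) auto
  also have "\<dots> = (LINT p|M. (cmod (g p))\<^sup>2)" by (intro integral_SM) measurable
  finally show ?thesis using that g 1 by blast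
qed

lemma integral_rep:
  fixes f :: cfun
  assumes "f \<in> borel_measurable SM" "g \<in> borel_measurable borel" "AE p in SM. f p = g p" "h \<in> borel_measurable borel"
  shows "(LINT p|SM. f p * h p) = (LINT p|M. g p * h p)"
proof -
  note [measurable] = assms(1) borel_imp_SM[OF assms(2)] borel_imp_SM[OF assms(4)] assms(2,4)
  have "(LINT p|SM. f p * h p) = (LINT p|SM. g p * h p)"
    using assms(3) by (intro integral_cong_AE) (auto elim!: AE_mp)
  also have "\<dots> = (LINT p|M. g p * h p)" by (intro integral_SM) measurable
  finally show ?thesis .
qed

abbreviation "T1 \<equiv> periodic_tests"
abbreviation "T2 \<equiv> interval_tests (r_min S) (r_max S)"
abbreviation "T3 \<equiv> interval_tests (x_min S) (x_max S)"

lemma test_spaces: "test_space 0 (2 * pi) T1" "test_space (r_min S) (r_max S) T2" "test_space (x_min S) (x_max S) T3"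
  using lt by (auto intro: test_space_periodic test_space_interval)

sublocale C1: coordinate 0 "2 * pi" T1 "N2 \<Otimes>\<^sub>M N3" "{\<lambda>p. f (fst p) * g (snd p) | f g. f \<in> T2 \<and> g \<in> T3}"
  by (intro coordinate_product test_spaces)
sublocale C2: coordinate "r_min S" "r_max S" T2 "N1 \<Otimes>\<^sub>M N3" "{\<lambda>p. f (fst p) * g (snd p) | f g. f \<in> T1 \<and> g \<in> T3}"
  by (intro coordinate_product test_spaces)
sublocale C3: coordinate "x_min S" "x_max S" T3 "N1 \<Otimes>\<^sub>M N2" "{\<lambda>p. f (fst p) * g (snd p) | f g. f \<in> T1 \<and> g \<in> T2}"
  by (intro coordinate_product test_spaces)

lemma pt_test:
  assumes "a \<in> T1" "b \<in> T2" "c \<in> T3" shows "test_function S (pt a b c)"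
proof -
  obtain l u where b: "Cinf b" "r_min S < l" "u < r_max S" "\<And>r. r \<notin> {l..u} \<Longrightarrow> b r = 0"
    using assms(2) by (auto simp: interval_tests_def)
  obtain l' u' where c: "Cinf c" "x_min S < l'" "u' < x_max S" "\<And>x. x \<notin> {l'..u'} \<Longrightarrow> c x = 0"
    using assms(3) by (auto simp: interval_tests_def)
  have "{l..u} \<times> {l'..u'} \<subseteq> {r_min S<..<r_max S} \<times> {x_min S<..<x_max S}" using b c by auto
  then have sub: "{l..u} \<times> {l'..u'} \<subseteq> interior (Omega S)" by (simp add: Omega_def interior_Times)
  have "pt a b c (\<phi>, r, x) = 0" if "(r, x) \<notin> {l..u} \<times> {l'..u'}" for \<phi> r x
  proof -
    have "r \<notin> {l..u} \<or> x \<notin> {l'..u'}" using that by auto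
    then show ?thesis using b(4)[of r] c(4)[of x] by (auto simp: pt_def)
  qed
  moreover have "compact ({l..u} \<times> {l'..u'})" by (intro compact_Times compact_Icc)
  moreover have "smooth (pt a b c)" using assms(1) b(1) c(1) by (intro pt_smooth) (auto simp: periodic_tests_def)
  moreover have "pt a b c (\<phi> + 2 * pi, r, x) = pt a b c (\<phi>, r, x)" for \<phi> r x
    using assms(1) by (simp add: periodic_tests_def pt_def)
  ultimately show ?thesis unfolding test_function_def using sub
    by (intro conjI exI[of _ "{l..u} \<times> {l'..u'}"] allI impI) simp_all
qed

lemma T_Cinf: "a \<in> T1 \<Longrightarrow> Cinf a" "b \<in> T2 \<Longrightarrow> Cinf b" "c \<in> T3 \<Longrightarrow> Cinf c"
  by (auto simp: interval_tests_def periodic_tests_def)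

lemma pt_measurable: "Cinf a \<Longrightarrow> Cinf b \<Longrightarrow> Cinf c \<Longrightarrow> pt a b c \<in> borel_measurable borel"
  by (intro borel_measurable_continuous_onI smoothD(2) pt_smooth)

lemma integral_\<tau>:
  fixes f :: "real \<times> real \<times> real \<Rightarrow> 'b::{banach, second_countable_topology}"
  assumes "f \<in> borel_measurable borel"
  shows "integral\<^sup>L M f = integral\<^sup>L C1.F (\<lambda>z. f (\<tau>1 z))" "integral\<^sup>L M f = integral\<^sup>L C2.F (\<lambda>z. f (\<tau>2 z))"
    "integral\<^sup>L M f = integral\<^sup>L C3.F (\<lambda>z. f (\<tau>3 z))"
proof -
  show "integral\<^sup>L M f = integral\<^sup>L C1.F (\<lambda>z. f (\<tau>1 z))"
    by (rule trans[OF arg_cong[OF distr_\<tau>(1)[symmetric], of "\<lambda>M. integral\<^sup>L M f"] integral_distr[OF \<tau>_measurable(1) assms]])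
  show "integral\<^sup>L M f = integral\<^sup>L C2.F (\<lambda>z. f (\<tau>2 z))"
    by (rule trans[OF arg_cong[OF distr_\<tau>(2)[symmetric], of "\<lambda>M. integral\<^sup>L M f"] integral_distr[OF \<tau>_measurable(2) assms]])
  show "integral\<^sup>L M f = integral\<^sup>L C3.F (\<lambda>z. f (\<tau>3 z))"
    by (rule trans[OF arg_cong[OF distr_\<tau>(3)[symmetric], of "\<lambda>M. integral\<^sup>L M f"] integral_distr[OF \<tau>_measurable(3) assms]])
qed

lemma integrable_\<tau>:
  fixes f :: "real \<times> real \<times> real \<Rightarrow> 'b::{banach, second_countable_topology}"
  assumes "integrable M f"
  shows "integrable C1.F (\<lambda>z. f (\<tau>1 z))" "integrable C2.F (\<lambda>z. f (\<tau>2 z))" "integrable C3.F (\<lambda>z. f (\<tau>3 z))"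
proof -
  note i = iffD2[OF arg_cong[of _ _ "\<lambda>M. integrable M f"] assms]
  show "integrable C1.F (\<lambda>z. f (\<tau>1 z))" by (rule integrable_distr[OF \<tau>_measurable(1) i[OF distr_\<tau>(1)]])
  show "integrable C2.F (\<lambda>z. f (\<tau>2 z))" by (rule integrable_distr[OF \<tau>_measurable(2) i[OF distr_\<tau>(2)]])
  show "integrable C3.F (\<lambda>z. f (\<tau>3 z))" by (rule integrable_distr[OF \<tau>_measurable(3) i[OF distr_\<tau>(3)]])
qed

lemma AE_\<tau>3: "{p. P p} \<in> sets borel \<Longrightarrow> (AE z in C3.F. P (\<tau>3 z)) \<Longrightarrow> AE p in M. P p"
proof -
  assume "{p. P p} \<in> sets borel" "AE z in C3.F. P (\<tau>3 z)"
  then have "AE p in distr C3.F borel \<tau>3. P p" by (simp add: AE_distr_iff)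
  then show "AE p in M. P p" unfolding distr_\<tau>(3)[symmetric] .
qed

text \<open>Products of one-variable tests are test functions and separate; one arrangement of the
  coordinates is enough for this. The lemma makes weak derivatives unique.\<close>

lemma orthogonal_tests_imp_zero:
  assumes z: "z \<in> L2 S" and 0: "\<And>\<theta>. test_function S \<theta> \<Longrightarrow> (LINT p|SM. z p * \<theta> p) = 0"
  shows "ae_eq S z (\<lambda>p. 0)"
proof -
  obtain g where g: "g \<in> borel_measurable borel" "AE p in SM. z p = g p" "integrable M (\<lambda>p. (cmod (g p))\<^sup>2)"
    using z by (rule L2_rep)
  have gi: "integrable M g"
    using g by (intro M.integrable_of_square) (simp_all add: borel_measurable_M)
  have "AE z in C3.F. g (\<tau>3 z) = 0"
  proof (rule C3.separating[OF integrable_\<tau>(3)[OF gi]])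
    fix f \<beta> assume f: "f \<in> T3" and "\<beta> \<in> {\<lambda>p. f (fst p) * g (snd p) | f g. f \<in> T1 \<and> g \<in> T2}"
    then obtain a b where \<beta>: "\<beta> = (\<lambda>p. a (fst p) * b (snd p))" "a \<in> T1" "b \<in> T2" by blast
    have m: "pt a b f \<in> borel_measurable borel" by (intro pt_measurable T_Cinf f \<beta>)
    have "(\<integral>z. g (\<tau>3 z) * of_real (\<beta> (fst z) * f (snd z)) \<partial>C3.F) = (\<integral>z. g (\<tau>3 z) * pt a b f (\<tau>3 z) \<partial>C3.F)"
      by (simp add: \<beta>(1) pt_def \<tau>3_def)
    also have "\<dots> = (LINT p|M. g p * pt a b f p)"
      using g(1) m by (intro integral_\<tau>(3)[symmetric]) measurable
    also have "\<dots> = (LINT p|SM. z p * pt a b f p)"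
      using z by (intro integral_rep[symmetric] g m) (simp add: L2_def)
    also have "\<dots> = 0" by (intro 0 pt_test f \<beta>)
    finally show "(\<integral>z. g (\<tau>3 z) * of_real (\<beta> (fst z) * f (snd z)) \<partial>C3.F) = 0" .
  qed
  then have "AE p in M. g p = 0" using g(1) by (intro AE_\<tau>3) measurable
  then show ?thesis unfolding ae_eq_def AE_SM_iff_M[symmetric] using g(2) by eventually_elim simp
qed

lemma pt_\<tau>:
  "pt f b c (\<tau>1 z) = of_real ((b (fst (fst z)) * c (snd (fst z))) * f (snd z))"
  "pt b f c (\<tau>2 z) = of_real ((b (fst (fst z)) * c (snd (fst z))) * f (snd z))"
  "pt b c f (\<tau>3 z) = of_real ((b (fst (fst z)) * c (snd (fst z))) * f (snd z))"
  by (simp_all add: pt_def \<tau>1_def \<tau>2_def \<tau>3_def mult_ac)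

lemma sq_\<tau>:
  assumes "f \<in> borel_measurable borel" "integrable M (\<lambda>p. (cmod (f p))\<^sup>2)"
  shows "C1.sq (\<lambda>z. f (\<tau>1 z))" "C2.sq (\<lambda>z. f (\<tau>2 z))" "C3.sq (\<lambda>z. f (\<tau>3 z))"
  unfolding C1.sq_def C2.sq_def C3.sq_def
  by (intro conjI integrable_\<tau>(1)[OF assms(2)] measurable_compose[OF \<tau>_measurable(1) assms(1)])
    (intro conjI integrable_\<tau>(2)[OF assms(2)] measurable_compose[OF \<tau>_measurable(2) assms(1)]
      integrable_\<tau>(3)[OF assms(2)] measurable_compose[OF \<tau>_measurable(3) assms(1)])+

text \<open>Specialising the test functions to products reduces a weak derivative on the slab to the
  slice notion of \<open>coordinate\<close>, once the chosen coordinate has been moved to the last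
  place.\<close>

lemma weak_rep:
  assumes u: "u \<in> L2 S" "u' \<in> borel_measurable borel" "AE p in SM. u p = u' p" "integrable M (\<lambda>p. (cmod (u' p))\<^sup>2)"
    and g: "g \<in> L2 S" "g' \<in> borel_measurable borel" "AE p in SM. g p = g' p" "integrable M (\<lambda>p. (cmod (g' p))\<^sup>2)"
  shows "is_weak_deriv S (1, 0, 0) u g \<Longrightarrow> C1.weak (\<lambda>z. u' (\<tau>1 z)) (\<lambda>z. g' (\<tau>1 z))"
    "is_weak_deriv S (0, 1, 0) u g \<Longrightarrow> C2.weak (\<lambda>z. u' (\<tau>2 z)) (\<lambda>z. g' (\<tau>2 z))"
    "is_weak_deriv S (0, 0, 1) u g \<Longrightarrow> C3.weak (\<lambda>z. u' (\<tau>3 z)) (\<lambda>z. g' (\<tau>3 z))"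
proof -
  have um: "u \<in> borel_measurable SM" "g \<in> borel_measurable SM" using u g by (auto simp: L2_def)
  have main: "(LINT p|M. u' p * frechet_derivative (pt a b c) (at p) e) = - (LINT p|M. g' p * pt a b c p)"
    if w: "is_weak_deriv S e u g" and t: "a \<in> T1" "b \<in> T2" "c \<in> T3"
      and m: "(\<lambda>p. frechet_derivative (pt a b c) (at p) e) \<in> borel_measurable borel" for a b c e
    using w[unfolded is_weak_deriv_def, rule_format, OF pt_test[OF t]]
      integral_rep[OF um(1) u(2,3) m] integral_rep[OF um(2) g(2,3) pt_measurable[OF T_Cinf(1)[OF t(1)] T_Cinf(2)[OF t(2)] T_Cinf(3)[OF t(3)]]]
    by simp
  { assume w: "is_weak_deriv S (1, 0, 0) u g"
    show "C1.weak (\<lambda>z. u' (\<tau>1 z)) (\<lambda>z. g' (\<tau>1 z))"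
      unfolding C1.weak_def
    proof (intro conjI ballI sq_\<tau>(1)[OF u(2,4)] sq_\<tau>(1)[OF g(2,4)])
      fix f \<beta> assume f: "f \<in> T1" and "\<beta> \<in> {\<lambda>p. f (fst p) * g (snd p) | f g. f \<in> T2 \<and> g \<in> T3}"
      then obtain b c where \<beta>: "\<beta> = (\<lambda>p. b (fst p) * c (snd p))" "b \<in> T2" "c \<in> T3" by blast
      note Ci = T_Cinf(1)[OF f] T_Cinf(2)[OF \<beta>(2)] T_Cinf(3)[OF \<beta>(3)]
      note pm = pt_measurable[OF Ci] pt_measurable[OF Cinf_deriv(2)[OF Ci(1)] Ci(2,3)]
      have "(LINT p|M. u' p * pt (deriv f) b c p) = - (LINT p|M. g' p * pt f b c p)"
        using main[OF w f \<beta>(2,3)] pm by (simp add: pt_frechet Ci)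
      then show "(\<integral>z. u' (\<tau>1 z) * of_real (\<beta> (fst z) * deriv f (snd z)) \<partial>C1.F) = - (\<integral>z. g' (\<tau>1 z) * of_real (\<beta> (fst z) * f (snd z)) \<partial>C1.F)"
        using integral_\<tau>(1)[OF borel_measurable_times[OF u(2) pm(2)]] integral_\<tau>(1)[OF borel_measurable_times[OF g(2) pm(1)]]
        by (simp only: \<beta>(1) pt_\<tau>)
    qed }
  { assume w: "is_weak_deriv S (0, 1, 0) u g"
    show "C2.weak (\<lambda>z. u' (\<tau>2 z)) (\<lambda>z. g' (\<tau>2 z))"
      unfolding C2.weak_def
    proof (intro conjI ballI sq_\<tau>(2)[OF u(2,4)] sq_\<tau>(2)[OF g(2,4)])
      fix f \<beta> assume f: "f \<in> T2" and "\<beta> \<in> {\<lambda>p. f (fst p) * g (snd p) | f g. f \<in> T1 \<and> g \<in> T3}"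
      then obtain b c where \<beta>: "\<beta> = (\<lambda>p. b (fst p) * c (snd p))" "b \<in> T1" "c \<in> T3" by blast
      note Ci = T_Cinf(1)[OF \<beta>(2)] T_Cinf(2)[OF f] T_Cinf(3)[OF \<beta>(3)]
      note pm = pt_measurable[OF Ci] pt_measurable[OF Ci(1) Cinf_deriv(2)[OF Ci(2)] Ci(3)]
      have "(LINT p|M. u' p * pt b (deriv f) c p) = - (LINT p|M. g' p * pt b f c p)"
        using main[OF w \<beta>(2) f \<beta>(3)] pm by (simp add: pt_frechet Ci)
      then show "(\<integral>z. u' (\<tau>2 z) * of_real (\<beta> (fst z) * deriv f (snd z)) \<partial>C2.F) = - (\<integral>z. g' (\<tau>2 z) * of_real (\<beta> (fst z) * f (snd z)) \<partial>C2.F)"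
        using integral_\<tau>(2)[OF borel_measurable_times[OF u(2) pm(2)]] integral_\<tau>(2)[OF borel_measurable_times[OF g(2) pm(1)]]
        by (simp only: \<beta>(1) pt_\<tau>)
    qed }
  { assume w: "is_weak_deriv S (0, 0, 1) u g"
    show "C3.weak (\<lambda>z. u' (\<tau>3 z)) (\<lambda>z. g' (\<tau>3 z))"
      unfolding C3.weak_def
    proof (intro conjI ballI sq_\<tau>(3)[OF u(2,4)] sq_\<tau>(3)[OF g(2,4)])
      fix f \<beta> assume f: "f \<in> T3" and "\<beta> \<in> {\<lambda>p. f (fst p) * g (snd p) | f g. f \<in> T1 \<and> g \<in> T2}"
      then obtain b c where \<beta>: "\<beta> = (\<lambda>p. b (fst p) * c (snd p))" "b \<in> T1" "c \<in> T2" by blast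
      note Ci = T_Cinf(1)[OF \<beta>(2)] T_Cinf(2)[OF \<beta>(3)] T_Cinf(3)[OF f]
      note pm = pt_measurable[OF Ci] pt_measurable[OF Ci(1,2) Cinf_deriv(2)[OF Ci(3)]]
      have "(LINT p|M. u' p * pt b c (deriv f) p) = - (LINT p|M. g' p * pt b c f p)"
        using main[OF w \<beta>(2,3) f] pm by (simp add: pt_frechet Ci)
      then show "(\<integral>z. u' (\<tau>3 z) * of_real (\<beta> (fst z) * deriv f (snd z)) \<partial>C3.F) = - (\<integral>z. g' (\<tau>3 z) * of_real (\<beta> (fst z) * f (snd z)) \<partial>C3.F)"
        using integral_\<tau>(3)[OF borel_measurable_times[OF u(2) pm(2)]] integral_\<tau>(3)[OF borel_measurable_times[OF g(2) pm(1)]]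
        by (simp only: \<beta>(1) pt_\<tau>)
    qed }
qed

end

context slab begin

section \<open>Coefficients\<close>

text \<open>The coefficients are only controlled on the slab, so they are replaced by 1 elsewhere.\<close>

definition extq :: "(real \<Rightarrow> real \<Rightarrow> real) \<Rightarrow> real \<times> real \<Rightarrow> real" where
  "extq k q = (if q \<in> Omega S then k (fst q) (snd q) else 1)"

definition ext :: "(real \<Rightarrow> real \<Rightarrow> real) \<Rightarrow> real \<times> real \<times> real \<Rightarrow> real" where
  "ext k p = extq k (snd p)"

abbreviation coef_cont :: "(real \<Rightarrow> real \<Rightarrow> real) \<Rightarrow> bool" where
  "coef_cont k \<equiv> continuous_on (Omega S) (\<lambda>(r, x). k r x)"

lemma Sig_iff: "(\<phi>, r, x) \<in> Sig \<longleftrightarrow> \<phi> \<in> {0..2 * pi} \<and> (r, x) \<in> Omega S"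
  by (auto simp: Sig_def Omega_def)

lemma compact_Omega: "compact (Omega S)" and Omega_ne: "Omega S \<noteq> {}"
  using lt by (auto simp: Omega_def intro!: compact_Times)

lemma pos:
  assumes "(r, x) \<in> Omega S"
  shows "rho2 S r x > 0" "Delta_r S r > 0" "Delta_x S x > 0" "coef_A S r x > 0" "coef_Phi S r x > 0"
  using admissible assms unfolding admissible_slab_def by auto

lemma coef_continuous:
  "coef_cont (coef_A S)" "coef_cont (coef_B S)" "coef_cont (coef_Phi S)"
  "coef_cont (\<lambda>r x. Delta_r S r)" "coef_cont (\<lambda>r x. Delta_x S x)"
proof -
  have d: "continuous_on (Omega S) (\<lambda>p. Delta_r S (fst p))" "continuous_on (Omega S) (\<lambda>p. Delta_x S (snd p))"
    unfolding Delta_r_def Delta_x_def by (intro continuous_intros)+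
  have nz: "\<forall>p\<in>Omega S. Delta_r S (fst p) \<noteq> 0" "\<forall>p\<in>Omega S. Delta_x S (snd p) \<noteq> 0"
    using pos by force+
  have "continuous_on (Omega S) (\<lambda>p. ((fst p)\<^sup>2 + (cs_a S)\<^sup>2)\<^sup>2 / Delta_r S (fst p)
      - (cs_a S)\<^sup>2 * (1 - (snd p)\<^sup>2)\<^sup>2 / Delta_x S (snd p))"
    by (intro continuous_intros d nz)
  then show "coef_cont (coef_A S)"
    by (rule continuous_on_cong[THEN iffD1, OF refl, rotated]) (auto simp: coef_explicit pos)
  have "continuous_on (Omega S) (\<lambda>p. - cs_a S * ((fst p)\<^sup>2 + (cs_a S)\<^sup>2) / Delta_r S (fst p)
      + cs_a S * (1 - (snd p)\<^sup>2) / Delta_x S (snd p))"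
    by (intro continuous_intros d nz)
  then show "coef_cont (coef_B S)"
    by (rule continuous_on_cong[THEN iffD1, OF refl, rotated]) (auto simp: coef_explicit pos)
  have "continuous_on (Omega S) (\<lambda>p. 1 / Delta_x S (snd p) - (cs_a S)\<^sup>2 / Delta_r S (fst p))"
    by (intro continuous_intros d nz)
  then show "coef_cont (coef_Phi S)"
    by (rule continuous_on_cong[THEN iffD1, OF refl, rotated]) (auto simp: coef_explicit pos)
  show "coef_cont (\<lambda>r x. Delta_r S r)" "coef_cont (\<lambda>r x. Delta_x S x)"
    using d by (simp_all add: split_beta)
qed

lemma extq_measurable: "coef_cont k \<Longrightarrow> extq k \<in> borel_measurable borel"
proof -
  assume k: "coef_cont k"
  have "(\<lambda>q. if q \<in> Omega S then (case q of (r, x) \<Rightarrow> k r x) else 1) \<in> borel_measurable borel"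
    using compact_Omega by (intro borel_measurable_continuous_on_if k continuous_on_const) (simp add: compact_imp_closed)
  also have "(\<lambda>q. if q \<in> Omega S then (case q of (r, x) \<Rightarrow> k r x) else 1) = extq k"
    by (auto simp: fun_eq_iff extq_def split_beta)
  finally show ?thesis .
qed

lemma ext_measurable [measurable]: "coef_cont k \<Longrightarrow> ext k \<in> borel_measurable borel"
  unfolding ext_def[abs_def] by (rule measurable_compose[OF _ extq_measurable])
    (intro borel_measurable_continuous_onI continuous_intros)

text \<open>On the compact slab the extrema are attained. Pointwise positivity of a coefficient thus
  passes to its infimum.\<close>

lemma coef_range:
  assumes "coef_cont k"
  shows "\<exists>q\<in>Omega S. (INF (r, x) \<in> Omega S. k r x) = k (fst q) (snd q)"
    "\<exists>q\<in>Omega S. (SUP (r, x) \<in> Omega S. k r x) = k (fst q) (snd q)"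
    "(r, x) \<in> Omega S \<Longrightarrow> (INF (r, x) \<in> Omega S. k r x) \<le> k r x"
    "(r, x) \<in> Omega S \<Longrightarrow> k r x \<le> (SUP (r, x) \<in> Omega S. k r x)"
proof -
  let ?k = "\<lambda>(r, x). k r x"
  obtain p where p: "p \<in> Omega S" "\<And>q. q \<in> Omega S \<Longrightarrow> ?k p \<le> ?k q"
    using continuous_attains_inf[OF compact_Omega Omega_ne assms] by blast
  obtain P where P: "P \<in> Omega S" "\<And>q. q \<in> Omega S \<Longrightarrow> ?k q \<le> ?k P"
    using continuous_attains_sup[OF compact_Omega Omega_ne assms] by blast
  have i: "(INF q \<in> Omega S. ?k q) = ?k p" by (rule cInf_eq_minimum) (use p in auto)
  have s: "(SUP q \<in> Omega S. ?k q) = ?k P" by (rule cSup_eq_maximum) (use P in auto)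
  show "\<exists>q\<in>Omega S. (INF (r, x) \<in> Omega S. k r x) = k (fst q) (snd q)"
    using p(1) i by (intro bexI[of _ p]) (simp add: split_beta)
  show "\<exists>q\<in>Omega S. (SUP (r, x) \<in> Omega S. k r x) = k (fst q) (snd q)"
    using P(1) s by (intro bexI[of _ P]) (simp add: split_beta)
  show "(INF (r, x) \<in> Omega S. k r x) \<le> k r x" if "(r, x) \<in> Omega S"
    using p(2)[OF that] unfolding i by simp
  show "k r x \<le> (SUP (r, x) \<in> Omega S. k r x)" if "(r, x) \<in> Omega S"
    using P(2)[OF that] unfolding s by simp
qed

lemma ext_bounded: "coef_cont k \<Longrightarrow> \<exists>C>0. \<forall>q. \<bar>extq k q\<bar> \<le> C"
proof -
  assume k: "coef_cont k"
  define C where "C = max 1 (max \<bar>INF (r, x) \<in> Omega S. k r x\<bar> \<bar>SUP (r, x) \<in> Omega S. k r x\<bar>)"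
  have "\<bar>extq k q\<bar> \<le> C" for q
  proof (cases "q \<in> Omega S")
    case True
    then show ?thesis using coef_range(3,4)[OF k, of "fst q" "snd q"]
      by (simp add: extq_def C_def abs_le_iff le_max_iff_disj) linarith
  qed (simp add: extq_def C_def)
  then show ?thesis by (intro exI[of _ C]) (simp add: C_def)
qed

lemma ext_pos: "coef_cont k \<Longrightarrow> (\<And>r x. (r, x) \<in> Omega S \<Longrightarrow> k r x > 0) \<Longrightarrow> \<exists>c>0. \<forall>q. c \<le> extq k q"
proof -
  assume k: "coef_cont k" and p: "\<And>r x. (r, x) \<in> Omega S \<Longrightarrow> k r x > 0"
  obtain q where "q \<in> Omega S" "(INF (r, x) \<in> Omega S. k r x) = k (fst q) (snd q)"
    using coef_range(1)[OF k] by blast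
  then have 0: "(INF (r, x) \<in> Omega S. k r x) > 0" using p[of "fst q" "snd q"] by simp
  have "min 1 (INF (r, x) \<in> Omega S. k r x) \<le> extq k q" for q
    using coef_range(3)[OF k, of "fst q" "snd q"] by (auto simp: extq_def intro: min.coboundedI2)
  then show ?thesis using 0 by (intro exI[of _ "min 1 (INF (r, x) \<in> Omega S. k r x)"]) simp
qed

lemma integral_A_ext: "integral_A S f = (LINT p|SM. f p * complex_of_real (ext (coef_A S) p))"
  unfolding integral_A_def
  by (intro Bochner_Integration.integral_cong) (auto simp: ext_def extq_def Sig_iff)

section \<open>Weak derivatives, Poincare inequality and skewness\<close>

lemma H1_weak_deriv:
  assumes "u \<in> H1 S" "e \<in> Basis"
  shows "weak_deriv S e u \<in> L2 S" "is_weak_deriv S e u (weak_deriv S e u)"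
proof -
  have "\<exists>g. g \<in> L2 S \<and> is_weak_deriv S e u g" using assms by (auto simp: H1_def)
  from someI_ex[OF this] show "weak_deriv S e u \<in> L2 S" "is_weak_deriv S e u (weak_deriv S e u)"
    by (simp_all add: weak_deriv_def)
qed

lemma basis_mem: "(1, 0, 0) \<in> (Basis :: (real \<times> real \<times> real) set)" "(0, 1, 0) \<in> (Basis :: (real \<times> real \<times> real) set)"
  "(0, 0, 1) \<in> (Basis :: (real \<times> real \<times> real) set)"
  by (simp_all add: Basis3)

lemma H1_L2: "u \<in> H1 S \<Longrightarrow> u \<in> L2 S" by (simp add: H1_def)

lemmas D_L2 = H1_weak_deriv(1)[OF _ basis_mem(1)] H1_weak_deriv(1)[OF _ basis_mem(2)] H1_weak_deriv(1)[OF _ basis_mem(3)]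
lemmas D_weak = H1_weak_deriv(2)[OF _ basis_mem(1)] H1_weak_deriv(2)[OF _ basis_mem(2)] H1_weak_deriv(2)[OF _ basis_mem(3)]

lemma oscillation_bound:
  "\<exists>C\<ge>0. \<forall>u\<in>H1 S. \<forall>u'. u' \<in> borel_measurable borel \<longrightarrow> (AE p in SM. u p = u' p) \<longrightarrow> integrable M (\<lambda>p. (cmod (u' p))\<^sup>2) \<longrightarrow>
     (\<integral>\<^sup>+p. \<integral>\<^sup>+q. ennreal ((cmod (u' p - u' q))\<^sup>2) \<partial>M \<partial>M)
       \<le> ennreal (C * ((norm_L2 S (D_phi S u))\<^sup>2 + (norm_L2 S (D_r S u))\<^sup>2 + (norm_L2 S (D_x S u))\<^sup>2))"
proof -
  define l1 l2 l3 where "l1 = 2 * pi - 0" and "l2 = r_max S - r_min S" and "l3 = x_max S - x_min S"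
  have l: "l1 > 0" "l2 > 0" "l3 > 0" using lt by (auto simp: l1_def l2_def l3_def)
  \<comment> \<open>Each constant multiplies the lengths of the two other sides, from the idle
    integrations, by the cube of the own side, from the slice estimate.\<close>
  define c1 c2 c3 where "c1 = l2 * l3 * l1 ^ 3" and "c2 = l1 * l3 * l2 ^ 3" and "c3 = l1 * l2 * l3 ^ 3"
  have c: "c1 > 0" "c2 > 0" "c3 > 0" using l by (auto simp: c1_def c2_def c3_def)
  have "(\<integral>\<^sup>+p. \<integral>\<^sup>+q. ennreal ((cmod (u' p - u' q))\<^sup>2) \<partial>M \<partial>M)
       \<le> ennreal (3 * (c1 + c2 + c3) * ((norm_L2 S (D_phi S u))\<^sup>2 + (norm_L2 S (D_r S u))\<^sup>2 + (norm_L2 S (D_x S u))\<^sup>2))"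
    if u: "u \<in> H1 S" "u' \<in> borel_measurable borel" "AE p in SM. u p = u' p" "integrable M (\<lambda>p. (cmod (u' p))\<^sup>2)" for u u'
  proof -
    note w = weak_rep[OF H1_L2[OF u(1)] u(2-4)]
    obtain g1 where g1: "g1 \<in> borel_measurable borel" "AE p in SM. D_phi S u p = g1 p" "integrable M (\<lambda>p. (cmod (g1 p))\<^sup>2)"
      "(norm_L2 S (D_phi S u))\<^sup>2 = (LINT p|M. (cmod (g1 p))\<^sup>2)" using L2_rep[OF D_L2(1)[OF u(1)]] .
    obtain g2 where g2: "g2 \<in> borel_measurable borel" "AE p in SM. D_r S u p = g2 p" "integrable M (\<lambda>p. (cmod (g2 p))\<^sup>2)"
      "(norm_L2 S (D_r S u))\<^sup>2 = (LINT p|M. (cmod (g2 p))\<^sup>2)" using L2_rep[OF D_L2(2)[OF u(1)]] .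
    obtain g3 where g3: "g3 \<in> borel_measurable borel" "AE p in SM. D_x S u p = g3 p" "integrable M (\<lambda>p. (cmod (g3 p))\<^sup>2)"
      "(norm_L2 S (D_x S u))\<^sup>2 = (LINT p|M. (cmod (g3 p))\<^sup>2)" using L2_rep[OF D_L2(3)[OF u(1)]] .
    have nn: "(\<integral>\<^sup>+p. ennreal ((cmod (g p))\<^sup>2) \<partial>M) = ennreal (LINT p|M. (cmod (g p))\<^sup>2)"
      if "integrable M (\<lambda>p. (cmod (g p))\<^sup>2)" for g :: cfun
      using that by (rule nn_integral_eq_integral) simp
    have hm: "(\<lambda>p. ennreal ((cmod (g p))\<^sup>2)) \<in> borel_measurable (borel \<Otimes>\<^sub>M (borel \<Otimes>\<^sub>M borel))"
      if "g \<in> borel_measurable borel" for g :: cfun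
      using that unfolding borel_prod by measurable
    have o1: "(\<integral>\<^sup>+p. \<integral>\<^sup>+s. \<integral>\<^sup>+s'. ennreal ((cmod (u' (\<tau>1 (p, s)) - u' (\<tau>1 (p, s'))))\<^sup>2) \<partial>N1 \<partial>N1 \<partial>(N2 \<Otimes>\<^sub>M N3))
        \<le> ennreal (l1 ^ 3) * ennreal ((norm_L2 S (D_phi S u))\<^sup>2)"
      using C1.weak_oscillation[OF w(1)[OF D_L2(1)[OF u(1)] g1(1-3) D_weak(1)[OF u(1)]]]
      unfolding nn_integral_\<tau>(1)[OF hm[OF g1(1)]] nn[OF g1(3)] g1(4) l1_def .
    have o2: "(\<integral>\<^sup>+p. \<integral>\<^sup>+s. \<integral>\<^sup>+s'. ennreal ((cmod (u' (\<tau>2 (p, s)) - u' (\<tau>2 (p, s'))))\<^sup>2) \<partial>N2 \<partial>N2 \<partial>(N1 \<Otimes>\<^sub>M N3))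
        \<le> ennreal (l2 ^ 3) * ennreal ((norm_L2 S (D_r S u))\<^sup>2)"
      using C2.weak_oscillation[OF w(2)[OF D_L2(2)[OF u(1)] g2(1-3) D_weak(2)[OF u(1)]]]
      unfolding nn_integral_\<tau>(2)[OF hm[OF g2(1)]] nn[OF g2(3)] g2(4) l2_def .
    have o3: "(\<integral>\<^sup>+p. \<integral>\<^sup>+s. \<integral>\<^sup>+s'. ennreal ((cmod (u' (\<tau>3 (p, s)) - u' (\<tau>3 (p, s'))))\<^sup>2) \<partial>N3 \<partial>N3 \<partial>(N1 \<Otimes>\<^sub>M N2))
        \<le> ennreal (l3 ^ 3) * ennreal ((norm_L2 S (D_x S u))\<^sup>2)"
      using C3.weak_oscillation[OF w(3)[OF D_L2(3)[OF u(1)] g3(1-3) D_weak(3)[OF u(1)]]]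
      unfolding nn_integral_\<tau>(3)[OF hm[OF g3(1)]] nn[OF g3(3)] g3(4) l3_def .
    have "(\<integral>\<^sup>+p. \<integral>\<^sup>+q. ennreal ((cmod (u' p - u' q))\<^sup>2) \<partial>M \<partial>M)
      \<le> 3 * (ennreal (l2 * l3) * (ennreal (l1 ^ 3) * ennreal ((norm_L2 S (D_phi S u))\<^sup>2))
         + ennreal (l1 * l3) * (ennreal (l2 ^ 3) * ennreal ((norm_L2 S (D_r S u))\<^sup>2))
         + ennreal (l1 * l2) * (ennreal (l3 ^ 3) * ennreal ((norm_L2 S (D_x S u))\<^sup>2)))"
      by (rule order_trans[OF double_integral_le_oscillations[OF u(2), folded l1_def l2_def l3_def]])
         (intro mult_left_mono add_mono o1 o2 o3 order_refl zero_le)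
    also have "\<dots> = ennreal (3 * (c1 * (norm_L2 S (D_phi S u))\<^sup>2 + c2 * (norm_L2 S (D_r S u))\<^sup>2 + c3 * (norm_L2 S (D_x S u))\<^sup>2))"
      using l by (simp add: c1_def c2_def c3_def mult.assoc flip: ennreal_mult ennreal_plus ennreal_numeral)
    also have "\<dots> \<le> ennreal (3 * (c1 + c2 + c3) * ((norm_L2 S (D_phi S u))\<^sup>2 + (norm_L2 S (D_r S u))\<^sup>2 + (norm_L2 S (D_x S u))\<^sup>2))"
    proof (rule ennreal_leI)
      have "c1 * a \<le> (c1 + c2 + c3) * a" "c2 * a \<le> (c1 + c2 + c3) * a" "c3 * a \<le> (c1 + c2 + c3) * a" if "a \<ge> 0" for a
        using that c by (auto intro: mult_right_mono)
      note this(1)[of "(norm_L2 S (D_phi S u))\<^sup>2"] this(2)[of "(norm_L2 S (D_r S u))\<^sup>2"] this(3)[of "(norm_L2 S (D_x S u))\<^sup>2"]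
      then show "3 * (c1 * (norm_L2 S (D_phi S u))\<^sup>2 + c2 * (norm_L2 S (D_r S u))\<^sup>2 + c3 * (norm_L2 S (D_x S u))\<^sup>2)
          \<le> 3 * (c1 + c2 + c3) * ((norm_L2 S (D_phi S u))\<^sup>2 + (norm_L2 S (D_r S u))\<^sup>2 + (norm_L2 S (D_x S u))\<^sup>2)"
        unfolding mult.assoc distrib_left[of "c1 + c2 + c3"] by simp
    qed
    finally show ?thesis .
  qed
  then show ?thesis using c by (intro exI[of _ "3 * (c1 + c2 + c3)"]) auto
qed

lemma measure_M_pos: "measure M UNIV > 0"
proof -
  have "emeasure M UNIV = (\<integral>\<^sup>+z. 1 \<partial>M)" by simp
  also have "\<dots> = (\<integral>\<^sup>+x. \<integral>\<^sup>+y. \<integral>\<^sup>+z. 1 \<partial>N3 \<partial>N2 \<partial>N1)" by (rule nn_integral_M) simp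
  also have "\<dots> > 0" using lt by (simp add: emeasure_Nm ennreal_zero_less_mult_iff)
  finally show ?thesis by (simp add: M.emeasure_eq_measure)
qed

text \<open>With vanishing A-average, the total mass of A times u(p) is the A-weighted integral of
  u(p) - u(q) over q. Cauchy-Schwarz in q and integration in p reduce the claim to the double
  integral of squared differences.\<close>

lemma poincare_gradient:
  "\<exists>C\<ge>0. \<forall>u\<in>H1 S. integral_A S u = 0 \<longrightarrow>
     (norm_L2 S u)\<^sup>2 \<le> C * ((norm_L2 S (D_phi S u))\<^sup>2 + (norm_L2 S (D_r S u))\<^sup>2 + (norm_L2 S (D_x S u))\<^sup>2)"
proof -
  obtain C where C: "C \<ge> 0" and osc: "\<forall>u\<in>H1 S. \<forall>u'. u' \<in> borel_measurable borel \<longrightarrow> (AE p in SM. u p = u' p) \<longrightarrow> integrable M (\<lambda>p. (cmod (u' p))\<^sup>2) \<longrightarrow>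
     (\<integral>\<^sup>+p. \<integral>\<^sup>+q. ennreal ((cmod (u' p - u' q))\<^sup>2) \<partial>M \<partial>M)
       \<le> ennreal (C * ((norm_L2 S (D_phi S u))\<^sup>2 + (norm_L2 S (D_r S u))\<^sup>2 + (norm_L2 S (D_x S u))\<^sup>2))"
    using oscillation_bound by blast
  let ?A = "ext (coef_A S)"
  have Am [measurable]: "?A \<in> borel_measurable borel" by (rule ext_measurable[OF coef_continuous(1)])
  obtain a1 where a1: "a1 > 0" "\<And>q. \<bar>?A q\<bar> \<le> a1"
    using ext_bounded[OF coef_continuous(1)] by (auto simp: ext_def)
  obtain a0 where a0: "a0 > 0" "\<And>q. a0 \<le> ?A q"
    using ext_pos[OF coef_continuous(1) pos(4)] by (auto simp: ext_def)
  define v where "v = measure M UNIV"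
  have v: "v > 0" using measure_M_pos by (simp add: v_def)
  have Ai: "integrable M ?A"
    by (rule M.integrable_const_bound[of _ a1]) (use a1(2) Am in \<open>auto simp: borel_measurable_M\<close>)
  define I where "I = integral\<^sup>L M ?A"
  have "(LINT p|M. a0) \<le> I" unfolding I_def by (rule integral_mono) (use Ai a0 in auto)
  then have I: "I > 0" using a0(1) v by (simp add: v_def) (meson less_le_trans mult_pos_pos)
  have "(norm_L2 S u)\<^sup>2 \<le> (a1\<^sup>2 * v * C / I\<^sup>2) * ((norm_L2 S (D_phi S u))\<^sup>2 + (norm_L2 S (D_r S u))\<^sup>2 + (norm_L2 S (D_x S u))\<^sup>2)"
    (is "_ \<le> _ * ?G") if u: "u \<in> H1 S" and mean: "integral_A S u = 0" for u
  proof -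
    obtain u' where u': "u' \<in> borel_measurable borel" "AE p in SM. u p = u' p" "integrable M (\<lambda>p. (cmod (u' p))\<^sup>2)"
      "(norm_L2 S u)\<^sup>2 = (LINT p|M. (cmod (u' p))\<^sup>2)" using L2_rep[OF H1_L2[OF u]] .
    note [measurable] = u'(1)
    have u'M [measurable]: "u' \<in> borel_measurable M" using u'(1) by (simp add: borel_measurable_M)
    have AM [measurable]: "?A \<in> borel_measurable M" using Am by (simp add: borel_measurable_M)
    have ui: "integrable M u'" using u'(3) by (intro M.integrable_of_square) simp_all
    have uA: "integrable M (\<lambda>q. u' q * complex_of_real (?A q))"
      by (rule integrable_bounded_mult[OF ui, where C = a1]) (use a1(2) in simp_all)
    have 0: "(LINT q|M. u' q * complex_of_real (?A q)) = 0"
    proof -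
      have "integral_A S u = (LINT q|M. u' q * complex_of_real (?A q))"
        unfolding integral_A_ext using H1_L2[OF u] by (intro integral_rep u') (auto simp: L2_def)
      then show ?thesis using mean by simp
    qed
    have pw: "I\<^sup>2 * (cmod (u' p))\<^sup>2 \<le> a1\<^sup>2 * v * (LINT q|M. (cmod (u' p - u' q))\<^sup>2)"
      and sqi: "integrable M (\<lambda>q. (cmod (u' p - u' q))\<^sup>2)" for p
    proof -
      have di: "integrable M (\<lambda>q. u' p - u' q)" using ui by simp
      show sqi: "integrable M (\<lambda>q. (cmod (u' p - u' q))\<^sup>2)"
      proof (rule Bochner_Integration.integrable_bound)
        show "integrable M (\<lambda>q. 2 * ((cmod (u' p))\<^sup>2 + (cmod (u' q))\<^sup>2))" using u'(3) by simp
        have "(cmod (z - w))\<^sup>2 \<le> 2 * ((cmod z)\<^sup>2 + (cmod w)\<^sup>2)" for z w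
          using cmod_add_sq_le[of z "- w"] by simp
        then show "AE q in M. norm ((cmod (u' p - u' q))\<^sup>2) \<le> norm (2 * ((cmod (u' p))\<^sup>2 + (cmod (u' q))\<^sup>2))" by simp
      qed measurable
      \<comment> \<open>The subtracted term \<open>u' q\<close> integrates to zero against A, which
        is the only use of the hypothesis on the average.\<close>
      have "complex_of_real I * u' p = (LINT q|M. (u' p - u' q) * complex_of_real (?A q))"
        using Ai uA 0 by (simp add: left_diff_distrib I_def)
      then have "I * cmod (u' p) = cmod (LINT q|M. (u' p - u' q) * complex_of_real (?A q))"
        using I by (metis abs_of_pos norm_mult norm_of_real)
      also have "\<dots> \<le> (LINT q|M. a1 * cmod (u' p - u' q))"
      proof (rule order_trans[OF integral_norm_bound integral_mono])
        show "integrable M (\<lambda>q. norm ((u' p - u' q) * complex_of_real (?A q)))"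
          by (intro integrable_norm integrable_bounded_mult[OF di, where C = a1]) (use a1(2) in simp_all)
        show "integrable M (\<lambda>q. a1 * cmod (u' p - u' q))" using di by simp
        show "norm ((u' p - u' q) * complex_of_real (?A q)) \<le> a1 * cmod (u' p - u' q)" for q
          using mult_left_mono[OF a1(2)[of q], of "cmod (u' p - u' q)"] by (simp add: norm_mult mult.commute)
      qed
      finally have "(I * cmod (u' p))\<^sup>2 \<le> (a1 * (LINT q|M. cmod (u' p - u' q)))\<^sup>2"
        using I by (intro power_mono) simp_all
      also have "\<dots> = a1\<^sup>2 * (LINT q|M. cmod (u' p - u' q))\<^sup>2" by (simp add: power_mult_distrib)
      also have "\<dots> \<le> a1\<^sup>2 * (v * (LINT q|M. (cmod (u' p - u' q))\<^sup>2))"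
        using di sqi v by (intro mult_left_mono M.integral_square_le) (simp_all add: v_def)
      finally show "I\<^sup>2 * (cmod (u' p))\<^sup>2 \<le> a1\<^sup>2 * v * (LINT q|M. (cmod (u' p - u' q))\<^sup>2)"
        by (simp add: power_mult_distrib mult.assoc)
    qed
    have "ennreal (I\<^sup>2 * (norm_L2 S u)\<^sup>2) = (\<integral>\<^sup>+p. ennreal (I\<^sup>2 * (cmod (u' p))\<^sup>2) \<partial>M)"
      unfolding u'(4) using u'(3) by (subst nn_integral_eq_integral) simp_all
    also have "\<dots> \<le> (\<integral>\<^sup>+p. ennreal (a1\<^sup>2 * v) * (\<integral>\<^sup>+q. ennreal ((cmod (u' p - u' q))\<^sup>2) \<partial>M) \<partial>M)"
    proof (rule nn_integral_mono)
      fix p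
      have "ennreal (I\<^sup>2 * (cmod (u' p))\<^sup>2) \<le> ennreal (a1\<^sup>2 * v * (LINT q|M. (cmod (u' p - u' q))\<^sup>2))"
        by (rule ennreal_leI[OF pw])
      also have "\<dots> = ennreal (a1\<^sup>2 * v) * ennreal (LINT q|M. (cmod (u' p - u' q))\<^sup>2)"
        using v by (intro ennreal_mult) simp_all
      also have "ennreal (LINT q|M. (cmod (u' p - u' q))\<^sup>2) = (\<integral>\<^sup>+q. ennreal ((cmod (u' p - u' q))\<^sup>2) \<partial>M)"
        by (rule nn_integral_eq_integral[OF sqi, symmetric]) simp
      finally show "ennreal (I\<^sup>2 * (cmod (u' p))\<^sup>2) \<le> ennreal (a1\<^sup>2 * v) * (\<integral>\<^sup>+q. ennreal ((cmod (u' p - u' q))\<^sup>2) \<partial>M)" .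
    qed
    also have "\<dots> = ennreal (a1\<^sup>2 * v) * (\<integral>\<^sup>+p. \<integral>\<^sup>+q. ennreal ((cmod (u' p - u' q))\<^sup>2) \<partial>M \<partial>M)"
      by (rule nn_integral_cmult) measurable
    also have "\<dots> \<le> ennreal (a1\<^sup>2 * v) * ennreal (C * ?G)"
      using osc u u' by (intro mult_left_mono) simp_all
    also have "\<dots> = ennreal (a1\<^sup>2 * v * (C * ?G))"
      using v C by (intro ennreal_mult[symmetric]) simp_all
    finally have "I\<^sup>2 * (norm_L2 S u)\<^sup>2 \<le> a1\<^sup>2 * v * (C * ?G)"
      using v C by (subst (asm) ennreal_le_iff) simp_all
    then show ?thesis using I by (simp add: field_simps)
  qed
  then show ?thesis using C v by (intro exI[of _ "a1\<^sup>2 * v * C / I\<^sup>2"]) simp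
qed

text \<open>Integration by parts in \<phi>: the coefficient B is a function of r and x, so it acts
  as a transverse weight, and periodicity removes the boundary term.\<close>

lemma skew_phi:
  assumes u: "u \<in> H1 S" and v: "v \<in> H1 S"
  shows "(LINT p|SM. (u p * cnj (D_phi S v p) + D_phi S u p * cnj (v p)) * complex_of_real (ext (coef_B S) p)) = 0"
proof -
  obtain u' where u': "u' \<in> borel_measurable borel" "AE p in SM. u p = u' p" "integrable M (\<lambda>p. (cmod (u' p))\<^sup>2)"
    using L2_rep[OF H1_L2[OF u]] .
  obtain v' where v': "v' \<in> borel_measurable borel" "AE p in SM. v p = v' p" "integrable M (\<lambda>p. (cmod (v' p))\<^sup>2)"
    using L2_rep[OF H1_L2[OF v]] .
  obtain g where g: "g \<in> borel_measurable borel" "AE p in SM. D_phi S u p = g p" "integrable M (\<lambda>p. (cmod (g p))\<^sup>2)"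
    using L2_rep[OF D_L2(1)[OF u]] .
  obtain h where h: "h \<in> borel_measurable borel" "AE p in SM. D_phi S v p = h p" "integrable M (\<lambda>p. (cmod (h p))\<^sup>2)"
    using L2_rep[OF D_L2(1)[OF v]] .
  note wu = weak_rep(1)[OF H1_L2[OF u] u'(1-3) D_L2(1)[OF u] g(1-3) D_weak(1)[OF u]]
  note wv = weak_rep(1)[OF H1_L2[OF v] v'(1-3) D_L2(1)[OF v] h(1-3) D_weak(1)[OF v]]
  have Bm: "ext (coef_B S) \<in> borel_measurable borel" by (rule ext_measurable[OF coef_continuous(2)])
  obtain C where C: "\<And>q. \<bar>extq (coef_B S) q\<bar> \<le> C" using ext_bounded[OF coef_continuous(2)] by blast
  have one: "(\<lambda>s. 1) \<in> T1" by (simp add: periodic_tests_def Cinf_const)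
  have "(\<lambda>q. complex_of_real (extq (coef_B S) q)) \<in> borel_measurable (N2 \<Otimes>\<^sub>M N3)"
  proof -
    have "(\<lambda>q. complex_of_real (extq (coef_B S) q)) \<in> borel_measurable (borel \<Otimes>\<^sub>M borel)"
      unfolding borel_prod using extq_measurable[OF coef_continuous(2)] by measurable
    then show ?thesis by (subst measurable_cong_sets[of _ "borel \<Otimes>\<^sub>M borel" _ borel]) (auto intro!: sets_pair_measure_cong)
  qed
  note sk = C1.weak_skew[OF wu wv one this, of C]
  have fm: "(\<lambda>p. u' p * cnj (h p) + g p * cnj (v' p)) \<in> borel_measurable borel"
    using u'(1) v'(1) g(1) h(1) by measurable
  have "(LINT p|SM. (u p * cnj (D_phi S v p) + D_phi S u p * cnj (v p)) * complex_of_real (ext (coef_B S) p))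
      = (LINT p|M. (u' p * cnj (h p) + g p * cnj (v' p)) * complex_of_real (ext (coef_B S) p))"
  proof (rule integral_rep[OF _ fm])
    show "(\<lambda>p. u p * cnj (D_phi S v p) + D_phi S u p * cnj (v p)) \<in> borel_measurable SM"
    proof -
      have [measurable]: "f \<in> borel_measurable SM" if "f \<in> L2 S" for f using that by (simp add: L2_def)
      note [measurable] = H1_L2[OF u] H1_L2[OF v] D_L2(1)[OF u] D_L2(1)[OF v]
      show ?thesis by measurable
    qed
    show "AE p in SM. u p * cnj (D_phi S v p) + D_phi S u p * cnj (v p) = u' p * cnj (h p) + g p * cnj (v' p)"
      using u'(2) v'(2) g(2) h(2) by eventually_elim simp
    show "(\<lambda>p. complex_of_real (ext (coef_B S) p)) \<in> borel_measurable borel" using Bm by measurable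
  qed
  also have "\<dots> = (LINT z|C1.F. (u' (\<tau>1 z) * cnj (h (\<tau>1 z)) + g (\<tau>1 z) * cnj (v' (\<tau>1 z))) * complex_of_real (ext (coef_B S) (\<tau>1 z)))"
    by (rule integral_\<tau>(1)) (use fm Bm in measurable)
  also have "\<dots> = 0"
    using sk C by (simp add: ext_def \<tau>1_def mult.commute)
  finally show ?thesis .
qed

end

type_synonym vec = "(real \<times> real \<times> real) l2"

context slab begin

section \<open>The slab spaces inside the Hilbert space\<close>

text \<open>Extension by zero places functions on the slab into one fixed Hilbert space over all of
  space; values outside the slab are irrelevant to the class.\<close>

definition cls :: "cfun \<Rightarrow> (real \<times> real \<times> real) l2" where
  "cls f = abs_l2 (\<lambda>p. indicator Sig p *\<^sub>R f p)"

lemma L2_iff: "f \<in> L2 S \<longleftrightarrow> sq_integrable (\<lambda>p. indicator Sig p *\<^sub>R f p)"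
proof -
  have "(\<lambda>p. (cmod (indicator Sig p *\<^sub>R f p))\<^sup>2) = (\<lambda>p. indicator Sig p *\<^sub>R (cmod (f p))\<^sup>2)"
    by (auto simp: fun_eq_iff indicator_def)
  then show ?thesis
    unfolding L2_def sq_integrable_def Sigma_meas_eq
    by (simp add: borel_measurable_restrict_space_iff integrable_restrict_space)
qed

lemma L2_add: "f \<in> L2 S \<Longrightarrow> g \<in> L2 S \<Longrightarrow> (\<lambda>p. f p + g p) \<in> L2 S"
  unfolding L2_iff scaleR_add_right by (rule sq_integrable_add)

lemma L2_diff: "f \<in> L2 S \<Longrightarrow> g \<in> L2 S \<Longrightarrow> (\<lambda>p. f p - g p) \<in> L2 S"
  unfolding L2_iff scaleR_diff_right by (rule sq_integrable_diff)

lemma bounded_measurable_const: "bounded_measurable (\<lambda>p. c)"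
  by (auto simp: bounded_measurable_def)

lemma bounded_measurable_ind: "bounded_measurable (\<lambda>p. complex_of_real (indicator Sig p))"
  unfolding bounded_measurable_def
  by (intro conjI exI[of _ 1] allI measurable_compose[OF borel_measurable_indicator[OF Sig_lebesgue]
        borel_measurable_continuous_onI[OF continuous_on_of_real[OF continuous_on_id]]])
     (simp add: indicator_def)

lemma L2_mult: "bounded_measurable m \<Longrightarrow> f \<in> L2 S \<Longrightarrow> (\<lambda>p. m p * f p) \<in> L2 S"
  unfolding L2_iff mult_scaleR_right[symmetric] by (rule sq_integrable_bounded_measurable_mult)

lemma L2_cmult: "f \<in> L2 S \<Longrightarrow> (\<lambda>p. c * f p) \<in> L2 S"
  by (rule L2_mult[OF bounded_measurable_const])

lemma cls_add: "f \<in> L2 S \<Longrightarrow> g \<in> L2 S \<Longrightarrow> cls (\<lambda>p. f p + g p) = cls f + cls g"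
  unfolding cls_def L2_iff scaleR_add_right by (rule abs_l2_add[symmetric])

lemma cls_diff: "f \<in> L2 S \<Longrightarrow> g \<in> L2 S \<Longrightarrow> cls (\<lambda>p. f p - g p) = cls f - cls g"
  unfolding cls_def L2_iff scaleR_diff_right by (rule abs_l2_diff[symmetric])

lemma cls_mult: "bounded_measurable m \<Longrightarrow> f \<in> L2 S \<Longrightarrow> cls (\<lambda>p. m p * f p) = mul m (cls f)"
  unfolding cls_def L2_iff mult_scaleR_right[symmetric] by (rule mul_abs_l2[symmetric])

lemma cls_cmult: "f \<in> L2 S \<Longrightarrow> cls (\<lambda>p. c * f p) = mul (\<lambda>_. c) (cls f)"
  by (rule cls_mult[OF bounded_measurable_const])

lemma cls_scaleR: "f \<in> L2 S \<Longrightarrow> cls (\<lambda>p. complex_of_real c * f p) = c *\<^sub>R cls f"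
  unfolding cls_def L2_iff mult_scaleR_right[symmetric] by (rule abs_l2_scaleR[symmetric])

lemma cls_eq_iff: "f \<in> L2 S \<Longrightarrow> g \<in> L2 S \<Longrightarrow> cls f = cls g \<longleftrightarrow> ae_eq S f g"
proof -
  assume L: "f \<in> L2 S" "g \<in> L2 S"
  have *: "(indicator Sig p *\<^sub>R f p = indicator Sig p *\<^sub>R g p) = (p \<in> Sig \<longrightarrow> f p = g p)" for p
    by (auto simp: indicator_def)
  show ?thesis
    using L unfolding cls_def L2_iff ae_eq_def AE_SM by (simp only: abs_l2_eq_iff *)
qed

lemma inner_cls:
  assumes "f \<in> L2 S" "g \<in> L2 S"
  shows "inner (cls f) (cls g) = Re (LINT p|SM. f p * cnj (g p))"
proof -
  have "inner (cls f) (cls g) = Re (LINT p|lebesgue. (indicator Sig p *\<^sub>R f p) * cnj (indicator Sig p *\<^sub>R g p))"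
    using assms unfolding cls_def L2_iff by (rule inner_abs_l2)
  also have "(\<lambda>p. (indicator Sig p *\<^sub>R f p) * cnj (indicator Sig p *\<^sub>R g p)) = (\<lambda>p. indicator Sig p *\<^sub>R (f p * cnj (g p)))"
    by (auto simp: fun_eq_iff indicator_def)
  also have "(LINT p|lebesgue. indicator Sig p *\<^sub>R (f p * cnj (g p))) = (LINT p|SM. f p * cnj (g p))"
    unfolding Sigma_meas_eq by (simp add: integral_restrict_space)
  finally show ?thesis .
qed

lemma norm_cls: "f \<in> L2 S \<Longrightarrow> norm (cls f) = norm_L2 S f"
proof -
  assume f: "f \<in> L2 S"
  have "(norm (cls f))\<^sup>2 = Re (LINT p|SM. f p * cnj (f p))"
    by (simp only: power2_norm_eq_inner inner_cls[OF f f])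
  also have "(LINT p|SM. f p * cnj (f p)) = (LINT p|SM. complex_of_real ((cmod (f p))\<^sup>2))"
    by (simp only: complex_norm_square)
  also have "Re \<dots> = (LINT p|SM. (cmod (f p))\<^sup>2)" by (simp only: integral_complex_of_real Re_complex_of_real)
  finally show ?thesis by (simp add: norm_L2_def real_sqrt_unique)
qed

lemma L2_integrable: "f \<in> L2 S \<Longrightarrow> g \<in> L2 S \<Longrightarrow> integrable SM (\<lambda>p. f p * cnj (g p))"
  unfolding L2_def by (intro integrable_mult_squares) auto

lemma L2_bounded: "f \<in> borel_measurable SM \<Longrightarrow> (\<And>p. p \<in> Sig \<Longrightarrow> cmod (f p) \<le> C) \<Longrightarrow> f \<in> L2 S"
proof -
  assume f [measurable]: "f \<in> borel_measurable SM" and C: "\<And>p. p \<in> Sig \<Longrightarrow> cmod (f p) \<le> C"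
  have "integrable SM (\<lambda>p. (cmod (f p))\<^sup>2)"
    by (rule SM.integrable_const_bound[of _ "C\<^sup>2"]) (auto intro!: AE_I2 power_mono C)
  then show ?thesis using f by (simp add: L2_def)
qed

lemma L2_continuous: "continuous_on UNIV f \<Longrightarrow> f \<in> L2 S"
proof -
  assume f: "continuous_on UNIV f"
  then have "bounded (f ` Sig)"
    by (intro compact_imp_bounded compact_continuous_image compact_Sig) (auto intro: continuous_on_subset)
  then obtain C where "\<forall>x\<in>Sig. cmod (f x) \<le> C" by (auto simp: bounded_iff)
  then show ?thesis
    by (intro L2_bounded[of f C] borel_imp_SM borel_measurable_continuous_onI f) auto
qed

lemma const_L2: "(\<lambda>p. c) \<in> L2 S"
  by (rule L2_continuous) (rule continuous_on_const)

lemma cls_surj: "mul (\<lambda>p. complex_of_real (indicator Sig p)) h = h \<Longrightarrow> \<exists>f\<in>L2 S. cls f = h"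
proof -
  assume h: "mul (\<lambda>p. complex_of_real (indicator Sig p)) h = h"
  obtain f where f: "sq_integrable f" "h = abs_l2 f" by (rule l2_cases)
  have b: "bounded_measurable (\<lambda>p. complex_of_real (indicator Sig p))"
    by (rule bounded_measurable_ind)
  have eq: "(\<lambda>p. complex_of_real (indicator Sig p) * f p) = (\<lambda>p. indicator Sig p *\<^sub>R f p)"
    by (simp add: scaleR_conv_of_real)
  have "f \<in> L2 S" unfolding L2_iff eq[symmetric] by (rule sq_integrable_bounded_measurable_mult[OF b f(1)])
  moreover have "cls f = h" unfolding cls_def eq[symmetric] mul_abs_l2[OF b f(1), symmetric] using h f(2) by simp
  ultimately show ?thesis by blast
qed

lemma mul_ind_cls: "f \<in> L2 S \<Longrightarrow> mul (\<lambda>p. complex_of_real (indicator Sig p)) (cls f) = cls f"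
proof -
  assume f: "f \<in> L2 S"
  have b: "bounded_measurable (\<lambda>p. complex_of_real (indicator Sig p))"
    by (rule bounded_measurable_ind)
  have "(\<lambda>p. indicator Sig p *\<^sub>R (complex_of_real (indicator Sig p) * f p)) = (\<lambda>p. indicator Sig p *\<^sub>R f p)"
    by (auto simp: fun_eq_iff indicator_def)
  then show ?thesis unfolding cls_mult[OF b f, symmetric] by (simp add: cls_def)
qed

text \<open>The classes of functions on the slab are the fixed points of multiplication by its
  indicator, a continuous map.\<close>

lemma closed_cls: "closed (cls ` L2 S)"
proof -
  let ?m = "mul (\<lambda>p. complex_of_real (indicator Sig p))"
  have "bounded_measurable (\<lambda>p. complex_of_real (indicator Sig p))"
    by (rule bounded_measurable_ind)
  then have "continuous_on UNIV ?m" by (intro linear_continuous_on bounded_linear_mul)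
  then have "closed {h. ?m h = h}" by (intro closed_Collect_eq continuous_on_id)
  moreover have "{h. ?m h = h} = cls ` L2 S"
  proof (intro set_eqI iffI)
    fix h assume "h \<in> {h. ?m h = h}"
    then have "\<exists>f\<in>L2 S. cls f = h" by (intro cls_surj) simp
    then show "h \<in> cls ` L2 S" by blast
  next
    fix h assume "h \<in> cls ` L2 S"
    then show "h \<in> {h. ?m h = h}" by (rule imageE) (simp add: mul_ind_cls)
  qed
  ultimately show ?thesis by simp
qed

section \<open>Weak derivatives in the Hilbert space\<close>

lemma test_L2:
  assumes "test_function S \<theta>"
  shows "(\<lambda>p. c * cnj (\<theta> p)) \<in> L2 S" "e \<in> Basis \<Longrightarrow> (\<lambda>p. c * cnj (frechet_derivative \<theta> (at p) e)) \<in> L2 S"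
proof -
  have s: "smooth \<theta>" using assms by (simp add: test_function_def)
  show "(\<lambda>p. c * cnj (\<theta> p)) \<in> L2 S"
    by (intro L2_continuous continuous_intros smoothD(2)[OF s])
  show "e \<in> Basis \<Longrightarrow> (\<lambda>p. c * cnj (frechet_derivative \<theta> (at p) e)) \<in> L2 S"
    by (intro L2_continuous continuous_intros smoothD(2)[OF smoothD(3)[OF s]])
qed

text \<open>The free factor c, taken as 1 and as \<i>, lets a real inner product express the complex
  identity. In this form weak derivatives visibly depend on classes only and survive limits.\<close>

lemma weak_iff:
  assumes u: "u \<in> L2 S" and g: "g \<in> L2 S" and e: "e \<in> Basis"
  shows "is_weak_deriv S e u g \<longleftrightarrow> (\<forall>\<theta> c. test_function S \<theta> \<longrightarrow>
    inner (cls u) (cls (\<lambda>p. c * cnj (frechet_derivative \<theta> (at p) e))) = - inner (cls g) (cls (\<lambda>p. c * cnj (\<theta> p))))"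
proof -
  have *: "inner (cls f) (cls (\<lambda>p. c * cnj (h p))) = Re (cnj c * (LINT p|SM. f p * h p))"
    if "f \<in> L2 S" "(\<lambda>p. c * cnj (h p)) \<in> L2 S" for f h c
  proof -
    have "inner (cls f) (cls (\<lambda>p. c * cnj (h p))) = Re (LINT p|SM. cnj c * (f p * h p))"
      unfolding inner_cls[OF that] by (simp add: mult_ac)
    then show ?thesis by (simp only: integral_mult_right_zero)
  qed
  have cI: "z = - w" if "\<And>c. Re (cnj c * z) = - Re (cnj c * w)" for z w
    using that[of 1] that[of \<i>] by (simp add: complex_eq_iff)
  show ?thesis
    unfolding is_weak_deriv_def
  proof (intro iffI allI impI)
    fix \<theta> c assume w: "\<forall>\<theta>. test_function S \<theta> \<longrightarrow> (LINT p|SM. u p * frechet_derivative \<theta> (at p) e) = - (LINT p|SM. g p * \<theta> p)"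
      and t: "test_function S \<theta>"
    have "(LINT p|SM. u p * frechet_derivative \<theta> (at p) e) = - (LINT p|SM. g p * \<theta> p)" using w t by blast
    then show "inner (cls u) (cls (\<lambda>p. c * cnj (frechet_derivative \<theta> (at p) e))) = - inner (cls g) (cls (\<lambda>p. c * cnj (\<theta> p)))"
      unfolding *[OF u test_L2(2)[OF t e]] *[OF g test_L2(1)[OF t]] by (simp only: mult_minus_right uminus_complex.sel)
  next
    fix \<theta> assume w: "\<forall>\<theta> c. test_function S \<theta> \<longrightarrow>
      inner (cls u) (cls (\<lambda>p. c * cnj (frechet_derivative \<theta> (at p) e))) = - inner (cls g) (cls (\<lambda>p. c * cnj (\<theta> p)))"
      and t: "test_function S \<theta>"
    show "(LINT p|SM. u p * frechet_derivative \<theta> (at p) e) = - (LINT p|SM. g p * \<theta> p)"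
    proof (rule cI)
      fix c show "Re (cnj c * (LINT p|SM. u p * frechet_derivative \<theta> (at p) e)) = - Re (cnj c * (LINT p|SM. g p * \<theta> p))"
        using w[rule_format, OF t, of c] unfolding *[OF u test_L2(2)[OF t e]] *[OF g test_L2(1)[OF t]] .
    qed
  qed
qed

text \<open>\<open>weak_deriv\<close> selects an arbitrary representative. Uniqueness of its class
  is what makes \<open>grad\<close> a well-defined operation.\<close>

lemma weak_unique:
  assumes "u \<in> L2 S" "v \<in> L2 S" "cls u = cls v" "g \<in> L2 S" "h \<in> L2 S" "e \<in> Basis"
    "is_weak_deriv S e u g" "is_weak_deriv S e v h"
  shows "cls g = cls h"
proof -
  have w: "is_weak_deriv S e u h"
    using assms(8) unfolding weak_iff[OF assms(1,5,6)] weak_iff[OF assms(2,5,6)] assms(3) .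
  have d: "(\<lambda>p. g p - h p) \<in> L2 S" by (rule L2_diff[OF assms(4,5)])
  have "(LINT p|SM. (g p - h p) * \<theta> p) = 0" if t: "test_function S \<theta>" for \<theta>
  proof -
    have t': "(\<lambda>p. cnj (\<theta> p)) \<in> L2 S" using test_L2(1)[OF t, of 1] by simp
    have "integrable SM (\<lambda>p. g p * \<theta> p)" "integrable SM (\<lambda>p. h p * \<theta> p)"
      using L2_integrable[OF assms(4) t'] L2_integrable[OF assms(5) t'] by simp_all
    then show ?thesis
      using assms(7) w t unfolding is_weak_deriv_def by (simp add: left_diff_distrib)
  qed
  then have "ae_eq S (\<lambda>p. g p - h p) (\<lambda>p. 0)" by (rule orthogonal_tests_imp_zero[OF d])
  then have "ae_eq S g h" unfolding ae_eq_def by eventually_elim simp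
  then show ?thesis using cls_eq_iff[OF assms(4,5)] by simp
qed

definition grad :: "cfun \<Rightarrow> vec \<times> vec \<times> vec" where
  "grad u = (cls (D_phi S u), cls (D_r S u), cls (D_x S u))"

text \<open>The graph embedding: its norm is the H1 norm, so continuity, closedness and completeness
  in H1 become statements about a product of Hilbert spaces.\<close>

definition G :: "cfun \<Rightarrow> vec \<times> vec \<times> vec \<times> vec" where
  "G u = (cls u, grad u)"

lemma H1I:
  assumes "u \<in> L2 S" "\<And>i. i < 3 \<Longrightarrow> g i \<in> L2 S"
    "is_weak_deriv S (1, 0, 0) u (g 0)" "is_weak_deriv S (0, 1, 0) u (g 1)" "is_weak_deriv S (0, 0, 1) u (g 2)"
  shows "u \<in> H1 S" "grad u = (cls (g (0::nat)), cls (g 1), cls (g 2))"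
proof -
  show u: "u \<in> H1 S" unfolding H1_def Basis3 using assms by force
  show "grad u = (cls (g 0), cls (g 1), cls (g 2))"
    unfolding grad_def
    using weak_unique[OF assms(1,1) refl D_L2(1)[OF u] assms(2)[of 0] basis_mem(1) D_weak(1)[OF u] assms(3)]
      weak_unique[OF assms(1,1) refl D_L2(2)[OF u] assms(2)[of 1] basis_mem(2) D_weak(2)[OF u] assms(4)]
      weak_unique[OF assms(1,1) refl D_L2(3)[OF u] assms(2)[of 2] basis_mem(3) D_weak(3)[OF u] assms(5)] by simp
qed

lemma weak_add:
  assumes "u \<in> L2 S" "v \<in> L2 S" "g \<in> L2 S" "h \<in> L2 S" "e \<in> Basis" "is_weak_deriv S e u g" "is_weak_deriv S e v h"
  shows "is_weak_deriv S e (\<lambda>p. u p + v p) (\<lambda>p. g p + h p)"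
  using assms(6,7) unfolding weak_iff[OF L2_add[OF assms(1,2)] L2_add[OF assms(3,4)] assms(5)]
    weak_iff[OF assms(1,3,5)] weak_iff[OF assms(2,4,5)]
  by (simp add: cls_add assms inner_add_left)

lemma weak_cmult:
  assumes "is_weak_deriv S e u g" shows "is_weak_deriv S e (\<lambda>p. c * u p) (\<lambda>p. c * g p)"
  using assms unfolding is_weak_deriv_def by (simp add: mult.assoc)

lemma H1_add:
  assumes "u \<in> H1 S" "v \<in> H1 S"
  shows "(\<lambda>p. u p + v p) \<in> H1 S" "G (\<lambda>p. u p + v p) = G u + G v"
proof -
  note D = D_L2[OF assms(1)] D_L2[OF assms(2)] and L = H1_L2[OF assms(1)] H1_L2[OF assms(2)]
  define g where "g i p = (if i = (0::nat) then D_phi S u p + D_phi S v p else if i = 1 then D_r S u p + D_r S v p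
     else D_x S u p + D_x S v p)" for i p
  have g: "g 0 = (\<lambda>p. D_phi S u p + D_phi S v p)" "g 1 = (\<lambda>p. D_r S u p + D_r S v p)" "g 2 = (\<lambda>p. D_x S u p + D_x S v p)"
    by (simp_all add: g_def fun_eq_iff)
  have gL: "g i \<in> L2 S" if "i < 3" for i
  proof -
    have "i = 0 \<or> i = 1 \<or> i = 2" using that by auto
    then show ?thesis using g D by (auto intro: L2_add)
  qed
  note w = weak_add[OF L D(1,4) basis_mem(1) D_weak(1)[OF assms(1)] D_weak(1)[OF assms(2)]]
    weak_add[OF L D(2,5) basis_mem(2) D_weak(2)[OF assms(1)] D_weak(2)[OF assms(2)]]
    weak_add[OF L D(3,6) basis_mem(3) D_weak(3)[OF assms(1)] D_weak(3)[OF assms(2)]]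
  note H = H1I[of "\<lambda>p. u p + v p" g, OF L2_add[OF L] gL, unfolded g, OF _ w]
  show "(\<lambda>p. u p + v p) \<in> H1 S" by (rule H(1)) simp
  show "G (\<lambda>p. u p + v p) = G u + G v"
    unfolding G_def using H(2) D L by (simp add: grad_def cls_add)
qed

definition mul4 :: "complex \<Rightarrow> vec \<times> vec \<times> vec \<times> vec \<Rightarrow> vec \<times> vec \<times> vec \<times> vec" where
  "mul4 c z = (mul (\<lambda>_. c) (fst z), mul (\<lambda>_. c) (fst (snd z)), mul (\<lambda>_. c) (fst (snd (snd z))), mul (\<lambda>_. c) (snd (snd (snd z))))"

lemma H1_cmult:
  assumes "u \<in> H1 S"
  shows "(\<lambda>p. c * u p) \<in> H1 S" "G (\<lambda>p. c * u p) = mul4 c (G u)"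
proof -
  note D = D_L2[OF assms] and L = H1_L2[OF assms]
  define g where "g i p = (if i = (0::nat) then c * D_phi S u p else if i = 1 then c * D_r S u p
     else c * D_x S u p)" for i p
  have g: "g 0 = (\<lambda>p. c * D_phi S u p)" "g 1 = (\<lambda>p. c * D_r S u p)" "g 2 = (\<lambda>p. c * D_x S u p)"
    by (simp_all add: g_def fun_eq_iff)
  have gL: "g i \<in> L2 S" if "i < 3" for i
  proof -
    have "i = 0 \<or> i = 1 \<or> i = 2" using that by auto
    then show ?thesis using g D by (auto intro: L2_cmult)
  qed
  note w = weak_cmult[OF D_weak(1)[OF assms], of c] weak_cmult[OF D_weak(2)[OF assms], of c] weak_cmult[OF D_weak(3)[OF assms], of c]
  note H = H1I[of "\<lambda>p. c * u p" g, OF L2_cmult[OF L] gL, unfolded g, OF _ w]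
  show "(\<lambda>p. c * u p) \<in> H1 S" by (rule H(1)) simp
  show "G (\<lambda>p. c * u p) = mul4 c (G u)"
    unfolding G_def mul4_def using H(2) D L by (simp add: grad_def cls_cmult)
qed

lemma mul_const_real: "mul (\<lambda>_. complex_of_real c) x = c *\<^sub>R x"
  by (rule l2_cases[of x]) (simp add: mul_abs_l2 bounded_measurable_const abs_l2_scaleR)

lemma mul4_real: "mul4 (complex_of_real c) z = c *\<^sub>R z"
  unfolding mul4_def mul_const_real by (simp add: prod_eq_iff)

lemma H1_diff:
  assumes "u \<in> H1 S" "v \<in> H1 S"
  shows "(\<lambda>p. u p - v p) \<in> H1 S" "G (\<lambda>p. u p - v p) = G u - G v"
proof -
  have m: "mul4 (-1) z = - z" for z using mul4_real[of "-1" z] by simp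
  have eq: "(\<lambda>p. u p - v p) = (\<lambda>p. u p + (-1) * v p)" by (simp add: fun_eq_iff)
  show "(\<lambda>p. u p - v p) \<in> H1 S" "G (\<lambda>p. u p - v p) = G u - G v"
    unfolding eq H1_add(2)[OF assms(1) H1_cmult(1)[OF assms(2)]] H1_cmult(2)[OF assms(2)] m
    using H1_add(1)[OF assms(1) H1_cmult(1)[OF assms(2)], of "-1"] by simp_all
qed

lemma norm_G: "u \<in> H1 S \<Longrightarrow> norm (G u) = norm_H1 S u"
  unfolding G_def grad_def norm_H1_def norm_Pair
  by (simp add: norm_cls H1_L2 D_L2 algebra_simps)

lemma norm_grad: "u \<in> H1 S \<Longrightarrow> (norm (grad u))\<^sup>2 = (norm_L2 S (D_phi S u))\<^sup>2 + (norm_L2 S (D_r S u))\<^sup>2 + (norm_L2 S (D_x S u))\<^sup>2"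
  unfolding grad_def norm_Pair by (simp add: norm_cls D_L2)

lemma grad_cong: "u \<in> H1 S \<Longrightarrow> v \<in> H1 S \<Longrightarrow> cls u = cls v \<Longrightarrow> grad u = grad v"
  unfolding grad_def
  by (intro arg_cong2[of _ _ _ _ Pair] weak_unique[OF H1_L2 H1_L2 _ D_L2(1) D_L2(1) basis_mem(1) D_weak(1) D_weak(1)]
      weak_unique[OF H1_L2 H1_L2 _ D_L2(2) D_L2(2) basis_mem(2) D_weak(2) D_weak(2)]
      weak_unique[OF H1_L2 H1_L2 _ D_L2(3) D_L2(3) basis_mem(3) D_weak(3) D_weak(3)])

lemma weak_limit:
  assumes "\<And>n. u n \<in> L2 S" "\<And>n. g n \<in> L2 S" "u0 \<in> L2 S" "g0 \<in> L2 S" "e \<in> Basis"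
    "\<And>n. is_weak_deriv S e (u n) (g n)" "(\<lambda>n. cls (u n)) \<longlonglongrightarrow> cls u0" "(\<lambda>n. cls (g n)) \<longlonglongrightarrow> cls g0"
  shows "is_weak_deriv S e u0 g0"
  unfolding weak_iff[OF assms(3-5)]
proof (intro allI impI)
  fix \<theta> c assume t: "test_function S \<theta>"
  let ?d = "cls (\<lambda>p. c * cnj (frechet_derivative \<theta> (at p) e))" and ?t = "cls (\<lambda>p. c * cnj (\<theta> p))"
  have "(\<lambda>n. inner (cls (u n)) ?d) \<longlonglongrightarrow> inner (cls u0) ?d" by (intro tendsto_intros assms)
  moreover have "(\<lambda>n. - inner (cls (g n)) ?t) \<longlonglongrightarrow> - inner (cls g0) ?t" by (intro tendsto_intros assms)
  moreover have "inner (cls (u n)) ?d = - inner (cls (g n)) ?t" for n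
    using assms(6)[of n] t unfolding weak_iff[OF assms(1,2,5)] by blast
  ultimately show "inner (cls u0) ?d = - inner (cls g0) ?t" by (simp add: LIMSEQ_unique)
qed

text \<open>Completeness of H1: the components of the limit are classes of functions on the slab,
  and the weak identity persists because it pairs them with fixed test vectors.\<close>

lemma H1_closed:
  assumes u: "\<And>n. u n \<in> H1 S" and lim: "(\<lambda>n. G (u n)) \<longlonglongrightarrow> z"
  shows "\<exists>v\<in>H1 S. G v = z"
proof -
  obtain x a b c where z: "z = (x, a, b, c)" by (metis surj_pair)
  have lims: "(\<lambda>n. cls (u n)) \<longlonglongrightarrow> x" "(\<lambda>n. cls (D_phi S (u n))) \<longlonglongrightarrow> a" "(\<lambda>n. cls (D_r S (u n))) \<longlonglongrightarrow> b"
    "(\<lambda>n. cls (D_x S (u n))) \<longlonglongrightarrow> c"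
    using tendsto_fst[OF lim] tendsto_fst[OF tendsto_snd[OF lim]] tendsto_fst[OF tendsto_snd[OF tendsto_snd[OF lim]]]
      tendsto_snd[OF tendsto_snd[OF tendsto_snd[OF lim]]]
    by (simp_all add: z G_def grad_def)
  have *: "\<exists>f\<in>L2 S. cls f = y" if "\<And>n. f n \<in> L2 S" "(\<lambda>n. cls (f n)) \<longlonglongrightarrow> y" for f :: "nat \<Rightarrow> cfun" and y
    using closed_sequentially[OF closed_cls _ that(2)] that(1) by force
  obtain v where v: "v \<in> L2 S" "cls v = x" using *[OF _ lims(1)] H1_L2[OF u] by blast
  obtain g1 where g1: "g1 \<in> L2 S" "cls g1 = a" using *[OF _ lims(2)] D_L2(1)[OF u] by blast
  obtain g2 where g2: "g2 \<in> L2 S" "cls g2 = b" using *[OF _ lims(3)] D_L2(2)[OF u] by blast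
  obtain g3 where g3: "g3 \<in> L2 S" "cls g3 = c" using *[OF _ lims(4)] D_L2(3)[OF u] by blast
  note lims' = lims[folded v(2) g1(2) g2(2) g3(2)]
  note w = weak_limit[OF H1_L2[OF u] D_L2(1)[OF u] v(1) g1(1) basis_mem(1) D_weak(1)[OF u] lims'(1,2)]
    weak_limit[OF H1_L2[OF u] D_L2(2)[OF u] v(1) g2(1) basis_mem(2) D_weak(2)[OF u] lims'(1,3)]
    weak_limit[OF H1_L2[OF u] D_L2(3)[OF u] v(1) g3(1) basis_mem(3) D_weak(3)[OF u] lims'(1,4)]
  define g where "g i = (if i = (0::nat) then g1 else if i = 1 then g2 else g3)" for i
  have g: "g 0 = g1" "g 1 = g2" "g 2 = g3" and gL: "\<And>i. g i \<in> L2 S"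
    using g1 g2 g3 by (simp_all add: g_def)
  note H = H1I[of v g, OF v(1) gL, unfolded g, OF w]
  show ?thesis
    by (rule bexI[of _ v]) (simp_all add: H G_def z v g1 g2 g3)
qed

text \<open>In the case without integrability the integral is zero by convention, so integrability
  need not be established.\<close>

lemma integral_slices_zero:
  fixes F :: "'b \<times> real \<Rightarrow> complex"
  assumes N: "sigma_finite_measure N" and Nm: "sigma_finite_measure L" and 0: "\<And>q. (LINT s|L. F (q, s)) = 0"
  shows "integral\<^sup>L (N \<Otimes>\<^sub>M L) F = 0"
proof (cases "integrable (N \<Otimes>\<^sub>M L) F")
  case True
  have "pair_sigma_finite N L" using N Nm by (rule pair_sigma_finite.intro)
  from pair_sigma_finite.integral_fst'[OF this True] 0 show ?thesis by simp
qed (rule not_integrable_integral_eq)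

lemma slice_zero:
  fixes \<theta> :: cfun
  assumes s: "smooth \<theta>" and e: "e \<in> Basis" and ab: "a \<le> b" and ends: "\<theta> (p + a *\<^sub>R e) = \<theta> (p + b *\<^sub>R e)"
  shows "(LINT s|Nm a b. frechet_derivative \<theta> (at (p + s *\<^sub>R e)) e) = 0"
proof -
  let ?f = "\<lambda>s. frechet_derivative \<theta> (at (p + s *\<^sub>R e)) e"
  have c: "continuous_on UNIV ?f"
    by (intro continuous_on_compose2[OF smoothD(2)[OF smoothD(3)[OF s e]]] continuous_intros) auto
  have d: "((\<lambda>s. \<theta> (p + s *\<^sub>R e)) has_vector_derivative ?f s) (at s within A)" for s A
  proof -
    have "((\<lambda>s. p + s *\<^sub>R e) has_derivative (\<lambda>h. h *\<^sub>R e)) (at s)" by (auto intro!: derivative_eq_intros)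
    from has_derivative_compose[OF this smoothD(1)[OF s]]
    have "((\<lambda>s. \<theta> (p + s *\<^sub>R e)) has_derivative (\<lambda>h. frechet_derivative \<theta> (at (p + s *\<^sub>R e)) (h *\<^sub>R e))) (at s)" .
    moreover have "linear (frechet_derivative \<theta> (at (p + s *\<^sub>R e)))"
      using smoothD(1)[OF s] has_derivative_linear by blast
    ultimately show ?thesis
      by (simp add: has_vector_derivative_def linear_scale has_derivative_at_withinI)
  qed
  have "(LINT s|Nm a b. ?f s) = (LINT x|lborel. indicator {a..b} x *\<^sub>R ?f x)"
    by (rule integral_Nm) (rule borel_measurable_continuous_onI[OF c])
  also have "\<dots> = \<theta> (p + b *\<^sub>R e) - \<theta> (p + a *\<^sub>R e)"
    by (rule integral_FTC_Icc[OF ab d continuous_on_subset[OF c]]) auto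
  finally show ?thesis using ends by simp
qed

text \<open>The claim is that derivatives of test functions integrate to zero. Along each coordinate
  line the end values of the test agree: by periodicity in \<phi>, and because both vanish in r and
  x.\<close>

lemma weak_const:
  assumes "e \<in> Basis" shows "is_weak_deriv S e (\<lambda>_. c) (\<lambda>_. 0)"
  unfolding is_weak_deriv_def
proof (intro allI impI)
  fix \<theta> assume t: "test_function S \<theta>"
  then have s: "smooth \<theta>" and per: "\<And>\<phi> r x. \<theta> (\<phi> + 2 * pi, r, x) = \<theta> (\<phi>, r, x)"
    by (simp_all add: test_function_def)
  obtain K where K: "K \<subseteq> interior (Omega S)" "\<And>\<phi> r x. (r, x) \<notin> K \<Longrightarrow> \<theta> (\<phi>, r, x) = 0"
    using t unfolding test_function_def by metis
  have z: "\<theta> (\<phi>, r, x) = 0" if "r = r_min S \<or> r = r_max S \<or> x = x_min S \<or> x = x_max S" for \<phi> r x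
    using K(1) that by (intro K(2)) (auto simp: Omega_def interior_Times)
  let ?f = "\<lambda>p. frechet_derivative \<theta> (at p) e"
  have m: "?f \<in> borel_measurable borel"
    by (rule borel_measurable_continuous_onI[OF smoothD(2)[OF smoothD(3)[OF s assms]]])
  have sf: "sigma_finite_measure N1" "sigma_finite_measure N2" "sigma_finite_measure N3"
    by (rule N1.sigma_finite_measure_axioms N2.sigma_finite_measure_axioms N3.sigma_finite_measure_axioms)+
  have sp: "sigma_finite_measure (N2 \<Otimes>\<^sub>M N3)" "sigma_finite_measure (N1 \<Otimes>\<^sub>M N3)" "sigma_finite_measure (N1 \<Otimes>\<^sub>M N2)"
    by (intro sigma_finite_pair_measure sf)+
  from assms consider "e = (1, 0, 0)" | "e = (0, 1, 0)" | "e = (0, 0, 1)" by (auto simp: Basis3)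
  then have "integral\<^sup>L M ?f = 0"
  proof cases
    case 1
    have "(LINT s|N1. ?f (\<tau>1 (q, s))) = 0" for q
      using slice_zero[OF s assms, of 0 "2 * pi" "(0, fst q, snd q)"] per[of 0 "fst q" "snd q"]
      by (simp add: \<tau>1_def 1 zero_prod_def[symmetric])
    then show ?thesis unfolding integral_\<tau>(1)[OF m] by (rule integral_slices_zero[OF sp(1) sf(1)])
  next
    case 2
    have "(LINT s|N2. ?f (\<tau>2 (q, s))) = 0" for q
      using slice_zero[OF s assms, of "r_min S" "r_max S" "(fst q, 0, snd q)"] lt
      by (simp add: \<tau>2_def 2 z)
    then show ?thesis unfolding integral_\<tau>(2)[OF m] by (rule integral_slices_zero[OF sp(2) sf(2)])
  next
    case 3
    have "(LINT s|N3. ?f (\<tau>3 (q, s))) = 0" for q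
      using slice_zero[OF s assms, of "x_min S" "x_max S" "(fst q, snd q, 0)"] lt
      by (simp add: \<tau>3_def 3 z)
    then show ?thesis unfolding integral_\<tau>(3)[OF m] by (rule integral_slices_zero[OF sp(3) sf(3)])
  qed
  then show "(LINT p|SM. c * ?f p) = - (LINT p|SM. 0 * \<theta> p)"
    by (simp add: integral_SM[OF m])
qed

lemma G_const: "(\<lambda>_. c) \<in> H1 S" "G (\<lambda>_. c) = (cls (\<lambda>_. c), 0)"
proof -
  have z: "cls (\<lambda>_. 0) = 0" using cls_scaleR[OF const_L2, of 0 1] by simp
  note H = H1I[of "\<lambda>_. c" "\<lambda>_ _. 0", OF const_L2 const_L2 weak_const[OF basis_mem(1)] weak_const[OF basis_mem(2)] weak_const[OF basis_mem(3)]]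
  show "(\<lambda>_. c) \<in> H1 S" by (rule H(1))
  show "G (\<lambda>_. c) = (cls (\<lambda>_. c), 0)" unfolding G_def using H(2) z by (simp add: zero_prod_def)
qed

end

section \<open>The lemma of du Bois-Reymond\<close>

lemma integral_lebesgue_support:
  fixes f :: "real \<Rightarrow> 'a::euclidean_space"
  assumes f: "continuous_on UNIV f" and z: "\<And>x. x \<notin> {a..b} \<Longrightarrow> f x = 0"
  shows "(LINT x|lebesgue. f x) = integral {a..b} f" "integrable lebesgue f"
proof -
  have eq: "(\<lambda>x. indicator {a..b} x *\<^sub>R f x) = f" using z by (auto simp: fun_eq_iff indicator_def)
  have s: "set_integrable lborel {a..b} f"
    by (rule borel_integrable_atLeastAtMost'[OF continuous_on_subset[OF f]]) simp
  have m: "f \<in> borel_measurable lborel" using borel_measurable_continuous_onI[OF f] by simp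
  show "(LINT x|lebesgue. f x) = integral {a..b} f"
    using set_borel_integral_eq_integral(2)[OF s]
    unfolding set_lebesgue_integral_def eq by (simp only: integral_completion[OF m])
  show "integrable lebesgue f"
    using s unfolding set_integrable_def eq by (simp only: integrable_completion[OF m])
qed

lemma integral_derivative:
  fixes F :: "real \<Rightarrow> 'a::euclidean_space"
  assumes "a \<le> b" "\<And>x. (F has_vector_derivative f x) (at x)"
  shows "integral {a..b} f = F b - F a"
  by (rule integral_unique[OF fundamental_theorem_of_calculus[OF assms(1)]])
     (rule has_vector_derivative_at_within[OF assms(2)])

lemma interval_testsD:
  assumes "f \<in> interval_tests a b"
  shows "Cinf f" "x \<notin> {a<..<b} \<Longrightarrow> f x = 0" "x \<notin> {a<..<b} \<Longrightarrow> deriv f x = 0"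
proof -
  obtain c d where cd: "a < c" "d < b" "\<And>x. x \<notin> {c..d} \<Longrightarrow> f x = 0" and fi: "Cinf f"
    using assms by (auto simp: interval_tests_def)
  show "Cinf f" by fact
  show "x \<notin> {a<..<b} \<Longrightarrow> f x = 0" using cd by auto
  assume x: "x \<notin> {a<..<b}"
  have "(f has_real_derivative 0) (at x)"
    by (rule has_field_derivative_transform_within_open[of "\<lambda>_. 0" _ _ "- {c..d}"])
       (use cd x in \<open>auto simp: open_Compl\<close>)
  then show "deriv f x = 0" by (rule DERIV_imp_deriv)
qed

lemma interval_bump_test:
  assumes "a \<le> l" "u \<le> b" shows "interval_bump l u n \<in> interval_tests a b"
proof -
  have "interval_bump l u n x = 0" if "x \<notin> {l + 1 / real (Suc n)..u - 1 / real (Suc n)}" for x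
    using interval_bump_support that by blast
  moreover have "a < l + 1 / real (Suc n)" "u - 1 / real (Suc n) < b"
    using assms by (smt (verit) divide_pos_pos of_nat_0_less_iff zero_less_Suc)+
  ultimately show ?thesis
    unfolding interval_tests_def using Cinf_interval_bump by blast
qed

lemma interval_bump_pos: "l < x \<Longrightarrow> x < u \<Longrightarrow> \<exists>n. 0 < interval_bump l u n x"
proof -
  assume "l < x" "x < u"
  then have "(\<lambda>n. interval_bump l u n x) \<longlonglongrightarrow> 1" using interval_bump_tendsto[of l u x] by simp
  then have "eventually (\<lambda>n. 0 < interval_bump l u n x) sequentially" by (rule order_tendstoD) simp
  then show ?thesis by (auto simp: eventually_sequentially)
qed

lemma nonpos_if_orthogonal_to_bumps:
  fixes \<psi> :: "real \<Rightarrow> real"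
  assumes \<psi>: "continuous_on UNIV \<psi>" and x: "a < x" "x < b"
    and 0: "\<And>f. f \<in> interval_tests a b \<Longrightarrow> integral {a..b} (\<lambda>x. f x * \<psi> x) = 0"
  shows "\<psi> x \<le> 0"
proof (rule ccontr)
  assume "\<not> \<psi> x \<le> 0"
  then have px: "\<psi> x > 0" by simp
  have "isCont \<psi> x" using \<psi> by (simp add: continuous_on_eq_continuous_at)
  then have "eventually (\<lambda>y. \<psi> y > 0) (nhds x)" using px
    by (auto simp: isCont_def tendsto_at_iff_tendsto_nhds intro: order_tendstoD)
  then obtain d where d: "d > 0" "\<And>y. dist y x < d \<Longrightarrow> \<psi> y > 0" by (auto simp: eventually_nhds_metric)
  define l u where "l = max a (x - d)" and "u = min b (x + d)"
  have lu: "l < x" "x < u" "a \<le> l" "u \<le> b" using d x by (auto simp: l_def u_def)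
  obtain n where n: "0 < interval_bump l u n x" using interval_bump_pos[OF lu(1,2)] by blast
  let ?f = "interval_bump l u n"
  have "?f y * \<psi> y \<ge> 0" for y
  proof (cases "l < y \<and> y < u")
    case True
    then have "\<psi> y > 0" by (intro d(2)) (auto simp: l_def u_def dist_real_def)
    then show ?thesis using interval_bump_range[of l u n y] by simp
  next
    case False
    then have "?f y = 0" using interval_testsD(2)[OF interval_bump_test[of l l u u n]] by simp
    then show ?thesis by simp
  qed
  moreover have "continuous_on {a..b} (\<lambda>y. ?f y * \<psi> y)"
    by (intro continuous_intros Cinf_continuous_on Cinf_interval_bump continuous_on_subset[OF \<psi>]) simp
  ultimately have "\<forall>y\<in>{a..b}. ?f y * \<psi> y = 0"
    using 0[OF interval_bump_test[OF lu(3,4)]] x integral_eq_0_iff[of a b "\<lambda>y. ?f y * \<psi> y"] by simp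
  then have "?f x * \<psi> x = 0" using x by simp
  then show False using n px by simp
qed

text \<open>If P is a primitive of F, then p + P is orthogonal to derivatives of tests, that is, to
  all tests of mean zero, and so it is constant. Continuity upgrades the distributional identity to
  a classical derivative.\<close>

lemma du_Bois_Reymond:
  fixes p F :: "real \<Rightarrow> real"
  assumes p: "continuous_on UNIV p" and F: "continuous_on UNIV F"
    and eq: "\<And>\<theta>. \<theta> \<in> interval_tests a b \<Longrightarrow> (LINT t|lebesgue. \<theta> t * F t) = (LINT t|lebesgue. deriv \<theta> t * p t)"
    and t: "a < t" "t < b"
  shows "(p has_real_derivative - F t) (at t)"
proof -
  let ?T = "interval_tests a b"
  let ?J = "\<lambda>f::real \<Rightarrow> real. integral {a..b} f"
  have ab: "a < b" using t by simp
  interpret test_space a b ?T by (rule test_space_interval[OF ab])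
  have "\<exists>P. \<forall>x. -\<infinity> < ereal x \<longrightarrow> ereal x < \<infinity> \<longrightarrow> (P has_vector_derivative F x) (at x)"
    by (rule einterval_antiderivative) (use F in \<open>auto simp: continuous_on_eq_continuous_at\<close>)
  then obtain P where P: "\<And>x. (P has_real_derivative F x) (at x)"
    by (auto simp: has_real_derivative_iff_has_vector_derivative)
  have Pc: "continuous_on UNIV P" by (rule DERIV_continuous_on[OF P[THEN has_field_derivative_at_within]])
  define \<psi> where "\<psi> = (\<lambda>x. p x + P x)"
  have \<psi>: "continuous_on UNIV \<psi>" unfolding \<psi>_def by (intro continuous_intros p Pc)
  have int: "f integrable_on {a..b}" if "continuous_on UNIV f" for f :: "real \<Rightarrow> real"
    by (rule integrable_continuous_real[OF continuous_on_subset[OF that]]) simp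
  have 1: "?J (\<lambda>x. deriv \<theta> x * \<psi> x) = 0" if \<theta>: "\<theta> \<in> ?T" for \<theta>
  proof -
    note Th = interval_testsD[OF \<theta>] and Cinf_deriv[OF interval_testsD(1)[OF \<theta>]]
    have c: "continuous_on UNIV \<theta>" "continuous_on UNIV (deriv \<theta>)"
      by (intro Cinf_continuous_on Th Cinf_deriv(2))+
    have "?J (\<lambda>x. \<theta> x * F x) = ?J (\<lambda>x. deriv \<theta> x * p x)"
      using eq[OF \<theta>] Th(2,3)
      by (subst (asm) (1 2) integral_lebesgue_support(1)[of _ a b]) (auto intro!: continuous_intros c F p)
    moreover have "?J (\<lambda>x. deriv \<theta> x * P x + \<theta> x * F x) = \<theta> b * P b - \<theta> a * P a"
    proof (rule integral_derivative)
      show "((\<lambda>x. \<theta> x * P x) has_vector_derivative (deriv \<theta> x * P x + \<theta> x * F x)) (at x)" for x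
        using DERIV_mult[OF Cinf_deriv(1)[OF Th(1)] P, of x]
        by (simp add: has_real_derivative_iff_has_vector_derivative algebra_simps)
    qed (use ab in simp)
    moreover have "?J (\<lambda>x. deriv \<theta> x * P x + \<theta> x * F x) = ?J (\<lambda>x. deriv \<theta> x * P x) + ?J (\<lambda>x. \<theta> x * F x)"
      by (intro integral_add int continuous_intros c F Pc)
    moreover have "?J (\<lambda>x. deriv \<theta> x * p x + deriv \<theta> x * P x) = ?J (\<lambda>x. deriv \<theta> x * p x) + ?J (\<lambda>x. deriv \<theta> x * P x)"
      by (intro integral_add int continuous_intros c p Pc)
    ultimately show ?thesis using Th(2)[of a] Th(2)[of b] by (simp add: \<psi>_def distrib_left)
  qed
  have 2: "?J (\<lambda>x. f x * \<psi> x) = 0" if f: "f \<in> ?T" "?J f = 0" for f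
  proof -
    have c: "continuous_on UNIV f" by (intro Cinf_continuous_on interval_testsD(1)[OF f(1)])
    have "integral\<^sup>L (Nm a b) f = (LINT x : {a..b} | lborel. f x)"
      unfolding set_lebesgue_integral_def by (rule integral_Nm) (rule borel_measurable_continuous_onI[OF c])
    also have "\<dots> = ?J f"
      by (intro set_borel_integral_eq_integral borel_integrable_atLeastAtMost' continuous_on_subset[OF c]) simp
    finally obtain F where F: "F \<in> ?T" "\<And>x. (F has_real_derivative f x) (at x)"
      using T_prim[OF f(1)] f(2) by auto
    have "deriv F = f" using DERIV_imp_deriv[OF F(2)] by blast
    then show ?thesis using 1[OF F(1)] by simp
  qed
  obtain n where n: "0 < interval_bump a b n t" using interval_bump_pos[OF t] by blast
  define h where "h = interval_bump a b n"
  have h: "h \<in> ?T" unfolding h_def by (rule interval_bump_test) simp_all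
  have hc: "continuous_on UNIV h" by (rule Cinf_continuous_on[OF interval_testsD(1)[OF h]])
  have "?J h \<noteq> 0"
  proof
    assume J: "?J h = 0"
    have "h x \<ge> 0" for x using interval_bump_range[of a b n x] by (simp add: h_def)
    from iffD1[OF integral_eq_0_iff[OF continuous_on_subset[OF hc] ab this] J] have "h t = 0" using t by simp
    then show False using n by (simp add: h_def)
  qed
  \<comment> \<open>The only possible value of the constant: the average of \<psi> with weight
    \<open>h\<close>.\<close>
  define c where "c = ?J (\<lambda>x. h x * \<psi> x) / ?J h"
  have 3: "?J (\<lambda>x. f x * (\<psi> x - c)) = 0" if f: "f \<in> ?T" for f
  proof -
    let ?k = "?J f / ?J h"
    have fc: "continuous_on UNIV f" by (rule Cinf_continuous_on[OF interval_testsD(1)[OF f]])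
    have "?J (\<lambda>x. f x - ?k * h x) = 0"
      using \<open>?J h \<noteq> 0\<close> by (subst integral_diff) (auto intro!: int continuous_intros fc hc)
    from 2[OF T_comb[OF f h] this] have "0 = ?J (\<lambda>x. f x * \<psi> x - ?k * (h x * \<psi> x))" by (simp add: left_diff_distrib mult.assoc)
    also have "\<dots> = ?J (\<lambda>x. f x * \<psi> x) - ?k * ?J (\<lambda>x. h x * \<psi> x)"
      using \<open>?J h \<noteq> 0\<close> by (subst integral_diff) (auto intro!: int continuous_intros fc hc \<psi>)
    finally have "?J (\<lambda>x. f x * \<psi> x) = ?J f * c" by (simp add: c_def)
    moreover have "?J (\<lambda>x. f x * \<psi> x - f x * c) = ?J (\<lambda>x. f x * \<psi> x) - ?J f * c"
      by (subst integral_diff) (auto intro!: int continuous_intros fc \<psi>)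
    ultimately show ?thesis by (simp add: right_diff_distrib)
  qed
  have 4: "p x = c - P x" if x: "x \<in> {a<..<b}" for x
  proof -
    have "\<psi> x - c \<le> 0" using x by (intro nonpos_if_orthogonal_to_bumps[of "\<lambda>x. \<psi> x - c" a x b] 3 continuous_intros \<psi>) auto
    moreover have "c - \<psi> x \<le> 0"
    proof (rule nonpos_if_orthogonal_to_bumps[of "\<lambda>x. c - \<psi> x" a x b])
      show "?J (\<lambda>x. f x * (c - \<psi> x)) = 0" if "f \<in> ?T" for f
        using 3[OF that] integral_neg[of "{a..b}" "\<lambda>x. f x * (\<psi> x - c)"] by (simp add: algebra_simps)
    qed (use x in \<open>auto intro!: continuous_intros \<psi>\<close>)
    ultimately show ?thesis by (simp add: \<psi>_def)
  qed
  show ?thesis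
    by (rule has_field_derivative_transform_within_open[of "\<lambda>x. c - P x" _ _ "{a<..<b}"])
       (use t 4 in \<open>auto intro!: derivative_eq_intros P\<close>)
qed

context slab begin

section \<open>The forms as inner products\<close>

definition pr :: "(real \<Rightarrow> real \<Rightarrow> real) \<Rightarrow> cfun \<Rightarrow> cfun \<Rightarrow> complex" where
  "pr k f g = (LINT p|SM. f p * cnj (g p) * complex_of_real (ext k p))"

lemma bm_real: "h \<in> borel_measurable borel \<Longrightarrow> (\<And>p. \<bar>h p\<bar> \<le> C) \<Longrightarrow> bounded_measurable (\<lambda>p. complex_of_real (h p))"
  unfolding bounded_measurable_def
  by (intro conjI exI[of _ C] allI measurable_completion)
     (auto intro!: measurable_compose[OF _ borel_measurable_continuous_onI[OF continuous_on_of_real[OF continuous_on_id]]])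

lemma bm_ext: "coef_cont k \<Longrightarrow> bounded_measurable (\<lambda>p. complex_of_real (ext k p))"
proof -
  assume k: "coef_cont k"
  obtain C where "\<And>q. \<bar>extq k q\<bar> \<le> C" using ext_bounded[OF k] by blast
  then show ?thesis by (intro bm_real[of _ C] ext_measurable k) (simp add: ext_def)
qed

lemma bm_sqrt: "coef_cont k \<Longrightarrow> bounded_measurable (\<lambda>p. complex_of_real (sqrt (ext k p)))"
proof -
  assume k: "coef_cont k"
  obtain C where C: "\<And>q. \<bar>extq k q\<bar> \<le> C" using ext_bounded[OF k] by blast
  have "\<bar>sqrt (ext k p)\<bar> \<le> sqrt C" for p
    using C[of "snd p"] by (simp add: abs_le_iff real_sqrt_minus[symmetric] ext_def)
  moreover have "(\<lambda>p. sqrt (ext k p)) \<in> borel_measurable borel"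
    by (rule measurable_compose[OF ext_measurable[OF k] borel_measurable_continuous_onI]) (intro continuous_intros)
  ultimately show ?thesis by (rule bm_real[rotated])
qed

lemma pr_integrable:
  "coef_cont k \<Longrightarrow> f \<in> L2 S \<Longrightarrow> g \<in> L2 S \<Longrightarrow> integrable SM (\<lambda>p. f p * cnj (g p) * complex_of_real (ext k p))"
  using L2_integrable[OF L2_mult[OF bm_ext]] by (simp add: mult_ac)

lemma pr_inner:
  "coef_cont k \<Longrightarrow> f \<in> L2 S \<Longrightarrow> g \<in> L2 S \<Longrightarrow> inner (cls f) (mul (\<lambda>p. complex_of_real (ext k p)) (cls g)) = Re (pr k f g)"
proof -
  assume k: "coef_cont k" and f: "f \<in> L2 S" and g: "g \<in> L2 S"
  show ?thesis
    unfolding cls_mult[OF bm_ext[OF k] g, symmetric] inner_cls[OF f L2_mult[OF bm_ext[OF k] g]] pr_def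
      complex_cnj_mult complex_cnj_complex_of_real by (simp only: mult_ac)
qed

lemma pr_sqrt:
  assumes k: "coef_cont k" "\<And>p. ext k p \<ge> 0" and fg: "f \<in> L2 S" "g \<in> L2 S"
  shows "inner (mul (\<lambda>p. complex_of_real (sqrt (ext k p))) (cls f)) (mul (\<lambda>p. complex_of_real (sqrt (ext k p))) (cls g)) = Re (pr k f g)"
proof -
  have *: "complex_of_real (sqrt (ext k p)) * f p * cnj (complex_of_real (sqrt (ext k p)) * g p) = f p * cnj (g p) * complex_of_real (ext k p)" for p
  proof -
    have "complex_of_real (ext k p) = complex_of_real (sqrt (ext k p)) * complex_of_real (sqrt (ext k p))"
      using k(2)[of p] by (simp flip: of_real_mult)
    then show ?thesis by (simp only: complex_cnj_mult complex_cnj_complex_of_real mult_ac)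
  qed
  show ?thesis
    unfolding cls_mult[OF bm_sqrt[OF k(1)] fg(1), symmetric] cls_mult[OF bm_sqrt[OF k(1)] fg(2), symmetric]
      inner_cls[OF L2_mult[OF bm_sqrt[OF k(1)] fg(1)] L2_mult[OF bm_sqrt[OF k(1)] fg(2)]] * pr_def ..
qed

lemma pr_cnj: "cnj (pr k f g) = pr k g f"
  unfolding pr_def Bochner_Integration.integral_cnj[symmetric] by (simp add: mult_ac)

lemma pr_left: "pr k (\<lambda>p. c * f p) g = c * pr k f g"
  by (simp add: pr_def mult.assoc)

lemma pr_right: "pr k f (\<lambda>p. c * g p) = cnj c * pr k f g"
  using arg_cong[OF pr_left[of k c g f], of cnj] by (simp add: pr_cnj)

text \<open>The real part is an inner product of classes; the imaginary part is the real part after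
  multiplying the first argument by -\<i>.\<close>

lemma pr_cong:
  assumes k: "coef_cont k" and L: "f \<in> L2 S" "g \<in> L2 S" "f' \<in> L2 S" "g' \<in> L2 S" and eq: "cls f = cls f'" "cls g = cls g'"
  shows "pr k f g = pr k f' g'"
proof (rule complex_eqI)
  show "Re (pr k f g) = Re (pr k f' g')"
    using pr_inner[OF k L(1,2)] pr_inner[OF k L(3,4)] eq by simp
  have "Re (pr k (\<lambda>p. (-\<i>) * f p) g) = Re (pr k (\<lambda>p. (-\<i>) * f' p) g')"
    unfolding pr_inner[OF k L2_cmult[OF L(1)] L(2), symmetric] pr_inner[OF k L2_cmult[OF L(3)] L(4), symmetric]
      cls_cmult[OF L(1)] cls_cmult[OF L(3)] eq ..
  then show "Im (pr k f g) = Im (pr k f' g')" by (simp only: pr_left) simp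
qed

lemma integral_A_pr: "integral_A S (\<lambda>p. f p * cnj (g p)) = pr (coef_A S) f g"
  by (simp add: integral_A_ext pr_def)

lemma ext_eq: "p \<in> Sig \<Longrightarrow> ext k p = k (fst (snd p)) (snd (snd p))"
  using Sig_iff[of "fst p" "fst (snd p)" "snd (snd p)"] by (simp add: ext_def extq_def)

lemma form_q_pr:
  assumes u: "u \<in> H1 S" and \<eta>: "\<eta> \<in> H1 S"
  shows "form_q S u \<eta> = pr (coef_Phi S) (D_phi S u) (D_phi S \<eta>) + pr (\<lambda>r x. Delta_r S r) (D_r S u) (D_r S \<eta>)
    + pr (\<lambda>r x. Delta_x S x) (D_x S u) (D_x S \<eta>)"
proof -
  note I1 = pr_integrable[OF coef_continuous(3) D_L2(1)[OF u] D_L2(1)[OF \<eta>]]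
    and I2 = pr_integrable[OF coef_continuous(4) D_L2(2)[OF u] D_L2(2)[OF \<eta>]]
    and I3 = pr_integrable[OF coef_continuous(5) D_L2(3)[OF u] D_L2(3)[OF \<eta>]]
  show ?thesis
    unfolding pr_def Bochner_Integration.integral_add[OF I1 I2, symmetric]
      Bochner_Integration.integral_add[OF Bochner_Integration.integrable_add[OF I1 I2] I3, symmetric] form_q_def
    by (intro Bochner_Integration.integral_cong refl) (simp add: split_beta ext_eq mult_ac)
qed

lemma form_c_pr: "form_c S v \<eta> = 2 * pr (coef_B S) v (D_phi S \<eta>)"
  unfolding pr_def form_c_def
  by (intro arg_cong[of _ _ "(*) 2"] Bochner_Integration.integral_cong refl) (simp add: split_beta ext_eq mult_ac)

lemma D_cmult:
  assumes "\<eta> \<in> H1 S"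
  shows "cls (D_phi S (\<lambda>p. c * \<eta> p)) = cls (\<lambda>p. c * D_phi S \<eta> p)" "cls (D_r S (\<lambda>p. c * \<eta> p)) = cls (\<lambda>p. c * D_r S \<eta> p)"
    "cls (D_x S (\<lambda>p. c * \<eta> p)) = cls (\<lambda>p. c * D_x S \<eta> p)"
  using H1_cmult(2)[OF assms, of c] unfolding G_def grad_def mul4_def by (simp_all add: cls_cmult D_L2[OF assms])

text \<open>The chosen derivative of a multiple is the multiple of the chosen derivative only almost
  everywhere, hence the passage through classes.\<close>

lemma form_cmult:
  assumes u: "u \<in> H1 S" and v: "v \<in> L2 S" and \<eta>: "\<eta> \<in> H1 S"
  shows "form_q S u (\<lambda>p. c * \<eta> p) = cnj c * form_q S u \<eta>" "form_c S v (\<lambda>p. c * \<eta> p) = cnj c * form_c S v \<eta>"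
proof -
  note D = D_L2[OF u] and E = D_L2[OF \<eta>] and Ec = D_L2[OF H1_cmult(1)[OF \<eta>, of c]]
  note F = L2_cmult[OF E(1), of c] L2_cmult[OF E(2), of c] L2_cmult[OF E(3), of c]
  show "form_q S u (\<lambda>p. c * \<eta> p) = cnj c * form_q S u \<eta>"
    unfolding form_q_pr[OF u H1_cmult(1)[OF \<eta>]] form_q_pr[OF u \<eta>]
      pr_cong[OF coef_continuous(3) D(1) Ec(1) D(1) F(1) refl D_cmult(1)[OF \<eta>]]
      pr_cong[OF coef_continuous(4) D(2) Ec(2) D(2) F(2) refl D_cmult(2)[OF \<eta>]]
      pr_cong[OF coef_continuous(5) D(3) Ec(3) D(3) F(3) refl D_cmult(3)[OF \<eta>]] pr_right
    by (simp add: distrib_left)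
  show "form_c S v (\<lambda>p. c * \<eta> p) = cnj c * form_c S v \<eta>"
    unfolding form_c_pr pr_cong[OF coef_continuous(2) v Ec(1) v F(1) refl D_cmult(1)[OF \<eta>]] pr_right
    by simp
qed

text \<open>Multiplying both arguments by the square root of a weight turns a weighted product into
  a plain one. This supplies the operators that the abstract wave equation expects:
  \<open>aop\<close> for A, \<open>wop\<close> for q, and \<open>bop\<close> for the mixed form
  including its factor 2.\<close>

definition aop :: "vec \<Rightarrow> vec" where
  "aop = mul (\<lambda>p. complex_of_real (sqrt (ext (coef_A S) p)))"

definition wop :: "vec \<times> vec \<times> vec \<Rightarrow> vec \<times> vec \<times> vec" where
  "wop z = (mul (\<lambda>p. complex_of_real (sqrt (ext (coef_Phi S) p))) (fst z),
     mul (\<lambda>p. complex_of_real (sqrt (ext (\<lambda>r x. Delta_r S r) p))) (fst (snd z)),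
     mul (\<lambda>p. complex_of_real (sqrt (ext (\<lambda>r x. Delta_x S x) p))) (snd (snd z)))"

definition bop :: "vec \<times> vec \<times> vec \<Rightarrow> vec" where
  "bop z = 2 *\<^sub>R mul (\<lambda>p. complex_of_real (ext (coef_B S) p)) (fst z)"

lemma ext_pos':
  assumes "coef_cont k" "\<And>r x. (r, x) \<in> Omega S \<Longrightarrow> k r x > 0"
  shows "\<exists>c>0. \<forall>p. c \<le> ext k p"
proof -
  obtain c where "c > 0" "\<forall>q. c \<le> extq k q" using ext_pos[OF assms] by blast
  then show ?thesis by (intro exI[of _ c]) (simp add: ext_def)
qed

lemma ext_lower:
  "\<exists>c>0. \<forall>p. c \<le> ext (coef_A S) p" "\<exists>c>0. \<forall>p. c \<le> ext (coef_Phi S) p"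
  "\<exists>c>0. \<forall>p. c \<le> ext (\<lambda>r x. Delta_r S r) p" "\<exists>c>0. \<forall>p. c \<le> ext (\<lambda>r x. Delta_x S x) p"
  proof -
  show "\<exists>c>0. \<forall>p. c \<le> ext (coef_A S) p" by (rule ext_pos'[OF coef_continuous(1)]) (rule pos)
  show "\<exists>c>0. \<forall>p. c \<le> ext (coef_Phi S) p" by (rule ext_pos'[OF coef_continuous(3)]) (rule pos)
  show "\<exists>c>0. \<forall>p. c \<le> ext (\<lambda>r x. Delta_r S r) p" by (rule ext_pos'[OF coef_continuous(4)]) (rule pos)
  show "\<exists>c>0. \<forall>p. c \<le> ext (\<lambda>r x. Delta_x S x) p" by (rule ext_pos'[OF coef_continuous(5)]) (rule pos)
qed

lemma nonneg_if_lower: "\<exists>c>0. \<forall>p. c \<le> h p \<Longrightarrow> 0 \<le> (h p :: real)"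
  by (meson less_imp_le order_trans)

lemmas ext_nonneg = ext_lower[THEN nonneg_if_lower]

lemma aop_inner: "f \<in> L2 S \<Longrightarrow> g \<in> L2 S \<Longrightarrow> inner (aop (cls f)) (aop (cls g)) = Re (integral_A S (\<lambda>p. f p * cnj (g p)))"
  unfolding aop_def integral_A_pr by (rule pr_sqrt[OF coef_continuous(1) ext_nonneg(1)])

lemma wop_inner: "u \<in> H1 S \<Longrightarrow> \<eta> \<in> H1 S \<Longrightarrow> inner (wop (grad u)) (wop (grad \<eta>)) = Re (form_q S u \<eta>)"
  unfolding wop_def grad_def
  by (simp add: form_q_pr pr_sqrt coef_continuous ext_nonneg D_L2)

lemma bop_inner: "v \<in> L2 S \<Longrightarrow> \<eta> \<in> H1 S \<Longrightarrow> inner (cls v) (bop (grad \<eta>)) = Re (form_c S v \<eta>)"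
  unfolding bop_def grad_def form_c_pr
  by (simp add: pr_inner[OF coef_continuous(2) _ D_L2(1)])

text \<open>\<open>skew_phi\<close> moves the derivative from v to u at the price of a sign, and
  Hermitian symmetry of the weighted product exchanges the two arguments without changing the real
  part.\<close>

lemma bop_skew: "u \<in> H1 S \<Longrightarrow> v \<in> H1 S \<Longrightarrow> inner (cls u) (bop (grad v)) = - inner (cls v) (bop (grad u))"
proof -
  assume u: "u \<in> H1 S" and v: "v \<in> H1 S"
  note I = pr_integrable[OF coef_continuous(2) H1_L2[OF u] D_L2(1)[OF v]] pr_integrable[OF coef_continuous(2) D_L2(1)[OF u] H1_L2[OF v]]
  have "pr (coef_B S) u (D_phi S v) + pr (coef_B S) (D_phi S u) v = 0"
    using skew_phi[OF u v] unfolding pr_def Bochner_Integration.integral_add[OF I, symmetric] by (simp only: distrib_right)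
  then have "Re (pr (coef_B S) u (D_phi S v)) = - Re (pr (coef_B S) (D_phi S u) v)" by (simp add: add_eq_0_iff2)
  also have "Re (pr (coef_B S) (D_phi S u) v) = Re (pr (coef_B S) v (D_phi S u))"
    by (subst pr_cnj[symmetric]) simp
  finally show ?thesis unfolding bop_inner[OF H1_L2[OF u] v] bop_inner[OF H1_L2[OF v] u] form_c_pr by simp
qed

lemma linear_ops: "bounded_linear aop" "bounded_linear wop" "bounded_linear bop"
proof -
  note m = bounded_linear_mul[OF bm_sqrt]
  show "bounded_linear aop" unfolding aop_def by (rule m[OF coef_continuous(1)])
  show "bounded_linear wop"
    unfolding wop_def[abs_def]
    by (rule bounded_linear_Pair[OF bounded_linear_compose[OF m[OF coef_continuous(3)] bounded_linear_fst]
        bounded_linear_Pair[OF bounded_linear_compose[OF m[OF coef_continuous(4)] bounded_linear_compose[OF bounded_linear_fst bounded_linear_snd]]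
          bounded_linear_compose[OF m[OF coef_continuous(5)] bounded_linear_compose[OF bounded_linear_snd bounded_linear_snd]]]])
  show "bounded_linear bop"
    unfolding bop_def[abs_def]
    by (rule bounded_linear_compose[OF bounded_linear_scaleR_right
          bounded_linear_compose[OF bounded_linear_mul[OF bm_ext[OF coef_continuous(2)]] bounded_linear_fst]])
qed

lemma mul_sqrt_lower:
  assumes "coef_cont k" "\<exists>c>0. \<forall>p. c \<le> ext k p"
  shows "\<exists>c>0. \<forall>x. c * norm x \<le> norm (mul (\<lambda>p. complex_of_real (sqrt (ext k p))) x)"
proof -
  obtain c where c: "c > 0" "\<And>p. c \<le> ext k p" using assms(2) by blast
  have "sqrt c \<le> cmod (complex_of_real (sqrt (ext k p)))" for p
    using c(1) c(2)[of p] by simp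
  then show ?thesis using c(1) norm_mul_ge[OF bm_sqrt[OF assms(1)]] by (intro exI[of _ "sqrt c"]) simp
qed

lemma aop_lower: "\<exists>c>0. \<forall>x. c * norm x \<le> norm (aop x)"
  unfolding aop_def by (rule mul_sqrt_lower[OF coef_continuous(1) ext_lower(1)])

lemma wop_lower: "\<exists>c>0. \<forall>z. c * norm z \<le> norm (wop z)"
proof -
  obtain c1 where c1: "c1 > 0" "\<And>x. c1 * norm x \<le> norm (mul (\<lambda>p. complex_of_real (sqrt (ext (coef_Phi S) p))) x)"
    using mul_sqrt_lower[OF coef_continuous(3) ext_lower(2)] by blast
  obtain c2 where c2: "c2 > 0" "\<And>x. c2 * norm x \<le> norm (mul (\<lambda>p. complex_of_real (sqrt (ext (\<lambda>r x. Delta_r S r) p))) x)"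
    using mul_sqrt_lower[OF coef_continuous(4) ext_lower(3)] by blast
  obtain c3 where c3: "c3 > 0" "\<And>x. c3 * norm x \<le> norm (mul (\<lambda>p. complex_of_real (sqrt (ext (\<lambda>r x. Delta_x S x) p))) x)"
    using mul_sqrt_lower[OF coef_continuous(5) ext_lower(4)] by blast
  define c where "c = min c1 (min c2 c3)"
  have c: "c > 0" "c \<le> c1" "c \<le> c2" "c \<le> c3" using c1 c2 c3 by (auto simp: c_def)
  have sq: "c\<^sup>2 * (norm x)\<^sup>2 \<le> (norm y)\<^sup>2" if "d * norm x \<le> norm y" "c \<le> d" for x y :: vec and d
  proof -
    have "c * norm x \<le> norm y" using that mult_right_mono[OF that(2), of "norm x"] by simp
    then show ?thesis using c(1) by (simp flip: power_mult_distrib add: power_mono)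
  qed
  have "c * norm z \<le> norm (wop z)" for z
  proof (rule power2_le_imp_le)
    obtain x y w where z: "z = (x, y, w)" by (rule prod_cases3)
    show "(c * norm z)\<^sup>2 \<le> (norm (wop z))\<^sup>2"
      using sq[OF c1(2)[of x] c(2)] sq[OF c2(2)[of y] c(3)] sq[OF c3(2)[of w] c(4)]
      by (simp add: z wop_def norm_Pair power_mult_distrib distrib_left)
  qed simp
  then show ?thesis using c(1) by blast
qed

text \<open>Skewness moves the derivative onto the constant. This is why an affine function of time
  solves the equation in spite of the mixed term.\<close>

lemma bop_const: "\<eta> \<in> H1 S \<Longrightarrow> inner (cls (\<lambda>_. c)) (bop (grad \<eta>)) = 0"
proof -
  assume \<eta>: "\<eta> \<in> H1 S"
  have "grad (\<lambda>_. c) = 0" using G_const(2)[of c] by (simp add: G_def)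
  then have "inner (cls \<eta>) (bop (grad (\<lambda>_. c))) = 0"
    using linear_0[OF bounded_linear.linear[OF linear_ops(3)]] by simp
  then show ?thesis using bop_skew[OF G_const(1)[of c] \<eta>] by simp
qed

end

section \<open>The reflecting domain as a closed subspace of the Hilbert space\<close>

locale slab_domain = slab +
  fixes V :: "cfun set"
  assumes domain: "reflecting_domain S V"
begin

lemmas dom1 = domain[unfolded reflecting_domain_def]
lemmas dom2 = dom1[THEN conjunct2]
lemmas dom3 = dom2[THEN conjunct2]
lemmas dom4 = dom3[THEN conjunct2]
lemmas dom5 = dom4[THEN conjunct2]

lemmas V_H1 = subsetD[OF dom1[THEN conjunct1]]
lemmas V_add = dom2[THEN conjunct1, rule_format]
lemmas V_cmult = dom3[THEN conjunct1, rule_format]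
lemmas V_dense = dom5[THEN conjunct1, rule_format]

lemma V_lim: "(\<And>n. f n \<in> V) \<Longrightarrow> u \<in> H1 S \<Longrightarrow> (\<lambda>n. norm_H1 S (\<lambda>p. f n p - u p)) \<longlonglongrightarrow> 0 \<Longrightarrow> u \<in> V"
  by (rule dom4[THEN conjunct1, THEN spec, THEN spec, THEN mp]) (intro conjI allI)

lemma V_one: "(\<lambda>p. 1) \<in> V"
  by (rule dom5[THEN conjunct2, THEN conjunct2])

lemmas V_L2 = H1_L2[OF V_H1]

lemma V_const: "(\<lambda>_. c) \<in> V"
  using V_cmult[OF V_one, of c] by simp

lemma V_diff: "u \<in> V \<Longrightarrow> v \<in> V \<Longrightarrow> (\<lambda>p. u p - v p) \<in> V"
  using V_add[OF _ V_cmult[of v "-1"], of u] by simp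

lemma V_limit:
  assumes "\<And>n. f n \<in> V" "u \<in> H1 S" "(\<lambda>n. G (f n)) \<longlonglongrightarrow> G u" shows "u \<in> V"
proof (rule V_lim[OF assms(1,2)])
  have "(\<lambda>n. norm (G (f n) - G u)) \<longlonglongrightarrow> 0" using assms(3) by (simp add: LIM_zero_iff tendsto_norm_zero_iff)
  then show "(\<lambda>n. norm_H1 S (\<lambda>p. f n p - u p)) \<longlonglongrightarrow> 0"
    by (simp add: norm_G[OF H1_diff(1)[OF V_H1[OF assms(1)] assms(2)], symmetric] H1_diff(2)[OF V_H1[OF assms(1)] assms(2)])
qed

text \<open>A limit of graphs is the graph of some H1 function by completeness of H1, and that
  function belongs to V by sequential closedness.\<close>

lemma W_closed: "closed (G ` V)"
proof -
  have W: "l \<in> G ` V" if x: "\<And>n. x n \<in> G ` V" and l: "x \<longlonglongrightarrow> l" for x l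
  proof -
  define f where "f n = (SOME u. u \<in> V \<and> G u = x n)" for n
  have f: "f n \<in> V \<and> G (f n) = x n" for n
  proof -
    have "\<exists>u. u \<in> V \<and> G u = x n" using x[of n] by (rule imageE) (intro exI conjI, assumption, rule sym)
    from someI_ex[OF this] show ?thesis unfolding f_def .
  qed
  have l': "(\<lambda>n. G (f n)) \<longlonglongrightarrow> l" using l by (simp only: conjunct2[OF f])
  obtain v where v: "v \<in> H1 S" "G v = l" using H1_closed[OF V_H1[OF conjunct1[OF f]] l'] by (rule bexE)
  have "v \<in> V" by (rule V_limit[of f v, OF conjunct1[OF f] v(1)]) (simp only: v(2) l')
  then show ?thesis unfolding v(2)[symmetric] by (rule imageI)
  qed
  show ?thesis
    unfolding closed_sequential_limits by (intro allI impI, elim conjE, rule W, erule spec, assumption)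
qed

lemma W_subspace: "subspace (G ` V)"
proof (rule subspaceI)
  have "G (\<lambda>_. 0) = 0" using G_const(2)[of 0] cls_scaleR[OF const_L2, of 0 1] by (simp add: zero_prod_def)
  then show "0 \<in> G ` V" using V_const[of 0] by (intro rev_image_eqI) simp_all
  show "x + y \<in> G ` V" if xy: "x \<in> G ` V" "y \<in> G ` V" for x y
  proof -
    obtain u where "x = G u" "u \<in> V" using xy(1) by (rule imageE)
    moreover obtain v where "y = G v" "v \<in> V" using xy(2) by (rule imageE)
    ultimately
    have "x + y = G (\<lambda>p. u p + v p)" "(\<lambda>p. u p + v p) \<in> V"
      by (simp_all only: H1_add(2)[OF V_H1 V_H1] V_add)
    then show ?thesis by blast
  qed
  show "c *\<^sub>R x \<in> G ` V" if x: "x \<in> G ` V" for c x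
  proof -
    obtain u where "x = G u" "u \<in> V" using x by (rule imageE)
    then have "c *\<^sub>R x = G (\<lambda>p. complex_of_real c * u p)" "(\<lambda>p. complex_of_real c * u p) \<in> V"
      by (simp_all only: H1_cmult(2)[OF V_H1] V_cmult mul4_real)
    then show ?thesis by blast
  qed
qed

end

section \<open>Energy solutions as curves in the Hilbert space\<close>

lemma time_testD:
  assumes "time_test \<theta>"
  shows "(\<theta> has_vector_derivative vector_derivative \<theta> (at t)) (at t)" "continuous_on UNIV \<theta>"
    "continuous_on UNIV (\<lambda>t. vector_derivative \<theta> (at t))"
proof -
  have s: "smooth \<theta>" using assms by (simp add: time_test_def)
  have d: "(\<theta> has_vector_derivative frechet_derivative \<theta> (at t) 1) (at t)" for t
  proof -
    note h = smoothD(1)[OF s, of t]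
    have lin: "linear (frechet_derivative \<theta> (at t))" using h by (rule has_derivative_linear)
    have eq: "frechet_derivative \<theta> (at t) = (\<lambda>x. x *\<^sub>R frechet_derivative \<theta> (at t) 1)"
    proof
      fix x show "frechet_derivative \<theta> (at t) x = x *\<^sub>R frechet_derivative \<theta> (at t) 1"
        using linear_scale[OF lin, of x 1] by (simp only: real_scaleR_def mult_1_right)
    qed
    show ?thesis unfolding has_vector_derivative_def eq[symmetric] by (rule h)
  qed
  have v: "vector_derivative \<theta> (at t) = frechet_derivative \<theta> (at t) 1" for t by (rule vector_derivative_at[OF d])
  show "(\<theta> has_vector_derivative vector_derivative \<theta> (at t)) (at t)" using d by (simp add: v)
  show "continuous_on UNIV \<theta>" by (rule smoothD(2)[OF s])
  show "continuous_on UNIV (\<lambda>t. vector_derivative \<theta> (at t))" unfolding v by (rule smoothD(2)[OF smoothD(3)[OF s]]) simp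
qed

lemma vector_derivative_zero_outside:
  fixes \<theta> :: "real \<Rightarrow> complex"
  assumes "\<And>t. \<bar>t\<bar> > T \<Longrightarrow> \<theta> t = 0" "\<bar>t\<bar> > T"
  shows "vector_derivative \<theta> (at t) = 0"
proof (rule vector_derivative_at)
  have o: "open {t::real. T < \<bar>t\<bar>}" by (intro open_Collect_less continuous_intros)
  have "((\<lambda>_. 0) has_vector_derivative (0::complex)) (at t)" by (rule has_vector_derivative_const)
  then show "(\<theta> has_vector_derivative 0) (at t)"
    by (rule has_vector_derivative_transform_within_open[OF _ o]) (use assms in auto)
qed

lemma integral_by_parts:
  fixes P :: "real \<Rightarrow> complex"
  assumes \<theta>: "time_test \<theta>" and P: "\<And>t. (P has_vector_derivative P' t) (at t)" and c: "continuous_on UNIV P'"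
  shows "(LINT t|lebesgue. \<theta> t * P' t) = - (LINT t|lebesgue. vector_derivative \<theta> (at t) * P t)"
proof -
  obtain T where T: "\<And>t. \<bar>t\<bar> > T \<Longrightarrow> \<theta> t = 0" using \<theta> unfolding time_test_def by blast
  note th = time_testD[OF \<theta>] and z = vector_derivative_zero_outside[OF T]
  have Pc: "continuous_on UNIV P"
    by (rule continuous_at_imp_continuous_on) (rule ballI, rule has_vector_derivative_continuous[OF P])
  let ?I = "{-\<bar>T\<bar> - 1..\<bar>T\<bar> + 1}"
  have out: "\<bar>t\<bar> > T" if "t \<notin> ?I" for t using that by auto
  have c1: "continuous_on A (\<lambda>t. \<theta> t * P' t)" and c2: "continuous_on A (\<lambda>t. vector_derivative \<theta> (at t) * P t)" for A
    using continuous_on_mult[OF th(2) c] continuous_on_mult[OF th(3) Pc] continuous_on_subset by blast+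
  have 1: "(LINT t|lebesgue. \<theta> t * P' t) = integral ?I (\<lambda>t. \<theta> t * P' t)"
    by (rule integral_lebesgue_support(1)[OF c1], drule out) (simp add: T)
  have 2: "(LINT t|lebesgue. vector_derivative \<theta> (at t) * P t) = integral ?I (\<lambda>t. vector_derivative \<theta> (at t) * P t)"
    by (rule integral_lebesgue_support(1)[OF c2], drule out) (simp add: z)
  have "integral ?I (\<lambda>t. \<theta> t * P' t + vector_derivative \<theta> (at t) * P t)
      = \<theta> (\<bar>T\<bar> + 1) * P (\<bar>T\<bar> + 1) - \<theta> (-\<bar>T\<bar> - 1) * P (-\<bar>T\<bar> - 1)"
    by (rule integral_derivative, simp, rule has_vector_derivative_mult[OF th(1) P])
  also have "\<dots> = 0" using T[of "\<bar>T\<bar> + 1"] T[of "-\<bar>T\<bar> - 1"] by simp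
  also have "integral ?I (\<lambda>t. \<theta> t * P' t + vector_derivative \<theta> (at t) * P t)
      = integral ?I (\<lambda>t. \<theta> t * P' t) + integral ?I (\<lambda>t. vector_derivative \<theta> (at t) * P t)"
    by (rule integral_add[OF integrable_continuous_real[OF c1] integrable_continuous_real[OF c2]])
  finally show ?thesis unfolding 1 2 by (simp only: add_eq_0_iff2)
qed

lemma time_test_of_real:
  assumes "\<theta> \<in> interval_tests a b"
  shows "time_test (\<lambda>t. complex_of_real (\<theta> t))"
    "vector_derivative (\<lambda>t. complex_of_real (\<theta> t)) (at t) = complex_of_real (deriv \<theta> t)"
proof -
  note T = interval_testsD[OF assms]
  have "\<theta> t = 0" if "\<bar>t\<bar> > max \<bar>a\<bar> \<bar>b\<bar>" for t using that by (intro T(2)) auto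
  then have "\<forall>t. \<bar>t\<bar> > max \<bar>a\<bar> \<bar>b\<bar> \<longrightarrow> complex_of_real (\<theta> t) = 0" by simp
  then show "time_test (\<lambda>t. complex_of_real (\<theta> t))" unfolding time_test_def using smooth_of_real[OF T(1)] by blast
  show "vector_derivative (\<lambda>t. complex_of_real (\<theta> t)) (at t) = complex_of_real (deriv \<theta> t)"
    by (intro vector_derivative_at has_vector_derivative_of_real)
       (simp add: Cinf_deriv(1)[OF T(1)] flip: has_real_derivative_iff_has_vector_derivative)
qed

context slab_domain begin

lemma norm_L2_diff: "f \<in> L2 S \<Longrightarrow> g \<in> L2 S \<Longrightarrow> norm_L2 S (\<lambda>p. f p - g p) = norm (cls f - cls g)"
  by (simp add: norm_cls[symmetric] L2_diff cls_diff)

lemma norm_H1_diff: "f \<in> H1 S \<Longrightarrow> g \<in> H1 S \<Longrightarrow> norm_H1 S (\<lambda>p. f p - g p) = norm (G f - G g)"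
  by (simp add: norm_G[symmetric] H1_diff)

lemma norm_L2_quotient:
  assumes "f \<in> L2 S" "g \<in> L2 S" "h \<in> L2 S"
  shows "norm_L2 S (\<lambda>p. (f p - g p) / complex_of_real r - h p) = norm ((1 / r) *\<^sub>R (cls f - cls g) - cls h)"
proof -
  have eq: "(f p - g p) / complex_of_real r = complex_of_real (1 / r) * (f p - g p)" for p
    by simp
  have mem: "(\<lambda>p. complex_of_real (1 / r) * (f p - g p)) \<in> L2 S"
    by (intro L2_cmult L2_diff assms)
  have c: "cls (\<lambda>p. complex_of_real (1 / r) * (f p - g p)) = (1 / r) *\<^sub>R (cls f - cls g)"
    by (simp only: cls_scaleR[OF L2_diff[OF assms(1,2)]] cls_diff[OF assms(1,2)])
  show ?thesis unfolding eq norm_L2_diff[OF mem assms(3)] c ..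
qed

lemma has_vector_derivative_quotient:
  "(f has_vector_derivative d) (at t) \<longleftrightarrow> ((\<lambda>s. norm ((1 / (s - t)) *\<^sub>R (f s - f t) - d)) \<longlongrightarrow> 0) (at t)"
proof -
  have n: "norm (f s - f t - (s - t) *\<^sub>R d) / norm (s - t) = norm ((1 / (s - t)) *\<^sub>R (f s - f t) - d)" if "s \<noteq> t" for s
  proof -
    have "(1 / (s - t)) *\<^sub>R (f s - f t) - d = (1 / (s - t)) *\<^sub>R (f s - f t - (s - t) *\<^sub>R d)"
      using that by (simp add: scaleR_diff_right)
    then show ?thesis by (simp only: norm_scaleR) simp
  qed
  show ?thesis
    unfolding has_vector_derivative_def has_derivative_iff_norm
    by (simp only: bounded_linear_scaleR_left simp_thms) (rule LIM_cong[OF refl _ refl], erule n)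
qed

lemma isCont_iff_norm: "isCont f t \<longleftrightarrow> ((\<lambda>s. norm (f s - f t)) \<longlongrightarrow> 0) (at t)"
  for f :: "real \<Rightarrow> 'x::real_normed_vector"
  unfolding isCont_def tendsto_norm_zero_iff LIM_zero_iff ..

text \<open>Continuity into V is continuity of the graph, and convergence of the L2 difference
  quotients is differentiability of the curve of classes.\<close>

lemma energy_curve_iff:
  "energy_curve S V u ut \<longleftrightarrow> (\<forall>t. u t \<in> V) \<and> (\<forall>t. ut t \<in> L2 S) \<and> continuous_on UNIV (\<lambda>t. G (u t)) \<and>
     continuous_on UNIV (\<lambda>t. cls (ut t)) \<and> (\<forall>t. ((\<lambda>t. cls (u t)) has_vector_derivative cls (ut t)) (at t))"
proof (cases "(\<forall>t. u t \<in> V) \<and> (\<forall>t. ut t \<in> L2 S)")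
  case True
  then have u: "\<And>t. u t \<in> V" and ut: "\<And>t. ut t \<in> L2 S" by simp_all
  have e1: "(\<forall>t. ((\<lambda>s. norm_H1 S (\<lambda>p. u s p - u t p)) \<longlongrightarrow> 0) (at t)) \<longleftrightarrow> continuous_on UNIV (\<lambda>t. G (u t))"
    unfolding continuous_on_eq_continuous_at[OF open_UNIV] isCont_iff_norm norm_H1_diff[OF V_H1[OF u] V_H1[OF u]] by blast
  have e2: "(\<forall>t. ((\<lambda>s. norm_L2 S (\<lambda>p. ut s p - ut t p)) \<longlongrightarrow> 0) (at t)) \<longleftrightarrow> continuous_on UNIV (\<lambda>t. cls (ut t))"
    unfolding continuous_on_eq_continuous_at[OF open_UNIV] isCont_iff_norm norm_L2_diff[OF ut ut] by blast
  have q: "norm_L2 S (\<lambda>p. (u s p - u t p) / complex_of_real (s - t) - ut t p)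
      = norm ((1 / (s - t)) *\<^sub>R (cls (u s) - cls (u t)) - cls (ut t))" for s t
    by (rule norm_L2_quotient[OF V_L2[OF u] V_L2[OF u] ut])
  show ?thesis
    unfolding energy_curve_def e1 e2 has_vector_derivative_quotient q[symmetric] of_real_diff
    using u ut by blast
qed (auto simp: energy_curve_def)

definition fq :: "cfun \<Rightarrow> cfun \<Rightarrow> cfun \<Rightarrow> complex" where
  "fq u v \<eta> = form_q S u \<eta> + form_c S v \<eta>"

definition rq :: "cfun \<Rightarrow> cfun \<Rightarrow> cfun \<Rightarrow> real" where
  "rq u v \<eta> = inner (wop (grad u)) (wop (grad \<eta>)) + inner (cls v) (bop (grad \<eta>))"

text \<open>The equation with the second derivative eliminated: each A-weighted pairing of u_t with
  a test is classically differentiable. Real parts suffice, because V is closed under multiplication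
  by \<i>.\<close>

definition weak_wave :: "(real \<Rightarrow> cfun) \<Rightarrow> (real \<Rightarrow> cfun) \<Rightarrow> bool" where
  "weak_wave u ut \<longleftrightarrow> (\<forall>\<eta>\<in>V. \<forall>t. ((\<lambda>t. inner (aop (cls (ut t))) (aop (cls \<eta>))) has_real_derivative - rq (u t) (ut t) \<eta>) (at t))"

lemma fq_parts:
  assumes "u \<in> H1 S" "v \<in> L2 S" "\<eta> \<in> H1 S"
  shows "Re (fq u v \<eta>) = rq u v \<eta>" "Im (fq u v \<eta>) = rq u v (\<lambda>p. \<i> * \<eta> p)"
    "fq u v (\<lambda>p. c * \<eta> p) = cnj c * fq u v \<eta>"
proof -
  have R: "Re (fq u v \<eta>) = rq u v \<eta>" if "\<eta> \<in> H1 S" for \<eta>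
    unfolding fq_def rq_def wop_inner[OF assms(1) that] bop_inner[OF assms(2) that] by (rule plus_complex.sel)
  have c: "fq u v (\<lambda>p. c * \<eta> p) = cnj c * fq u v \<eta>" for c
    unfolding fq_def form_cmult[OF assms] by (rule distrib_left[symmetric])
  show "Re (fq u v \<eta>) = rq u v \<eta>" by (rule R[OF assms(3)])
  show "fq u v (\<lambda>p. c * \<eta> p) = cnj c * fq u v \<eta>" by (rule c)
  show "Im (fq u v \<eta>) = rq u v (\<lambda>p. \<i> * \<eta> p)"
    using R[OF H1_cmult(1)[OF assms(3), of \<i>]] unfolding c by simp
qed

lemma A_parts:
  assumes "f \<in> L2 S" "\<eta> \<in> L2 S"
  shows "Re (integral_A S (\<lambda>p. f p * cnj (\<eta> p))) = inner (aop (cls f)) (aop (cls \<eta>))"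
    "Im (integral_A S (\<lambda>p. f p * cnj (\<eta> p))) = inner (aop (cls f)) (aop (cls (\<lambda>p. \<i> * \<eta> p)))"
proof -
  show "Re (integral_A S (\<lambda>p. f p * cnj (\<eta> p))) = inner (aop (cls f)) (aop (cls \<eta>))"
    by (rule aop_inner[OF assms, symmetric])
  show "Im (integral_A S (\<lambda>p. f p * cnj (\<eta> p))) = inner (aop (cls f)) (aop (cls (\<lambda>p. \<i> * \<eta> p)))"
    unfolding aop_inner[OF assms(1) L2_cmult[OF assms(2)]] integral_A_pr pr_right by simp
qed

lemma grad_G: "grad u = snd (G u)" and cls_G: "cls u = fst (G u)"
  by (simp_all add: G_def)

lemma continuous_complex: "continuous_on A (\<lambda>t. Re (f t)) \<Longrightarrow> continuous_on A (\<lambda>t. Im (f t)) \<Longrightarrow> continuous_on A f"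
proof -
  assume "continuous_on A (\<lambda>t. Re (f t))" "continuous_on A (\<lambda>t. Im (f t))"
  then have "continuous_on A (\<lambda>t. complex_of_real (Re (f t)) + \<i> * complex_of_real (Im (f t)))"
    by (intro continuous_on_add continuous_on_mult continuous_on_const continuous_on_of_real)
  then show ?thesis by (simp only: complex_eq[symmetric])
qed

lemma curve_continuous:
  assumes "energy_curve S V u ut" "\<eta> \<in> H1 S"
  shows "continuous_on UNIV (\<lambda>t. rq (u t) (ut t) \<eta>)" "continuous_on UNIV (\<lambda>t. fq (u t) (ut t) \<eta>)"
    "continuous_on UNIV (\<lambda>t. inner (aop (cls (ut t))) (aop h))"
    "continuous_on UNIV (\<lambda>t. integral_A S (\<lambda>p. ut t p * cnj (\<eta> p)))"
proof -
  have u: "\<And>t. u t \<in> V" and ut: "\<And>t. ut t \<in> L2 S" and c: "continuous_on UNIV (\<lambda>t. G (u t))" "continuous_on UNIV (\<lambda>t. cls (ut t))"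
    using assms(1) unfolding energy_curve_iff by simp_all
  show r: "continuous_on UNIV (\<lambda>t. rq (u t) (ut t) \<eta>)" for \<eta>
    unfolding rq_def grad_G[of "u _"]
    by (intro continuous_intros c bounded_linear.continuous_on[OF linear_ops(2)])
  show "continuous_on UNIV (\<lambda>t. fq (u t) (ut t) \<eta>)"
    by (rule continuous_complex) (simp_all add: fq_parts[OF V_H1[OF u] ut assms(2)] r)
  show a: "continuous_on UNIV (\<lambda>t. inner (aop (cls (ut t))) (aop h))" for h
    by (intro continuous_intros c bounded_linear.continuous_on[OF linear_ops(1)])
  show "continuous_on UNIV (\<lambda>t. integral_A S (\<lambda>p. ut t p * cnj (\<eta> p)))"
    by (rule continuous_complex) (simp_all add: A_parts[OF ut H1_L2[OF assms(2)]] a)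
qed

text \<open>The definition of the second derivative replaces it by minus a time derivative on the
  test function. What remains is a distributional identity between continuous functions of time, to
  which the du Bois-Reymond lemma applies on an interval around t.\<close>

lemma weak_wave_if_solution:
  assumes "energy_solution S V u ut" shows "weak_wave u ut"
  unfolding weak_wave_def
proof (intro ballI allI)
  fix \<eta> t assume \<eta>: "\<eta> \<in> V"
  have E: "energy_curve S V u ut" using assms by (simp add: energy_solution_def)
  obtain utt where lin: "Linf_loc_dual S V utt" and der: "is_second_time_deriv S V ut utt"
    and eq: "\<forall>\<eta>\<in>V. \<forall>\<theta>. time_test \<theta> \<longrightarrow>
           (LINT t|lebesgue. \<theta> t * (utt t \<eta> + form_q S (u t) \<eta> + form_c S (ut t) \<eta>)) = 0"
    using assms unfolding energy_solution_def by (elim conjE exE)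
  have u: "\<And>t. u t \<in> V" and ut: "\<And>t. ut t \<in> L2 S" using E unfolding energy_curve_iff by simp_all
  note cont = curve_continuous[OF E V_H1[OF \<eta>]]
  show "((\<lambda>t. inner (aop (cls (ut t))) (aop (cls \<eta>))) has_real_derivative - rq (u t) (ut t) \<eta>) (at t)"
  proof (rule du_Bois_Reymond[OF cont(3,1)])
    show "t - 1 < t" "t < t + 1" by simp_all
    fix \<theta> assume T: "\<theta> \<in> interval_tests (t - 1) (t + 1)"
    note Td = interval_testsD[OF T] and tt = time_test_of_real[OF T]
    have c: "continuous_on UNIV \<theta>" "continuous_on UNIV (deriv \<theta>)"
      by (intro Cinf_continuous_on Td Cinf_deriv(2))+
    have supp: "\<theta> s = 0" "deriv \<theta> s = 0" if "s \<notin> {t - 1..t + 1}" for s using that Td(2,3)[of s] by auto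
    let ?q = "\<lambda>s. complex_of_real (\<theta> s) * fq (u s) (ut s) \<eta>"
      and ?p = "\<lambda>s. complex_of_real (deriv \<theta> s) * integral_A S (\<lambda>p. ut s p * cnj (\<eta> p))"
      and ?w = "\<lambda>s. complex_of_real (\<theta> s) * utt s \<eta>"
    have iq: "integrable lebesgue ?q"
      by (rule integral_lebesgue_support(2)[of _ "t - 1" "t + 1"], intro continuous_intros c cont) (simp add: supp)
    have ip: "integrable lebesgue ?p"
      by (rule integral_lebesgue_support(2)[of _ "t - 1" "t + 1"], intro continuous_intros c cont) (simp add: supp)
    \<comment> \<open>Splitting the integral of the sum requires this summand to be integrable by
      itself; it follows from weak measurability and the local essential bound in the dual.\<close>
    have iw: "integrable lebesgue ?w"
    proof -
      obtain C where C: "AE s in lebesgue. \<bar>s\<bar> \<le> \<bar>t\<bar> + 1 \<longrightarrow> (\<forall>\<eta>\<in>V. cmod (utt s \<eta>) \<le> C * norm_H1 S \<eta>)"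
        using lin unfolding Linf_loc_dual_def by (elim conjE allE[of _ "\<bar>t\<bar> + 1"] exE)
      show ?thesis
      proof (rule Bochner_Integration.integrable_bound)
        show "integrable lebesgue (\<lambda>s. \<theta> s * (C * norm_H1 S \<eta>))"
          by (rule integral_lebesgue_support(2)[of _ "t - 1" "t + 1"]) (auto intro!: continuous_intros c simp: supp)
        have m: "(\<lambda>t. utt t \<eta>) \<in> borel_measurable lebesgue" using lin \<eta> by (simp add: Linf_loc_dual_def)
        have "(\<lambda>s. complex_of_real (\<theta> s)) \<in> borel_measurable lebesgue"
          by (intro measurable_completion) (auto intro!: borel_measurable_continuous_onI continuous_intros c)
        then show "?w \<in> borel_measurable lebesgue" using m by (rule borel_measurable_times)
        show "AE s in lebesgue. norm (?w s) \<le> norm (\<theta> s * (C * norm_H1 S \<eta>))"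
          using C
        proof eventually_elim
          case (elim s)
          show ?case
          proof (cases "s \<in> {t - 1..t + 1}")
            case True
            then have "cmod (utt s \<eta>) \<le> C * norm_H1 S \<eta>" using elim \<eta> by auto
            then have "cmod (utt s \<eta>) \<le> \<bar>C * norm_H1 S \<eta>\<bar>" by linarith
            then have "\<bar>\<theta> s\<bar> * cmod (utt s \<eta>) \<le> \<bar>\<theta> s\<bar> * \<bar>C * norm_H1 S \<eta>\<bar>" by (rule mult_left_mono) simp
            then show ?thesis by (simp add: norm_mult abs_mult)
          qed (simp add: supp)
        qed
      qed
    qed
    have "(LINT s|lebesgue. ?w s + ?q s) = 0"
      using eq[rule_format, OF \<eta> tt(1)] by (simp add: fq_def distrib_left add.assoc)
    then have "integral\<^sup>L lebesgue ?w + integral\<^sup>L lebesgue ?q = 0"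
      by (simp only: Bochner_Integration.integral_add[OF iw iq])
    moreover have "integral\<^sup>L lebesgue ?w = - integral\<^sup>L lebesgue ?p"
      using der \<eta> tt(1) unfolding is_second_time_deriv_def tt(2)[symmetric] by blast
    ultimately have "integral\<^sup>L lebesgue ?q = integral\<^sup>L lebesgue ?p" by simp
    then have "(LINT s|lebesgue. Re (?q s)) = (LINT s|lebesgue. Re (?p s))"
      by (simp only: integral_Re[OF iq] integral_Re[OF ip])
    then show "(LINT s|lebesgue. \<theta> s * rq (u s) (ut s) \<eta>)
        = (LINT s|lebesgue. deriv \<theta> s * inner (aop (cls (ut s))) (aop (cls \<eta>)))"
      by (simp add: fq_parts[OF V_H1[OF u] ut V_H1[OF \<eta>]] A_parts[OF ut V_L2[OF \<eta>]])
  qed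
qed

lemma mul4_i_norm: "norm (mul4 \<i> z) \<le> norm z"
proof -
  obtain x y w v where z: "z = (x, y, w, v)" by (rule prod_cases4)
  have n: "(norm (mul (\<lambda>_. \<i>) x))\<^sup>2 \<le> (norm x)\<^sup>2" for x :: vec
    using norm_mul_le[OF bounded_measurable_const[of \<i>], of 1 x] by (intro power_mono) simp_all
  show ?thesis
    using n[of x] n[of y] n[of w] n[of v] unfolding z mul4_def norm_Pair
    by (simp add: add_mono)
qed

lemma rq_bound: "\<exists>K\<ge>0. \<forall>u v \<eta>. \<bar>rq u v \<eta>\<bar> \<le> K * (norm (G u) + norm (cls v)) * norm (G \<eta>)"
proof -
  obtain K1 where K1: "K1 > 0" "\<And>z. norm (wop z) \<le> norm z * K1" using bounded_linear.pos_bounded[OF linear_ops(2)] by blast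
  obtain K2 where K2: "K2 > 0" "\<And>z. norm (bop z) \<le> norm z * K2" using bounded_linear.pos_bounded[OF linear_ops(3)] by blast
  have gG: "norm (grad u) \<le> norm (G u)" for u by (simp add: G_def norm_snd_le)
  have "\<bar>rq u v \<eta>\<bar> \<le> (K1 * K1 + K2) * (norm (G u) + norm (cls v)) * norm (G \<eta>)" for u v \<eta>
  proof -
    have "\<bar>inner (wop (grad u)) (wop (grad \<eta>))\<bar> \<le> norm (wop (grad u)) * norm (wop (grad \<eta>))" by (rule Cauchy_Schwarz_ineq2)
    also have "\<dots> \<le> (norm (G u) * K1) * (norm (G \<eta>) * K1)"
      using K1 gG by (intro mult_mono order_trans[OF K1(2)] mult_right_mono) auto
    finally have 1: "\<bar>inner (wop (grad u)) (wop (grad \<eta>))\<bar> \<le> (K1 * K1) * norm (G u) * norm (G \<eta>)" by (simp add: mult_ac)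
    have "\<bar>inner (cls v) (bop (grad \<eta>))\<bar> \<le> norm (cls v) * norm (bop (grad \<eta>))" by (rule Cauchy_Schwarz_ineq2)
    also have "\<dots> \<le> norm (cls v) * (norm (G \<eta>) * K2)"
      using K2 gG by (intro mult_left_mono order_trans[OF K2(2)] mult_right_mono) auto
    finally have 2: "\<bar>inner (cls v) (bop (grad \<eta>))\<bar> \<le> K2 * norm (cls v) * norm (G \<eta>)" by (simp add: mult_ac)
    have 3: "0 \<le> K1 * K1 * (norm (cls v) * norm (G \<eta>))" "0 \<le> K2 * (norm (G u) * norm (G \<eta>))" using K1 K2 by auto
    have "\<bar>rq u v \<eta>\<bar> \<le> (K1 * K1) * norm (G u) * norm (G \<eta>) + K2 * norm (cls v) * norm (G \<eta>)"
      unfolding rq_def by (rule order_trans[OF abs_triangle_ineq add_mono[OF 1 2]])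
    also have "\<dots> \<le> (K1 * K1 + K2) * (norm (G u) + norm (cls v)) * norm (G \<eta>)"
      using 3 by (simp only: distrib_left distrib_right mult.assoc)
    finally show ?thesis .
  qed
  moreover have "K1 * K1 + K2 \<ge> 0" using K1(1) K2(1) by simp
  ultimately show ?thesis by (intro exI[of _ "K1 * K1 + K2"] conjI allI)
qed

lemma rq_add: "\<eta> \<in> H1 S \<Longrightarrow> \<zeta> \<in> H1 S \<Longrightarrow> rq u v (\<lambda>p. \<eta> p + \<zeta> p) = rq u v \<eta> + rq u v \<zeta>"
  by (simp add: rq_def grad_G H1_add(2) linear_add[OF bounded_linear.linear[OF linear_ops(2)]]
      linear_add[OF bounded_linear.linear[OF linear_ops(3)]] inner_add_right)

text \<open>The equation itself defines the second derivative, as the functional minus (q + c). Its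
  bound is continuous in time, hence locally bounded, and integration by parts in time identifies it
  as the distributional derivative.\<close>

lemma solution_if_weak_wave:
  assumes E: "energy_curve S V u ut" and W: "weak_wave u ut" shows "energy_solution S V u ut"
proof -
  have u: "\<And>t. u t \<in> V" and ut: "\<And>t. ut t \<in> L2 S" and c: "continuous_on UNIV (\<lambda>t. G (u t))" "continuous_on UNIV (\<lambda>t. cls (ut t))"
    using E unfolding energy_curve_iff by simp_all
  define utt where "utt = (\<lambda>t \<eta>. - fq (u t) (ut t) \<eta>)"
  note parts = fq_parts[OF V_H1[OF u] ut]
  obtain K where K0: "K \<ge> 0 \<and> (\<forall>u v \<eta>. \<bar>rq u v \<eta>\<bar> \<le> K * (norm (G u) + norm (cls v)) * norm (G \<eta>))"
    using rq_bound by (rule exE)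
  note K = K0[THEN conjunct1] K0[THEN conjunct2, rule_format]
  \<comment> \<open>The factor 2 covers the real and the imaginary part, each of which is a value of
    \<open>rq\<close>.\<close>
  define N where "N = (\<lambda>t. 2 * K * (norm (G (u t)) + norm (cls (ut t))))"
  have bound: "cmod (utt t \<eta>) \<le> N t * norm_H1 S \<eta>" if "\<eta> \<in> V" for t \<eta>
  proof -
    have h: "\<eta> \<in> H1 S" by (rule V_H1[OF that])
    have nG: "norm (G (\<lambda>p. \<i> * \<eta> p)) \<le> norm (G \<eta>)" unfolding H1_cmult(2)[OF h] by (rule mul4_i_norm)
    have "cmod (utt t \<eta>) \<le> \<bar>rq (u t) (ut t) \<eta>\<bar> + \<bar>rq (u t) (ut t) (\<lambda>p. \<i> * \<eta> p)\<bar>"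
      using cmod_le[of "fq (u t) (ut t) \<eta>"] by (simp add: utt_def parts[OF h])
    also have "\<dots> \<le> K * (norm (G (u t)) + norm (cls (ut t))) * norm (G \<eta>) + K * (norm (G (u t)) + norm (cls (ut t))) * norm (G \<eta>)"
      by (intro add_mono K(2) order_trans[OF K(2) mult_left_mono[OF nG]]) (use K(1) in auto)
    also have "\<dots> = N t * norm_H1 S \<eta>" by (simp add: N_def norm_G[OF h])
    finally show ?thesis .
  qed
  have "Linf_loc_dual S V utt"
    unfolding Linf_loc_dual_def
  proof (intro conjI allI ballI)
    show "in_dual S V (utt t)" for t
      unfolding in_dual_def
    proof (intro conjI allI ballI exI)
      fix \<eta> \<zeta> assume "\<eta> \<in> V" "\<zeta> \<in> V"
      then have h: "\<eta> \<in> H1 S" "\<zeta> \<in> H1 S" by (simp_all add: V_H1)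
      note hi = H1_cmult(1)[OF h(1), of \<i>] H1_cmult(1)[OF h(2), of \<i>]
      have "rq (u t) (ut t) (\<lambda>p. \<i> * (\<eta> p + \<zeta> p)) = rq (u t) (ut t) (\<lambda>p. \<i> * \<eta> p) + rq (u t) (ut t) (\<lambda>p. \<i> * \<zeta> p)"
        unfolding distrib_left by (rule rq_add[OF hi])
      then show "utt t (\<lambda>p. \<eta> p + \<zeta> p) = utt t \<eta> + utt t \<zeta>"
        by (simp add: utt_def complex_eq_iff parts(1,2) h H1_add(1) rq_add)
    next
      fix c \<eta> assume "\<eta> \<in> V"
      then show "utt t (\<lambda>p. c * \<eta> p) = cnj c * utt t \<eta>" by (simp add: utt_def parts(3) V_H1)
    next
      fix \<eta> assume "\<eta> \<in> V"
      then show "cmod (utt t \<eta>) \<le> N t * norm_H1 S \<eta>" by (rule bound)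
    qed
    show "(\<lambda>t. utt t \<eta>) \<in> borel_measurable lebesgue" if "\<eta> \<in> V" for \<eta>
      unfolding utt_def
      by (intro measurable_completion) (simp add: borel_measurable_continuous_onI continuous_on_minus curve_continuous(2)[OF E V_H1[OF that]])
    fix T :: real
    have "continuous_on {-T..T} N" unfolding N_def
      by (intro continuous_intros continuous_on_subset[OF c(1)] continuous_on_subset[OF c(2)]) simp_all
    then have "bounded (N ` {-T..T})" by (intro compact_imp_bounded compact_continuous_image compact_Icc)
    then obtain C where "\<forall>t\<in>{-T..T}. \<bar>N t\<bar> \<le> C" by (auto simp: bounded_iff)
    then have C: "\<And>t. t \<in> {-T..T} \<Longrightarrow> \<bar>N t\<bar> \<le> C" by (rule bspec)
    show "\<exists>C. AE t in lebesgue. \<bar>t\<bar> \<le> T \<longrightarrow> (\<forall>\<eta>\<in>V. cmod (utt t \<eta>) \<le> C * norm_H1 S \<eta>)"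
    proof (intro exI[of _ C] AE_I2 impI ballI)
      fix t \<eta> assume t: "\<bar>t\<bar> \<le> T" and \<eta>: "\<eta> \<in> V"
      have "N t * norm_H1 S \<eta> \<le> C * norm_H1 S \<eta>"
      proof (rule mult_right_mono)
        have "t \<in> {-T..T}" using t by auto
        from C[OF this] show "N t \<le> C" by (rule abs_le_D1)
      qed (simp add: norm_H1_def)
      then show "cmod (utt t \<eta>) \<le> C * norm_H1 S \<eta>" using bound[OF \<eta>, of t] by linarith
    qed
  qed
  moreover have "is_second_time_deriv S V ut utt"
    unfolding is_second_time_deriv_def
  proof (intro ballI allI impI)
    fix \<eta> \<theta> assume \<eta>: "\<eta> \<in> V" and \<theta>: "time_test \<theta>"
    let ?P = "\<lambda>t. integral_A S (\<lambda>p. ut t p * cnj (\<eta> p))"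
    have P: "(?P has_vector_derivative utt t \<eta>) (at t)" for t
      unfolding has_vector_derivative_complex_iff
      using W \<eta> V_cmult[OF \<eta>, of \<i>] unfolding weak_wave_def A_parts[OF ut V_L2[OF \<eta>]] utt_def
      by (simp add: parts[OF V_H1[OF \<eta>]] flip: has_real_derivative_iff_has_vector_derivative)
    have "continuous_on UNIV (\<lambda>t. utt t \<eta>)" unfolding utt_def by (intro continuous_on_minus curve_continuous(2)[OF E V_H1[OF \<eta>]])
    from integral_by_parts[OF \<theta> P this]
    show "(LINT t|lebesgue. \<theta> t * utt t \<eta>) = - (LINT t|lebesgue. vector_derivative \<theta> (at t) * ?P t)" .
  qed
  moreover have "utt t \<eta> + form_q S (u t) \<eta> + form_c S (ut t) \<eta> = 0" for t \<eta> by (simp add: utt_def fq_def)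
  ultimately show ?thesis
    unfolding energy_solution_def using E by (intro conjI exI[of _ utt] ballI allI impI) simp_all
qed

end

context slab_domain begin

section \<open>Weighted averages and the zero modes\<close>

abbreviation mass :: complex where "mass \<equiv> integral_A S (\<lambda>p. 1)"

lemma mean_parts:
  assumes "f \<in> L2 S"
  shows "Re (integral_A S f) = inner (aop (cls f)) (aop (cls (\<lambda>_. 1)))"
    "Im (integral_A S f) = inner (aop (cls f)) (aop (cls (\<lambda>_. \<i>)))"
  using A_parts[OF assms const_L2[of 1]] by simp_all

lemma mean_cmult: "integral_A S (\<lambda>p. c * f p) = c * integral_A S f"
  by (simp add: integral_A_ext mult.assoc)

lemma mean_const: "integral_A S (\<lambda>_. c) = c * mass"
  using mean_cmult[of c "\<lambda>_. 1"] by simp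

lemma mean_diff: "f \<in> L2 S \<Longrightarrow> g \<in> L2 S \<Longrightarrow> integral_A S (\<lambda>p. f p - g p) = integral_A S f - integral_A S g"
  by (simp add: complex_eq_iff mean_parts L2_diff cls_diff linear_diff[OF bounded_linear.linear[OF linear_ops(1)]] inner_diff_left)

lemma mean_diff_const: "f \<in> L2 S \<Longrightarrow> integral_A S (\<lambda>p. f p - c) = integral_A S f - c * mass"
  using mean_diff[OF _ const_L2[of c], of f] unfolding mean_const[of c] .

lemma mean_cong: "f \<in> L2 S \<Longrightarrow> g \<in> L2 S \<Longrightarrow> cls f = cls g \<Longrightarrow> integral_A S f = integral_A S g"
  by (simp add: complex_eq_iff mean_parts)

lemma mass_ne: "mass \<noteq> 0"
proof -
  obtain c where c: "c > 0" "\<And>x. c * norm x \<le> norm (aop x)" using aop_lower by blast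
  have sp: "space M = UNIV" by (simp add: M_def)
  have "(LINT p|SM. 1 :: real) = measure M UNIV" by (subst integral_SM) (simp_all add: sp)
  then have "norm (cls (\<lambda>_. 1)) > 0" using measure_M_pos by (simp only: norm_cls[OF const_L2] norm_L2_def norm_one power_one) simp
  then have "norm (aop (cls (\<lambda>_. 1))) > 0" using less_le_trans[OF mult_pos_pos[OF c(1)] c(2)] by blast
  then have "Re mass \<noteq> 0" using mean_parts(1)[OF const_L2[of 1]] by (simp add: inner_eq_zero_iff)
  then show ?thesis by auto
qed

lemma grad_const: "grad (\<lambda>_. c) = 0"
  using G_const(2)[of c] by (simp add: G_def)

lemma ops_zero: "aop 0 = 0" "wop 0 = 0" "bop 0 = 0"
  using linear_ops[THEN bounded_linear.linear, THEN linear_0] by simp_all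

lemma rq_const: "rq u v (\<lambda>_. c) = 0"
  by (simp add: rq_def grad_const ops_zero)

lemma cls_const: "cls (\<lambda>_. c) = Re c *\<^sub>R cls (\<lambda>_. 1) + Im c *\<^sub>R cls (\<lambda>_. \<i>)"
proof -
  have "cls (\<lambda>_. c) = cls (\<lambda>p. complex_of_real (Re c) * 1 + complex_of_real (Im c) * \<i>)"
    by (rule arg_cong[of _ _ cls]) (simp add: fun_eq_iff complex_eq_iff)
  also have "\<dots> = Re c *\<^sub>R cls (\<lambda>_. 1) + Im c *\<^sub>R cls (\<lambda>_. \<i>)"
    by (simp only: cls_add[OF const_L2 const_L2] cls_scaleR[OF const_L2])
  finally show ?thesis .
qed

lemma solution_diff:
  assumes "energy_curve S V u ut" "energy_curve S V w wt"
  shows "energy_curve S V (\<lambda>t p. u t p - w t p) (\<lambda>t p. ut t p - wt t p)"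
    "weak_wave u ut \<Longrightarrow> weak_wave w wt \<Longrightarrow> weak_wave (\<lambda>t p. u t p - w t p) (\<lambda>t p. ut t p - wt t p)"
proof -
  have u: "\<And>t. u t \<in> V" "\<And>t. ut t \<in> L2 S" and w: "\<And>t. w t \<in> V" "\<And>t. wt t \<in> L2 S"
    and cu: "continuous_on UNIV (\<lambda>t. G (u t))" "continuous_on UNIV (\<lambda>t. cls (ut t))"
      "\<And>t. ((\<lambda>t. cls (u t)) has_vector_derivative cls (ut t)) (at t)"
    and cw: "continuous_on UNIV (\<lambda>t. G (w t))" "continuous_on UNIV (\<lambda>t. cls (wt t))"
      "\<And>t. ((\<lambda>t. cls (w t)) has_vector_derivative cls (wt t)) (at t)"
    using assms unfolding energy_curve_iff by simp_all
  note GG = H1_diff(2)[OF V_H1[OF u(1)] V_H1[OF w(1)]] and cc = cls_diff[OF u(2) w(2)] cls_diff[OF V_L2[OF u(1)] V_L2[OF w(1)]]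
  show "energy_curve S V (\<lambda>t p. u t p - w t p) (\<lambda>t p. ut t p - wt t p)"
    unfolding energy_curve_iff GG cc
    by (intro conjI allI V_diff u w L2_diff continuous_on_diff cu cw has_vector_derivative_diff)
  assume U: "weak_wave u ut" and W: "weak_wave w wt"
  show "weak_wave (\<lambda>t p. u t p - w t p) (\<lambda>t p. ut t p - wt t p)"
    unfolding weak_wave_def
  proof (intro ballI allI)
    fix \<eta> t assume \<eta>: "\<eta> \<in> V"
    have "rq (\<lambda>p. u t p - w t p) (\<lambda>p. ut t p - wt t p) \<eta> = rq (u t) (ut t) \<eta> - rq (w t) (wt t) \<eta>"
      by (simp add: rq_def grad_G GG cc linear_diff[OF bounded_linear.linear[OF linear_ops(2)]] inner_diff_left)
    moreover have "((\<lambda>t. inner (aop (cls (ut t))) (aop (cls \<eta>)) - inner (aop (cls (wt t))) (aop (cls \<eta>)))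
       has_real_derivative (- rq (u t) (ut t) \<eta>) - (- rq (w t) (wt t) \<eta>)) (at t)"
      using U W \<eta> unfolding weak_wave_def by (intro DERIV_diff) simp_all
    ultimately show "((\<lambda>t. inner (aop (cls (\<lambda>p. ut t p - wt t p))) (aop (cls \<eta>)))
       has_real_derivative - rq (\<lambda>p. u t p - w t p) (\<lambda>p. ut t p - wt t p) \<eta>) (at t)"
      by (simp add: cc linear_diff[OF bounded_linear.linear[OF linear_ops(1)]] inner_diff_left)
  qed
qed

text \<open>Gradients vanish, and the mixed form of a constant velocity vanishes by
  \<open>bop_const\<close>.\<close>

lemma zero_mode_solution:
  "energy_curve S V (\<lambda>t p. c0 + c1 * complex_of_real t) (\<lambda>t p. c1)" "weak_wave (\<lambda>t p. c0 + c1 * complex_of_real t) (\<lambda>t p. c1)"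
proof -
  have c: "cls (\<lambda>p. c0 + c1 * complex_of_real t) = cls (\<lambda>_. c0) + t *\<^sub>R cls (\<lambda>_. c1)" for t
    by (simp only: cls_add[OF const_L2 const_L2] mult.commute[of c1] cls_scaleR[OF const_L2])
  have d: "((\<lambda>t. cls (\<lambda>_. c0) + t *\<^sub>R cls (\<lambda>_. c1)) has_vector_derivative cls (\<lambda>_. c1)) (at t)" for t
    unfolding has_vector_derivative_def by (auto intro!: derivative_eq_intros)
  show "energy_curve S V (\<lambda>t p. c0 + c1 * complex_of_real t) (\<lambda>t p. c1)"
    unfolding energy_curve_iff G_const(2) c
    by (intro conjI allI V_const const_L2 continuous_intros d)
  show "weak_wave (\<lambda>t p. c0 + c1 * complex_of_real t) (\<lambda>t p. c1)"
    unfolding weak_wave_def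
    by (simp add: rq_def grad_const ops_zero bop_const V_H1)
qed

text \<open>Constants belong to V and annihilate both forms when used as tests, so the average of
  u_t is conserved. The tests 1 and \<i> give its two real components.\<close>

lemma mean_evolution:
  assumes E: "energy_curve S V u ut" and W: "weak_wave u ut"
  shows "integral_A S (ut t) = integral_A S (ut 0)" "integral_A S (u t) = integral_A S (u 0) + complex_of_real t * integral_A S (ut 0)"
proof -
  have u: "\<And>t. u t \<in> V" and ut: "\<And>t. ut t \<in> L2 S" and d: "\<And>t. ((\<lambda>t. cls (u t)) has_vector_derivative cls (ut t)) (at t)"
    using E unfolding energy_curve_iff by simp_all
  have 1: "inner (aop (cls (ut t))) (aop (cls (\<lambda>_. c))) = inner (aop (cls (ut 0))) (aop (cls (\<lambda>_. c)))" for c t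
  proof (rule DERIV_isconst_all[of "\<lambda>t. inner (aop (cls (ut t))) (aop (cls (\<lambda>_. c)))"], rule allI)
    show "((\<lambda>t. inner (aop (cls (ut t))) (aop (cls (\<lambda>_. c)))) has_real_derivative 0) (at s)" for s
      using bspec[OF W[unfolded weak_wave_def] V_const[of c], THEN spec, of s] unfolding rq_const by simp
  qed
  have 2: "inner (aop (cls (u t))) (aop (cls (\<lambda>_. c))) = inner (aop (cls (u 0))) (aop (cls (\<lambda>_. c))) + t * inner (aop (cls (ut 0))) (aop (cls (\<lambda>_. c)))" for c t
  proof -
    let ?f = "\<lambda>t. inner (aop (cls (u t))) (aop (cls (\<lambda>_. c))) - t * inner (aop (cls (ut 0))) (aop (cls (\<lambda>_. c)))"
    have "?f t = ?f 0"
    proof (rule DERIV_isconst_all[of ?f], rule allI)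
      fix s
      have "((\<lambda>t. inner (aop (cls (u t))) (aop (cls (\<lambda>_. c)))) has_vector_derivative inner (aop (cls (ut s))) (aop (cls (\<lambda>_. c)))) (at s)"
        by (intro bounded_linear.has_vector_derivative[OF bounded_linear_inner_left] bounded_linear.has_vector_derivative[OF linear_ops(1)] d)
      then have "((\<lambda>t. inner (aop (cls (u t))) (aop (cls (\<lambda>_. c)))) has_real_derivative inner (aop (cls (ut 0))) (aop (cls (\<lambda>_. c)))) (at s)"
        unfolding has_real_derivative_iff_has_vector_derivative 1[of s] .
      from DERIV_diff[OF this DERIV_cmult_right[OF DERIV_ident, where c = "inner (aop (cls (ut 0))) (aop (cls (\<lambda>_. c)))"]]
      show "(?f has_real_derivative 0) (at s)" by simp
    qed
    then show ?thesis by simp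
  qed
  show "integral_A S (ut t) = integral_A S (ut 0)"
    unfolding complex_eq_iff mean_parts[OF ut] by (intro conjI 1)
  show "integral_A S (u t) = integral_A S (u 0) + complex_of_real t * integral_A S (ut 0)"
    unfolding complex_eq_iff using 2[of t 1] 2[of t \<i>] by (simp add: mean_parts[OF ut] mean_parts[OF V_L2[OF u]])
qed

section \<open>Energy conservation and uniqueness\<close>

lemma energy_conserved:
  assumes E: "energy_curve S V u ut" and W: "weak_wave u ut"
  shows "(norm (aop (cls (ut t))))\<^sup>2 + (norm (wop (grad (u t))))\<^sup>2 = (norm (aop (cls (ut 0))))\<^sup>2 + (norm (wop (grad (u 0))))\<^sup>2"
proof (rule wave_energy_conserved[OF linear_ops])
  have u: "\<And>t. u t \<in> V" and c: "continuous_on UNIV (\<lambda>t. G (u t))" "continuous_on UNIV (\<lambda>t. cls (ut t))"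
    and d: "\<And>t. ((\<lambda>t. cls (u t)) has_vector_derivative cls (ut t)) (at t)"
    using E unfolding energy_curve_iff by simp_all
  show "(cls (u t), grad (u t)) \<in> G ` V" for t using imageI[OF u[of t], of G] by (simp add: G_def)
  show "inner a (bop h) = - inner b (bop g)" if ab: "(a, g) \<in> G ` V" "(b, h) \<in> G ` V" for a b g h
  proof -
    obtain \<eta> where 1: "(a, g) = G \<eta>" "\<eta> \<in> V" using ab(1) by (rule imageE)
    obtain \<zeta> where 2: "(b, h) = G \<zeta>" "\<zeta> \<in> V" using ab(2) by (rule imageE)
    have "a = cls \<eta>" "g = grad \<eta>" "b = cls \<zeta>" "h = grad \<zeta>" using 1(1) 2(1) by (simp_all add: G_def)
    then show ?thesis using bop_skew[OF V_H1[OF 1(2)] V_H1[OF 2(2)]] by simp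
  qed
  show "((\<lambda>t. cls (u t)) has_vector_derivative cls (ut t)) (at t)" for t by (rule d)
  show "continuous_on UNIV (\<lambda>t. cls (ut t))" by (rule c)
  show "continuous_on UNIV (\<lambda>t. grad (u t))" unfolding grad_G by (intro continuous_intros c)
  show "((\<lambda>t. inner (aop (cls (ut t))) (aop h)) has_real_derivative
               - (inner (wop (grad (u t))) (wop h') + inner (cls (ut t)) (bop h'))) (at t)" if hh: "(h, h') \<in> G ` V" for h h' t
  proof -
    obtain \<eta> where "(h, h') = G \<eta>" "\<eta> \<in> V" using hh by (rule imageE)
    then show ?thesis using W unfolding weak_wave_def rq_def by (simp add: G_def)
  qed
qed

text \<open>The energy does not see constants, but its conservation forces u_t to vanish; u is then
  constant in time and equal to its initial value.\<close>

lemma zero_if_vanishing_data: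
  assumes E: "energy_curve S V u ut" and W: "weak_wave u ut" and 0: "cls (u 0) = 0" "cls (ut 0) = 0"
  shows "cls (u t) = 0" "cls (ut t) = 0"
proof -
  have u: "\<And>t. u t \<in> V" and d: "\<And>t. ((\<lambda>t. cls (u t)) has_vector_derivative cls (ut t)) (at t)"
    using E unfolding energy_curve_iff by simp_all
  have z: "cls (\<lambda>_. 0) = 0" using cls_scaleR[OF const_L2, of 0 1] by simp
  have "grad (u 0) = 0" using grad_cong[OF V_H1[OF u] G_const(1)[of 0], of 0] 0 z grad_const by simp
  then have e: "norm (aop (cls (ut t))) = 0" for t using energy_conserved[OF E W, of t] 0 by (simp add: ops_zero sum_power2_eq_zero_iff)
  obtain c where c: "c > 0" "\<And>x. c * norm x \<le> norm (aop x)" using aop_lower by blast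
  have v: "cls (ut t) = 0" for t using c(1) c(2)[of "cls (ut t)"] e[of t] by (simp add: mult_le_0_iff)
  then show "cls (ut t) = 0" .
  obtain k where k: "\<And>x. x \<in> UNIV \<Longrightarrow> cls (u x) = k"
  proof (rule has_vector_derivative_zero_constant[of UNIV "\<lambda>t. cls (u t)"])
    show "((\<lambda>t. cls (u t)) has_vector_derivative 0) (at t within UNIV)" for t using d[of t] v[of t] by simp
  qed auto
  show "cls (u t) = 0" using k[of t] k[of 0] 0(1) by simp
qed

lemma poincare_wop: "\<exists>C\<ge>0. \<forall>u\<in>H1 S. integral_A S u = 0 \<longrightarrow> (norm (cls u))\<^sup>2 \<le> C * (norm (wop (grad u)))\<^sup>2"
proof -
  obtain C where C: "C \<ge> 0" "\<forall>u\<in>H1 S. integral_A S u = 0 \<longrightarrow>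
     (norm_L2 S u)\<^sup>2 \<le> C * ((norm_L2 S (D_phi S u))\<^sup>2 + (norm_L2 S (D_r S u))\<^sup>2 + (norm_L2 S (D_x S u))\<^sup>2)"
    using poincare_gradient by (elim exE conjE)
  obtain c where c: "c > 0" "\<And>x. c * norm x \<le> norm (wop x)" using wop_lower by blast
  have "(norm (cls u))\<^sup>2 \<le> C / c\<^sup>2 * (norm (wop (grad u)))\<^sup>2" if u: "u \<in> H1 S" "integral_A S u = 0" for u
  proof -
    have 1: "(norm (cls u))\<^sup>2 \<le> C * (norm (grad u))\<^sup>2"
      using C(2)[rule_format, OF u] by (simp add: norm_grad[OF u(1)] norm_cls[OF H1_L2[OF u(1)]])
    have "c\<^sup>2 * (norm (grad u))\<^sup>2 \<le> (norm (wop (grad u)))\<^sup>2"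
      using power_mono[OF c(2)[of "grad u"], of 2] c(1) by (simp add: power_mult_distrib)
    then have "(norm (grad u))\<^sup>2 \<le> (norm (wop (grad u)))\<^sup>2 / c\<^sup>2"
      using c(1) by (simp add: pos_le_divide_eq mult.commute)
    from order_trans[OF 1 mult_left_mono[OF this C(1)]] show ?thesis by simp
  qed
  then show ?thesis using C(1) c(1) by (intro exI[of _ "C / c\<^sup>2"]) simp
qed

section \<open>Existence\<close>

text \<open>The abstract theorem is applied to the graphs over functions of vanishing A-average,
  where the Poincare inequality holds. Two gaps remain: density after imposing the average
  condition, and the equation for tests whose average does not vanish.\<close>

lemma existence_mean_zero:
  assumes v0: "v0 \<in> V" "integral_A S v0 = 0" and v1: "v1 \<in> L2 S" "integral_A S v1 = 0"
  shows "\<exists>u ut. energy_curve S V u ut \<and> weak_wave u ut \<and> cls (u 0) = cls v0 \<and> cls (ut 0) = cls v1"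
proof -
  let ?e1 = "cls (\<lambda>_. 1)" and ?e2 = "cls (\<lambda>_. \<i>)"
  define H where "H = {h \<in> cls ` L2 S. inner (aop h) (aop ?e1) = 0 \<and> inner (aop h) (aop ?e2) = 0}"
  define W where "W = {z \<in> G ` V. fst z \<in> H}"
  note lin = bounded_linear.linear[OF linear_ops(1)]
  have H_iff: "cls f \<in> H \<longleftrightarrow> integral_A S f = 0" if "f \<in> L2 S" for f
    using that by (simp add: H_def complex_eq_iff mean_parts)
  have subL: "subspace (cls ` L2 S)"
  proof (rule subspaceI)
    have "cls (\<lambda>_. 0) = 0" using cls_scaleR[OF const_L2, of 0 1] by simp
    then show "0 \<in> cls ` L2 S" using const_L2[of 0] by (metis imageI)
    show "x + y \<in> cls ` L2 S" if "x \<in> cls ` L2 S" "y \<in> cls ` L2 S" for x y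
      using that by (auto simp: cls_add[symmetric] intro!: imageI L2_add)
    show "c *\<^sub>R x \<in> cls ` L2 S" if "x \<in> cls ` L2 S" for c x
      using that by (auto simp: cls_scaleR[symmetric] intro!: imageI L2_cmult)
  qed
  have sH: "subspace H"
    using subspace_0[OF subL] subspace_add[OF subL] subspace_scale[OF subL]
    unfolding subspace_def H_def by (simp add: linear_add[OF lin] linear_scale[OF lin] ops_zero inner_add_left)
  have ca: "continuous_on UNIV aop" by (rule linear_continuous_on[OF linear_ops(1)])
  have cH: "closed H"
  proof -
    have "closed {h. inner (aop h) (aop e) = 0}" for e
      by (intro closed_Collect_eq continuous_intros ca)
    then have "closed (cls ` L2 S \<inter> ({h. inner (aop h) (aop ?e1) = 0} \<inter> {h. inner (aop h) (aop ?e2) = 0}))"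
      by (intro closed_Int closed_cls)
    moreover have "H = cls ` L2 S \<inter> ({h. inner (aop h) (aop ?e1) = 0} \<inter> {h. inner (aop h) (aop ?e2) = 0})"
      by (auto simp: H_def)
    ultimately show ?thesis by simp
  qed
  have sW: "subspace W"
    using subspace_0[OF W_subspace] subspace_add[OF W_subspace] subspace_scale[OF W_subspace]
      subspace_0[OF sH] subspace_add[OF sH] subspace_scale[OF sH]
    unfolding subspace_def W_def by simp
  have cW: "closed W"
  proof -
    have "closed (fst -` H :: (vec \<times> vec \<times> vec \<times> vec) set)" by (intro closed_vimage cH continuous_intros)
    moreover have "W = G ` V \<inter> fst -` H" by (auto simp: W_def)
    ultimately show ?thesis using W_closed by (simp add: closed_Int)
  qed
  \<comment> \<open>The mass of A is real, so division by it respects real and imaginary parts,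
    matching the two real constraints that define H.\<close>
  have massR: "z / mass = Complex (Re z / Re mass) (Im z / Re mass)" for z
  proof -
    have "cnj mass = mass" using integral_A_pr[of "\<lambda>_. 1" "\<lambda>_. 1"] pr_cnj[of "coef_A S" "\<lambda>_. 1" "\<lambda>_. 1"] by simp
    then have "Im (cnj mass) = Im mass" by (rule arg_cong)
    then have "Im mass = 0" by simp
    then have "mass = complex_of_real (Re mass)" by (simp add: complex_eq_iff)
    then have m: "z / mass = z / complex_of_real (Re mass)" by (rule arg_cong)
    show ?thesis unfolding m by (simp add: complex_eq_iff Re_divide_of_real Im_divide_of_real)
  qed
  define k where "k = 1 / Re mass"
  \<comment> \<open>Subtraction of the A-average, expressed on classes. It is continuous and fixes
    H, so approximants from V can be corrected to average zero without leaving V.\<close>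
  define Pz where "Pz = (\<lambda>h. h - ((k * inner (aop h) (aop ?e1)) *\<^sub>R ?e1 + (k * inner (aop h) (aop ?e2)) *\<^sub>R ?e2))"
  have cPz: "continuous_on UNIV Pz" unfolding Pz_def by (intro continuous_intros ca)
  have Pz_V: "cls (\<lambda>p. \<eta> p - integral_A S \<eta> / mass) = Pz (cls \<eta>)" if \<eta>: "\<eta> \<in> V" for \<eta>
  proof -
    let ?z = "integral_A S \<eta>"
    have "cls (\<lambda>_. ?z / mass) = Re (?z / mass) *\<^sub>R ?e1 + Im (?z / mass) *\<^sub>R ?e2" by (rule cls_const)
    also have "Re (?z / mass) = k * Re ?z" by (simp add: massR k_def)
    also have "Im (?z / mass) = k * Im ?z" by (simp add: massR k_def)
    finally show ?thesis
      unfolding cls_diff[OF V_L2[OF \<eta>] const_L2] Pz_def by (simp only: mean_parts[OF V_L2[OF \<eta>]])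
  qed
  have centred: "(\<lambda>p. \<eta> p - integral_A S \<eta> / mass) \<in> V" "integral_A S (\<lambda>p. \<eta> p - integral_A S \<eta> / mass) = 0"
      "grad (\<lambda>p. \<eta> p - integral_A S \<eta> / mass) = grad \<eta>" if "\<eta> \<in> V" for \<eta>
  proof -
    show "(\<lambda>p. \<eta> p - integral_A S \<eta> / mass) \<in> V" by (rule V_diff[OF that V_const])
    show "integral_A S (\<lambda>p. \<eta> p - integral_A S \<eta> / mass) = 0"
      using mass_ne by (simp only: mean_diff_const[OF V_L2[OF that]]) simp
    show "grad (\<lambda>p. \<eta> p - integral_A S \<eta> / mass) = grad \<eta>"
      by (simp only: grad_G H1_diff(2)[OF V_H1[OF that] G_const(1)] snd_diff G_const(2) snd_conv) simp
  qed
  have memW: "G \<eta> \<in> W" if "\<eta> \<in> V" "integral_A S \<eta> = 0" for \<eta>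
  proof -
    have "fst (G \<eta>) = cls \<eta>" by (simp add: G_def)
    then have "fst (G \<eta>) \<in> H" using H_iff[OF V_L2[OF that(1)]] that(2) by simp
    then show ?thesis unfolding W_def using that(1) by simp
  qed
  have dense: "\<exists>(u, g)\<in>W. norm (h - u) < e" if h: "h \<in> H" and e: "e > 0" for h e
  proof -
    have "h \<in> cls ` L2 S" and "Pz h = h" using h by (simp_all add: H_def Pz_def)
    then obtain f where f: "h = cls f" "f \<in> L2 S" by (elim imageE)
    have "\<exists>d. d > 0 \<and> (\<forall>y. dist y h < d \<longrightarrow> dist (Pz y) (Pz h) < e)"
      using cPz[unfolded continuous_on_iff, THEN bspec, OF UNIV_I, THEN spec, THEN mp, OF e, of h] by simp
    then obtain d where d0: "d > 0 \<and> (\<forall>y. dist y h < d \<longrightarrow> dist (Pz y) (Pz h) < e)" by (rule exE)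
    note d = d0[THEN conjunct1] d0[THEN conjunct2, rule_format]
    obtain \<eta> where \<eta>: "\<eta> \<in> V" "norm_L2 S (\<lambda>p. f p - \<eta> p) < d" using V_dense[OF f(2) d(1)] by (rule bexE)
    have "dist (cls \<eta>) h < d"
      using \<eta>(2) unfolding norm_L2_diff[OF f(2) V_L2[OF \<eta>(1)]] f(1) dist_norm norm_minus_commute[of "cls \<eta>"] .
    from d(2)[OF this] have "norm (Pz (cls \<eta>) - h) < e" unfolding \<open>Pz h = h\<close> dist_norm .
    then have n: "norm (h - cls (\<lambda>p. \<eta> p - integral_A S \<eta> / mass)) < e"
      unfolding Pz_V[OF \<eta>(1)] by (subst norm_minus_commute)
    show ?thesis
    proof (rule bexI[OF _ memW[OF centred(1,2)[OF \<eta>(1)]]])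
      show "case G (\<lambda>p. \<eta> p - integral_A S \<eta> / mass) of (u, g) \<Rightarrow> norm (h - u) < e"
        unfolding G_def prod.case by (rule n)
    qed
  qed
  have W_obtain: "\<exists>\<eta>. \<eta> \<in> V \<and> G \<eta> = z \<and> integral_A S \<eta> = 0" if "z \<in> W" for z
  proof -
    have "z \<in> G ` V" "fst z \<in> H" using that by (simp_all add: W_def)
    then obtain \<eta> where \<eta>: "z = G \<eta>" "\<eta> \<in> V" by (elim imageE)
    then have "integral_A S \<eta> = 0" using \<open>fst z \<in> H\<close> H_iff[OF V_L2[OF \<eta>(2)]] by (simp add: G_def)
    then show ?thesis using \<eta> by blast
  qed
  have VH: "u \<in> H" if "(u, g) \<in> W" for u g using that by (simp add: W_def)
  have closable: "g = 0" if g: "(0, g) \<in> W" for g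
  proof -
    obtain \<eta> where \<eta>: "\<eta> \<in> V" "G \<eta> = (0, g)" using W_obtain[OF g] by blast
    have "cls (\<lambda>_. 0) = 0" using cls_scaleR[OF const_L2, of 0 1] by simp
    then show ?thesis using grad_cong[OF V_H1[OF \<eta>(1)] G_const(1)[of 0]] \<eta>(2) grad_const[of 0] by (simp add: G_def)
  qed
  have skew: "inner a (bop h) = - inner b (bop g)" if ab: "(a, g) \<in> W" "(b, h) \<in> W" for a b g h
  proof -
    obtain \<eta> where "\<eta> \<in> V" "G \<eta> = (a, g)" using W_obtain[OF ab(1)] by blast
    moreover obtain \<zeta> where "\<zeta> \<in> V" "G \<zeta> = (b, h)" using W_obtain[OF ab(2)] by blast
    ultimately show ?thesis using bop_skew[OF V_H1 V_H1, of \<eta> \<zeta>] by (simp add: G_def)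
  qed
  obtain C where C: "C \<ge> 0" "\<forall>u\<in>H1 S. integral_A S u = 0 \<longrightarrow> (norm (cls u))\<^sup>2 \<le> C * (norm (wop (grad u)))\<^sup>2"
    using poincare_wop by (elim exE conjE)
  have poin: "norm u \<le> sqrt C * norm (wop g)" if ug: "(u, g) \<in> W" for u g
  proof (rule power2_le_imp_le)
    obtain \<eta> where "\<eta> \<in> V" "G \<eta> = (u, g)" "integral_A S \<eta> = 0" using W_obtain[OF ug] by blast
    then show "(norm u)\<^sup>2 \<le> (sqrt C * norm (wop g))\<^sup>2"
      using C(2)[rule_format, OF V_H1, of \<eta>] C(1) by (simp add: G_def power_mult_distrib)
  qed (use C(1) in simp)
  obtain ka where ka: "ka > 0" "\<And>x. ka * norm x \<le> norm (aop x)" using aop_lower by blast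
  obtain kw where kw: "kw > 0" "\<And>x. kw * norm x \<le> norm (wop x)" using wop_lower by blast
  have sC: "sqrt C \<ge> 0" using C(1) by simp
  have init: "(cls v0, grad v0) \<in> W" "cls v1 \<in> H" using memW[OF v0] H_iff[OF v1(1)] v1(2) by (simp_all add: G_def)
  show ?thesis
  proof (rule wave_existence[OF linear_ops ka kw sW cW sH cH VH dense sC poin skew closable init])
    fix u g v
    assume ug: "\<And>t. (u t, g t) \<in> W" and v: "\<And>t. v t \<in> H" and i: "u 0 = cls v0" "v 0 = cls v1"
      and c: "continuous_on UNIV u" "continuous_on UNIV g" "continuous_on UNIV v"
      and d: "\<And>t. (u has_vector_derivative v t) (at t)"
      and eq: "\<And>h h' t. (h, h') \<in> W \<Longrightarrow> ((\<lambda>t. inner (aop (v t)) (aop h)) has_real_derivative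
               - (inner (wop (g t)) (wop h') + inner (v t) (bop h'))) (at t)"
    \<comment> \<open>The abstract solution consists of classes; representatives in V are chosen
      separately at each time, which is harmless because every condition depends on classes
      only.\<close>
    define U where "U = (\<lambda>t. SOME \<eta>. \<eta> \<in> V \<and> G \<eta> = (u t, g t) \<and> integral_A S \<eta> = 0)"
    have U: "U t \<in> V \<and> G (U t) = (u t, g t) \<and> integral_A S (U t) = 0" for t
      unfolding U_def by (rule someI_ex[OF W_obtain[OF ug[of t]]])
    define Ut where "Ut = (\<lambda>t. SOME f. f \<in> L2 S \<and> cls f = v t)"
    have Ut: "Ut t \<in> L2 S \<and> cls (Ut t) = v t" for t
    proof -
      have "v t \<in> cls ` L2 S" using v[of t] by (simp add: H_def)
      then have "\<exists>f. f \<in> L2 S \<and> cls f = v t" by auto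
      then show ?thesis unfolding Ut_def by (rule someI_ex)
    qed
    have cg: "cls (U t) = u t" "grad (U t) = g t" for t using U[of t] by (simp_all add: G_def)
    have E: "energy_curve S V U Ut"
      unfolding energy_curve_iff cg
      using U Ut d continuous_on_Pair[OF c(1,2)] c(3) by simp
    \<comment> \<open>With this, a general test may be replaced by its centred version: the constant
      removed has zero gradient and is orthogonal to the velocity.\<close>
    have orth: "inner (aop (v t)) (aop (cls (\<lambda>_. c))) = 0" for t c
      using v[of t] unfolding cls_const[of c] by (simp add: H_def linear_add[OF lin] linear_scale[OF lin] inner_add_right)
    have "weak_wave U Ut"
      unfolding weak_wave_def rq_def cg conjunct2[OF Ut]
    proof (intro ballI allI)
      fix \<eta> t assume \<eta>: "\<eta> \<in> V"
      let ?c = "integral_A S \<eta> / mass"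
      have "(cls (\<lambda>p. \<eta> p - ?c), grad \<eta>) \<in> W"
        using memW[OF centred(1,2)[OF \<eta>]] unfolding G_def centred(3)[OF \<eta>] .
      from eq[OF this] show "((\<lambda>t. inner (aop (v t)) (aop (cls \<eta>))) has_real_derivative
         - (inner (wop (g t)) (wop (grad \<eta>)) + inner (v t) (bop (grad \<eta>)))) (at t)"
        unfolding cls_diff[OF V_L2[OF \<eta>] const_L2] linear_diff[OF lin] inner_diff_right orth by simp
    qed
    then show ?thesis using E cg(1)[of 0] Ut[of 0] i by (intro exI[of _ U] exI[of _ Ut]) simp
  qed
qed

lemma existence:
  assumes u0: "u0 \<in> V" and u1: "u1 \<in> L2 S"
  shows "\<exists>u ut. energy_curve S V u ut \<and> weak_wave u ut \<and> cls (u 0) = cls u0 \<and> cls (ut 0) = cls u1"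
proof -
  define c0 c1 where "c0 = integral_A S u0 / mass" and "c1 = integral_A S u1 / mass"
  have 0: "(\<lambda>p. u0 p - c0) \<in> V" "integral_A S (\<lambda>p. u0 p - c0) = 0" "(\<lambda>p. u1 p - c1) \<in> L2 S" "integral_A S (\<lambda>p. u1 p - c1) = 0"
    by (rule V_diff[OF u0 V_const], simp only: mean_diff_const[OF V_L2[OF u0]] c0_def, simp add: mass_ne,
        rule L2_diff[OF u1 const_L2], simp only: mean_diff_const[OF u1] c1_def, simp add: mass_ne)
  from existence_mean_zero[OF this] obtain w wt where w: "energy_curve S V w wt" "weak_wave w wt"
    "cls (w 0) = cls (\<lambda>p. u0 p - c0)" "cls (wt 0) = cls (\<lambda>p. u1 p - c1)" by (elim exE conjE)
  \<comment> \<open>Negative coefficients, because superposition is available in the form of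
    differences of solutions.\<close>
  note z = zero_mode_solution[of "- c0" "- c1"]
  have w0: "w 0 \<in> L2 S" "wt 0 \<in> L2 S" using w(1) V_L2 unfolding energy_curve_iff by simp_all
  note s = solution_diff(1)[OF w(1) z(1)] solution_diff(2)[OF w(1) z(1) w(2) z(2)]
  have e: "cls (\<lambda>p. w 0 p - (- c0 + - c1 * complex_of_real 0)) = cls u0" "cls (\<lambda>p. wt 0 p - - c1) = cls u1"
    unfolding cls_diff[OF w0(1) const_L2] cls_diff[OF w0(2) const_L2] w(3,4)
      cls_diff[OF V_L2[OF u0] const_L2] cls_diff[OF u1 const_L2]
    by (simp_all add: cls_const[of "- c0"] cls_const[of "- c1"] cls_const[of c0] cls_const[of c1])
  show ?thesis by (intro exI conjI) (rule s(1), rule s(2), rule e(1), rule e(2))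
qed

end

context slab_domain begin

section \<open>Coefficient bounds\<close>

lemma mul_sqrt_bounds:
  assumes k: "coef_cont k" "\<And>p. ext k p \<ge> 0" and lh: "\<forall>(r, x)\<in>Omega S. lo \<le> k r x \<and> k r x \<le> hi"
    and f: "f \<in> L2 S"
  shows "lo * (norm (cls f))\<^sup>2 \<le> (norm (mul (\<lambda>p. complex_of_real (sqrt (ext k p))) (cls f)))\<^sup>2"
    "(norm (mul (\<lambda>p. complex_of_real (sqrt (ext k p))) (cls f)))\<^sup>2 \<le> hi * (norm (cls f))\<^sup>2"
proof -
  have eq: "f p * cnj (f p) * complex_of_real (ext k p) = complex_of_real ((cmod (f p))\<^sup>2 * ext k p)" for p
    unfolding of_real_mult complex_norm_square ..
  have i1: "integrable SM (\<lambda>p. (cmod (f p))\<^sup>2)" using f by (simp add: L2_def)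
  have i2: "integrable SM (\<lambda>p. (cmod (f p))\<^sup>2 * ext k p)"
    using pr_integrable[OF k(1) f f] unfolding eq complex_of_real_integrable_eq .
  have n1: "(norm (cls f))\<^sup>2 = (LINT p|SM. (cmod (f p))\<^sup>2)"
    by (simp add: norm_cls[OF f] norm_L2_def)
  have n2: "(norm (mul (\<lambda>p. complex_of_real (sqrt (ext k p))) (cls f)))\<^sup>2 = (LINT p|SM. (cmod (f p))\<^sup>2 * ext k p)"
    unfolding power2_norm_eq_inner pr_sqrt[OF k f f] pr_def eq integral_complex_of_real Re_complex_of_real ..
  have r: "lo \<le> ext k p \<and> ext k p \<le> hi" if "p \<in> Sig" for p
  proof -
    have "snd p \<in> Omega S" using that Sig_iff[of "fst p" "fst (snd p)" "snd (snd p)"] by simp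
    from bspec[OF lh this] show ?thesis unfolding ext_eq[OF that] by (simp add: split_beta)
  qed
  have "(LINT p|SM. lo * (cmod (f p))\<^sup>2) \<le> (LINT p|SM. (cmod (f p))\<^sup>2 * ext k p)"
    by (rule integral_mono[OF integrable_mult_right[OF i1] i2]) (simp only: space_SM mult.commute[of lo], rule mult_left_mono[OF conjunct1[OF r]], simp_all)
  then show "lo * (norm (cls f))\<^sup>2 \<le> (norm (mul (\<lambda>p. complex_of_real (sqrt (ext k p))) (cls f)))\<^sup>2" unfolding n1 n2 by simp
  have "(LINT p|SM. (cmod (f p))\<^sup>2 * ext k p) \<le> (LINT p|SM. hi * (cmod (f p))\<^sup>2)"
    by (rule integral_mono[OF i2 integrable_mult_right[OF i1]]) (simp only: space_SM mult.commute[of hi], rule mult_left_mono[OF conjunct2[OF r]], simp_all)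
  then show "(norm (mul (\<lambda>p. complex_of_real (sqrt (ext k p))) (cls f)))\<^sup>2 \<le> hi * (norm (cls f))\<^sup>2" unfolding n1 n2 by simp
qed

lemma aop_bounds:
  assumes "f \<in> L2 S"
  shows "a_minus S * (norm (cls f))\<^sup>2 \<le> (norm (aop (cls f)))\<^sup>2" "(norm (aop (cls f)))\<^sup>2 \<le> a_plus S * (norm (cls f))\<^sup>2"
proof -
  have "\<forall>(r, x)\<in>Omega S. a_minus S \<le> coef_A S r x \<and> coef_A S r x \<le> a_plus S"
    using coef_range(3,4)[OF coef_continuous(1)] unfolding a_minus_def a_plus_def by fast
  note b = mul_sqrt_bounds[OF coef_continuous(1) ext_nonneg(1) this assms]
  show "a_minus S * (norm (cls f))\<^sup>2 \<le> (norm (aop (cls f)))\<^sup>2" unfolding aop_def by (rule b(1))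
  show "(norm (aop (cls f)))\<^sup>2 \<le> a_plus S * (norm (cls f))\<^sup>2" unfolding aop_def by (rule b(2))
qed

lemma nabla_range:
  assumes "(r, x) \<in> Omega S"
  shows "m_nabla S \<le> coef_Phi S r x" "coef_Phi S r x \<le> M_nabla S" "m_nabla S \<le> Delta_r S r" "Delta_r S r \<le> M_nabla S"
    "m_nabla S \<le> Delta_x S x" "Delta_x S x \<le> M_nabla S"
proof -
  note R = coef_range(3,4)[OF coef_continuous(3) assms] coef_range(3,4)[OF coef_continuous(4) assms] coef_range(3,4)[OF coef_continuous(5) assms]
  show "m_nabla S \<le> coef_Phi S r x" unfolding m_nabla_def by (rule order_trans[OF Min_le R(1)]) simp_all
  show "m_nabla S \<le> Delta_r S r" unfolding m_nabla_def by (rule order_trans[OF Min_le R(3)]) simp_all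
  show "m_nabla S \<le> Delta_x S x" unfolding m_nabla_def by (rule order_trans[OF Min_le R(5)]) simp_all
  show "coef_Phi S r x \<le> M_nabla S" unfolding M_nabla_def by (rule order_trans[OF R(2) Max_ge]) simp_all
  show "Delta_r S r \<le> M_nabla S" unfolding M_nabla_def by (rule order_trans[OF R(4) Max_ge]) simp_all
  show "Delta_x S x \<le> M_nabla S" unfolding M_nabla_def by (rule order_trans[OF R(6) Max_ge]) simp_all
qed

lemma constants_pos: "a_minus S > 0" "m_nabla S > 0" "C_high S > 0"
proof -
  obtain q where q: "q \<in> Omega S" "(INF (r, x) \<in> Omega S. coef_A S r x) = coef_A S (fst q) (snd q)"
    using coef_range(1)[OF coef_continuous(1)] by (rule bexE)
  show a: "a_minus S > 0" unfolding a_minus_def q(2) using q(1) by (intro pos(4)) simp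
  obtain q1 where q1: "q1 \<in> Omega S" "(INF (r, x) \<in> Omega S. coef_Phi S r x) = coef_Phi S (fst q1) (snd q1)"
    using coef_range(1)[OF coef_continuous(3)] by (rule bexE)
  obtain q2 where q2: "q2 \<in> Omega S" "(INF (r, x) \<in> Omega S. Delta_r S r) = Delta_r S (fst q2)"
    using coef_range(1)[OF coef_continuous(4)] by (rule bexE)
  obtain q3 where q3: "q3 \<in> Omega S" "(INF (r, x) \<in> Omega S. Delta_x S x) = Delta_x S (snd q3)"
    using coef_range(1)[OF coef_continuous(5)] by (rule bexE)
  have "coef_Phi S (fst q1) (snd q1) > 0" "Delta_r S (fst q2) > 0" "Delta_x S (snd q3) > 0"
    using pos(5)[of "fst q1" "snd q1"] pos(2)[of "fst q2" "snd q2"] pos(3)[of "fst q3" "snd q3"] q1(1) q2(1) q3(1) by simp_all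
  then show "m_nabla S > 0" unfolding m_nabla_def q1(2) q2(2) q3(2) by (simp add: Min_gr_iff)
  have "a_minus S \<le> coef_A S (fst q) (snd q)" "coef_A S (fst q) (snd q) \<le> a_plus S"
    using coef_range(3,4)[OF coef_continuous(1), of "fst q" "snd q"] q(1) by (simp_all add: a_minus_def a_plus_def)
  then have "a_plus S > 0" using a by linarith
  then show "C_high S > 0" unfolding C_high_def by (simp add: less_max_iff_disj)
qed

lemma wop_bounds:
  assumes u: "u \<in> H1 S"
  shows "m_nabla S * (norm (grad u))\<^sup>2 \<le> (norm (wop (grad u)))\<^sup>2" "(norm (wop (grad u)))\<^sup>2 \<le> M_nabla S * (norm (grad u))\<^sup>2"
proof -
  have l: "\<forall>(r, x)\<in>Omega S. m_nabla S \<le> coef_Phi S r x \<and> coef_Phi S r x \<le> M_nabla S"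
    "\<forall>(r, x)\<in>Omega S. m_nabla S \<le> Delta_r S r \<and> Delta_r S r \<le> M_nabla S"
    "\<forall>(r, x)\<in>Omega S. m_nabla S \<le> Delta_x S x \<and> Delta_x S x \<le> M_nabla S"
    using nabla_range by fast+
  note b1 = mul_sqrt_bounds[OF coef_continuous(3) ext_nonneg(2) l(1) D_L2(1)[OF u]]
    and b2 = mul_sqrt_bounds[OF coef_continuous(4) ext_nonneg(3) l(2) D_L2(2)[OF u]]
    and b3 = mul_sqrt_bounds[OF coef_continuous(5) ext_nonneg(4) l(3) D_L2(3)[OF u]]
  show "m_nabla S * (norm (grad u))\<^sup>2 \<le> (norm (wop (grad u)))\<^sup>2"
    using b1(1) b2(1) b3(1) by (simp add: grad_def wop_def norm_Pair distrib_left)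
  show "(norm (wop (grad u)))\<^sup>2 \<le> M_nabla S * (norm (grad u))\<^sup>2"
    using b1(2) b2(2) b3(2) by (simp add: grad_def wop_def norm_Pair distrib_left)
qed

section \<open>The four assertions\<close>

lemma solves_iff:
  assumes "u0 \<in> V" "u1 \<in> L2 S"
  shows "solves_Cauchy S V u0 u1 u ut \<longleftrightarrow> energy_curve S V u ut \<and> weak_wave u ut \<and> cls (u 0) = cls u0 \<and> cls (ut 0) = cls u1"
proof (cases "energy_curve S V u ut")
  case True
  then have "u 0 \<in> L2 S" "ut 0 \<in> L2 S" using V_L2 unfolding energy_curve_iff by simp_all
  then show ?thesis
    unfolding solves_Cauchy_def cls_eq_iff[OF \<open>u 0 \<in> L2 S\<close> V_L2[OF assms(1)]] cls_eq_iff[OF \<open>ut 0 \<in> L2 S\<close> assms(2)]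
    using weak_wave_if_solution solution_if_weak_wave True by blast
qed (simp add: solves_Cauchy_def energy_solution_def)

lemma well_posed:
  assumes u0: "u0 \<in> V" and u1: "u1 \<in> L2 S"
  shows "\<exists>u ut. solves_Cauchy S V u0 u1 u ut \<and> (\<forall>w wt. solves_Cauchy S V u0 u1 w wt \<longrightarrow> (\<forall>t. ae_eq S (w t) (u t)))"
proof -
  obtain u ut where u: "energy_curve S V u ut" "weak_wave u ut" "cls (u 0) = cls u0" "cls (ut 0) = cls u1"
    using existence[OF assms] by (elim exE conjE)
  have "ae_eq S (w t) (u t)" if "solves_Cauchy S V u0 u1 w wt" for w wt t
  proof -
    have w: "energy_curve S V w wt" "weak_wave w wt" "cls (w 0) = cls u0" "cls (wt 0) = cls u1"
      using that unfolding solves_iff[OF assms] by simp_all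
    have L: "u s \<in> L2 S" "ut s \<in> L2 S" "w s \<in> L2 S" "wt s \<in> L2 S" for s
      using u(1) w(1) V_L2 unfolding energy_curve_iff by simp_all
    have "cls (\<lambda>p. w t p - u t p) = 0"
      by (rule zero_if_vanishing_data(1)[OF solution_diff(1)[OF w(1) u(1)] solution_diff(2)[OF w(1) u(1) w(2) u(2)]])
         (simp_all add: cls_diff L u w)
    then show ?thesis using cls_eq_iff[OF L(3,1)] by (simp add: cls_diff L)
  qed
  moreover have "solves_Cauchy S V u0 u1 u ut" unfolding solves_iff[OF assms] using u by simp
  ultimately show ?thesis by (intro exI[of _ u] exI[of _ ut]) simp
qed

lemma decomposition:
  assumes E: "energy_curve S V u ut" and W: "weak_wave u ut"
    and c: "integral_A S (u 0) = c0 * mass" "integral_A S (ut 0) = c1 * mass"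
  shows "zero_mode_decomposition S V u c0 c1 (\<lambda>t p. u t p - (c0 + c1 * complex_of_real t)) (\<lambda>t p. ut t p - c1)"
  unfolding zero_mode_decomposition_def
proof (intro conjI allI)
  have L: "u t \<in> L2 S" "ut t \<in> L2 S" for t using E V_L2 unfolding energy_curve_iff by simp_all
  show "energy_curve S V (\<lambda>t p. u t p - (c0 + c1 * complex_of_real t)) (\<lambda>t p. ut t p - c1)"
    by (rule solution_diff(1)[OF E zero_mode_solution(1)])
  show "ae_eq S (u t) (\<lambda>p. c0 + c1 * complex_of_real t + (u t p - (c0 + c1 * complex_of_real t)))" for t
    by (simp add: ae_eq_def)
  show "integral_A S (\<lambda>p. u t p - (c0 + c1 * complex_of_real t)) = 0" for t
    unfolding mean_diff_const[OF L(1)] mean_evolution(2)[OF E W, of t] c by (simp add: algebra_simps)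
  show "integral_A S (\<lambda>p. ut t p - c1) = 0" for t
    unfolding mean_diff_const[OF L(2)] mean_evolution(1)[OF E W, of t] c by simp
qed

text \<open>Averaging the decomposition shows that two affine functions of time coincide, and times
  0 and 1 fix the coefficients. The velocity parts then agree as derivatives of the same curve in
  L2.\<close>

lemma decomposition_unique:
  assumes E: "energy_curve S V u ut" and W: "weak_wave u ut"
    and c: "integral_A S (u 0) = c0 * mass" "integral_A S (ut 0) = c1 * mass"
    and D: "zero_mode_decomposition S V u d0 d1 w wt"
  shows "d0 = c0" "d1 = c1" "cls (w t) = cls (\<lambda>p. u t p - (c0 + c1 * complex_of_real t))" "cls (wt t) = cls (\<lambda>p. ut t p - c1)"
proof -
  have L: "u t \<in> L2 S" "ut t \<in> L2 S" for t using E V_L2 unfolding energy_curve_iff by simp_all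
  have Ew: "energy_curve S V w wt" and ae: "\<And>t. ae_eq S (u t) (\<lambda>p. d0 + d1 * complex_of_real t + w t p)"
    and m: "\<And>t. integral_A S (w t) = 0"
    using D unfolding zero_mode_decomposition_def by simp_all
  have Lw: "w t \<in> L2 S" "wt t \<in> L2 S" for t using Ew V_L2 unfolding energy_curve_iff by simp_all
  have cw: "cls (w t) = cls (\<lambda>p. u t p - (d0 + d1 * complex_of_real t))" for t
  proof -
    have "ae_eq S (w t) (\<lambda>p. u t p - (d0 + d1 * complex_of_real t))"
      using ae[of t] unfolding ae_eq_def by eventually_elim simp
    then show ?thesis unfolding cls_eq_iff[OF Lw(1) L2_diff[OF L(1) const_L2]] .
  qed
  have "(c0 + c1 * complex_of_real t) * mass = (d0 + d1 * complex_of_real t) * mass" for t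
    using mean_cong[OF Lw(1) L2_diff[OF L(1) const_L2] cw[of t]] m[of t]
    unfolding mean_diff_const[OF L(1)] mean_evolution(2)[OF E W, of t] c by (simp add: algebra_simps)
  then have *: "c0 + c1 * complex_of_real t = d0 + d1 * complex_of_real t" for t using mass_ne by simp
  show d: "d0 = c0" "d1 = c1" using *[of 0] *[of 1] by simp_all
  show cw': "cls (w t) = cls (\<lambda>p. u t p - (c0 + c1 * complex_of_real t))" for t using cw[of t] by (simp only: d)
  have "((\<lambda>t. cls (w t)) has_vector_derivative cls (wt t)) (at t)" using Ew unfolding energy_curve_iff by simp
  moreover have "((\<lambda>t. cls (w t)) has_vector_derivative cls (\<lambda>p. ut t p - c1)) (at t)"
    using solution_diff(1)[OF E zero_mode_solution(1)[of c0 c1]] unfolding energy_curve_iff cw' by simp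
  ultimately show "cls (wt t) = cls (\<lambda>p. ut t p - c1)" by (rule vector_derivative_unique_at)
qed

lemma energy_norm: "v \<in> H1 S \<Longrightarrow> (norm_H1 S v)\<^sup>2 = (norm (cls v))\<^sup>2 + (norm (grad v))\<^sup>2"
  by (simp add: norm_G[symmetric] G_def norm_Pair)

text \<open>The conserved quantity is twice the physical energy, which lies between
  \<open>c_low\<close> and \<open>C_high\<close> times the squared norm; comparing at times t and 0
  gives the ratio under the root. The second assertion records that a negative constant can occur
  only for zero data, which matters when the bound is later multiplied by other quantities.\<close>

lemma stability:
  assumes CP: "Poincare_constant S CP" and E: "energy_curve S V v vt" and W: "weak_wave v vt" and m: "\<And>t. integral_A S (v t) = 0"
  shows "sqrt ((norm_H1 S (v t))\<^sup>2 + (norm_L2 S (vt t))\<^sup>2) \<le> C_stab S CP * sqrt ((norm_H1 S (v 0))\<^sup>2 + (norm_L2 S (vt 0))\<^sup>2)"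
    "C_stab S CP \<ge> 0 \<or> (norm_H1 S (v 0) = 0 \<and> norm_L2 S (vt 0) = 0)"
proof -
  have v: "\<And>t. v t \<in> H1 S" and vt: "\<And>t. vt t \<in> L2 S" and d: "\<And>t. ((\<lambda>t. cls (v t)) has_vector_derivative cls (vt t)) (at t)"
    using E V_H1 unfolding energy_curve_iff by simp_all
  define X where "X = (\<lambda>t. (norm_H1 S (v t))\<^sup>2 + (norm_L2 S (vt t))\<^sup>2)"
  define q where "q = (\<lambda>t. (norm (wop (grad (v t))))\<^sup>2)"
  define K where "K = CP + 1 / m_nabla S"
  have Xe: "X t = (norm (cls (v t)))\<^sup>2 + (norm (grad (v t)))\<^sup>2 + (norm (cls (vt t)))\<^sup>2" for t
    by (simp add: X_def energy_norm[OF v] norm_cls[OF vt])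
  have q0: "q t \<ge> 0" for t by (simp add: q_def)
  have X0: "X t \<ge> 0" for t by (simp add: X_def)
  have H: "(norm (cls (v t)))\<^sup>2 + (norm (grad (v t)))\<^sup>2 \<le> K * q t" for t
  proof -
    have "(norm (cls (v t)))\<^sup>2 \<le> CP * q t"
      using CP v[of t] m[of t] wop_inner[OF v v, of t t] unfolding Poincare_constant_def q_def power2_norm_eq_inner[of "wop _"]
      by (simp add: norm_cls[OF H1_L2[OF v]])
    moreover have "(norm (grad (v t)))\<^sup>2 \<le> 1 / m_nabla S * q t"
      using wop_bounds(1)[OF v, of t] constants_pos(2) unfolding q_def by (simp add: pos_le_divide_eq mult.commute)
    ultimately show ?thesis unfolding K_def distrib_right by linarith
  qed
  have e: "(norm (aop (cls (vt t))))\<^sup>2 + q t = (norm (aop (cls (vt 0))))\<^sup>2 + q 0" for t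
    unfolding q_def by (rule energy_conserved[OF E W])
  have up: "(norm (aop (cls (vt 0))))\<^sup>2 + q 0 \<le> 2 * C_high S * X 0"
  proof -
    let ?m = "max (a_plus S) (M_nabla S)"
    have "(norm (aop (cls (vt 0))))\<^sup>2 \<le> ?m * (norm (cls (vt 0)))\<^sup>2"
      by (rule order_trans[OF aop_bounds(2)[OF vt]]) (simp add: mult_right_mono)
    moreover have "q 0 \<le> ?m * (norm (grad (v 0)))\<^sup>2"
      unfolding q_def by (rule order_trans[OF wop_bounds(2)[OF v]]) (simp add: mult_right_mono)
    \<comment> \<open>The energy does not contain the L2 norm of v; this nonnegative term completes
      it to the full squared norm.\<close>
    moreover have "0 \<le> ?m * (norm (cls (v 0)))\<^sup>2" using constants_pos(3) by (simp add: C_high_def)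
    ultimately have "(norm (aop (cls (vt 0))))\<^sup>2 + q 0 \<le> ?m * X 0" unfolding Xe distrib_left by linarith
    then show ?thesis by (simp add: C_high_def)
  qed
  have main: "sqrt (X t) \<le> C_stab S CP * sqrt (X 0) \<and> (C_stab S CP \<ge> 0 \<or> X 0 = 0)"
  \<comment> \<open>No sign is assumed for \<open>CP\<close>. If K is not positive, the Poincare and
    gradient bounds together force v to vanish at all times, and with it its derivative.\<close>
  proof (cases "K > 0")
    case True
    define cl where "cl = c_low S CP"
    have cl: "cl \<le> a_minus S / 2" "cl \<le> 1 / (2 * K)" unfolding cl_def c_low_def K_def by simp_all
    have clp: "cl > 0" unfolding cl_def c_low_def using constants_pos True by (simp add: K_def)
    have "cl * ((norm (cls (v t)))\<^sup>2 + (norm (grad (v t)))\<^sup>2) \<le> cl * (K * q t)" by (rule mult_left_mono[OF H]) (use clp in simp)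
    \<comment> \<open>This is the origin of the second entry of \<open>c_low\<close>: half of q pays
      for the whole H1 norm.\<close>
    also have "\<dots> \<le> 1 / (2 * K) * (K * q t)" by (rule mult_right_mono[OF cl(2)]) (use True q0[of t] in simp)
    also have "\<dots> = q t / 2" using True by simp
    finally have 1: "cl * ((norm (cls (v t)))\<^sup>2 + (norm (grad (v t)))\<^sup>2) \<le> q t / 2" .
    have "cl * (norm (cls (vt t)))\<^sup>2 \<le> a_minus S / 2 * (norm (cls (vt t)))\<^sup>2" by (rule mult_right_mono[OF cl(1)]) simp
    also have "\<dots> \<le> (norm (aop (cls (vt t))))\<^sup>2 / 2" using aop_bounds(1)[OF vt[of t]] by simp
    finally have "cl * (norm (cls (vt t)))\<^sup>2 \<le> (norm (aop (cls (vt t))))\<^sup>2 / 2" .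
    from add_mono[OF 1 this] have "cl * X t \<le> ((norm (aop (cls (vt t))))\<^sup>2 + q t) / 2"
      unfolding Xe by (simp only: distrib_left add_divide_distrib add_ac)
    moreover have "((norm (aop (cls (vt t))))\<^sup>2 + q t) / 2 \<le> (2 * C_high S * X 0) / 2"
      by (rule divide_right_mono[OF order_trans[OF eq_refl[OF e] up]]) simp
    ultimately have "cl * X t \<le> (2 * C_high S * X 0) / 2" by (rule order_trans)
    then have "cl * X t \<le> C_high S * X 0" by simp
    then have "X t \<le> C_high S / cl * X 0" using clp by (simp add: field_simps)
    then have "sqrt (X t) \<le> C_stab S CP * sqrt (X 0)"
      unfolding C_stab_def cl_def[symmetric] real_sqrt_mult[symmetric] by (rule real_sqrt_le_mono)
    moreover have "C_stab S CP \<ge> 0" unfolding C_stab_def cl_def[symmetric] using clp constants_pos(3) by simp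
    ultimately show ?thesis by simp
  next
    case False
    have z: "cls (v t) = 0 \<and> grad (v t) = 0" for t
    proof -
      have "K * q t \<le> 0" using False q0[of t] by (simp add: mult_nonpos_nonneg)
      then have "(norm (cls (v t)))\<^sup>2 + (norm (grad (v t)))\<^sup>2 \<le> 0" using H[of t] by linarith
      then show ?thesis by (simp add: sum_power2_le_zero_iff)
    qed
    have "cls (vt t) = 0" for t
    proof (rule vector_derivative_unique_at)
      show "((\<lambda>t. cls (v t)) has_vector_derivative cls (vt t)) (at t)" by (rule d)
      show "((\<lambda>t. cls (v t)) has_vector_derivative 0) (at t)" using z by simp
    qed
    then have "X t = 0" for t unfolding Xe using z by simp
    then show ?thesis by simp
  qed
  then show "sqrt ((norm_H1 S (v t))\<^sup>2 + (norm_L2 S (vt t))\<^sup>2) \<le> C_stab S CP * sqrt ((norm_H1 S (v 0))\<^sup>2 + (norm_L2 S (vt 0))\<^sup>2)"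
    unfolding X_def by (rule conjunct1)
  show "C_stab S CP \<ge> 0 \<or> (norm_H1 S (v 0) = 0 \<and> norm_L2 S (vt 0) = 0)"
    using main unfolding X_def by (simp add: sum_power2_eq_zero_iff)
qed

lemma norm_grad_cmult: "u \<in> H1 S \<Longrightarrow> cmod c * norm (grad u) \<le> norm (grad (\<lambda>p. c * u p))"
proof -
  assume u: "u \<in> H1 S"
  have n: "(cmod c)\<^sup>2 * (norm x)\<^sup>2 \<le> (norm (mul (\<lambda>_. c) x))\<^sup>2" for x :: vec
    using power_mono[OF norm_mul_ge[OF bounded_measurable_const[of c], of "cmod c" x], of 2] by (simp add: power_mult_distrib)
  show ?thesis
  proof (rule power2_le_imp_le)
    show "(cmod c * norm (grad u))\<^sup>2 \<le> (norm (grad (\<lambda>p. c * u p)))\<^sup>2"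
      using n[of "cls (D_phi S u)"] n[of "cls (D_r S u)"] n[of "cls (D_x S u)"]
      unfolding grad_G[of "\<lambda>p. c * u p"] H1_cmult(2)[OF u]
      by (simp add: mul4_def G_def grad_def norm_Pair power_mult_distrib distrib_left)
  qed simp
qed

text \<open>The average of a solution is affine in time and its energy is constant, while a growing
  mode multiplies its average by an exponential and the gradient part of its energy by the square of
  one. Both the average and the gradient of the profile must vanish, and the Poincare inequality
  leaves only zero.\<close>

lemma no_growing_mode:
  assumes \<sigma>: "Im \<sigma> > 0" and mode: "finite_energy_mode S V \<sigma> \<psi>"
  shows "ae_eq S \<psi> (\<lambda>p. 0)"
proof -
  define e where "e = (\<lambda>t. exp (- \<i> * \<sigma> * complex_of_real t))"
  define s where "s = Im \<sigma>"
  have s: "s > 0" using \<sigma> by (simp add: s_def)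
  have ne: "cmod (e t) = exp (s * t)" for t by (simp add: e_def s_def)
  obtain ut where \<psi>: "\<psi> \<in> V" and sol: "energy_solution S V (\<lambda>t p. e t * \<psi> p) ut"
    using mode unfolding finite_energy_mode_def e_def by (elim conjE exE)
  have E: "energy_curve S V (\<lambda>t p. e t * \<psi> p) ut" using sol by (simp add: energy_solution_def)
  have W: "weak_wave (\<lambda>t p. e t * \<psi> p) ut" by (rule weak_wave_if_solution[OF sol])
  note h = V_H1[OF \<psi>]
  have mz: "integral_A S \<psi> = 0"
  proof (rule ccontr)
    assume m: "integral_A S \<psi> \<noteq> 0"
    have ev: "e t * integral_A S \<psi> = e 0 * integral_A S \<psi> + complex_of_real t * integral_A S (ut 0)" for t
      using mean_evolution(2)[OF E W, of t] unfolding mean_cmult .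
    \<comment> \<open>Adding the values of an affine function at opposite times gives twice its
      value at 0. At 3/s the two moduli are exp 3, at least 4, and exp(-3), at most 1, so the sum of
      the exponentials cannot be 2.\<close>
    have "(e (3 / s) + e (- (3 / s))) * integral_A S \<psi> = 2 * integral_A S \<psi>"
      using ev[of "3 / s"] ev[of "- (3 / s)"] by (simp add: distrib_right e_def[THEN fun_cong, of 0])
    then have "e (3 / s) + e (- (3 / s)) = 2" using m by simp
    then have "e (3 / s) = 2 - e (- (3 / s))" by (simp add: eq_diff_eq)
    then have "cmod (e (3 / s)) \<le> 2 + cmod (e (- (3 / s)))" using norm_triangle_ineq4[of 2 "e (- (3 / s))"] by simp
    then have "exp 3 \<le> 2 + exp (- (3::real))" using s by (simp add: ne)
    moreover have "exp (3::real) \<ge> 4" using exp_ge_add_one_self[of 3] by simp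
    moreover have "exp (- (3::real)) \<le> 1" by simp
    ultimately show False by linarith
  qed
  have gz: "grad \<psi> = 0"
  proof (rule ccontr)
    assume g: "grad \<psi> \<noteq> 0"
    obtain kw where kw: "kw > 0" "\<And>x. kw * norm x \<le> norm (wop x)" using wop_lower by blast
    define E0 where "E0 = (norm (aop (cls (ut 0))))\<^sup>2 + (norm (wop (grad (\<lambda>p. e 0 * \<psi> p))))\<^sup>2"
    have b: "exp (s * t) * (kw * norm (grad \<psi>)) \<le> sqrt E0" for t
    proof -
      have "exp (s * t) * (kw * norm (grad \<psi>)) = kw * (cmod (e t) * norm (grad \<psi>))" by (simp add: ne)
      also have "\<dots> \<le> kw * norm (grad (\<lambda>p. e t * \<psi> p))" by (rule mult_left_mono[OF norm_grad_cmult[OF h]]) (use kw in simp)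
      also have "\<dots> \<le> norm (wop (grad (\<lambda>p. e t * \<psi> p)))" by (rule kw)
      also have "\<dots> \<le> sqrt E0"
      proof (rule real_le_rsqrt)
        have "0 \<le> (norm (aop (cls (ut t))))\<^sup>2" by simp
        then show "(norm (wop (grad (\<lambda>p. e t * \<psi> p))))\<^sup>2 \<le> E0"
          unfolding E0_def energy_conserved[OF E W, of t, symmetric] by (simp only: le_add_same_cancel2)
      qed
      finally show ?thesis .
    qed
    define c where "c = kw * norm (grad \<psi>)"
    have c: "c > 0" using kw(1) g by (simp add: c_def)
    \<comment> \<open>At the time \<open>sqrt E0 / (c * s)\<close> already the linear lower bound of
      the exponential violates the energy bound, by the amount \<open>c\<close>.\<close>
    have "(1 + s * (sqrt E0 / (c * s))) * c \<le> exp (s * (sqrt E0 / (c * s))) * c"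
      by (rule mult_right_mono[OF exp_ge_add_one_self]) (use c in simp)
    also have "\<dots> \<le> sqrt E0" unfolding c_def by (rule b)
    finally have "(1 + s * (sqrt E0 / (c * s))) * c \<le> sqrt E0" .
    moreover have "(1 + s * (sqrt E0 / (c * s))) * c = c + sqrt E0" using c s by (simp add: distrib_right)
    ultimately show False using c by linarith
  qed
  obtain C where "\<forall>u\<in>H1 S. integral_A S u = 0 \<longrightarrow> (norm (cls u))\<^sup>2 \<le> C * (norm (wop (grad u)))\<^sup>2"
    using poincare_wop by (elim exE conjE)
  note C = this
  have "(norm (cls \<psi>))\<^sup>2 \<le> C * (norm (wop (grad \<psi>)))\<^sup>2" by (rule C[rule_format, OF h mz])
  then have "(norm (cls \<psi>))\<^sup>2 \<le> 0" unfolding gz ops_zero by simp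
  then have "cls \<psi> = 0" by simp
  moreover have "cls (\<lambda>_. 0) = 0" using cls_scaleR[OF const_L2, of 0 1] by simp
  ultimately show ?thesis using cls_eq_iff[OF V_L2[OF \<psi>] const_L2[of 0]] by simp
qed

lemma decomposition_average:
  assumes "u0 \<in> V" "u1 \<in> L2 S" "solves_Cauchy S V u0 u1 u ut"
  shows "energy_curve S V u ut" "weak_wave u ut"
    "integral_A S (u 0) = average_A S u0 * mass" "integral_A S (ut 0) = average_A S u1 * mass"
proof -
  have s: "energy_curve S V u ut" "weak_wave u ut" "cls (u 0) = cls u0" "cls (ut 0) = cls u1"
    using assms(3) unfolding solves_iff[OF assms(1,2)] by simp_all
  have L: "u 0 \<in> L2 S" "ut 0 \<in> L2 S" using s(1) V_L2 unfolding energy_curve_iff by simp_all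
  show "integral_A S (u 0) = average_A S u0 * mass"
    unfolding mean_cong[OF L(1) V_L2[OF assms(1)] s(3)] average_A_def using mass_ne by simp
  show "integral_A S (ut 0) = average_A S u1 * mass"
    unfolding mean_cong[OF L(2) assms(2) s(4)] average_A_def using mass_ne by simp
  show "energy_curve S V u ut" "weak_wave u ut" by (rule s)+
qed

text \<open>The factor \<open>sqrt 2\<close> arises on the left when the sum of the two norms is
  replaced by the Euclidean combination; on the right the Euclidean combination is at most the
  sum.\<close>

lemma stable_decomposition:
  assumes CP: "Poincare_constant S CP" and u0: "u0 \<in> V" "u1 \<in> L2 S" "solves_Cauchy S V u0 u1 u ut"
    and D: "zero_mode_decomposition S V u (average_A S u0) (average_A S u1) v vt"
  shows "sqrt ((norm_H1 S (v t))\<^sup>2 + (norm_L2 S (vt t))\<^sup>2) \<le> C_stab S CP * sqrt ((norm_H1 S (v 0))\<^sup>2 + (norm_L2 S (vt 0))\<^sup>2)"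
    "norm_H1 S (v t) + norm_L2 S (vt t) \<le> sqrt 2 * C_stab S CP * (norm_H1 S (v 0) + norm_L2 S (vt 0))"
proof -
  let ?c0 = "average_A S u0" and ?c1 = "average_A S u1"
  note a = decomposition_average[OF u0]
  have E: "energy_curve S V v vt" and m: "\<And>t. integral_A S (v t) = 0"
    using D unfolding zero_mode_decomposition_def by simp_all
  note c = decomposition_unique(3,4)[OF a D]
  note E' = solution_diff(1)[OF a(1) zero_mode_solution(1)[of ?c0 ?c1]]
    and W' = solution_diff(2)[OF a(1) zero_mode_solution(1)[of ?c0 ?c1] a(2) zero_mode_solution(2)]
  have "v t \<in> H1 S" "(\<lambda>p. u t p - (?c0 + ?c1 * complex_of_real t)) \<in> H1 S" for t
    using E E' V_H1 unfolding energy_curve_iff by simp_all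
  then have g: "grad (v t) = grad (\<lambda>p. u t p - (?c0 + ?c1 * complex_of_real t))" for t
    using c(1) by (rule grad_cong)
  \<comment> \<open>\<open>weak_wave\<close> sees only classes and gradients, so it passes from u
    minus its zero modes to any representative v of the decomposition.\<close>
  have W: "weak_wave v vt" using W' unfolding weak_wave_def rq_def c(2) g .
  note st = stability[OF CP E W m]
  show 1: "sqrt ((norm_H1 S (v t))\<^sup>2 + (norm_L2 S (vt t))\<^sup>2) \<le> C_stab S CP * sqrt ((norm_H1 S (v 0))\<^sup>2 + (norm_L2 S (vt 0))\<^sup>2)"
    by (rule st(1))
  let ?x = "norm_H1 S (v t)" and ?y = "norm_L2 S (vt t)" and ?a = "norm_H1 S (v 0)" and ?b = "norm_L2 S (vt 0)"
  have nn: "?a \<ge> 0" "?b \<ge> 0" by (simp_all add: norm_H1_def norm_L2_def)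
  have 2: "C_stab S CP * sqrt (?a\<^sup>2 + ?b\<^sup>2) \<le> C_stab S CP * (?a + ?b)"
  proof (cases "C_stab S CP \<ge> 0")
    case True
    then show ?thesis by (rule mult_left_mono[OF sqrt_sum_squares_le_sum[OF nn]])
  next
    case False
    then have "?a = 0" "?b = 0" using st(2) by simp_all
    then show ?thesis by simp
  qed
  have "?x + ?y \<le> sqrt (2 * (?x\<^sup>2 + ?y\<^sup>2))"
  proof (rule real_le_rsqrt)
    have "2 * ?x * ?y \<le> ?x\<^sup>2 + ?y\<^sup>2" by (rule sum_squares_bound)
    then show "(?x + ?y)\<^sup>2 \<le> 2 * (?x\<^sup>2 + ?y\<^sup>2)" by (simp add: power2_sum)
  qed
  also have "\<dots> = sqrt 2 * sqrt (?x\<^sup>2 + ?y\<^sup>2)" by (rule real_sqrt_mult)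
  also have "\<dots> \<le> sqrt 2 * (C_stab S CP * sqrt (?a\<^sup>2 + ?b\<^sup>2))" by (rule mult_left_mono[OF 1]) simp
  also have "\<dots> \<le> sqrt 2 * (C_stab S CP * (?a + ?b))"
    by (rule mult_left_mono[OF 2]) simp
  finally show "?x + ?y \<le> sqrt 2 * C_stab S CP * (?a + ?b)" by (simp only: mult.assoc)
qed

lemma Poincare_constant_exists: "\<exists>CP. Poincare_constant S CP"
proof -
  obtain C where C: "\<forall>u\<in>H1 S. integral_A S u = 0 \<longrightarrow> (norm (cls u))\<^sup>2 \<le> C * (norm (wop (grad u)))\<^sup>2"
    using poincare_wop by (elim exE conjE)
  have "(norm_L2 S u)\<^sup>2 \<le> C * Re (form_q S u u)" if "u \<in> H1 S" "integral_A S u = 0" for u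
    using C[rule_format, OF that] by (simp only: wop_inner[OF that(1) that(1), symmetric] power2_norm_eq_inner norm_cls[OF H1_L2[OF that(1)], symmetric])
  then show ?thesis unfolding Poincare_constant_def by blast
qed

lemma unique_decomposition:
  assumes u0: "u0 \<in> V" "u1 \<in> L2 S" "solves_Cauchy S V u0 u1 u ut"
  shows "\<exists>v vt. zero_mode_decomposition S V u (average_A S u0) (average_A S u1) v vt \<and>
          (\<forall>d0 d1 w wt. zero_mode_decomposition S V u d0 d1 w wt \<longrightarrow>
             d0 = average_A S u0 \<and> d1 = average_A S u1 \<and> (\<forall>t. ae_eq S (w t) (v t) \<and> ae_eq S (wt t) (vt t)))"
proof -
  let ?v = "\<lambda>t p. u t p - (average_A S u0 + average_A S u1 * complex_of_real t)" and ?vt = "\<lambda>t p. ut t p - average_A S u1"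
  note a = decomposition_average[OF u0]
  have L: "u t \<in> L2 S" "ut t \<in> L2 S" for t using a(1) V_L2 unfolding energy_curve_iff by simp_all
  have U0: "d0 = average_A S u0 \<and> d1 = average_A S u1 \<and> (\<forall>t. ae_eq S (w t) (?v t) \<and> ae_eq S (wt t) (?vt t))"
    if D: "zero_mode_decomposition S V u d0 d1 w wt" for d0 d1 w wt
  proof -
    have "energy_curve S V w wt" using D unfolding zero_mode_decomposition_def by simp
    then have Lw: "w t \<in> L2 S" "wt t \<in> L2 S" for t using V_L2 unfolding energy_curve_iff by simp_all
    note U = decomposition_unique[OF a D]
    have "ae_eq S (w t) (?v t)" "ae_eq S (wt t) (?vt t)" for t
      using U(3,4)[of t] unfolding cls_eq_iff[OF Lw(1) L2_diff[OF L(1) const_L2]] cls_eq_iff[OF Lw(2) L2_diff[OF L(2) const_L2]] .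
    then show ?thesis by (intro conjI allI U(1,2))
  qed
  show ?thesis
    by (rule exI[of _ ?v], rule exI[of _ ?vt], rule conjI, rule decomposition[OF a], intro allI impI, rule U0)
qed

end

theorem theorem1p3:
  fixes S :: carter_slab and V :: "cfun set"
  assumes "admissible_slab S" and "reflecting_domain S V"
  shows
    "(\<forall>u0\<in>V. \<forall>u1\<in>L2 S. \<exists>u ut.
        solves_Cauchy S V u0 u1 u ut \<and>
        (\<forall>w wt. solves_Cauchy S V u0 u1 w wt \<longrightarrow> (\<forall>t. ae_eq S (w t) (u t)))) \<and>
     (\<forall>u0\<in>V. \<forall>u1\<in>L2 S. \<forall>u ut. solves_Cauchy S V u0 u1 u ut \<longrightarrow>
        (\<exists>v vt. zero_mode_decomposition S V u (average_A S u0) (average_A S u1) v vt \<and>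
          (\<forall>d0 d1 w wt. zero_mode_decomposition S V u d0 d1 w wt \<longrightarrow>
             d0 = average_A S u0 \<and> d1 = average_A S u1 \<and>
             (\<forall>t. ae_eq S (w t) (v t) \<and> ae_eq S (wt t) (vt t))))) \<and>
     (\<exists>CP. Poincare_constant S CP) \<and>
     (\<forall>CP. Poincare_constant S CP \<longrightarrow>
        (\<forall>u0\<in>V. \<forall>u1\<in>L2 S. \<forall>u ut v vt. solves_Cauchy S V u0 u1 u ut \<longrightarrow>
           zero_mode_decomposition S V u (average_A S u0) (average_A S u1) v vt \<longrightarrow>
           (\<forall>t. sqrt ((norm_H1 S (v t))\<^sup>2 + (norm_L2 S (vt t))\<^sup>2)
                  \<le> C_stab S CP * sqrt ((norm_H1 S (v 0))\<^sup>2 + (norm_L2 S (vt 0))\<^sup>2)) \<and>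
           (\<forall>t. norm_H1 S (v t) + norm_L2 S (vt t)
                  \<le> sqrt 2 * C_stab S CP * (norm_H1 S (v 0) + norm_L2 S (vt 0))))) \<and>
     (\<forall>\<sigma> \<psi>. Im \<sigma> > 0 \<and> finite_energy_mode S V \<sigma> \<psi> \<longrightarrow> ae_eq S \<psi> (\<lambda>p. 0))"
proof -
  interpret slab_domain S V using assms by unfold_locales
  show ?thesis
  proof (intro conjI)
    show "\<forall>u0\<in>V. \<forall>u1\<in>L2 S. \<exists>u ut. solves_Cauchy S V u0 u1 u ut \<and>
        (\<forall>w wt. solves_Cauchy S V u0 u1 w wt \<longrightarrow> (\<forall>t. ae_eq S (w t) (u t)))"
      by (rule ballI, rule ballI, rule well_posed)
    show "\<forall>u0\<in>V. \<forall>u1\<in>L2 S. \<forall>u ut. solves_Cauchy S V u0 u1 u ut \<longrightarrow>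
        (\<exists>v vt. zero_mode_decomposition S V u (average_A S u0) (average_A S u1) v vt \<and>
          (\<forall>d0 d1 w wt. zero_mode_decomposition S V u d0 d1 w wt \<longrightarrow>
             d0 = average_A S u0 \<and> d1 = average_A S u1 \<and>
             (\<forall>t. ae_eq S (w t) (v t) \<and> ae_eq S (wt t) (vt t))))"
      by (rule ballI, rule ballI, rule allI, rule allI, rule impI, rule unique_decomposition)
    show "\<exists>CP. Poincare_constant S CP" by (rule Poincare_constant_exists)
  next
    show "\<forall>CP. Poincare_constant S CP \<longrightarrow>
        (\<forall>u0\<in>V. \<forall>u1\<in>L2 S. \<forall>u ut v vt. solves_Cauchy S V u0 u1 u ut \<longrightarrow>
           zero_mode_decomposition S V u (average_A S u0) (average_A S u1) v vt \<longrightarrow>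
           (\<forall>t. sqrt ((norm_H1 S (v t))\<^sup>2 + (norm_L2 S (vt t))\<^sup>2)
                  \<le> C_stab S CP * sqrt ((norm_H1 S (v 0))\<^sup>2 + (norm_L2 S (vt 0))\<^sup>2)) \<and>
           (\<forall>t. norm_H1 S (v t) + norm_L2 S (vt t)
                  \<le> sqrt 2 * C_stab S CP * (norm_H1 S (v 0) + norm_L2 S (vt 0))))"
      by (intro allI impI ballI conjI; rule stable_decomposition; assumption)
    show "\<forall>\<sigma> \<psi>. Im \<sigma> > 0 \<and> finite_energy_mode S V \<sigma> \<psi> \<longrightarrow> ae_eq S \<psi> (\<lambda>p. 0)"
      by (intro allI impI, elim conjE, rule no_growing_mode)
  qed
qed

end
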